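(* Let $\mathbf s,\mathbf t,\boldsymbol\varepsilon,\boldsymbol\sigma=\boldsymbol\sigma(\boldsymbol\varepsilon)\in\mathbb R^j$ be such that for every $l\in\{1,\dots,j\}$: $s_l+t_l>n_l/2$, $0<\varepsilon_l<s_l+t_l-n_l/2$ and $\sigma_l=\min\{s_l,\,t_l,\,s_l+t_l-n_l/2-\varepsilon_l\}$. Then $$\mathcal H_{\mathrm{ul}}^{\mathbf s}(\mathbb R^n)\cdot\mathcal H^{\mathbf t}(\mathbb R^n)\subset\mathcal H^{\boldsymbol\sigma}(\mathbb R^n),\qquad \mathcal H^{\mathbf s}(\mathbb R^n)\cdot\mathcal H_{\mathrm{ul}}^{\mathbf t}(\mathbb R^n)\subset\mathcal H^{\boldsymbol\sigma}(\mathbb R^n).$$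
   Context: Let $j\in\{1,\dots,n\}$ and $\mathbb R^n=\mathbb R^{n_1}\times\cdots\times\mathbb R^{n_j}$ with $n_1,\dots,n_j$ positive integers. For $\mathbf s=(s_1,\dots,s_j)\in\mathbb R^j$ and $\xi=(\xi_1,\dots,\xi_j)$ put $\langle\langle\xi\rangle\rangle^{\mathbf s}=\prod_{l=1}^j(1+|\xi_l|^2)^{s_l/2}$, and let $\langle\langle D\rangle\rangle^{\mathbf s}$ be the corresponding Fourier multiplier. $\mathcal H^{\mathbf s}(\mathbb R^n)=\{u\in\mathcal S'(\mathbb R^n):\langle\langle D\rangle\rangle^{\mathbf s}u\in L^2\}$, $\|u\|_{\mathcal H^{\mathbf s}}=\|\langle\langle D\rangle\rangle^{\mathbf s}u\|_{L^2}$ (with $\|u\|_{\mathcal H^{\mathbf s}}=\infty$ if $u\notin\mathcal H^{\mathbf s}$). $u\in\mathcal D'(\mathbb R^n)$ belongs to $\mathcal H_{\mathrm{ul}}^{\mathbf s}(\mathbb R^n)$ if there is $\chi\in\mathcal C_0^\infty(\mathbb R^n)\smallsetminus0$ such that $\sup_{y\in\mathbb R^n}\|u\,\tau_y\chi\|_{\mathcal H^{\mathbf s}}<\infty$, where $\tau_y\chi=\chi(\cdot-y)$; the space does not depend on the choice of $\chi$. Products: under the stated condition on $\mathbf s,\mathbf t,\boldsymbol\varepsilon$, the product of $u\in\mathcal H^{\mathbf s}$ and $v\in\mathcal H^{\mathbf t}$ is the continuous extension, with values in $\mathcal H^{\boldsymbol\sigma}$, of the pointwise product on $\mathcal S(\mathbb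 R^n)\times\mathcal S(\mathbb R^n)$. If one or both factors are only locally in these spaces, the product $uv$ is the distribution defined locally by $uv\,\tau_y\chi^2=(u\,\tau_y\chi)(v\,\tau_y\chi)$ for $\chi\in\mathcal C_0^\infty(\mathbb R^n)$, $y\in\mathbb R^n$. *)

theory Defs
  imports "HOL-Analysis.Analysis"
begin

text \<open>
  The space is \<open>real ^ 'n\<close>; its splitting into \<open>j\<close> factors is a surjection
  \<open>b :: 'n \<Rightarrow> 'j\<close> sending each coordinate to the factor it belongs to. Thus the \<open>l\<close>-th factor
  has dimension \<open>card (b -` {l})\<close>, which is positive by surjectivity, and \<open>j \<le> n\<close>.
\<close>

subsection \<open>Test functions and Schwartz functions\<close>

definition partial_derivative ::
    "'n::finite \<Rightarrow> (real ^ 'n \<Rightarrow> complex) \<Rightarrow> real ^ 'n \<Rightarrow> complex" where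
  "partial_derivative i f = (\<lambda>x. frechet_derivative f (at x) (axis i 1))"

text \<open>A list of coordinates plays the role of a multi-index, its length that of the order.\<close>

definition partial_derivatives ::
    "'n::finite list \<Rightarrow> (real ^ 'n \<Rightarrow> complex) \<Rightarrow> real ^ 'n \<Rightarrow> complex" where
  "partial_derivatives is f = foldr partial_derivative is f"

definition smooth :: "(real ^ 'n::finite \<Rightarrow> complex) \<Rightarrow> bool" where
  "smooth f \<longleftrightarrow> (\<forall>is. partial_derivatives is f differentiable_on UNIV)"

definition test_functions :: "(real ^ 'n::finite \<Rightarrow> complex) set" where
  "test_functions = {f. smooth f \<and> compact (closure {x. f x \<noteq> 0})}"

definition schwartz_functions :: "(real ^ 'n::finite \<Rightarrow> complex) set" where
  "schwartz_functions = {f. smooth f \<and>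
     (\<forall>N is. bdd_above (range (\<lambda>x. (1 + norm x) ^ N * cmod (partial_derivatives is f x))))}"

definition test_seminorm :: "nat \<Rightarrow> (real ^ 'n::finite \<Rightarrow> complex) \<Rightarrow> real" where
  "test_seminorm N f =
     (SUP (is, x) \<in> {is. length is \<le> N} \<times> UNIV. cmod (partial_derivatives is f x))"

definition schwartz_seminorm :: "nat \<Rightarrow> (real ^ 'n::finite \<Rightarrow> complex) \<Rightarrow> real" where
  "schwartz_seminorm N f =
     (SUP (is, x) \<in> {is. length is \<le> N} \<times> UNIV.
        (1 + norm x) ^ N * cmod (partial_derivatives is f x))"

definition translate :: "real ^ 'n::finite \<Rightarrow> (real ^ 'n \<Rightarrow> complex) \<Rightarrow> real ^ 'n \<Rightarrow> complex" where
  "translate y f = (\<lambda>x. f (x - y))"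

subsection \<open>Distributions\<close>

text \<open>
  Distributions and tempered distributions are functionals on all functions, of which only the
  values on test functions, respectively on Schwartz functions, are meaningful. Hence two
  distributions are the same iff they satisfy \<open>same_distribution\<close>, not iff they are equal as
  HOL functions.
\<close>

type_synonym 'n func = "(real ^ 'n \<Rightarrow> complex) \<Rightarrow> complex"

definition linear_functional_on :: "(real ^ 'n::finite \<Rightarrow> complex) set \<Rightarrow> 'n func \<Rightarrow> bool" where
  "linear_functional_on V u \<longleftrightarrow>
     (\<forall>\<phi>\<in>V. \<forall>\<psi>\<in>V. u (\<lambda>x. \<phi> x + \<psi> x) = u \<phi> + u \<psi>) \<and>
     (\<forall>c. \<forall>\<phi>\<in>V. u (\<lambda>x. c * \<phi> x) = c * u \<phi>)"

definition distributions :: "'n::finite func set" where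
  "distributions = {u. linear_functional_on test_functions u \<and>
     (\<forall>K. compact K \<longrightarrow> (\<exists>C N. \<forall>\<phi>\<in>test_functions.
        closure {x. \<phi> x \<noteq> 0} \<subseteq> K \<longrightarrow> cmod (u \<phi>) \<le> C * test_seminorm N \<phi>))}"

definition tempered_distributions :: "'n::finite func set" where
  "tempered_distributions = {U. linear_functional_on schwartz_functions U \<and>
     (\<exists>C N. \<forall>\<phi>\<in>schwartz_functions. cmod (U \<phi>) \<le> C * schwartz_seminorm N \<phi>)}"

definition same_distribution :: "'n::finite func \<Rightarrow> 'n func \<Rightarrow> bool" where
  "same_distribution u v \<longleftrightarrow> (\<forall>\<phi>\<in>test_functions. u \<phi> = v \<phi>)"

definition distribution_of :: "(real ^ 'n::finite \<Rightarrow> complex) \<Rightarrow> 'n func" where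
  "distribution_of f = (\<lambda>\<phi>. \<integral>x. f x * \<phi> x \<partial>lborel)"

definition mult_distribution :: "(real ^ 'n::finite \<Rightarrow> complex) \<Rightarrow> 'n func \<Rightarrow> 'n func" where
  "mult_distribution a u = (\<lambda>\<phi>. u (\<lambda>x. a x * \<phi> x))"

subsection \<open>Fourier multipliers\<close>

definition fourier :: "(real ^ 'n::finite \<Rightarrow> complex) \<Rightarrow> real ^ 'n \<Rightarrow> complex" where
  "fourier f = (\<lambda>\<xi>. \<integral>x. exp (- \<i> * complex_of_real (x \<bullet> \<xi>)) * f x \<partial>lborel)"

definition inverse_fourier :: "(real ^ 'n::finite \<Rightarrow> complex) \<Rightarrow> real ^ 'n \<Rightarrow> complex" where
  "inverse_fourier f = (\<lambda>x. (\<integral>\<xi>. exp (\<i> * complex_of_real (x \<bullet> \<xi>)) * f \<xi> \<partial>lborel) /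
     complex_of_real ((2 * pi) ^ CARD('n)))"

definition fourier_distribution :: "'n::finite func \<Rightarrow> 'n func" where
  "fourier_distribution U = (\<lambda>\<phi>. U (fourier \<phi>))"

definition inverse_fourier_distribution :: "'n::finite func \<Rightarrow> 'n func" where
  "inverse_fourier_distribution U = (\<lambda>\<phi>. U (inverse_fourier \<phi>))"

definition fourier_multiplier :: "(real ^ 'n::finite \<Rightarrow> complex) \<Rightarrow> 'n func \<Rightarrow> 'n func" where
  "fourier_multiplier a U =
     inverse_fourier_distribution (mult_distribution a (fourier_distribution U))"

definition bracket :: "('n::finite \<Rightarrow> 'j::finite) \<Rightarrow> real ^ 'j \<Rightarrow> real ^ 'n \<Rightarrow> real" where
  "bracket b s \<xi> = (\<Prod>l\<in>UNIV. (1 + (\<Sum>i\<in>b -` {l}. (\<xi> $ i)\<^sup>2)) powr (s $ l / 2))"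

definition bracket_D :: "('n::finite \<Rightarrow> 'j::finite) \<Rightarrow> real ^ 'j \<Rightarrow> 'n func \<Rightarrow> 'n func" where
  "bracket_D b s = fourier_multiplier (\<lambda>\<xi>. complex_of_real (bracket b s \<xi>))"

subsection \<open>Sobolev spaces\<close>

definition L2_functions :: "(real ^ 'n::finite \<Rightarrow> complex) set" where
  "L2_functions = {f. f \<in> borel_measurable lborel \<and> integrable lborel (\<lambda>x. (cmod (f x))\<^sup>2)}"

definition L2_function_norm :: "(real ^ 'n::finite \<Rightarrow> complex) \<Rightarrow> real" where
  "L2_function_norm f = sqrt (\<integral>x. (cmod (f x))\<^sup>2 \<partial>lborel)"

text \<open>
  \<open>represents_bracket_D b s u f\<close> says that the distribution \<open>u\<close> is tempered, i.e. that it is the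
  restriction to test functions of some (necessarily unique) tempered distribution \<open>U\<close>, and
  that the tempered distribution \<open>bracket_D b s U\<close> is the function \<open>f \<in> L\<^sup>2\<close>.
\<close>

definition represents_bracket_D ::
    "('n::finite \<Rightarrow> 'j::finite) \<Rightarrow> real ^ 'j \<Rightarrow> 'n func \<Rightarrow> (real ^ 'n \<Rightarrow> complex) \<Rightarrow> bool" where
  "represents_bracket_D b s u f \<longleftrightarrow> f \<in> L2_functions \<and>
     (\<exists>U\<in>tempered_distributions. same_distribution U u \<and>
        (\<forall>\<phi>\<in>schwartz_functions. bracket_D b s U \<phi> = distribution_of f \<phi>))"

definition sobolev :: "('n::finite \<Rightarrow> 'j::finite) \<Rightarrow> real ^ 'j \<Rightarrow> 'n func set" where
  "sobolev b s = {u. \<exists>f. represents_bracket_D b s u f}"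

text \<open>The representing function is unique up to null sets, so its norm is well-defined.\<close>

definition sobolev_norm :: "('n::finite \<Rightarrow> 'j::finite) \<Rightarrow> real ^ 'j \<Rightarrow> 'n func \<Rightarrow> ennreal" where
  "sobolev_norm b s u =
     (if u \<in> sobolev b s then ennreal (L2_function_norm (SOME f. represents_bracket_D b s u f))
      else \<infinity>)"

definition sobolev_ul :: "('n::finite \<Rightarrow> 'j::finite) \<Rightarrow> real ^ 'j \<Rightarrow> 'n func set" where
  "sobolev_ul b s = {u \<in> distributions. \<exists>\<theta>\<in>test_functions. \<theta> \<noteq> (\<lambda>x. 0) \<and>
     (SUP y. sobolev_norm b s (mult_distribution (translate y \<theta>) u)) < \<infinity>}"

subsection \<open>Products\<close>

definition sobolev_converges ::
    "('n::finite \<Rightarrow> 'j::finite) \<Rightarrow> real ^ 'j \<Rightarrow> (nat \<Rightarrow> 'n func) \<Rightarrow> 'n func \<Rightarrow> bool" where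
  "sobolev_converges b s us u \<longleftrightarrow> (\<lambda>k. sobolev_norm b s (\<lambda>\<phi>. us k \<phi> - u \<phi>)) \<longlonglongrightarrow> 0"

text \<open>
  \<open>B\<close> is the continuous extension, with values in \<open>sobolev b \<sigma>\<close>, of the pointwise product of
  Schwartz functions. It is unique up to \<open>same_distribution\<close> since Schwartz functions are dense.
\<close>

definition is_extended_product ::
    "('n::finite \<Rightarrow> 'j::finite) \<Rightarrow> real ^ 'j \<Rightarrow> real ^ 'j \<Rightarrow> real ^ 'j \<Rightarrow>
     ('n func \<Rightarrow> 'n func \<Rightarrow> 'n func) \<Rightarrow> bool" where
  "is_extended_product b s t \<sigma> B \<longleftrightarrow>
     (\<forall>u\<in>sobolev b s. \<forall>v\<in>sobolev b t. B u v \<in> sobolev b \<sigma>) \<and>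
     (\<forall>\<phi>\<in>schwartz_functions. \<forall>\<psi>\<in>schwartz_functions.
        same_distribution (B (distribution_of \<phi>) (distribution_of \<psi>))
          (distribution_of (\<lambda>x. \<phi> x * \<psi> x))) \<and>
     (\<forall>us vs. \<forall>u\<in>sobolev b s. \<forall>v\<in>sobolev b t.
        (\<forall>k. us k \<in> sobolev b s) \<longrightarrow> (\<forall>k. vs k \<in> sobolev b t) \<longrightarrow>
        sobolev_converges b s us u \<longrightarrow> sobolev_converges b t vs v \<longrightarrow>
        sobolev_converges b \<sigma> (\<lambda>k. B (us k) (vs k)) (B u v))"

definition is_sobolev_product ::
    "('n::finite \<Rightarrow> 'j::finite) \<Rightarrow> real ^ 'j \<Rightarrow> real ^ 'j \<Rightarrow> real ^ 'j \<Rightarrow>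
     'n func \<Rightarrow> 'n func \<Rightarrow> 'n func \<Rightarrow> bool" where
  "is_sobolev_product b s t \<sigma> u v w \<longleftrightarrow> u \<in> sobolev b s \<and> v \<in> sobolev b t \<and>
     (\<exists>B. is_extended_product b s t \<sigma> B \<and> same_distribution w (B u v))"

definition is_local_product ::
    "('n::finite \<Rightarrow> 'j::finite) \<Rightarrow> real ^ 'j \<Rightarrow> real ^ 'j \<Rightarrow> real ^ 'j \<Rightarrow>
     'n func \<Rightarrow> 'n func \<Rightarrow> 'n func \<Rightarrow> bool" where
  "is_local_product b s t \<sigma> u v w \<longleftrightarrow> w \<in> distributions \<and>
     (\<forall>\<theta>\<in>test_functions. \<forall>y.
        is_sobolev_product b s t \<sigma>
          (mult_distribution (translate y \<theta>) u) (mult_distribution (translate y \<theta>) v)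
          (mult_distribution (\<lambda>x. (translate y \<theta> x)\<^sup>2) w))"

end

theory Submission
  imports Defs "HOL-Probability.Probability"
begin

text \<open>
  A distribution \<open>u\<close> lies in \<open>H\<^sup>s\<close> iff \<open>\<bar>u \<phi>\<bar> \<le> C \<parallel>\<phi>\<parallel>\<^bsub>-s\<^esub>\<close> for all test functions \<open>\<phi>\<close>, and the product
  \<open>H\<^sup>s \<times> H\<^sup>t \<rightarrow> H\<^bsup>\<sigma>\<^esup>\<close> extends a trilinear estimate
  \<open>\<bar>\<integral> f g h\<bar> \<le> C \<parallel>f\<parallel>\<^bsub>s\<^esub> \<parallel>g\<parallel>\<^bsub>t\<^esub> \<parallel>h\<parallel>\<^bsub>-\<sigma>\<^esub>\<close> for Schwartz functions, obtained on the Fourier side.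
  Let \<open>\<chi>\<close> be a window with \<open>\<parallel>\<tau>\<^sub>y\<chi> u\<parallel>\<^bsub>s\<^esub> \<le> M\<close> for all \<open>y\<close>. Averaging over the translates of \<open>\<bar>\<chi>\<bar>\<^sup>4\<close> gives
  \<open>(\<integral> \<bar>\<chi>\<bar>\<^sup>4) (u v) \<phi> = \<integral> ((\<tau>\<^sub>y\<chi> u) (\<tau>\<^sub>y\<chi> v)) (\<tau>\<^sub>y\<eta> \<phi>) dy\<close> with \<open>\<eta>\<close> the square of the conjugate of \<open>\<chi>\<close>.
  The integrand is at most \<open>C M \<parallel>\<tau>\<^sub>y\<chi> v\<parallel>\<^bsub>t\<^esub> \<parallel>\<tau>\<^sub>y\<eta> \<phi>\<parallel>\<^bsub>-\<sigma>\<^esub>\<close>. Since \<open>\<integral> \<parallel>\<tau>\<^sub>y\<theta> w\<parallel>\<^bsub>r\<^esub>\<^sup>2 dy \<le> C' \<parallel>w\<parallel>\<^bsub>r\<^esub>\<^sup>2\<close> by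
  Plancherel in \<open>y\<close>, the Cauchy-Schwarz inequality bounds the average by a multiple of
  \<open>\<parallel>v\<parallel>\<^bsub>t\<^esub> \<parallel>\<phi>\<parallel>\<^bsub>-\<sigma>\<^esub>\<close>.
\<close>

text \<open>The obstacle is uniformity. For a test function \<theta> the product \<theta> u lies in
  H^s, but with a norm that may grow with the support of \<theta>, so multiplying by v gives only a
  local result. In the average over y the cutoff \<theta> can be shifted onto \<phi>, where it is
  absorbed, and only the windowed pieces of u, bounded by M, remain. The fourth power arises as
  follows: u and v each consume one copy of the window, \<phi> must keep a window as well, since the
  Cauchy-Schwarz inequality in y asks for square integrability on both sides, and conjugating the
  remaining copies makes the total mass positive. The averaging identity is not applied to the
  distribution u v itself. The cut-off product is approximated by Schwartz functions, for which the
  identity is Fubini's theorem, and the error is integrated over the bounded set of relevant y.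
  Likewise v is a Schwartz function at first, and is made general once the bound is known to be
  independent of \<theta>. The second inclusion is the first with the factors exchanged.\<close>

section \<open>Smooth functions and the flat function\<close>

text \<open>Iterated derivatives never leave \<open>P\<close>. Smoothness is therefore proved by
  exhibiting a class that is closed under differentiation, which avoids formulas for higher
  derivatives.\<close>

lemma smooth_coinduct:
  assumes "P f" and "\<And>g. P g \<Longrightarrow> g differentiable_on UNIV"
    and "\<And>g i. P g \<Longrightarrow> P (partial_derivative i g)"
  shows "smooth f"
proof -
  have "P (partial_derivatives is f)" for "is"
    by (induction "is") (auto simp: partial_derivatives_def assms)
  then show ?thesis by (auto simp: smooth_def assms)
qed

text \<open>The fold applies the last index first, so a derivative taken before all others is an
  index appended at the end.\<close>

lemma partial_derivatives_snoc:
  "partial_derivatives is (partial_derivative i f) = partial_derivatives (is @ [i]) f"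
  by (simp add: partial_derivatives_def)

lemma partial_derivatives_Nil [simp]: "partial_derivatives [] f = f"
  by (simp add: partial_derivatives_def)

lemma partial_derivatives_Cons [simp]:
  "partial_derivatives (i # is) f = partial_derivative i (partial_derivatives is f)"
  by (simp add: partial_derivatives_def)

lemma smooth_partial_derivative: "smooth f \<Longrightarrow> smooth (partial_derivative i f)"
  by (auto simp: smooth_def partial_derivatives_snoc)

lemma smooth_partial_derivatives: "smooth f \<Longrightarrow> smooth (partial_derivatives is f)"
  by (induction "is") (auto simp: smooth_partial_derivative)

lemma smooth_imp_differentiable_on: "smooth f \<Longrightarrow> f differentiable_on UNIV"
  unfolding smooth_def by (metis partial_derivatives_Nil)

lemma smooth_imp_differentiable: "smooth f \<Longrightarrow> f differentiable (at x)"
  using smooth_imp_differentiable_on by (auto simp: differentiable_on_def)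

lemma smooth_imp_continuous_on: "smooth f \<Longrightarrow> continuous_on A f"
  by (meson smooth_imp_differentiable_on differentiable_imp_continuous_on continuous_on_subset subset_UNIV)

lemma partial_derivative_eqI:
  "(f has_derivative f') (at x) \<Longrightarrow> partial_derivative i f x = f' (axis i 1)"
  by (simp add: partial_derivative_def frechet_derivative_at [symmetric])

lemma differentiable_onI_has_derivative:
  "(\<And>x. \<exists>f'. (f has_derivative f') (at x)) \<Longrightarrow> f differentiable_on UNIV"
  by (auto simp: differentiable_on_def differentiable_def)

lemma differentiable_on_UNIV_has_derivative:
  "f differentiable_on UNIV \<Longrightarrow> (f has_derivative frechet_derivative f (at x)) (at x)"
  by (auto simp: differentiable_on_def frechet_derivative_works)

text \<open>The derivatives of the flat function \<open>flat 0\<close> are linear combinations of the \<open>flat k\<close>.\<close>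

definition flat :: "nat \<Rightarrow> real \<Rightarrow> real" where
  "flat k t = (if t \<le> 0 then 0 else exp (- (1 / t)) / t ^ k)"

lemma flat_nonneg: "0 \<le> flat k t"
  by (simp add: flat_def)

lemma flat_pos: "0 < t \<Longrightarrow> 0 < flat k t"
  by (simp add: flat_def)

lemma flat_eq_0 [simp]: "t \<le> 0 \<Longrightarrow> flat k t = 0"
  by (simp add: flat_def)

text \<open>The exponential series dominates its term of order \<open>k + 2\<close>. Two powers more
  than the denominator of \<open>flat k\<close> are taken so that the quotient of
  \<open>flat k t\<close> by \<open>t\<close> still tends to 0 at the origin.\<close>

lemma flat_bound: "\<bar>flat k t\<bar> \<le> fact (k + 2) * t\<^sup>2"
proof (cases "t \<le> 0")
  case False
  then have t: "t > 0" by simp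
  have "(1 / t) ^ (k+2) / fact (k+2) \<le> (\<Sum>i\<le>k+2. (1/t) ^ i /\<^sub>R fact i)"
    using t member_le_sum[of "k+2" "{..k+2}" "\<lambda>i. (1/t) ^ i /\<^sub>R fact i"]
    by (auto simp: field_simps)
  also have "\<dots> \<le> exp (1/t)"
    unfolding exp_def by (rule sum_le_suminf) (use t summable_exp_generic[of "1/t"] in auto)
  finally have "1 / (t ^ (k+2) * fact (k+2)) \<le> exp (1/t)"
    by (simp add: power_one_over divide_simps del: fact_Suc power_Suc add_2_eq_Suc')
  then have "exp (- (1/t)) \<le> t ^ (k+2) * fact (k+2)"
    using t by (simp add: exp_minus divide_simps mult_ac del: fact_Suc power_Suc add_2_eq_Suc')
  then have "exp (- (1/t)) / t ^ k \<le> fact (k+2) * t\<^sup>2"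
    using t by (simp add: pos_divide_le_eq power_add mult_ac del: fact_Suc power_Suc add_2_eq_Suc')
  then show ?thesis using t by (simp add: flat_def)
qed simp

text \<open>Away from 0 this is elementary calculus on each side. At 0 the quadratic bound makes the
  difference quotient vanish, and both terms of the formula are 0 there as well.\<close>

lemma flat_has_real_derivative:
  "(flat k has_real_derivative flat (k + 2) t - real k * flat (k + 1) t) (at t)"
proof -
  consider "t < 0" | "t = 0" | "t > 0" by linarith
  then show ?thesis
  proof cases
    case 1
    have "((\<lambda>t. 0) has_real_derivative 0) (at t)" by simp
    then have "(flat k has_real_derivative 0) (at t)"
      by (rule has_field_derivative_transform_within_open[where S = "{..<0}"]) (use 1 in auto)
    with 1 show ?thesis by simp
  next
    case 2
    have "((\<lambda>h. flat k h / h) \<longlongrightarrow> 0) (at 0)"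
    proof (rule tendsto_0_le[where f = "\<lambda>h. h" and K = "fact (k+2)"])
      show "\<forall>\<^sub>F x in at 0. norm (flat k x / x) \<le> norm x * fact (k + 2)"
      proof (rule eventually_at_topological[THEN iffD2], intro exI[of _ UNIV] conjI ballI impI)
        fix x :: real assume "x \<noteq> 0"
        then show "norm (flat k x / x) \<le> norm x * fact (k + 2)"
          using flat_bound[of k x] power2_abs[of x, symmetric]
          by (simp add: pos_divide_le_eq power2_eq_square mult_ac del: power2_abs fact_Suc)
      qed auto
    qed (rule tendsto_ident_at)
    then show ?thesis using 2 by (simp add: DERIV_def)
  next
    case 3
    have "((\<lambda>t. exp (- (1 / t)) / t ^ k) has_real_derivative
        (exp (- (1 / t)) * (1 / t\<^sup>2) * t ^ k - exp (- (1/t)) * (real k * t ^ (k - 1))) /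
          (t ^ k * t ^ k)) (at t)"
      using 3 by (auto intro!: derivative_eq_intros simp: power2_eq_square)
    also have "(exp (- (1 / t)) * (1 / t\<^sup>2) * t ^ k - exp (- (1/t)) * (real k * t ^ (k - 1))) / (t ^ k * t ^ k)
        = flat (k + 2) t - real k * flat (k + 1) t"
      using 3 by (cases k) (auto simp: flat_def field_simps power2_eq_square power_add)
    finally have *: "((\<lambda>t. exp (- (1 / t)) / t ^ k) has_real_derivative flat (k + 2) t - real k * flat
        (k + 1) t) (at t)" .
    show ?thesis
      by (rule has_field_derivative_transform_within_open[OF *,
        where S = "{0<..}"]) (use 3 in \<open>auto simp: flat_def\<close>)
  qed
qed

section \<open>Closure properties of smooth functions\<close>

text \<open>The rules are chosen so that each derivative is again generated: powers turn into powers
  with another exponent, \<open>flat k\<close> into a combination of \<open>flat (k + 1)\<close> and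
  \<open>flat (k + 2)\<close>. This is why \<open>r\<close> and \<open>k\<close> range freely. Real
  functions enter through \<open>Re\<close> because smoothness is only available for complex
  values.\<close>

inductive_set smooth_closure :: "(real ^ 'n::finite \<Rightarrow> complex) set" where
  base: "smooth f \<Longrightarrow> f \<in> smooth_closure"
| const: "(\<lambda>x. c) \<in> smooth_closure"
| coord: "(\<lambda>x. complex_of_real (x $ i)) \<in> smooth_closure"
| add: "f \<in> smooth_closure \<Longrightarrow> g \<in> smooth_closure \<Longrightarrow> (\<lambda>x. f x + g x) \<in> smooth_closure"
| mult: "f \<in> smooth_closure \<Longrightarrow> g \<in> smooth_closure \<Longrightarrow> (\<lambda>x. f x * g x) \<in> smooth_closure"
| Re: "f \<in> smooth_closure \<Longrightarrow> (\<lambda>x. complex_of_real (Re (f x))) \<in> smooth_closure"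
| powr: "f \<in> smooth_closure \<Longrightarrow> (\<And>x. Re (f x) > 0) \<Longrightarrow> (\<lambda>x. complex_of_real (Re (f x) powr r)) \<in> smooth_closure"
| flat: "f \<in> smooth_closure \<Longrightarrow> (\<lambda>x. complex_of_real (flat k (Re (f x)))) \<in> smooth_closure"

lemma has_derivative_of_real_comp:
  assumes "(f has_derivative f') (at x)" "(h has_real_derivative d) (at (Re (f x)))"
  shows "((\<lambda>x. complex_of_real (h (Re (f x)))) has_derivative (\<lambda>v. complex_of_real (d * Re (f' v)))) (at x)"
proof -
  have "((\<lambda>x. Re (f x)) has_derivative (\<lambda>v. Re (f' v))) (at x)"
    using assms(1) by (rule has_derivative_Re)
  from has_derivative_compose[OF this assms(2)[unfolded has_field_derivative_def]]
  show ?thesis by (rule has_derivative_of_real)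
qed

lemma smooth_closure_step:
  assumes "f \<in> smooth_closure"
  shows "f differentiable_on UNIV \<and> (\<forall>i. partial_derivative i f \<in> smooth_closure)"
  using assms
proof (induction rule: smooth_closure.induct)
  case (base f)
  then show ?case
    by (auto intro: smooth_imp_differentiable_on smooth_partial_derivative smooth_closure.base)
next
  case (const c)
  have "((\<lambda>x::real^'a. c) has_derivative (\<lambda>_. 0)) (at x)" for x by simp
  then have "partial_derivative i (\<lambda>x::real^'a. c) = (\<lambda>x. 0)" for i
    by (intro ext, subst partial_derivative_eqI) auto
  then show ?case by (auto intro: smooth_closure.intros)
next
  case (coord j)
  have *: "((\<lambda>x::real^'a. complex_of_real (x $ j)) has_derivative (\<lambda>v. of_real (v $ j))) (at x)" for x
    by (intro has_derivative_of_real bounded_linear_imp_has_derivative bounded_linear_vec_nth)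
  then have "partial_derivative i (\<lambda>x::real^'a. complex_of_real (x $ j)) = (\<lambda>x. of_real (axis i 1 $ j))" for i
    by (intro ext, subst partial_derivative_eqI) auto
  then show ?case using * by (auto intro: smooth_closure.intros differentiable_onI_has_derivative)
next
  case (add f g)
  have *: "((\<lambda>x. f x + g x) has_derivative (\<lambda>v. frechet_derivative f (at x) v + frechet_derivative g
      (at x) v)) (at x)" for x
    using add.IH by (intro has_derivative_add differentiable_on_UNIV_has_derivative) auto
  have "partial_derivative i (\<lambda>x. f x + g x) = (\<lambda>x. partial_derivative i f x + partial_derivative i g x)" for i
    by (intro ext, subst partial_derivative_eqI[OF *]) (simp add: partial_derivative_def)
  then show ?case using * add.IH by (auto intro: smooth_closure.intros differentiable_onI_has_derivative)
next
  case (mult f g)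
  have *: "((\<lambda>x. f x * g x) has_derivative (\<lambda>v. f x * frechet_derivative g (at x) v + frechet_derivative
      f (at x) v * g x)) (at x)" for x
    using mult.IH by (intro has_derivative_mult differentiable_on_UNIV_has_derivative) auto
  have "partial_derivative i (\<lambda>x. f x * g x) = (\<lambda>x. f x * partial_derivative i g x + partial_derivative
      i f x * g x)" for i
    by (intro ext, subst partial_derivative_eqI[OF *]) (simp add: partial_derivative_def)
  then show ?case using * mult by (auto intro!: smooth_closure.intros(4,5) intro:
      differentiable_onI_has_derivative)
next
  case (Re f)
  have *: "((\<lambda>x. complex_of_real (Re (f x))) has_derivative
      (\<lambda>v. of_real (1 * Re (frechet_derivative f (at x) v)))) (at x)" for x
    using Re.IH by (intro has_derivative_of_real_comp[where h = "\<lambda>x. x"]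
      differentiable_on_UNIV_has_derivative) auto
  have "partial_derivative i (\<lambda>x. complex_of_real (Re (f x))) =
      (\<lambda>x. of_real (Re (partial_derivative i f x)))" for i
    by (intro ext, subst partial_derivative_eqI[OF *]) (simp add: partial_derivative_def)
  then show ?case using * Re.IH by (auto intro: smooth_closure.intros differentiable_onI_has_derivative)
next
  case (powr f r)
  have d: "((\<lambda>t. t powr r) has_real_derivative r * Re (f x) powr (r - 1)) (at (Re (f x)))" for x
    using powr.hyps(2)[of x] by (auto intro!: derivative_eq_intros simp: powr_diff)
  have *: "((\<lambda>x. complex_of_real (Re (f x) powr r)) has_derivative
      (\<lambda>v. of_real ((r * Re (f x) powr (r - 1)) * Re (frechet_derivative f (at x) v)))) (at x)" for x
    using powr.IH by (intro has_derivative_of_real_comp[where h = "\<lambda>t. t powr r"]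
      differentiable_on_UNIV_has_derivative d) auto
  have "partial_derivative i (\<lambda>x. complex_of_real (Re (f x) powr r)) =
      (\<lambda>x. (of_real r * of_real (Re (f x) powr (r - 1))) * of_real (Re (partial_derivative i f x)))" for i
    by (intro ext, subst partial_derivative_eqI[OF *]) (simp add: partial_derivative_def)
  then show ?case using * powr.IH powr.hyps
    by (auto intro!: smooth_closure.intros(2,5,6,7) intro: differentiable_onI_has_derivative)
next
  case (flat f k)
  have *: "((\<lambda>x. complex_of_real (flat k (Re (f x)))) has_derivative
      (\<lambda>v. of_real ((flat (k + 2) (Re (f x)) - real k * flat (k + 1) (Re (f x))) * Re
        (frechet_derivative f (at x) v)))) (at x)" for x
    using flat.IH by (intro has_derivative_of_real_comp[where h = "flat k"]
      differentiable_on_UNIV_has_derivative flat_has_real_derivative) auto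
  have "partial_derivative i (\<lambda>x. complex_of_real (flat k (Re (f x)))) =
      (\<lambda>x. (of_real (flat (k+2) (Re (f x))) + of_real (- real k) * of_real (flat (k+1) (Re (f x)))) *
        of_real (Re (partial_derivative i f x)))" for i
    by (intro ext, subst partial_derivative_eqI[OF *]) (simp add: partial_derivative_def)
  moreover have "(\<lambda>x. (of_real (flat (k+2) (Re (f x))) + of_real (- real k) * of_real
      (flat (k+1) (Re (f x)))) * of_real (Re (partial_derivative i f x))) \<in> smooth_closure" for i
    using flat by (intro smooth_closure.intros(2,4,5,6,8)) auto
  moreover have "(\<lambda>x. complex_of_real (flat k (Re (f x)))) differentiable_on UNIV"
    by (intro differentiable_onI_has_derivative exI, rule *)
  ultimately show ?case by metis
qed

lemma smooth_closureD: "f \<in> smooth_closure \<Longrightarrow> smooth f"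
  by (rule smooth_coinduct[where P = "\<lambda>f. f \<in> smooth_closure"]) (simp_all add: smooth_closure_step)

lemma smooth_const [simp, intro]: "smooth (\<lambda>x. c)"
  by (rule smooth_closureD[OF smooth_closure.const])

lemma smooth_coord: "smooth (\<lambda>x. complex_of_real (x $ i))"
  by (rule smooth_closureD[OF smooth_closure.coord])

lemma smooth_add: "smooth f \<Longrightarrow> smooth g \<Longrightarrow> smooth (\<lambda>x. f x + g x)"
  by (rule smooth_closureD[OF smooth_closure.add[OF smooth_closure.base smooth_closure.base]])

lemma smooth_mult: "smooth f \<Longrightarrow> smooth g \<Longrightarrow> smooth (\<lambda>x. f x * g x)"
  by (rule smooth_closureD[OF smooth_closure.mult[OF smooth_closure.base smooth_closure.base]])

lemma smooth_Re: "smooth f \<Longrightarrow> smooth (\<lambda>x. complex_of_real (Re (f x)))"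
  by (rule smooth_closureD[OF smooth_closure.Re[OF smooth_closure.base]])

lemma smooth_powr: "smooth f \<Longrightarrow> (\<And>x. Re (f x) > 0) \<Longrightarrow> smooth (\<lambda>x. complex_of_real (Re (f x) powr r))"
  by (rule smooth_closureD[OF smooth_closure.powr[OF smooth_closure.base]])

lemma smooth_flat: "smooth f \<Longrightarrow> smooth (\<lambda>x. complex_of_real (flat k (Re (f x))))"
  by (rule smooth_closureD[OF smooth_closure.flat[OF smooth_closure.base]])

lemma smooth_cnj:
  assumes "smooth f" shows "smooth (\<lambda>x. cnj (f x))"
proof -
  have "smooth (\<lambda>x. 2 * complex_of_real (Re (f x)) + (-1) * f x)"
    using assms by (intro smooth_add smooth_mult smooth_Re smooth_const)
  moreover have "(\<lambda>x. 2 * complex_of_real (Re (f x)) + (-1) * f x) = (\<lambda>x. cnj (f x))"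
    by (auto simp: complex_eq_iff)
  ultimately show ?thesis by simp
qed

lemma smooth_sum: "(\<And>i. i \<in> I \<Longrightarrow> smooth (f i)) \<Longrightarrow> smooth (\<lambda>x. \<Sum>i\<in>I. f i x)"
  by (induction I rule: infinite_finite_induct) (simp_all add: smooth_add)

lemma smooth_prod: "(\<And>i. i \<in> I \<Longrightarrow> smooth (f i)) \<Longrightarrow> smooth (\<lambda>x. \<Prod>i\<in>I. f i x)"
  by (induction I rule: infinite_finite_induct) (simp_all add: smooth_mult)

section \<open>Derivatives of sums, products, conjugates, translates and dilations\<close>

lemma partial_derivative_add:
  assumes "smooth f" "smooth g"
  shows "partial_derivative i (\<lambda>x. f x + g x) = (\<lambda>x. partial_derivative i f x + partial_derivative i g x)"
proof
  fix x
  have "((\<lambda>x. f x + g x) has_derivative (\<lambda>v. frechet_derivative f (at x) v + frechet_derivative g (at x)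
      v)) (at x)" for x
    using assms by (intro has_derivative_add differentiable_on_UNIV_has_derivative
      smooth_imp_differentiable_on) auto
  then show "partial_derivative i (\<lambda>x. f x + g x) x = partial_derivative i f x + partial_derivative i g x"
    by (subst partial_derivative_eqI) (auto simp: partial_derivative_def)
qed

lemma partial_derivative_mult:
  assumes "smooth f" "smooth g"
  shows "partial_derivative i (\<lambda>x. f x * g x) = (\<lambda>x. f x * partial_derivative i g x + partial_derivative
      i f x * g x)"
proof
  fix x
  have "((\<lambda>x. f x * g x) has_derivative (\<lambda>v. f x * frechet_derivative g (at x) v + frechet_derivative f
      (at x) v * g x)) (at x)" for x
    using assms by (intro has_derivative_mult differentiable_on_UNIV_has_derivative
      smooth_imp_differentiable_on) auto
  then show "partial_derivative i (\<lambda>x. f x * g x) x =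
      f x * partial_derivative i g x + partial_derivative i f x * g x"
    by (subst partial_derivative_eqI) (auto simp: partial_derivative_def)
qed

lemma partial_derivative_cmult:
  fixes f :: "real ^ 'n::finite \<Rightarrow> complex"
  assumes "smooth f"
  shows "partial_derivative i (\<lambda>x. c * f x) = (\<lambda>x. c * partial_derivative i f x)"
proof -
  have "partial_derivative i (\<lambda>x::real^'n. c) x = 0" for x
    by (subst partial_derivative_eqI[OF has_derivative_const]) simp
  then show ?thesis using partial_derivative_mult[of "\<lambda>x. c" f i] assms by simp
qed

lemma partial_derivative_cnj:
  assumes "smooth f"
  shows "partial_derivative i (\<lambda>x. cnj (f x)) = (\<lambda>x. cnj (partial_derivative i f x))"
proof
  fix x
  have "((\<lambda>x. cnj (f x)) has_derivative (\<lambda>v. cnj (frechet_derivative f (at x) v))) (at x)" for x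
    using assms by (intro has_derivative_cnj differentiable_on_UNIV_has_derivative smooth_imp_differentiable_on)
  then show "partial_derivative i (\<lambda>x. cnj (f x)) x = cnj (partial_derivative i f x)"
    by (subst partial_derivative_eqI) (auto simp: partial_derivative_def)
qed

lemma partial_derivative_translate:
  assumes "smooth f"
  shows "partial_derivative i (translate y f) = translate y (partial_derivative i f)"
proof
  fix x
  have "(f has_derivative frechet_derivative f (at (x - y))) (at (x - y))"
    using assms by (intro differentiable_on_UNIV_has_derivative smooth_imp_differentiable_on)
  moreover have "((\<lambda>x. x - y) has_derivative (\<lambda>v. v)) (at x)"
    by (auto intro!: derivative_eq_intros)
  ultimately have "((\<lambda>x. f (x - y)) has_derivative frechet_derivative f (at (x - y))) (at x)"
    using has_derivative_compose by fastforce
  then show "partial_derivative i (translate y f) x = translate y (partial_derivative i f) x"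
    unfolding translate_def by (subst partial_derivative_eqI) (auto simp: partial_derivative_def)
qed

lemma partial_derivative_scale:
  assumes "smooth f"
  shows "partial_derivative i (\<lambda>x. f (c *\<^sub>R x)) = (\<lambda>x. of_real c * partial_derivative i f (c *\<^sub>R x))"
proof
  fix x
  have d: "(f has_derivative frechet_derivative f (at (c *\<^sub>R x))) (at (c *\<^sub>R x))"
    using assms by (intro differentiable_on_UNIV_has_derivative smooth_imp_differentiable_on)
  moreover have "((\<lambda>x. c *\<^sub>R x) has_derivative (\<lambda>v. c *\<^sub>R v)) (at x)"
    by (auto intro!: derivative_eq_intros)
  ultimately have "((\<lambda>x. f (c *\<^sub>R x)) has_derivative
      (\<lambda>v. frechet_derivative f (at (c *\<^sub>R x)) (c *\<^sub>R v))) (at x)"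
    using has_derivative_compose by fastforce
  then have "partial_derivative i (\<lambda>x. f (c *\<^sub>R x)) x = frechet_derivative f (at (c *\<^sub>R x)) (c *\<^sub>R axis i 1)"
    by (rule partial_derivative_eqI)
  also have "\<dots> = of_real c * partial_derivative i f (c *\<^sub>R x)"
    unfolding linear_scale[OF has_derivative_linear[OF d]] partial_derivative_def
      by (simp add: scaleR_conv_of_real)
  finally show "partial_derivative i (\<lambda>x. f (c *\<^sub>R x)) x = of_real c * partial_derivative i f (c *\<^sub>R x)" .
qed

lemma smooth_translate:
  assumes "smooth f" shows "smooth (translate y f)"
proof (rule smooth_coinduct[where P = "\<lambda>g. g \<in> translate y ` Collect smooth"])
  fix g i assume "g \<in> translate y ` Collect smooth"
  then obtain f where f: "smooth f" "g = translate y f" by auto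
  have "(\<lambda>x. f (x - y)) differentiable (at x)" for x
    using differentiable_compose[of f "\<lambda>x. x - y" x]
    by (auto intro: smooth_imp_differentiable f(1) derivative_intros)
  then show "g differentiable_on UNIV" by (simp add: f translate_def differentiable_on_def)
  show "partial_derivative i g \<in> translate y ` Collect smooth"
    using f by (auto simp: partial_derivative_translate intro: smooth_partial_derivative)
qed (use assms in auto)

lemma smooth_scale:
  assumes "smooth f" shows "smooth (\<lambda>x. f (c *\<^sub>R x))"
proof (rule smooth_coinduct[where P = "\<lambda>g. g \<in> (\<lambda>f x. f (c *\<^sub>R x)) ` Collect smooth"])
  fix g :: "real ^ 'a \<Rightarrow> complex" and i assume "g \<in> (\<lambda>f x. f (c *\<^sub>R x)) ` Collect smooth"
  then obtain f where f: "smooth f" "g = (\<lambda>x. f (c *\<^sub>R x))" by (elim imageE CollectE)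
  have "(\<lambda>x. f (c *\<^sub>R x)) differentiable (at x)" for x
    using differentiable_compose[of f "\<lambda>x. c *\<^sub>R x" x]
    by (auto intro: smooth_imp_differentiable f(1) derivative_intros)
  then show "g differentiable_on UNIV" by (simp add: f differentiable_on_def)
  have "smooth (\<lambda>x. of_real c * partial_derivative i f x)"
    using f by (intro smooth_mult smooth_const smooth_partial_derivative)
  moreover have "partial_derivative i g = (\<lambda>x. of_real c * partial_derivative i f (c *\<^sub>R x))"
    using f by (simp only: partial_derivative_scale)
  ultimately show "partial_derivative i g \<in> (\<lambda>f x. f (c *\<^sub>R x)) ` Collect smooth"
    by (intro image_eqI[of _ _ "\<lambda>x. of_real c * partial_derivative i f x"]) simp_all
qed (use assms in simp)

subsection \<open>Schwartz functions\<close>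

text \<open>Decay of a single function, separated from smoothness: a class that is closed under
  differentiation and has only rapid members consists of Schwartz functions.\<close>

definition rapid :: "(real ^ 'n::finite \<Rightarrow> complex) \<Rightarrow> bool" where
  "rapid f \<longleftrightarrow> (\<forall>N. \<exists>C. \<forall>x. (1 + norm x) ^ N * cmod (f x) \<le> C)"

lemma schwartz_iff_rapid:
  "f \<in> schwartz_functions \<longleftrightarrow> smooth f \<and> (\<forall>is. rapid (partial_derivatives is f))"
  by (auto simp: schwartz_functions_def rapid_def bdd_above_def)

lemma schwartz_smooth: "f \<in> schwartz_functions \<Longrightarrow> smooth f"
  by (simp add: schwartz_iff_rapid)

lemma schwartz_rapid: "f \<in> schwartz_functions \<Longrightarrow> rapid f"
  unfolding schwartz_iff_rapid by (metis partial_derivatives_Nil)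

lemma schwartz_partial_derivative:
  "f \<in> schwartz_functions \<Longrightarrow> partial_derivative i f \<in> schwartz_functions"
  by (simp add: schwartz_iff_rapid smooth_partial_derivative partial_derivatives_snoc)

lemma schwartz_coinduct:
  assumes "P f" and "\<And>g. P g \<Longrightarrow> g differentiable_on UNIV" "\<And>g. P g \<Longrightarrow> rapid g"
    and "\<And>g i. P g \<Longrightarrow> P (partial_derivative i g)"
  shows "f \<in> schwartz_functions"
proof -
  have "smooth f" by (rule smooth_coinduct[of P]) (auto simp: assms)
  moreover have "P (partial_derivatives is f)" for "is"
    by (induction "is") (auto simp: assms)
  ultimately show ?thesis by (auto simp: schwartz_iff_rapid assms)
qed

lemma rapid_add:
  assumes "rapid f" "rapid g" shows "rapid (\<lambda>x. f x + g x)"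
  unfolding rapid_def
proof
  fix N
  obtain C D where *: "\<And>x. (1 + norm x) ^ N * cmod (f x) \<le> C" "\<And>x. (1 + norm x) ^ N * cmod (g x) \<le> D"
    using assms unfolding rapid_def by metis
  have "(1 + norm x) ^ N * cmod (f x + g x) \<le> C + D" for x
  proof -
    have "(1 + norm x) ^ N * cmod (f x + g x) \<le> (1 + norm x) ^ N * (cmod (f x) + cmod (g x))"
      by (intro mult_left_mono norm_triangle_ineq) simp
    also have "\<dots> \<le> C + D" using *[of x] by (simp add: distrib_left)
    finally show ?thesis .
  qed
  then show "\<exists>C. \<forall>x. (1 + norm x) ^ N * cmod (f x + g x) \<le> C" by blast
qed

section \<open>Polynomial growth and multipliers of the Schwartz space\<close>

definition slow :: "(real ^ 'n::finite \<Rightarrow> complex) \<Rightarrow> bool" where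
  "slow f \<longleftrightarrow> (\<exists>N C. C \<ge> 0 \<and> (\<forall>x. cmod (f x) \<le> C * (1 + norm x) ^ N))"

lemma slow_bounded: "(\<And>x. cmod (f x) \<le> C) \<Longrightarrow> slow f"
proof -
  assume *: "\<And>x. cmod (f x) \<le> C"
  then have "C \<ge> 0" by (meson norm_ge_zero order_trans)
  then show ?thesis using * unfolding slow_def by (intro exI[of _ 0] exI[of _ C]) auto
qed

lemma slow_add:
  assumes "slow f" "slow g" shows "slow (\<lambda>x. f x + g x)"
proof -
  obtain C D N M where *: "\<And>x. cmod (f x) \<le> C * (1 + norm x) ^ N" "C \<ge> 0" "D \<ge> 0"
      "\<And>x. cmod (g x) \<le> D * (1 + norm x) ^ M"
    using assms unfolding slow_def by metis
  have "cmod (f x + g x) \<le> (C + D) * (1 + norm x) ^ (max N M)" for x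
  proof -
    have "cmod (f x + g x) \<le> C * (1 + norm x) ^ N + D * (1 + norm x) ^ M"
      using *(1)[of x] *(4)[of x] norm_triangle_ineq[of "f x" "g x"] by simp
    also have "\<dots> \<le> C * (1 + norm x) ^ (max N M) + D * (1 + norm x) ^ (max N M)"
      by (intro add_mono mult_left_mono power_increasing * ) auto
    finally show ?thesis by (simp add: distrib_right)
  qed
  then show ?thesis using * unfolding slow_def by (intro exI[of _ "max N M"] exI[of _ "C + D"]) auto
qed

lemma slow_mult:
  assumes "slow f" "slow g" shows "slow (\<lambda>x. f x * g x)"
proof -
  obtain C D N M where *: "\<And>x. cmod (f x) \<le> C * (1 + norm x) ^ N" "C \<ge> 0" "D \<ge> 0"
      "\<And>x. cmod (g x) \<le> D * (1 + norm x) ^ M"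
    using assms unfolding slow_def by metis
  have "cmod (f x * g x) \<le> (C * D) * (1 + norm x) ^ (N + M)" for x
    using mult_mono[OF *(1)[of x] *(4)[of x]] * by (simp add: norm_mult power_add mult_ac)
  then show ?thesis using * unfolding slow_def by (intro exI[of _ "N + M"] exI[of _ "C * D"]) auto
qed

lemma rapid_slow_mult:
  assumes "slow f" "rapid g" shows "rapid (\<lambda>x. f x * g x)"
  unfolding rapid_def
proof
  fix N
  obtain M C where C: "\<And>x. cmod (f x) \<le> C * (1 + norm x) ^ M" "C \<ge> 0"
    using assms unfolding slow_def by metis
  obtain D where D: "\<And>x. (1 + norm x) ^ (N + M) * cmod (g x) \<le> D"
    using assms unfolding rapid_def by metis
  have "(1 + norm x) ^ N * cmod (f x * g x) \<le> C * D" for x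
  proof -
    have "(1 + norm x) ^ N * cmod (f x * g x) \<le> (1 + norm x) ^ N * ((C * (1 + norm x) ^ M) * cmod (g x))"
      unfolding norm_mult by (intro mult_left_mono mult_right_mono C) auto
    also have "\<dots> = C * ((1 + norm x) ^ (N + M) * cmod (g x))" by (simp add: power_add mult_ac)
    also have "\<dots> \<le> C * D" by (intro mult_left_mono C D)
    finally show ?thesis .
  qed
  then show "\<exists>C. \<forall>x. (1 + norm x) ^ N * cmod (f x * g x) \<le> C" by blast
qed

lemma rapid_imp_bounded: "rapid f \<Longrightarrow> \<exists>C. \<forall>x. cmod (f x) \<le> C"
  unfolding rapid_def by (metis mult_1 power_0)

lemma rapid_imp_slow: "rapid f \<Longrightarrow> slow f"
  using rapid_imp_bounded slow_bounded by metis

lemma sum_squares_le_norm: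
  fixes x :: "real ^ 'n::finite"
  shows "(\<Sum>i\<in>I. (x $ i)\<^sup>2) \<le> (norm x)\<^sup>2"
proof -
  have "(\<Sum>i\<in>I. (x $ i)\<^sup>2) \<le> (\<Sum>i\<in>UNIV. (x $ i)\<^sup>2)" by (intro sum_mono2) auto
  also have "\<dots> = (norm x)\<^sup>2"
    by (simp add: norm_vec_def L2_set_def sum_nonneg)
  finally show ?thesis .
qed

text \<open>With \<open>I\<close> the set of coordinates of the l-th factor this is 1 + |\<xi>_l|^2;
  the bracket is a product of real powers of such terms.\<close>

definition block :: "'n set \<Rightarrow> real ^ 'n::finite \<Rightarrow> real" where
  "block I x = 1 + (\<Sum>i\<in>I. (x $ i)\<^sup>2)"

lemma block_ge_1: "block I x \<ge> 1"
  by (simp add: block_def sum_nonneg)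

lemma block_pos: "block I x > 0"
  using block_ge_1[of I x] by linarith

lemma block_le: "block I x \<le> (1 + norm x)\<^sup>2"
  using sum_squares_le_norm[of x I] by (simp add: block_def power2_sum add_increasing2)

text \<open>Closed under differentiation by construction, so that polynomial growth of the members
  passes to all their derivatives.\<close>

inductive_set slow_smooth :: "(real ^ 'n::finite \<Rightarrow> complex) set" where
  const: "(\<lambda>x. c) \<in> slow_smooth"
| coord: "(\<lambda>x. complex_of_real (x $ i)) \<in> slow_smooth"
| add: "f \<in> slow_smooth \<Longrightarrow> g \<in> slow_smooth \<Longrightarrow> (\<lambda>x. f x + g x) \<in> slow_smooth"
| mult: "f \<in> slow_smooth \<Longrightarrow> g \<in> slow_smooth \<Longrightarrow> (\<lambda>x. f x * g x) \<in> slow_smooth"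
| block: "(\<lambda>x. complex_of_real (block I x powr r)) \<in> slow_smooth"
| char: "(\<lambda>x. exp (\<i> * complex_of_real (x \<bullet> y))) \<in> slow_smooth"

lemma smooth_block: "smooth (\<lambda>x. complex_of_real (block I x powr r))"
proof -
  have eq: "(\<lambda>x::real^'a. complex_of_real (block I x)) = (\<lambda>x. 1 + (\<Sum>i\<in>I. of_real (x $ i) * of_real (x $ i)))"
    by (auto simp: block_def power2_eq_square)
  have "smooth (\<lambda>x. 1 + (\<Sum>i\<in>I. complex_of_real (x $ i) * of_real (x $ i)))"
    by (intro smooth_add smooth_const smooth_sum smooth_mult smooth_coord)
  from smooth_powr[OF this[folded eq], of r] show ?thesis by (simp add: block_pos)
qed

lemma block_has_derivative:
  "((\<lambda>x. complex_of_real (block I x powr r)) has_derivative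
     (\<lambda>v. of_real (r * block I x powr (r - 1) * (\<Sum>i\<in>I. 2 * x $ i * v $ i)))) (at x)"
proof -
  have nth: "((\<lambda>x. x $ i) has_derivative (\<lambda>v. v $ i)) (at x)" for i
    by (intro bounded_linear_imp_has_derivative bounded_linear_vec_nth)
  have "((\<lambda>x. 1 + (\<Sum>i\<in>I. (x $ i)\<^sup>2)) has_derivative (\<lambda>v. (\<Sum>i\<in>I. 2 * x $ i * v $ i))) (at x)"
    by (rule derivative_eq_intros nth refl | simp add: mult_ac)+
  then have 1: "(block I has_derivative (\<lambda>v. (\<Sum>i\<in>I. 2 * x $ i * v $ i))) (at x)"
    unfolding block_def[abs_def] .
  have "((\<lambda>t. t powr r) has_real_derivative r * block I x powr (r - 1)) (at (block I x))"
    using block_pos[of I x] by (auto intro!: derivative_eq_intros simp: powr_diff)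
  from has_derivative_compose[OF 1 this[unfolded has_field_derivative_def]]
  show ?thesis by (rule has_derivative_of_real)
qed

lemma char_has_derivative:
  "((\<lambda>x. exp (\<i> * complex_of_real (x \<bullet> y))) has_derivative
     (\<lambda>v. \<i> * of_real (v \<bullet> y) * exp (\<i> * complex_of_real (x \<bullet> y)))) (at x)"
proof -
  have "((\<lambda>x. \<i> * complex_of_real (x \<bullet> y)) has_derivative (\<lambda>v. \<i> * of_real (v \<bullet> y))) (at x)"
    by (rule derivative_eq_intros refl | simp)+
  moreover have "(exp has_field_derivative exp (\<i> * complex_of_real (x \<bullet> y)))
      (at (\<i> * complex_of_real (x \<bullet> y)))"
    by (rule DERIV_exp)
  ultimately show ?thesis
    using has_derivative_compose[of "\<lambda>x. \<i> * complex_of_real (x \<bullet> y)" _ _ _ exp]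
    unfolding has_field_derivative_def by (fastforce simp: mult_ac)
qed

lemma slow_smooth_step:
  assumes "f \<in> slow_smooth"
  shows "smooth f \<and> slow f \<and> (\<forall>i. partial_derivative i f \<in> slow_smooth)"
  using assms
proof (induction rule: slow_smooth.induct)
  case (const c)
  have "partial_derivative i (\<lambda>x::real^'a. c) = (\<lambda>x. 0)" for i
    by (intro ext, subst partial_derivative_eqI[OF has_derivative_const]) simp
  then show ?case by (auto intro: slow_bounded slow_smooth.intros)
next
  case (coord j)
  have *: "((\<lambda>x::real^'a. complex_of_real (x $ j)) has_derivative (\<lambda>v. of_real (v $ j))) (at x)" for x
    by (intro has_derivative_of_real bounded_linear_imp_has_derivative bounded_linear_vec_nth)
  then have "partial_derivative i (\<lambda>x::real^'a. complex_of_real (x $ j)) = (\<lambda>x. of_real (axis i 1 $ j))" for i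
    by (intro ext, subst partial_derivative_eqI) auto
  moreover have "cmod (complex_of_real (x $ j)) \<le> 1 * (1 + norm x) ^ 1" for x :: "real^'a"
    using component_le_norm_cart[of x j] by simp
  then have "slow (\<lambda>x::real^'a. complex_of_real (x $ j))"
    unfolding slow_def by (intro exI[of _ 1]) auto
  ultimately show ?case by (simp add: smooth_coord slow_smooth.const)
next
  case (add f g)
  then show ?case
    by (simp add: smooth_add slow_add partial_derivative_add slow_smooth.add)
next
  case (mult f g)
  then show ?case
    by (simp add: smooth_mult slow_mult partial_derivative_mult slow_smooth.add slow_smooth.mult)
next
  case (block I r)
  have "partial_derivative i (\<lambda>x::real^'a. complex_of_real (block I x powr r)) =
      (\<lambda>x. (of_real (if i \<in> I then 2 * r else 0) * of_real (block I x powr (r - 1))) * of_real (x $ i))" for i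
  proof
    fix x :: "real^'a"
    have "(\<Sum>k\<in>I. 2 * x $ k * axis i 1 $ k) = (\<Sum>k\<in>I. if k = i then 2 * x $ k else 0)"
      by (intro sum.cong) (auto simp: axis_def)
    also have "\<dots> = (if i \<in> I then 2 * x $ i else 0)" by simp
    finally show "partial_derivative i (\<lambda>x::real^'a. complex_of_real (block I x powr r)) x =
      (of_real (if i \<in> I then 2 * r else 0) * of_real (block I x powr (r - 1))) * of_real (x $ i)"
      by (subst partial_derivative_eqI[OF block_has_derivative]) simp
  qed
  moreover have "slow (\<lambda>x::real^'a. complex_of_real (block I x powr r))"
  proof -
    \<comment> \<open>As \<open>block I x\<close> is at least 1, a real power is dominated by a
      natural one, hence by a polynomial in the norm.\<close>
    obtain m :: nat where m: "\<bar>r\<bar> \<le> real m" using real_arch_simple by blast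
    have "cmod (complex_of_real (block I x powr r)) \<le> 1 * (1 + norm x) ^ (2 * m)" for x :: "real^'a"
    proof -
      have "block I x powr r \<le> block I x powr (real m)"
        using m by (intro powr_mono) (auto simp: block_ge_1)
      also have "\<dots> = block I x ^ m" by (simp add: powr_realpow block_pos)
      also have "\<dots> \<le> ((1 + norm x)\<^sup>2) ^ m" using block_pos[of I x] by (intro power_mono block_le) auto
      finally show ?thesis by (simp add: power_mult)
    qed
    then show ?thesis unfolding slow_def by (intro exI[of _ "2 * m"] exI[of _ 1]) auto
  qed
  ultimately show ?case by (simp only: smooth_block slow_smooth.const slow_smooth.mult slow_smooth.block
      slow_smooth.coord) simp
next
  case (char y)
  have pd: "partial_derivative i (\<lambda>x. exp (\<i> * complex_of_real (x \<bullet> y))) =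
      (\<lambda>x. (\<i> * of_real (axis i 1 \<bullet> y)) * exp (\<i> * complex_of_real (x \<bullet> y)))" for i
    by (intro ext, subst partial_derivative_eqI[OF char_has_derivative]) simp
  \<comment> \<open>The characters are generators, so their smoothness has to be shown directly: the
    scalar multiples of one character form a class closed under differentiation.\<close>
  have "smooth (\<lambda>x. exp (\<i> * complex_of_real (x \<bullet> y)))"
  proof (rule smooth_coinduct[where P = "\<lambda>f. f \<in> range (\<lambda>c x. c * exp (\<i> * complex_of_real (x \<bullet> y)))"])
    show "(\<lambda>x. exp (\<i> * complex_of_real (x \<bullet> y))) \<in> range (\<lambda>c x. c * exp (\<i> * complex_of_real (x \<bullet> y)))"
      by (rule range_eqI[of _ _ 1]) simp
    fix g i assume "g \<in> range (\<lambda>c x. c * exp (\<i> * complex_of_real (x \<bullet> y)))"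
    then obtain c where g: "g = (\<lambda>x. c * exp (\<i> * complex_of_real (x \<bullet> y)))" by (elim rangeE)
    have *: "(g has_derivative (\<lambda>v. c * (\<i> * of_real (v \<bullet> y) * exp (\<i> * complex_of_real (x \<bullet> y)))))
        (at x)" for x
      unfolding g by (intro has_derivative_mult_right char_has_derivative)
    then show "g differentiable_on UNIV" by (intro differentiable_onI_has_derivative exI)
    have "partial_derivative i g = (\<lambda>x. (c * (\<i> * of_real (axis i 1 \<bullet> y))) * exp (\<i> * complex_of_real (x \<bullet> y)))"
      by (intro ext, subst partial_derivative_eqI[OF *]) (simp add: mult_ac)
    then show "partial_derivative i g \<in> range (\<lambda>c x. c * exp (\<i> * complex_of_real (x \<bullet> y)))"
      by (rule range_eqI)
  qed
  moreover have "slow (\<lambda>x. exp (\<i> * complex_of_real (x \<bullet> y)))"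
    by (rule slow_bounded[of _ 1]) (simp add: norm_exp_i_times)
  ultimately show ?case using pd by (simp only: slow_smooth.const slow_smooth.mult slow_smooth.char) simp
qed

lemma slow_smooth_smooth: "f \<in> slow_smooth \<Longrightarrow> smooth f"
  by (simp add: slow_smooth_step)

lemma slow_smooth_prod: "(\<And>i. i \<in> I \<Longrightarrow> f i \<in> slow_smooth) \<Longrightarrow> (\<lambda>x. \<Prod>i\<in>I. f i x) \<in> slow_smooth"
  by (induction I rule: infinite_finite_induct) (simp_all add: slow_smooth.const slow_smooth.mult)

lemma slow_smooth_sum: "(\<And>i. i \<in> I \<Longrightarrow> f i \<in> slow_smooth) \<Longrightarrow> (\<lambda>x. \<Sum>i\<in>I. f i x) \<in> slow_smooth"
  by (induction I rule: infinite_finite_induct) (simp_all add: slow_smooth.const slow_smooth.add)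

section \<open>Algebra of the Schwartz space\<close>

text \<open>The right factor of a product carries the decay, the left one only has to be controlled
  together with its derivatives. Both kinds of left factor are stable under differentiation, so the
  product rule stays inside the class.\<close>

inductive_set schwartz_closure :: "(real ^ 'n::finite \<Rightarrow> complex) set" where
  base: "f \<in> schwartz_functions \<Longrightarrow> f \<in> schwartz_closure"
| add: "f \<in> schwartz_closure \<Longrightarrow> g \<in> schwartz_closure \<Longrightarrow> (\<lambda>x. f x + g x) \<in> schwartz_closure"
| mult: "f \<in> slow_smooth \<or> f \<in> schwartz_functions \<Longrightarrow> g \<in> schwartz_closure \<Longrightarrow> (\<lambda>x. f x * g x) \<in> schwartz_closure"

lemma schwartz_closure_step:
  assumes "f \<in> schwartz_closure"
  shows "smooth f \<and> rapid f \<and> (\<forall>i. partial_derivative i f \<in> schwartz_closure)"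
  using assms
proof (induction rule: schwartz_closure.induct)
  case (base f)
  then show ?case
    by (simp add: schwartz_smooth schwartz_rapid schwartz_partial_derivative schwartz_closure.base)
next
  case (add f g)
  then show ?case
    by (simp add: smooth_add rapid_add partial_derivative_add schwartz_closure.add)
next
  case (mult f g)
  then have "smooth f" "slow f" "partial_derivative i f \<in> slow_smooth \<or> partial_derivative i f \<in>
      schwartz_functions" for i
    by (auto simp: slow_smooth_step schwartz_smooth rapid_imp_slow schwartz_rapid schwartz_partial_derivative)
  with mult show ?case
    by (simp add: smooth_mult rapid_slow_mult partial_derivative_mult schwartz_closure.add
      schwartz_closure.mult)
qed

lemma schwartz_closureD: "f \<in> schwartz_closure \<Longrightarrow> f \<in> schwartz_functions"
  by (rule schwartz_coinduct[where P = "\<lambda>f. f \<in> schwartz_closure"])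
     (simp_all add: schwartz_closure_step smooth_imp_differentiable_on)

lemma schwartz_add:
  "f \<in> schwartz_functions \<Longrightarrow> g \<in> schwartz_functions \<Longrightarrow> (\<lambda>x. f x + g x) \<in> schwartz_functions"
  by (rule schwartz_closureD[OF schwartz_closure.add[OF schwartz_closure.base schwartz_closure.base]])

lemma schwartz_slow_mult:
  "f \<in> slow_smooth \<Longrightarrow> g \<in> schwartz_functions \<Longrightarrow> (\<lambda>x. f x * g x) \<in> schwartz_functions"
  by (rule schwartz_closureD[OF schwartz_closure.mult[OF disjI1 schwartz_closure.base]])

lemma schwartz_mult:
  "f \<in> schwartz_functions \<Longrightarrow> g \<in> schwartz_functions \<Longrightarrow> (\<lambda>x. f x * g x) \<in> schwartz_functions"
  by (rule schwartz_closureD[OF schwartz_closure.mult[OF disjI2 schwartz_closure.base]])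

lemma schwartz_cmult: "f \<in> schwartz_functions \<Longrightarrow> (\<lambda>x. c * f x) \<in> schwartz_functions"
  by (rule schwartz_slow_mult[OF slow_smooth.const])

lemma schwartz_diff:
  "f \<in> schwartz_functions \<Longrightarrow> g \<in> schwartz_functions \<Longrightarrow> (\<lambda>x. f x - g x) \<in> schwartz_functions"
  using schwartz_add[OF _ schwartz_cmult[of g "-1"], of f] by simp

lemma schwartz_zero: "(\<lambda>x. 0) \<in> schwartz_functions"
proof -
  have "partial_derivative i (\<lambda>x::real^'a. 0) = (\<lambda>x. 0)" for i
    by (intro ext, subst partial_derivative_eqI[OF has_derivative_const]) simp
  then show ?thesis
    by (intro schwartz_coinduct[where P = "\<lambda>f. f = (\<lambda>x. 0)"]) (auto simp: rapid_def)
qed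

lemma schwartz_sum:
  "(\<And>i. i \<in> I \<Longrightarrow> f i \<in> schwartz_functions) \<Longrightarrow> (\<lambda>x. \<Sum>i\<in>I. f i x) \<in> schwartz_functions"
  by (induction I rule: infinite_finite_induct) (simp_all add: schwartz_zero schwartz_add)

lemma schwartz_cnj:
  assumes "f \<in> schwartz_functions" shows "(\<lambda>x. cnj (f x)) \<in> schwartz_functions"
proof (rule schwartz_coinduct[where P = "\<lambda>g. g \<in> (\<lambda>f x. cnj (f x)) ` schwartz_functions"])
  fix g i assume "g \<in> (\<lambda>f x. cnj (f x)) ` schwartz_functions"
  then obtain f where f: "f \<in> schwartz_functions" "g = (\<lambda>x. cnj (f x))" by (elim imageE)
  then show "g differentiable_on UNIV" by (simp add: smooth_imp_differentiable_on smooth_cnj schwartz_smooth)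
  show "rapid g" using f schwartz_rapid[OF f(1)] by (simp add: rapid_def)
  show "partial_derivative i g \<in> (\<lambda>f x. cnj (f x)) ` schwartz_functions"
    using f by (intro image_eqI[of _ _ "partial_derivative i f"])
      (simp_all add: partial_derivative_cnj schwartz_smooth schwartz_partial_derivative)
qed (use assms in simp)

lemma rapid_translate:
  assumes "rapid f" shows "rapid (translate y f)"
  unfolding rapid_def
proof
  fix N
  obtain C where C: "\<And>x. (1 + norm x) ^ N * cmod (f x) \<le> C" using assms unfolding rapid_def by metis
  have "(1 + norm x) ^ N * cmod (translate y f x) \<le> (1 + norm y) ^ N * C" for x
  proof -
    have "1 + norm x \<le> (1 + norm (x - y)) + norm y"
      using norm_triangle_sub[of x y] by simp
    also have "\<dots> \<le> (1 + norm y) * (1 + norm (x - y))" by (simp add: algebra_simps)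
    finally have "(1 + norm x) ^ N \<le> ((1 + norm y) * (1 + norm (x - y))) ^ N"
      by (intro power_mono) auto
    then have "(1 + norm x) ^ N * cmod (translate y f x) \<le>
        (1 + norm y) ^ N * ((1 + norm (x - y)) ^ N * cmod (f (x - y)))"
      unfolding translate_def by (metis mult.assoc mult_right_mono norm_ge_zero power_mult_distrib)
    also have "\<dots> \<le> (1 + norm y) ^ N * C" by (intro mult_left_mono C) simp
    finally show ?thesis .
  qed
  then show "\<exists>C. \<forall>x. (1 + norm x) ^ N * cmod (translate y f x) \<le> C" by blast
qed

lemma schwartz_translate:
  assumes "f \<in> schwartz_functions" shows "translate y f \<in> schwartz_functions"
proof (rule schwartz_coinduct[where P = "\<lambda>g. g \<in> translate y ` schwartz_functions"])
  fix g i assume "g \<in> translate y ` schwartz_functions"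
  then obtain f where f: "f \<in> schwartz_functions" "g = translate y f" by (elim imageE)
  then show "g differentiable_on UNIV" by (simp add: smooth_imp_differentiable_on smooth_translate
      schwartz_smooth)
  show "rapid g" using f by (simp add: rapid_translate schwartz_rapid)
  show "partial_derivative i g \<in> translate y ` schwartz_functions"
    using f by (simp add: partial_derivative_translate schwartz_smooth schwartz_partial_derivative)
qed (use assms in simp)

lemma schwartz_reflect:
  assumes "f \<in> schwartz_functions" shows "(\<lambda>x. f (- x)) \<in> schwartz_functions"
proof -
  have pd: "partial_derivative i (\<lambda>x. f (- x)) = (\<lambda>x. - partial_derivative i f (- x))" if "smooth f" for i f
    using partial_derivative_scale[OF that, of i "-1"] by simp
  show ?thesis
  proof (rule schwartz_coinduct[where P = "\<lambda>g. g \<in> (\<lambda>f x. f (- x)) ` schwartz_functions"])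
    fix g i assume "g \<in> (\<lambda>f x. f (- x)) ` (schwartz_functions :: (real ^ 'a \<Rightarrow> complex) set)"
    then obtain f where f: "f \<in> schwartz_functions" "g = (\<lambda>x. f (- x))" by (elim imageE)
    then show "g differentiable_on UNIV"
      using smooth_scale[of f "-1"] by (simp add: smooth_imp_differentiable_on schwartz_smooth)
    show "rapid g" using f schwartz_rapid[OF f(1)] unfolding rapid_def by (metis norm_minus_cancel)
    show "partial_derivative i g \<in> (\<lambda>f x. f (- x)) ` schwartz_functions"
      using f schwartz_cmult[OF schwartz_partial_derivative[OF f(1), of i], of "-1"]
      by (intro image_eqI[of _ _ "\<lambda>x. - partial_derivative i f x"])
        (simp_all add: pd schwartz_smooth)
  qed (use assms in simp)
qed

subsection \<open>Test functions\<close>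

text \<open>Bounded sets are exactly those with compact closure in finite dimension. The support
  condition is used in this bounded form from here on.\<close>

lemma test_functions_iff:
  "f \<in> test_functions \<longleftrightarrow> smooth f \<and> (\<exists>R. \<forall>x. f x \<noteq> 0 \<longrightarrow> norm x \<le> R)"
proof -
  have "compact (closure {x. f x \<noteq> 0}) \<longleftrightarrow> (\<exists>R. \<forall>x. f x \<noteq> 0 \<longrightarrow> norm x \<le> R)"
    by (simp add: compact_closure bounded_iff)
  then show ?thesis by (simp add: test_functions_def)
qed

lemma test_smooth: "f \<in> test_functions \<Longrightarrow> smooth f"
  by (simp add: test_functions_def)

lemma partial_derivative_eq_0_outside:
  assumes "\<And>x. norm x > R \<Longrightarrow> f x = 0" "norm x > R"
  shows "partial_derivative i f x = 0"
proof -
  have "((\<lambda>x. 0::complex) has_derivative (\<lambda>v. 0)) (at x)" by simp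
  moreover have "open {x :: real ^ 'a. norm x > R}" by (intro open_Collect_less continuous_intros)
  ultimately have "(f has_derivative (\<lambda>v. 0)) (at x)"
    using assms has_derivative_transform_within_open[of "\<lambda>x. 0" "\<lambda>v. 0" x UNIV "{x. norm x > R}" f] by auto
  then show ?thesis by (simp add: partial_derivative_eqI)
qed

lemma continuous_bounded_support_rapid:
  assumes "continuous_on UNIV f" "\<And>x. norm x > R \<Longrightarrow> f x = 0"
  shows "rapid f"
  unfolding rapid_def
proof
  fix N
  have "compact ((\<lambda>x. (1 + norm x) ^ N * cmod (f x)) ` cball 0 R)"
    by (intro compact_continuous_image continuous_intros continuous_on_subset[OF assms(1)]) auto
  then have "bdd_above ((\<lambda>x. (1 + norm x) ^ N * cmod (f x)) ` cball 0 R)"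
    by (intro bounded_imp_bdd_above compact_imp_bounded)
  then obtain C where C: "\<And>x. norm x \<le> R \<Longrightarrow> (1 + norm x) ^ N * cmod (f x) \<le> C"
    unfolding bdd_above_def by (metis imageI mem_cball_0)
  have "(1 + norm x) ^ N * cmod (f x) \<le> max C 0" for x
    using C[of x] assms(2)[of x] by (cases "norm x \<le> R") auto
  then show "\<exists>C. \<forall>x. (1 + norm x) ^ N * cmod (f x) \<le> C" by blast
qed

lemma test_imp_schwartz:
  assumes "f \<in> test_functions" shows "f \<in> schwartz_functions"
proof -
  obtain R where R: "\<And>x. norm x > R \<Longrightarrow> f x = 0" and "smooth f"
    using assms unfolding test_functions_iff by (metis not_le)
  then show ?thesis
    by (intro schwartz_coinduct[where P = "\<lambda>g. smooth g \<and> (\<forall>x. norm x > R \<longrightarrow> g x = 0)"])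
       (auto intro: smooth_imp_differentiable_on continuous_bounded_support_rapid[of _ R]
         smooth_imp_continuous_on
         smooth_partial_derivative partial_derivative_eq_0_outside)
qed

lemma test_smooth_mult:
  "smooth f \<Longrightarrow> g \<in> test_functions \<Longrightarrow> (\<lambda>x. f x * g x) \<in> test_functions"
  unfolding test_functions_iff by (auto intro: smooth_mult)

lemma test_mult:
  "f \<in> test_functions \<Longrightarrow> g \<in> test_functions \<Longrightarrow> (\<lambda>x. f x * g x) \<in> test_functions"
  by (simp add: test_smooth_mult test_smooth)

lemma test_add:
  assumes "f \<in> test_functions" "g \<in> test_functions" shows "(\<lambda>x. f x + g x) \<in> test_functions"
proof -
  obtain R R' where "\<And>x. f x \<noteq> 0 \<Longrightarrow> norm x \<le> R" "\<And>x. g x \<noteq> 0 \<Longrightarrow> norm x \<le> R'"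
    using assms unfolding test_functions_iff by metis
  then have "f x + g x \<noteq> 0 \<Longrightarrow> norm x \<le> max R R'" for x by (cases "f x = 0") (auto simp: le_max_iff_disj)
  then show ?thesis using assms unfolding test_functions_iff by (blast intro: smooth_add)
qed

lemma test_cmult: "f \<in> test_functions \<Longrightarrow> (\<lambda>x. c * f x) \<in> test_functions"
  by (rule test_smooth_mult) auto

lemma test_cnj: "f \<in> test_functions \<Longrightarrow> (\<lambda>x. cnj (f x)) \<in> test_functions"
  unfolding test_functions_iff by (auto intro: smooth_cnj)

lemma test_translate:
  assumes "f \<in> test_functions" shows "translate y f \<in> test_functions"
proof -
  obtain R where R: "\<And>x. f x \<noteq> 0 \<Longrightarrow> norm x \<le> R" using assms unfolding test_functions_iff by metis
  have "norm x \<le> R + norm y" if "translate y f x \<noteq> 0" for x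
    using R[of "x - y"] that norm_triangle_sub[of x y] by (auto simp: translate_def)
  then show ?thesis using assms unfolding test_functions_iff by (blast intro: smooth_translate)
qed

lemma test_zero: "(\<lambda>x. 0) \<in> test_functions"
  by (simp add: test_functions_iff)

lemma test_sum:
  "(\<And>i. i \<in> I \<Longrightarrow> f i \<in> test_functions) \<Longrightarrow> (\<lambda>x. \<Sum>i\<in>I. f i x) \<in> test_functions"
  by (induction I rule: infinite_finite_induct) (simp_all add: test_zero test_add)

text \<open>The quotient of \<open>flat 0 p\<close> by \<open>flat 0 p + flat 0 q\<close>, with p =
  2 - |x|^2 and q = |x|^2 - 1. At every point p or q is positive, so the denominator never vanishes;
  q is at most 0 on the unit ball, which gives the value 1, and p is at most 0 far out.\<close>

lemma cutoff_exists:
  obtains \<eta> :: "real ^ 'n::finite \<Rightarrow> complex"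
  where "\<eta> \<in> test_functions" "\<And>x. norm x \<le> 1 \<Longrightarrow> \<eta> x = 1"
proof -
  define p where "p x = complex_of_real (2 - block UNIV x powr 1 + 1)" for x :: "real ^ 'n"
  define q where "q x = complex_of_real (block UNIV x powr 1 - 2)" for x :: "real ^ 'n"
  have bl: "block UNIV x = 1 + (norm x)\<^sup>2" for x :: "real ^ 'n"
    by (simp add: block_def norm_vec_def L2_set_def sum_nonneg)
  have sp: "smooth p"
    using smooth_add[OF smooth_const[of 3] smooth_mult[OF smooth_const[of "-1"] smooth_block[of UNIV 1]]]
    by (simp add: p_def[abs_def] algebra_simps)
  have sq: "smooth q"
    using smooth_add[OF smooth_const[of "-2"] smooth_block[of UNIV 1]]
    by (simp add: q_def[abs_def] algebra_simps)
  define s where "s x = complex_of_real (flat 0 (Re (p x))) + complex_of_real (flat 0 (Re (q x)))" for x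
  have ss: "smooth s" unfolding s_def[abs_def] by (intro smooth_add smooth_flat sp sq)
  have pos: "Re (s x) > 0" for x
  proof (cases "Re (p x) > 0")
    case True
    then show ?thesis using flat_pos[of "Re (p x)" 0] flat_nonneg[of 0 "Re (q x)"] by (simp add: s_def)
  next
    case False
    then have "Re (q x) > 0" by (auto simp: p_def q_def)
    then show ?thesis using flat_pos[of "Re (q x)" 0] flat_nonneg[of 0 "Re (p x)"] by (simp add: s_def)
  qed
  define \<eta> where "\<eta> x = complex_of_real (flat 0 (Re (p x))) * complex_of_real (Re (s x) powr (-1))" for x
  have "smooth \<eta>" unfolding \<eta>_def[abs_def] by (intro smooth_mult smooth_flat sp smooth_powr ss pos)
  moreover have "norm x \<le> 2" if "\<eta> x \<noteq> 0" for x
  proof (rule ccontr)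
    assume "\<not> norm x \<le> 2"
    then have "(norm x)\<^sup>2 \<ge> 2\<^sup>2" by (intro power_mono) auto
    then have "Re (p x) \<le> 0" by (simp add: p_def bl)
    with that show False by (simp add: \<eta>_def)
  qed
  moreover have "\<eta> x = 1" if "norm x \<le> 1" for x
  proof -
    have "(norm x)\<^sup>2 \<le> 1" using that by (simp add: power_le_one)
    then have "Re (q x) \<le> 0" by (simp add: q_def bl)
    then have "s x = complex_of_real (flat 0 (Re (p x)))" by (simp add: s_def)
    then show ?thesis using pos[of x] by (simp add: \<eta>_def powr_minus)
  qed
  ultimately show thesis using that unfolding test_functions_iff by blast
qed

lemma cutoff_ball_exists:
  fixes R :: real
  obtains \<theta> :: "real ^ 'n::finite \<Rightarrow> complex"
  where "\<theta> \<in> test_functions" "\<And>x. norm x \<le> R \<Longrightarrow> \<theta> x = 1"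
proof -
  obtain \<eta> :: "real ^ 'n::finite \<Rightarrow> complex" where \<eta>: "\<eta> \<in> test_functions" "\<And>x. norm x \<le> 1 \<Longrightarrow> \<eta> x = 1"
    using cutoff_exists by blast
  \<comment> \<open>The maximum keeps \<open>c\<close> positive for every sign of
    \<open>R\<close>.\<close>
  define c where "c = 1 / max R 1"
  have c: "c > 0" "c * R \<le> 1" unfolding c_def by (auto simp: field_simps)
  obtain S where S: "\<And>x. \<eta> x \<noteq> 0 \<Longrightarrow> norm x \<le> S" using \<eta>(1) unfolding test_functions_iff by metis
  have "norm x \<le> S / c" if "\<eta> (c *\<^sub>R x) \<noteq> 0" for x
    using S[OF that] c by (simp add: field_simps)
  then have "(\<lambda>x. \<eta> (c *\<^sub>R x)) \<in> test_functions"
    using smooth_scale[OF test_smooth[OF \<eta>(1)], of c] unfolding test_functions_iff by blast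
  moreover have "\<eta> (c *\<^sub>R x) = 1" if "norm x \<le> R" for x
    using c that order_trans[OF mult_left_mono[OF that, of c] c(2)] by (intro \<eta>(2)) auto
  ultimately show thesis using that by blast
qed

subsection \<open>Integrability\<close>

text \<open>The integrand is at most 1 on [-1, 1] and at most |x| to the power -2r outside. The
  threshold 1/2 for a single coordinate is the source of the threshold n_l / 2: the exponent of a
  block is later shared out among its n_l coordinates.\<close>

lemma nn_integral_japanese_bracket_finite:
  fixes r :: real
  assumes "r > 1 / 2"
  shows "(\<integral>\<^sup>+x. ennreal ((1 + x\<^sup>2) powr (- r)) \<partial>lborel) < \<infinity>"
proof -
  define f where "f x = indicator {1..} x * x powr (- 2 * r)" for x :: real
  have fm [measurable]: "f \<in> borel_measurable borel" unfolding f_def[abs_def] by measurable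
  have 1: "(\<integral>\<^sup>+x. ennreal (x powr (- 2 * r)) * indicator {1..} x \<partial>lborel) =
      ennreal (0 - (- (1 powr (1 - 2 * r)) / (2 * r - 1)))"
  proof (rule nn_integral_FTC_atLeast[where F = "\<lambda>x. - (x powr (1 - 2 * r)) / (2 * r - 1)"])
    fix x :: real assume "1 \<le> x"
    then have "((\<lambda>x. x powr (1 - 2 * r)) has_real_derivative (1 - 2 * r) * x powr (1 - 2 * r - 1)) (at x)"
      by (intro has_real_derivative_powr) simp
    then have "((\<lambda>x. - (x powr (1 - 2 * r)) / (2 * r - 1)) has_real_derivative
        - ((1 - 2 * r) * x powr (1 - 2 * r - 1)) / (2 * r - 1)) (at x)"
      by (intro DERIV_cdivide DERIV_minus)
    moreover have "- ((1 - 2 * r) * x powr (1 - 2 * r - 1)) / (2 * r - 1) = x powr (- 2 * r)"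
      using assms by (simp add: field_simps)
    ultimately show "((\<lambda>x. - (x powr (1 - 2 * r)) / (2 * r - 1)) has_real_derivative x powr (- 2 * r))
        (at x)" by simp
  next
    have "((\<lambda>x. x powr (1 - 2 * r)) \<longlongrightarrow> 0) at_top"
      using assms by (intro tendsto_neg_powr filterlim_ident) auto
    from tendsto_divide[OF tendsto_minus[OF this] tendsto_const[of "2 * r - 1"]] assms
    show "((\<lambda>x. - (x powr (1 - 2 * r)) / (2 * r - 1)) \<longlongrightarrow> 0) at_top" by simp
  qed auto
  have f: "(\<integral>\<^sup>+x. ennreal (f x) \<partial>lborel) < \<infinity>"
    using 1 unfolding f_def by (simp add: ennreal_mult'' mult.commute ennreal_indicator)
  have f': "(\<integral>\<^sup>+x. ennreal (f (- x)) \<partial>lborel) < \<infinity>"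
  proof -
    have "(\<integral>\<^sup>+x. ennreal (f x) \<partial>lborel) = (\<integral>\<^sup>+x. ennreal (f x) \<partial>distr lborel borel uminus)"
      by (simp add: lborel_distr_uminus)
    also have "\<dots> = (\<integral>\<^sup>+x. ennreal (f (- x)) \<partial>lborel)" by (subst nn_integral_distr) auto
    finally show ?thesis using f by simp
  qed
  have bound: "(1 + x\<^sup>2) powr (- r) \<le> f x + f (- x) + indicator {-1..1} x" for x :: real
  proof (cases "\<bar>x\<bar> \<le> 1")
    case True
    have "(1 + x\<^sup>2) powr (- r) \<le> (1 + x\<^sup>2) powr 0" using assms by (intro powr_mono) auto
    also have "\<dots> = 1" by (simp add: add_pos_nonneg less_imp_neq[symmetric])
    finally show ?thesis using True by (simp add: f_def abs_le_iff add_increasing)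
  next
    case False
    have "(1 + x\<^sup>2) powr (- r) \<le> (\<bar>x\<bar> powr 2) powr (- r)"
      using assms False by (intro powr_mono2') auto
    also have "\<dots> = \<bar>x\<bar> powr (- 2 * r)" by (simp only: powr_powr) simp
    also have "\<dots> \<le> f x + f (- x)" using False by (auto simp: f_def indicator_def)
    finally show ?thesis using False by (simp add: add_increasing2)
  qed
  have "(\<integral>\<^sup>+x. ennreal ((1 + x\<^sup>2) powr (- r)) \<partial>lborel) \<le>
      (\<integral>\<^sup>+x. ennreal (f x) + ennreal (f (- x)) + indicator {-1..1} x \<partial>lborel)"
  proof (rule nn_integral_mono)
    fix x :: real
    have "ennreal ((1 + x\<^sup>2) powr (- r)) \<le> ennreal (f x + f (- x) + indicator {-1..1} x)"
      by (rule ennreal_leI[OF bound])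
    also have "\<dots> = ennreal (f x) + ennreal (f (- x)) + indicator {-1..1} x"
      by (simp add: f_def ennreal_plus ennreal_indicator)
    finally show "ennreal ((1 + x\<^sup>2) powr (- r)) \<le> ennreal (f x) + ennreal (f (- x)) + indicator {-1..1} x" .
  qed
  also have "\<dots> = (\<integral>\<^sup>+x. ennreal (f x) \<partial>lborel) + (\<integral>\<^sup>+x. ennreal (f (- x)) \<partial>lborel) + 2"
    by (simp add: nn_integral_add)
  also have "\<dots> < \<infinity>" using f f' by (simp add: ennreal_add_eq_top less_top)
  finally show ?thesis .
qed

text \<open>Lebesgue measure is a product over the basis vectors; \<open>axis_index\<close>
  translates these into coordinates.\<close>

lemma nn_integral_vec_prod:
  fixes g :: "'n::finite \<Rightarrow> real \<Rightarrow> real"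
  assumes "\<And>i. g i \<in> borel_measurable borel" and "\<And>i x. 0 \<le> g i x"
  shows "(\<integral>\<^sup>+x. ennreal (\<Prod>i\<in>UNIV. g i (x $ i)) \<partial>(lborel :: (real ^ 'n) measure)) =
    (\<Prod>i\<in>UNIV. (\<integral>\<^sup>+x. ennreal (g i x) \<partial>lborel))"
proof -
  have B: "(Basis :: (real ^ 'n) set) = (\<lambda>i. axis i 1) ` UNIV"
    by (auto simp: Basis_vec_def)
  have inj: "inj (\<lambda>i::'n. axis i (1::real))" by (auto simp: inj_on_def axis_eq_axis)
  have "(\<integral>\<^sup>+x. (\<Prod>b\<in>Basis. ennreal (g (axis_index b) (x \<bullet> b))) \<partial>(lborel :: (real ^ 'n) measure)) =
      (\<Prod>b\<in>(Basis :: (real ^ 'n) set). (\<integral>\<^sup>+x. ennreal (g (axis_index b) x) \<partial>lborel))"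
    using nn_integral_lborel_prod[of "\<lambda>b::real^'n. g (axis_index b)"] assms by (simp add: prod_ennreal)
  then show ?thesis
    unfolding B prod.reindex[OF inj] by (simp add: comp_def inner_axis prod_ennreal assms)
qed

text \<open>A fixed integrable majorant. The exponent makes the denominator dominate the product of
  all 1 + x_i^2, so that integrability reduces to one dimension.\<close>

definition decay :: "real ^ 'n::finite \<Rightarrow> real" where
  "decay x = 1 / (1 + norm x) ^ (2 * CARD('n))"

lemma decay_pos: "decay x > 0"
  by (simp add: decay_def add_pos_nonneg)

lemma decay_measurable [measurable]: "decay \<in> borel_measurable borel"
  unfolding decay_def[abs_def] by measurable

lemma integrable_decay: "integrable lborel (decay :: real ^ 'n::finite \<Rightarrow> real)"
proof (rule integrableI_bounded)
  have le: "decay x \<le> (\<Prod>i\<in>UNIV. (1 + (x $ i)\<^sup>2) powr (-1))" for x :: "real ^ 'n"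
  proof -
    have "1 / (1 + norm x)\<^sup>2 \<le> (1 + (x $ i)\<^sup>2) powr (-1)" for i
    proof -
      have "1 + (x $ i)\<^sup>2 \<le> (1 + norm x)\<^sup>2" using block_le[of "{i}" x] by (simp add: block_def)
      then show ?thesis
        using frac_le[of 1 1 "1 + (x $ i)\<^sup>2" "(1 + norm x)\<^sup>2"]
        by (simp add: powr_minus_divide add_pos_nonneg)
    qed
    then have "(\<Prod>i\<in>(UNIV::'n set). 1 / (1 + norm x)\<^sup>2) \<le> (\<Prod>i\<in>(UNIV::'n set). (1 + (x $ i)\<^sup>2) powr (-1))"
      by (intro prod_mono) auto
    then show ?thesis by (simp add: decay_def power_mult power_one_over)
  qed
  have "(\<integral>\<^sup>+x. ennreal (norm (decay (x :: real ^ 'n))) \<partial>lborel) \<le>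
      (\<integral>\<^sup>+x. ennreal (\<Prod>i\<in>UNIV. (1 + (x $ i)\<^sup>2) powr (-1)) \<partial>(lborel :: (real ^ 'n) measure))"
    by (intro nn_integral_mono ennreal_leI) (simp only: real_norm_def abs_of_pos[OF decay_pos] le)
  also have "\<dots> = (\<Prod>i\<in>(UNIV::'n set). (\<integral>\<^sup>+x. ennreal ((1 + x\<^sup>2) powr (-1)) \<partial>lborel))"
    by (rule nn_integral_vec_prod) auto
  also have "\<dots> < \<infinity>"
    using nn_integral_japanese_bracket_finite[of 1] by (simp add: power_less_top_ennreal)
  finally show "(\<integral>\<^sup>+x. ennreal (norm (decay (x :: real ^ 'n))) \<partial>lborel) < \<infinity>" .
qed simp

lemma rapid_decay:
  assumes "rapid f"
  obtains C where "C \<ge> 0" "\<And>x. (1 + norm x) ^ N * cmod (f x) \<le> C * decay x"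
proof -
  obtain C where C: "\<And>x. (1 + norm x) ^ (N + 2 * CARD('a)) * cmod (f x) \<le> C"
    using assms unfolding rapid_def by metis
  have "(1 + norm x) ^ N * cmod (f x) \<le> C * decay x" for x
    using C[of x] by (simp add: decay_def power_add field_simps add_pos_nonneg)
  moreover have "C \<ge> 0" using C[of 0] by (smt (verit) norm_ge_zero zero_le_mult_iff zero_le_power)
  ultimately show thesis using that by blast
qed

lemma schwartz_measurable [measurable_dest]:
  "f \<in> schwartz_functions \<Longrightarrow> f \<in> borel_measurable borel"
  by (intro borel_measurable_continuous_onI smooth_imp_continuous_on schwartz_smooth)

lemma rapid_integrable:
  assumes "rapid f" and [measurable]: "f \<in> borel_measurable borel"
  shows "integrable lborel f"
proof -
  obtain C where C: "C \<ge> 0" "\<And>x. (1 + norm x) ^ 0 * cmod (f x) \<le> C * decay x"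
    using rapid_decay[OF assms(1)] by metis
  show ?thesis
    by (rule Bochner_Integration.integrable_bound[OF integrable_mult_right[OF integrable_decay, of C]])
       (use C in \<open>auto simp: abs_mult decay_pos less_imp_le intro!: AE_I2\<close>)
qed

lemma schwartz_integrable: "f \<in> schwartz_functions \<Longrightarrow> integrable lborel f"
  by (rule rapid_integrable) (simp_all add: schwartz_rapid schwartz_measurable)

subsection \<open>Square-integrable functions\<close>

lemma L2_measurable [measurable_dest]: "f \<in> L2_functions \<Longrightarrow> f \<in> borel_measurable borel"
  by (simp add: L2_functions_def)

lemma L2_integrable: "f \<in> L2_functions \<Longrightarrow> integrable lborel (\<lambda>x. (cmod (f x))\<^sup>2)"
  by (simp add: L2_functions_def)

lemma L2_norm_nonneg: "L2_function_norm f \<ge> 0"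
  by (simp add: L2_function_norm_def)

lemma L2_norm_power2: "(L2_function_norm f)\<^sup>2 = (\<integral>x. (cmod (f x))\<^sup>2 \<partial>lborel)"
  by (simp add: L2_function_norm_def)

lemma L2_nn_integral:
  assumes "f \<in> L2_functions"
  shows "(\<integral>\<^sup>+x. ennreal ((cmod (f x))\<^sup>2) \<partial>lborel) = ennreal ((L2_function_norm f)\<^sup>2)"
  unfolding L2_norm_power2 by (rule nn_integral_eq_integral) (use assms in \<open>auto simp: L2_integrable\<close>)

lemma L2_functionsI:
  assumes [measurable]: "f \<in> borel_measurable borel"
    and "(\<integral>\<^sup>+x. ennreal ((cmod (f x))\<^sup>2) \<partial>lborel) \<le> ennreal (C\<^sup>2)" "C \<ge> 0"
  shows "f \<in> L2_functions" "L2_function_norm f \<le> C"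
proof -
  have "(\<integral>\<^sup>+x. ennreal (norm ((cmod (f x))\<^sup>2)) \<partial>lborel) < \<infinity>"
    using assms(2) by (simp add: le_less_trans[OF _ ennreal_less_top])
  then have "integrable lborel (\<lambda>x. (cmod (f x))\<^sup>2)" by (intro integrableI_bounded) auto
  then show *: "f \<in> L2_functions" by (simp add: L2_functions_def)
  have "(L2_function_norm f)\<^sup>2 \<le> C\<^sup>2" using L2_nn_integral[OF *] assms(2) by simp
  then show "L2_function_norm f \<le> C" using assms(3) by (rule power2_le_imp_le)
qed

lemma schwartz_L2: assumes "f \<in> schwartz_functions" shows "f \<in> L2_functions"
proof -
  have "integrable lborel (\<lambda>x. f x * cnj (f x))"
    by (intro schwartz_integrable schwartz_mult schwartz_cnj assms)
  then have "integrable lborel (\<lambda>x. norm (f x * cnj (f x)))" by (rule integrable_norm)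
  then show ?thesis using assms
    by (simp add: L2_functions_def schwartz_measurable norm_mult power2_eq_square)
qed

lemma L2_mult_integrable:
  assumes "f \<in> L2_functions" "g \<in> L2_functions"
  shows "integrable lborel (\<lambda>x. f x * g x)"
proof (rule Bochner_Integration.integrable_bound)
  show "integrable lborel (\<lambda>x. (cmod (f x))\<^sup>2 + (cmod (g x))\<^sup>2)"
    by (intro Bochner_Integration.integrable_add L2_integrable assms)
  show "(\<lambda>x. f x * g x) \<in> borel_measurable lborel" using assms[THEN L2_measurable] by measurable
  show "AE x in lborel. cmod (f x * g x) \<le> norm ((cmod (f x))\<^sup>2 + (cmod (g x))\<^sup>2)"
  proof (rule AE_I2)
    fix x
    have "2 * (cmod (f x) * cmod (g x)) \<le> (cmod (f x))\<^sup>2 + (cmod (g x))\<^sup>2"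
      using sum_squares_bound[of "cmod (f x)" "cmod (g x)"] by simp
    moreover have "0 \<le> cmod (f x) * cmod (g x)" by (intro mult_nonneg_nonneg norm_ge_zero)
    moreover have "0 \<le> (cmod (f x))\<^sup>2 + (cmod (g x))\<^sup>2" by simp
    ultimately show "cmod (f x * g x) \<le> norm ((cmod (f x))\<^sup>2 + (cmod (g x))\<^sup>2)"
      unfolding norm_mult real_norm_def by linarith
  qed
qed

lemma L2_Cauchy_Schwarz:
  assumes f: "f \<in> L2_functions" and g: "g \<in> L2_functions"
  shows "cmod (\<integral>x. f x * g x \<partial>lborel) \<le> L2_function_norm f * L2_function_norm g"
proof -
  have [measurable]: "f \<in> borel_measurable borel" "g \<in> borel_measurable borel"
    using f g by (auto dest: L2_measurable)
  have "(\<integral>\<^sup>+x. ennreal (cmod (f x)) * ennreal (cmod (g x)) \<partial>lborel)\<^sup>2 \<le>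
      (\<integral>\<^sup>+x. (ennreal (cmod (f x)))\<^sup>2 \<partial>lborel) * (\<integral>\<^sup>+x. (ennreal (cmod (g x)))\<^sup>2 \<partial>lborel)"
    by (rule Cauchy_Schwarz_nn_integral) auto
  also have "\<dots> = ennreal ((L2_function_norm f * L2_function_norm g)\<^sup>2)"
    using L2_nn_integral[OF f] L2_nn_integral[OF g]
    by (simp add: ennreal_power power_mult_distrib ennreal_mult)
  finally have *: "(\<integral>\<^sup>+x. ennreal (cmod (f x * g x)) \<partial>lborel)\<^sup>2 \<le> ennreal
      ((L2_function_norm f * L2_function_norm g)\<^sup>2)"
    by (simp add: norm_mult ennreal_mult)
  have "(\<integral>\<^sup>+x. ennreal (cmod (f x * g x)) \<partial>lborel) = ennreal (\<integral>x. cmod (f x * g x) \<partial>lborel)"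
    by (intro nn_integral_eq_integral integrable_norm L2_mult_integrable f g) auto
  with * have "(\<integral>x. cmod (f x * g x) \<partial>lborel)\<^sup>2 \<le> (L2_function_norm f * L2_function_norm g)\<^sup>2"
    by (simp add: ennreal_power)
  then have "(\<integral>x. cmod (f x * g x) \<partial>lborel) \<le> L2_function_norm f * L2_function_norm g"
    by (rule power2_le_imp_le) (simp add: L2_norm_nonneg)
  then show ?thesis using integral_norm_bound[of lborel "\<lambda>x. f x * g x"] by linarith
qed

lemma L2_cmult:
  assumes "f \<in> L2_functions"
  shows "(\<lambda>x. c * f x) \<in> L2_functions" "L2_function_norm (\<lambda>x. c * f x) = cmod c * L2_function_norm f"
proof -
  show "(\<lambda>x. c * f x) \<in> L2_functions" using assms L2_measurable[OF assms]
    by (simp add: L2_functions_def norm_mult power_mult_distrib)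
  show "L2_function_norm (\<lambda>x. c * f x) = cmod c * L2_function_norm f"
    by (simp add: L2_function_norm_def norm_mult power_mult_distrib real_sqrt_mult)
qed

lemma L2_cnj:
  assumes "f \<in> L2_functions" shows "(\<lambda>x. cnj (f x)) \<in> L2_functions"
  using assms measurable_compose[OF L2_measurable[OF assms], of cnj borel]
  unfolding L2_functions_def by (simp add: borel_measurable_continuous_onI continuous_intros)

lemma L2_norm_cnj: "L2_function_norm (\<lambda>x. cnj (f x)) = L2_function_norm f"
  by (simp add: L2_function_norm_def)

lemma L2_add:
  assumes f: "f \<in> L2_functions" and g: "g \<in> L2_functions"
  shows "(\<lambda>x. f x + g x) \<in> L2_functions"
    and "(L2_function_norm (\<lambda>x. f x + g x))\<^sup>2 =
      (L2_function_norm f)\<^sup>2 + 2 * Re (\<integral>x. cnj (f x) * g x \<partial>lborel) + (L2_function_norm g)\<^sup>2"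
proof -
  have eq: "(cmod (f x + g x))\<^sup>2 = (cmod (f x))\<^sup>2 + 2 * Re (cnj (f x) * g x) + (cmod (g x))\<^sup>2" for x
    by (simp only: cmod_power2) (simp add: power2_eq_square algebra_simps)
  have int: "integrable lborel (\<lambda>x. cnj (f x) * g x)"
    by (intro L2_mult_integrable L2_cnj f g)
  have int': "integrable lborel (\<lambda>x. (cmod (f x))\<^sup>2 + 2 * Re (cnj (f x) * g x))"
    using int f by (intro Bochner_Integration.integrable_add integrable_mult_right integrable_Re L2_integrable)
  have "integrable lborel (\<lambda>x. (cmod (f x + g x))\<^sup>2)"
    unfolding eq by (intro Bochner_Integration.integrable_add int' L2_integrable g)
  moreover have "(\<lambda>x. f x + g x) \<in> borel_measurable lborel" using assms[THEN L2_measurable] by measurable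
  ultimately show "(\<lambda>x. f x + g x) \<in> L2_functions" by (simp add: L2_functions_def)
  have "(L2_function_norm (\<lambda>x. f x + g x))\<^sup>2 =
      (\<integral>x. (cmod (f x))\<^sup>2 \<partial>lborel) + (\<integral>x. 2 * Re (cnj (f x) * g x) \<partial>lborel) + (\<integral>x. (cmod (g x))\<^sup>2 \<partial>lborel)"
    unfolding L2_norm_power2 eq
    using int f g int'
    by (subst Bochner_Integration.integral_add, simp, simp add: L2_integrable)
       (subst Bochner_Integration.integral_add, auto simp: L2_integrable simp del: times_complex.sel)
  also have "(\<integral>x. 2 * Re (cnj (f x) * g x) \<partial>lborel) = 2 * Re (\<integral>x. cnj (f x) * g x \<partial>lborel)"
    using int by (simp del: times_complex.sel)
  finally show "(L2_function_norm (\<lambda>x. f x + g x))\<^sup>2 =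
      (L2_function_norm f)\<^sup>2 + 2 * Re (\<integral>x. cnj (f x) * g x \<partial>lborel) + (L2_function_norm g)\<^sup>2"
    by (simp add: L2_norm_power2)
qed

lemma L2_diff:
  assumes "f \<in> L2_functions" "g \<in> L2_functions"
  shows "(\<lambda>x. f x - g x) \<in> L2_functions"
  using L2_add(1)[OF assms(1) L2_cmult(1)[OF assms(2), of "-1"]] by simp

lemma L2_norm_minus: "L2_function_norm (\<lambda>x. f x - g x) = L2_function_norm (\<lambda>x. g x - f x)"
  by (simp add: L2_function_norm_def norm_minus_commute)

lemma L2_triangle:
  assumes f: "f \<in> L2_functions" and g: "g \<in> L2_functions"
  shows "L2_function_norm (\<lambda>x. f x + g x) \<le> L2_function_norm f + L2_function_norm g"
proof (rule power2_le_imp_le)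
  have "Re (\<integral>x. cnj (f x) * g x \<partial>lborel) \<le> L2_function_norm f * L2_function_norm g"
    using complex_Re_le_cmod L2_Cauchy_Schwarz[OF L2_cnj[OF f] g] unfolding L2_norm_cnj by (rule order_trans)
  then show "(L2_function_norm (\<lambda>x. f x + g x))\<^sup>2 \<le> (L2_function_norm f + L2_function_norm g)\<^sup>2"
    unfolding L2_add(2)[OF f g] by (simp add: power2_sum)
qed (simp add: L2_norm_nonneg)

lemma L2_triangle_diff:
  assumes f: "f \<in> L2_functions" and g: "g \<in> L2_functions"
  shows "\<bar>L2_function_norm f - L2_function_norm g\<bar> \<le> L2_function_norm (\<lambda>x. f x - g x)"
  using L2_triangle[OF L2_diff[OF f g] g] L2_triangle[OF L2_diff[OF g f] f] L2_norm_minus[of f g] by simp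

lemma L2_parallelogram:
  assumes f: "f \<in> L2_functions" and g: "g \<in> L2_functions"
  shows "(L2_function_norm (\<lambda>x. f x + g x))\<^sup>2 + (L2_function_norm (\<lambda>x. f x - g x))\<^sup>2 =
    2 * (L2_function_norm f)\<^sup>2 + 2 * (L2_function_norm g)\<^sup>2"
  using L2_add(2)[OF f g] L2_add(2)[OF f L2_cmult(1)[OF g, of "-1"]] L2_cmult(2)[OF g, of "-1"]
  by simp

text \<open>The Riesz-Fischer argument, with the rate in the hypothesis taking the place of a
  subsequence. The factors \<open>2 ^ k\<close> in \<open>d\<close> leave a convergent series of
  integrals and yet force geometric decay of the differences at almost every point, so the
  telescoping series converges there. Fatou's lemma then gives convergence in norm.\<close>

lemma L2_complete:
  fixes g :: "nat \<Rightarrow> real ^ 'n::finite \<Rightarrow> complex"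
  assumes g: "\<And>k. g k \<in> L2_functions" and c: "c \<ge> 0"
    and cauchy: "\<And>k m. k \<le> m \<Longrightarrow> (L2_function_norm (\<lambda>x. g k x - g m x))\<^sup>2 \<le> c * (1/4) ^ k"
  obtains h where "h \<in> L2_functions" "(\<lambda>k. L2_function_norm (\<lambda>x. g k x - h x)) \<longlonglongrightarrow> 0"
proof -
  have gm [measurable]: "g k \<in> borel_measurable borel" for k using g by (rule L2_measurable)
  have nn: "(\<integral>\<^sup>+x. ennreal ((cmod (g k x - g m x))\<^sup>2) \<partial>lborel) \<le> ennreal (c * (1/4) ^ k)" if "k \<le> m" for k m
    using cauchy[OF that] by (simp add: L2_nn_integral[OF L2_diff[OF g g]] ennreal_leI)
  define d where "d k x = ennreal (2 ^ k) * ennreal ((cmod (g k x - g (Suc k) x))\<^sup>2)" for k x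
  have [measurable]: "d k \<in> borel_measurable borel" for k unfolding d_def[abs_def] by measurable
  have "(\<integral>\<^sup>+x. (\<Sum>k. d k x) \<partial>lborel) = (\<Sum>k. \<integral>\<^sup>+x. d k x \<partial>lborel)"
    by (rule nn_integral_suminf) simp
  also have "\<dots> \<le> (\<Sum>k. ennreal (c * (1/2) ^ k))"
  proof (intro suminf_le allI)
    fix k
    have "(\<integral>\<^sup>+x. d k x \<partial>lborel) = ennreal (2 ^ k) * (\<integral>\<^sup>+x. ennreal ((cmod (g k x - g (Suc k) x))\<^sup>2) \<partial>lborel)"
      unfolding d_def by (rule nn_integral_cmult) simp
    also have "\<dots> \<le> ennreal (2 ^ k) * ennreal (c * (1/4) ^ k)"
      by (intro mult_left_mono nn) auto
    also have "\<dots> = ennreal (2 ^ k * (c * (1/4) ^ k))" by (rule ennreal_mult[symmetric]) (use c in auto)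
    also have "2 ^ k * (c * (1/4) ^ k) = c * (1/2) ^ k"
      by (simp add: power_mult_distrib[symmetric] mult.left_commute)
    finally show "(\<integral>\<^sup>+x. d k x \<partial>lborel) \<le> ennreal (c * (1/2) ^ k)" .
  qed auto
  also have "\<dots> = ennreal (\<Sum>k. c * (1/2) ^ k)"
    by (rule suminf_ennreal2) (use c in \<open>auto intro!: summable_mult summable_geometric\<close>)
  finally have "(\<integral>\<^sup>+x. (\<Sum>k. d k x) \<partial>lborel) \<noteq> \<infinity>" by (auto simp: top_unique)
  then have AE: "AE x in lborel. (\<Sum>k. d k x) \<noteq> \<infinity>" by (intro nn_integral_PInf_AE) auto
  have conv: "convergent (\<lambda>k. g k x)" if x: "(\<Sum>k. d k x) \<noteq> \<infinity>" for x
  proof -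
    obtain B where B: "(\<Sum>k. d k x) = ennreal B" "B \<ge> 0" using x by (cases "\<Sum>k. d k x") auto
    have le: "cmod (g (Suc k) x - g k x) \<le> sqrt B * (sqrt (1/2)) ^ k" for k
    proof -
      have "d k x \<le> (\<Sum>k. d k x)" using sum_le_suminf[of "\<lambda>k. d k x" "{k}"] by simp
      then have "2 ^ k * (cmod (g k x - g (Suc k) x))\<^sup>2 \<le> B"
        using B by (simp add: d_def ennreal_mult''[symmetric])
      then have "(cmod (g (Suc k) x - g k x))\<^sup>2 \<le> B * (1/2) ^ k"
        by (simp add: field_simps norm_minus_commute)
      then have "sqrt ((cmod (g (Suc k) x - g k x))\<^sup>2) \<le> sqrt (B * (1/2) ^ k)" by (rule real_sqrt_le_mono)
      then show ?thesis by (simp add: real_sqrt_mult real_sqrt_power)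
    qed
    have "summable (\<lambda>k. sqrt B * (sqrt (1/2)) ^ k)"
      by (intro summable_mult summable_geometric) (simp add: real_less_lsqrt)
    then have "summable (\<lambda>k. g (Suc k) x - g k x)"
      by (rule summable_comparison_test[rotated]) (use le in auto)
    then have "convergent (\<lambda>n. \<Sum>k<n. g (Suc k) x - g k x)" by (simp add: summable_iff_convergent)
    then have "convergent (\<lambda>n. g n x - g 0 x)" by (simp add: sum_lessThan_telescope[of "\<lambda>k. g k x"])
    from convergent_add[OF this convergent_const[of "g 0 x"]] show ?thesis by simp
  qed
  define h where "h x = lim (\<lambda>k. g k x)" for x
  have hm [measurable]: "h \<in> borel_measurable borel" unfolding h_def[abs_def] by measurable
  have h: "AE x in lborel. (\<lambda>k. g k x) \<longlonglongrightarrow> h x"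
    using AE by eventually_elim (use conv in \<open>simp add: h_def convergent_LIMSEQ_iff\<close>)
  have fatou: "(\<integral>\<^sup>+x. ennreal ((cmod (g k x - h x))\<^sup>2) \<partial>lborel) \<le> ennreal ((sqrt (c * (1/4) ^ k))\<^sup>2)" for k
  proof -
    have "(\<integral>\<^sup>+x. ennreal ((cmod (g k x - h x))\<^sup>2) \<partial>lborel) =
        (\<integral>\<^sup>+x. liminf (\<lambda>m. ennreal ((cmod (g k x - g m x))\<^sup>2)) \<partial>lborel)"
    proof (rule nn_integral_cong_AE, use h in eventually_elim)
      case (elim x)
      have "(\<lambda>m. ennreal ((cmod (g k x - g m x))\<^sup>2)) \<longlonglongrightarrow> ennreal ((cmod (g k x - h x))\<^sup>2)"
        by (intro tendsto_intros elim tendsto_ennrealI)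
      then show ?case by (metis lim_imp_Liminf sequentially_bot)
    qed
    also have "\<dots> \<le> liminf (\<lambda>m. \<integral>\<^sup>+x. ennreal ((cmod (g k x - g m x))\<^sup>2) \<partial>lborel)"
      by (rule nn_integral_liminf) simp
    also have "\<dots> \<le> limsup (\<lambda>m. \<integral>\<^sup>+x. ennreal ((cmod (g k x - g m x))\<^sup>2) \<partial>lborel)"
      by (rule Liminf_le_Limsup) simp
    also have "\<dots> \<le> ennreal (c * (1/4) ^ k)"
      by (rule Limsup_bounded) (use nn in \<open>auto simp: eventually_sequentially\<close>)
    finally show ?thesis using c by simp
  qed
  have s0: "sqrt (c * (1/4) ^ k) \<ge> 0" for k using c by simp
  have L: "(\<lambda>x. g k x - h x) \<in> L2_functions" "L2_function_norm (\<lambda>x. g k x - h x) \<le> sqrt (c * (1/4) ^ k)" for k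
    using L2_functionsI[OF _ fatou s0] by auto
  have "(\<lambda>x. g 0 x - (g 0 x - h x)) \<in> L2_functions" by (rule L2_diff[OF g L(1)])
  then have hL: "h \<in> L2_functions" by simp
  have "(\<lambda>k. sqrt (c * (1/4) ^ k)) \<longlonglongrightarrow> sqrt (c * 0)"
    by (intro tendsto_real_sqrt tendsto_mult tendsto_const LIMSEQ_realpow_zero) simp_all
  then have "(\<lambda>k. sqrt (c * (1/4) ^ k)) \<longlonglongrightarrow> 0" by simp
  moreover have "\<forall>\<^sub>F k in sequentially. norm (L2_function_norm (\<lambda>x. g k x - h x)) \<le> sqrt (c * (1/4) ^ k)"
    by (rule always_eventually) (simp add: L(2) L2_norm_nonneg)
  ultimately have "(\<lambda>k. L2_function_norm (\<lambda>x. g k x - h x)) \<longlonglongrightarrow> 0"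
    by (rule Lim_null_comparison[rotated])
  with hL that show thesis by blast
qed


subsection \<open>A Riesz representation theorem\<close>

text \<open>The representing function is the \<open>L\<^sup>2\<close> limit of a minimizing sequence of
  \<open>\<phi> \<mapsto> \<parallel>T \<phi>\<parallel>\<^sup>2 - 2 Re (\<Lambda> \<phi>)\<close>, which is Cauchy by the parallelogram law.\<close>

lemma Riesz_representation:
  fixes V :: "(real ^ 'n::finite \<Rightarrow> complex) set"
    and T :: "(real ^ 'n \<Rightarrow> complex) \<Rightarrow> real ^ 'm::finite \<Rightarrow> complex"
  assumes V0: "(\<lambda>x. 0) \<in> V"
    and V_add: "\<And>\<phi> \<psi>. \<phi> \<in> V \<Longrightarrow> \<psi> \<in> V \<Longrightarrow> (\<lambda>x. \<phi> x + \<psi> x) \<in> V"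
    and V_cmult: "\<And>c \<phi>. \<phi> \<in> V \<Longrightarrow> (\<lambda>x. c * \<phi> x) \<in> V"
    and \<Lambda>: "linear_functional_on V \<Lambda>"
    and T_add: "\<And>\<phi> \<psi>. \<phi> \<in> V \<Longrightarrow> \<psi> \<in> V \<Longrightarrow> T (\<lambda>x. \<phi> x + \<psi> x) = (\<lambda>x. T \<phi> x + T \<psi> x)"
    and T_cmult: "\<And>c \<phi>. \<phi> \<in> V \<Longrightarrow> T (\<lambda>x. c * \<phi> x) = (\<lambda>x. c * T \<phi> x)"
    and T_L2: "\<And>\<phi>. \<phi> \<in> V \<Longrightarrow> T \<phi> \<in> L2_functions"
    and bound: "\<And>\<phi>. \<phi> \<in> V \<Longrightarrow> cmod (\<Lambda> \<phi>) \<le> C * L2_function_norm (T \<phi>)" and C: "C \<ge> 0"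
  obtains f \<phi> where "f \<in> L2_functions" "L2_function_norm f \<le> C"
    "\<And>\<psi>. \<psi> \<in> V \<Longrightarrow> \<Lambda> \<psi> = (\<integral>x. f x * T \<psi> x \<partial>lborel)"
    "\<And>k::nat. \<phi> k \<in> V" "(\<lambda>k. L2_function_norm (\<lambda>x. f x - cnj (T (\<phi> k) x))) \<longlonglongrightarrow> 0"
proof -
  let ?N = L2_function_norm
  define J where "J \<phi> = (?N (T \<phi>))\<^sup>2 - 2 * Re (\<Lambda> \<phi>)" for \<phi>
  have \<Lambda>_add: "\<Lambda> (\<lambda>x. \<phi> x + \<psi> x) = \<Lambda> \<phi> + \<Lambda> \<psi>" if "\<phi> \<in> V" "\<psi> \<in> V" for \<phi> \<psi>
    using \<Lambda> that by (simp add: linear_functional_on_def)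
  have \<Lambda>_cmult: "\<Lambda> (\<lambda>x. c * \<phi> x) = c * \<Lambda> \<phi>" if "\<phi> \<in> V" for c \<phi>
    using \<Lambda> that by (simp add: linear_functional_on_def)
  have J_ge: "J \<phi> \<ge> - C\<^sup>2" if "\<phi> \<in> V" for \<phi>
  proof -
    have "Re (\<Lambda> \<phi>) \<le> C * ?N (T \<phi>)" using bound[OF that] complex_Re_le_cmod order_trans by blast
    moreover have "0 \<le> (?N (T \<phi>) - C)\<^sup>2" by simp
    ultimately show ?thesis unfolding J_def power2_diff by (simp add: mult_ac)
  qed
  define d where "d = Inf (J ` V)"
  have bdd: "bdd_below (J ` V)" using J_ge by (auto intro!: bdd_belowI2)
  have d_le: "d \<le> J \<phi>" if "\<phi> \<in> V" for \<phi> unfolding d_def using bdd that by (auto intro: cInf_lower)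
  have "\<exists>\<phi>\<in>V. J \<phi> < d + (1/4) ^ k" for k :: nat
  proof -
    have "\<exists>y\<in>J ` V. y < d + (1/4) ^ k"
      using V0 by (subst cInf_less_iff[symmetric]) (auto simp: bdd d_def[symmetric])
    then show ?thesis by blast
  qed
  then obtain \<phi> where \<phi>: "\<And>k::nat. \<phi> k \<in> V" "\<And>k. J (\<phi> k) < d + (1/4) ^ k" by metis
  have cauchy: "(?N (\<lambda>x. T (\<phi> k) x - T (\<phi> m) x))\<^sup>2 \<le> 4 * (1/4) ^ k" if "k \<le> m" for k m
  proof -
    let ?a = "T (\<phi> k)" and ?b = "T (\<phi> m)"
    \<comment> \<open>The infimum is tested at the midpoint: by the parallelogram law
      near-minimality at both ends forces the ends together.\<close>
    define \<psi> where "\<psi> = (\<lambda>x. (1/2) * (\<phi> k x + \<phi> m x))"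
    have V: "(\<lambda>x. \<phi> k x + \<phi> m x) \<in> V" "\<psi> \<in> V" unfolding \<psi>_def by (intro V_add V_cmult \<phi>)+
    have T\<psi>: "T \<psi> = (\<lambda>x. (1/2) * (?a x + ?b x))"
      unfolding \<psi>_def by (subst T_cmult[OF V(1)]) (simp add: T_add \<phi>)
    have L: "?a \<in> L2_functions" "?b \<in> L2_functions" "(\<lambda>x. ?a x + ?b x) \<in> L2_functions"
      by (intro T_L2 \<phi> L2_add)+
    have "J \<psi> = (?N (\<lambda>x. ?a x + ?b x))\<^sup>2 / 4 - Re (\<Lambda> (\<phi> k)) - Re (\<Lambda> (\<phi> m))"
      unfolding J_def T\<psi> L2_cmult(2)[OF L(3)] unfolding \<psi>_def \<Lambda>_cmult[OF V(1)] \<Lambda>_add[OF \<phi>(1) \<phi>(1)]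
      by (simp add: power_divide add_divide_distrib)
    then have "(?N (\<lambda>x. ?a x - ?b x))\<^sup>2 = 2 * J (\<phi> k) + 2 * J (\<phi> m) - 4 * J \<psi>"
      using L2_parallelogram[OF L(1,2)] by (simp add: J_def)
    also have "\<dots> \<le> 2 * (1/4) ^ k + 2 * (1/4) ^ m"
      using d_le[OF V(2)] \<phi>(2)[of k] \<phi>(2)[of m] by simp
    also have "(1/4::real) ^ m \<le> (1/4) ^ k" using that by (intro power_decreasing) auto
    finally show ?thesis by simp
  qed
  obtain g where g: "g \<in> L2_functions" "(\<lambda>k. ?N (\<lambda>x. T (\<phi> k) x - g x)) \<longlonglongrightarrow> 0"
    using L2_complete[of "\<lambda>k. T (\<phi> k)" 4] cauchy T_L2 \<phi>(1) by auto
  define f where "f x = cnj (g x)" for x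
  have f: "f \<in> L2_functions" unfolding f_def[abs_def] by (rule L2_cnj[OF g(1)])
  have lim: "(\<lambda>k. ?N (\<lambda>x. f x - cnj (T (\<phi> k) x))) \<longlonglongrightarrow> 0"
  proof -
    have "?N (\<lambda>x. f x - cnj (T (\<phi> k) x)) = ?N (\<lambda>x. T (\<phi> k) x - g x)" for k
      using L2_norm_cnj[of "\<lambda>x. g x - T (\<phi> k) x"] L2_norm_minus[of g] by (simp add: f_def)
    with g(2) show ?thesis by simp
  qed
  have ip: "(\<lambda>k. \<integral>x. cnj (T (\<phi> k) x) * T \<psi> x \<partial>lborel) \<longlonglongrightarrow> (\<integral>x. f x * T \<psi> x \<partial>lborel)" if \<psi>: "\<psi> \<in> V" for \<psi>
  proof (rule LIM_zero_cancel, rule tendsto_0_le[OF lim, of _ "?N (T \<psi>)"], rule always_eventually, rule allI)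
    fix k
    have L: "(\<lambda>x. cnj (T (\<phi> k) x)) \<in> L2_functions" "T \<psi> \<in> L2_functions"
      by (intro L2_cnj T_L2 \<phi> \<psi>)+
    have "(\<integral>x. cnj (T (\<phi> k) x) * T \<psi> x \<partial>lborel) - (\<integral>x. f x * T \<psi> x \<partial>lborel)
        = (\<integral>x. (cnj (T (\<phi> k) x) - f x) * T \<psi> x \<partial>lborel)"
      unfolding left_diff_distrib by (rule Bochner_Integration.integral_diff[symmetric])
        (intro L2_mult_integrable L f)+
    also have "cmod \<dots> \<le> ?N (\<lambda>x. cnj (T (\<phi> k) x) - f x) * ?N (T \<psi>)"
      by (intro L2_Cauchy_Schwarz L2_diff L f)
    also have "?N (\<lambda>x. cnj (T (\<phi> k) x) - f x) = ?N (\<lambda>x. f x - cnj (T (\<phi> k) x))" by (rule L2_norm_minus)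
    finally show "norm ((\<integral>x. cnj (T (\<phi> k) x) * T \<psi> x \<partial>lborel) - (\<integral>x. f x * T \<psi> x \<partial>lborel))
      \<le> norm (?N (\<lambda>x. f x - cnj (T (\<phi> k) x))) * ?N (T \<psi>)" by (simp add: L2_norm_nonneg)
  qed
  have rep: "\<Lambda> \<psi> = (\<integral>x. f x * T \<psi> x \<partial>lborel)" if \<psi>: "\<psi> \<in> V" for \<psi>
  proof -
    define z where "z = (\<integral>x. f x * T \<psi> x \<partial>lborel) - \<Lambda> \<psi>"
    \<comment> \<open>A variation of \<open>J\<close> at \<open>\<phi> k\<close> in the direction
      \<open>t * \<psi>\<close>. Near-minimality gives the inequality with an error
      \<open>(1/4) ^ k\<close>, which disappears in the limit.\<close>
    have ineq: "0 \<le> 2 * Re (t * z) + (cmod t * ?N (T \<psi>))\<^sup>2" for t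
    proof (rule LIMSEQ_le_const)
      define z' where "z' k = (\<integral>x. cnj (T (\<phi> k) x) * T \<psi> x \<partial>lborel) - \<Lambda> \<psi>" for k
      have "(\<lambda>k. (1/4) ^ k + (2 * Re (t * z' k) + (cmod t * ?N (T \<psi>))\<^sup>2)) \<longlonglongrightarrow> 0 +
          (2 * Re (t * z) + (cmod t * ?N (T \<psi>))\<^sup>2)"
        unfolding z'_def z_def by (intro tendsto_intros ip \<psi> LIMSEQ_realpow_zero) auto
      then show "(\<lambda>k. (1/4) ^ k + (2 * Re (t * z' k) + (cmod t * ?N (T \<psi>))\<^sup>2)) \<longlonglongrightarrow> 2 * Re (t * z) +
          (cmod t * ?N (T \<psi>))\<^sup>2" by simp
      show "\<exists>N. \<forall>n\<ge>N. 0 \<le> (1/4) ^ n + (2 * Re (t * z' n) + (cmod t * ?N (T \<psi>))\<^sup>2)"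
      proof (intro exI allI impI)
        fix k
        have V: "(\<lambda>x. t * \<psi> x) \<in> V" "(\<lambda>x. \<phi> k x + t * \<psi> x) \<in> V" by (intro V_add V_cmult \<phi> \<psi>)+
        have L: "T (\<phi> k) \<in> L2_functions" "(\<lambda>x. t * T \<psi> x) \<in> L2_functions" "T \<psi> \<in> L2_functions"
          by (intro T_L2 \<phi> \<psi> L2_cmult)+
        have Tk: "T (\<lambda>x. \<phi> k x + t * \<psi> x) = (\<lambda>x. T (\<phi> k) x + t * T \<psi> x)"
          using T_add[OF \<phi>(1)[of k] V(1)] T_cmult[OF \<psi>] by simp
        have "(\<integral>x. cnj (T (\<phi> k) x) * (t * T \<psi> x) \<partial>lborel) = t * (\<integral>x. cnj (T (\<phi> k) x) * T \<psi> x \<partial>lborel)"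
          by (subst integral_mult_right_zero[symmetric]) (simp add: mult.left_commute)
        then have "J (\<lambda>x. \<phi> k x + t * \<psi> x) = J (\<phi> k) + 2 * Re (t * z' k) + (cmod t * ?N (T \<psi>))\<^sup>2"
          unfolding J_def Tk L2_add(2)[OF L(1,2)] L2_cmult(2)[OF L(3)] \<Lambda>_add[OF \<phi>(1) V(1)] \<Lambda>_cmult[OF \<psi>] z'_def
          by (simp add: right_diff_distrib del: times_complex.sel)
        then show "0 \<le> (1/4) ^ k + (2 * Re (t * z' k) + (cmod t * ?N (T \<psi>))\<^sup>2)"
          using d_le[OF V(2)] \<phi>(2)[of k] by simp
      qed
    qed
    have "z = 0"
    proof (rule ccontr)
      assume "z \<noteq> 0"
      then have z: "(cmod z)\<^sup>2 > 0" by simp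
      \<comment> \<open>With t = - cnj z / M the linear term is -2 |z|^2 / M and the quadratic term
        at most |z|^2 / M, which is absurd unless z = 0. The summand 1 keeps \<open>M\<close>
        positive when \<open>T \<psi>\<close> vanishes.\<close>
      define M where "M = (?N (T \<psi>))\<^sup>2 + 1"
      have M: "M > 0" "(?N (T \<psi>))\<^sup>2 < M" by (auto simp: M_def add_nonneg_pos)
      have zz: "z * cnj z = of_real ((cmod z)\<^sup>2)" by (rule complex_norm_square[symmetric])
      have eq: "of_real (- 1 / M) * cnj z * z = of_real (- (cmod z)\<^sup>2 / M)"
        unfolding mult.assoc mult.commute[of "cnj z"] zz of_real_mult[symmetric] by simp
      have "Re (of_real (- 1 / M) * cnj z * z) = - (cmod z)\<^sup>2 / M" unfolding eq by (rule Re_complex_of_real)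
      moreover have "(cmod (of_real (- 1 / M) * cnj z) * ?N (T \<psi>))\<^sup>2 = (cmod z)\<^sup>2 / M * ((?N (T \<psi>))\<^sup>2 / M)"
        using M by (simp add: norm_mult norm_divide power_mult_distrib power_divide power2_eq_square)
      moreover have "(?N (T \<psi>))\<^sup>2 / M \<le> 1" using M by simp
      then have "(cmod z)\<^sup>2 / M * ((?N (T \<psi>))\<^sup>2 / M) \<le> (cmod z)\<^sup>2 / M"
        using M z by (intro mult_left_le) auto
      ultimately have "0 \<le> - ((cmod z)\<^sup>2 / M)" using ineq[of "of_real (- 1 / M) * cnj z"] by linarith
      moreover have "(cmod z)\<^sup>2 / M > 0" using z M by simp
      ultimately show False by linarith
    qed
    then show ?thesis by (simp add: z_def)
  qed
  have norm_lim: "(\<lambda>k. ?N (T (\<phi> k))) \<longlonglongrightarrow> ?N f"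
  proof (rule LIM_zero_cancel, rule tendsto_0_le[OF lim, of _ 1], rule always_eventually, rule allI)
    fix k
    have "(\<lambda>x. cnj (T (\<phi> k) x)) \<in> L2_functions" by (intro L2_cnj T_L2 \<phi>)
    from L2_triangle_diff[OF f this]
    show "norm (?N (T (\<phi> k)) - ?N f) \<le> norm (?N (\<lambda>x. f x - cnj (T (\<phi> k) x))) * 1"
      by (simp add: L2_norm_cnj L2_norm_nonneg abs_minus_commute)
  qed
  \<comment> \<open>The functions \<open>T (\<phi> k)\<close> tend to the conjugate of
    \<open>f\<close>. Replacing the conjugate by them in the integral of |f|^2 gives
    \<open>\<Lambda> (\<phi> k)\<close>, to which the hypothesis applies, up to a vanishing
    error.\<close>
  have "?N f \<le> C"
  proof (rule ccontr)
    assume "\<not> ?N f \<le> C"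
    then have pos: "?N f > 0" using C by linarith
    have "(\<lambda>k. (?N f)\<^sup>2 - ?N f * ?N (\<lambda>x. f x - cnj (T (\<phi> k) x))) \<longlonglongrightarrow> (?N f)\<^sup>2 - ?N f * 0"
      by (intro tendsto_intros lim)
    moreover have "(\<lambda>k. C * ?N (T (\<phi> k))) \<longlonglongrightarrow> C * ?N f" by (intro tendsto_intros norm_lim)
    moreover have "(?N f)\<^sup>2 - ?N f * ?N (\<lambda>x. f x - cnj (T (\<phi> k) x)) \<le> C * ?N (T (\<phi> k))" for k
    proof -
      have L: "T (\<phi> k) \<in> L2_functions" "(\<lambda>x. cnj (f x)) \<in> L2_functions" by (intro T_L2 \<phi> L2_cnj f)+
      have "(?N f)\<^sup>2 = Re (\<integral>x. f x * cnj (f x) \<partial>lborel)"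
        unfolding L2_norm_power2 complex_norm_square[symmetric]
          by (simp only: integral_complex_of_real Re_complex_of_real)
      also have "(\<integral>x. f x * cnj (f x) \<partial>lborel) = (\<integral>x. f x * T (\<phi> k) x \<partial>lborel) +
          (\<integral>x. f x * (cnj (f x) - T (\<phi> k) x) \<partial>lborel)"
        unfolding right_diff_distrib
        by (subst Bochner_Integration.integral_diff) (intro L2_mult_integrable f L | simp)+
      also have "Re \<dots> \<le> cmod (\<integral>x. f x * T (\<phi> k) x \<partial>lborel) + cmod (\<integral>x. f x * (cnj (f x) - T (\<phi> k) x) \<partial>lborel)"
        using complex_Re_le_cmod norm_triangle_ineq order_trans by blast
      also have "cmod (\<integral>x. f x * T (\<phi> k) x \<partial>lborel) \<le> C * ?N (T (\<phi> k))"
        using bound[OF \<phi>(1)[of k]] rep[OF \<phi>(1)[of k]] by simp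
      also have "cmod (\<integral>x. f x * (cnj (f x) - T (\<phi> k) x) \<partial>lborel) \<le> ?N f * ?N (\<lambda>x. cnj (f x) - T (\<phi> k) x)"
        by (intro L2_Cauchy_Schwarz L2_diff f L)
      also have "?N (\<lambda>x. cnj (f x) - T (\<phi> k) x) = ?N (\<lambda>x. f x - cnj (T (\<phi> k) x))"
        using L2_norm_cnj[of "\<lambda>x. f x - cnj (T (\<phi> k) x)"] by simp
      finally show ?thesis by simp
    qed
    ultimately have "(?N f)\<^sup>2 - ?N f * 0 \<le> C * ?N f" by (intro LIMSEQ_le) auto
    then have "?N f \<le> C" using pos by (simp add: power2_eq_square)
    with \<open>\<not> ?N f \<le> C\<close> show False by simp
  qed
  with f rep \<phi>(1) lim that show thesis by blast
qed

subsection \<open>The fundamental lemma of the calculus of variations\<close>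

text \<open>As \<open>m\<close> grows, these products tend to the indicator of the open box. Box
  integrals are thereby limits of integrals against test functions.\<close>

lemma box_bump_test:
  fixes a b :: "real ^ 'n::finite" and m :: nat
  shows "(\<lambda>x. \<Prod>i\<in>UNIV. complex_of_real (flat 0 (real m * (x $ i - a $ i))) *
      complex_of_real (flat 0 (real m * (b $ i - x $ i)))) \<in> test_functions"
    (is "?f \<in> _")
proof -
  have lin: "smooth (\<lambda>x::real^'n. complex_of_real (c * x $ i + d))" for c d i
    using smooth_add[OF smooth_mult[OF smooth_const[of "of_real c"] smooth_coord[of i]]
      smooth_const[of "of_real d"]]
    by simp
  have "smooth (\<lambda>x::real^'n. complex_of_real (flat 0 (real m * (x $ i - a $ i))))" for i
    using smooth_flat[OF lin[of "real m" i "- real m * a $ i"], of 0] by (simp add: algebra_simps)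
  moreover have "smooth (\<lambda>x::real^'n. complex_of_real (flat 0 (real m * (b $ i - x $ i))))" for i
    using smooth_flat[OF lin[of "- real m" i "real m * b $ i"], of 0] by (simp add: algebra_simps)
  ultimately have "smooth ?f" by (intro smooth_prod smooth_mult)
  moreover obtain R where R: "\<And>x. x \<in> cbox a b \<Longrightarrow> norm x \<le> R"
    using bounded_cbox[of a b] unfolding bounded_iff by metis
  have "norm x \<le> R" if "?f x \<noteq> 0" for x
  proof (rule R)
    have "flat 0 (real m * (x $ i - a $ i)) \<noteq> 0" "flat 0 (real m * (b $ i - x $ i)) \<noteq> 0" for i
      using that by auto
    then have "real m * (x $ i - a $ i) > 0" "real m * (b $ i - x $ i) > 0" for i
      using flat_eq_0 by (metis not_le)+
    then have "a $ i \<le> x $ i" "x $ i \<le> b $ i" for i by (simp_all add: zero_less_mult_iff less_imp_le)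
    then show "x \<in> cbox a b" by (simp add: mem_box_cart)
  qed
  ultimately show ?thesis unfolding test_functions_iff by blast
qed

lemma flat_le_1: "flat 0 t \<le> 1"
  by (simp add: flat_def)

lemma flat_scale_limit: "(\<lambda>m. flat 0 (real m * t)) \<longlonglongrightarrow> (if t > 0 then 1 else 0)"
proof (cases "t > 0")
  case True
  have "(\<lambda>m. exp (- (1 / (real m * t)))) \<longlonglongrightarrow> exp (- 0)"
  proof (intro tendsto_intros)
    have "(\<lambda>m. (1 / real m) * (1 / t)) \<longlonglongrightarrow> 0 * (1 / t)" by (intro tendsto_intros lim_1_over_n)
    then show "(\<lambda>m. 1 / (real m * t)) \<longlonglongrightarrow> 0" by simp
  qed
  moreover have "\<forall>\<^sub>F m in sequentially. exp (- (1 / (real m * t))) = flat 0 (real m * t)"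
    using eventually_gt_at_top[of 0] by eventually_elim (use True in \<open>simp add: flat_def not_le\<close>)
  ultimately have "(\<lambda>m. flat 0 (real m * t)) \<longlonglongrightarrow> exp (- 0)" by (rule Lim_transform_eventually)
  then show ?thesis using True by simp
next
  case False
  then have "flat 0 (real m * t) = 0" for m by (intro flat_eq_0) (simp add: mult_nonneg_nonpos)
  then show ?thesis using False by simp
qed

text \<open>\<open>ennreal\<close> truncates at 0, so the two densities are the positive and the
  negative part of \<open>g\<close>. They define measures that agree on boxes, a generator stable
  under intersection, and therefore agree almost everywhere; a number whose positive and negative
  parts coincide is 0.\<close>

lemma AE_0_if_box_integrals_0:
  fixes g :: "real ^ 'n::finite \<Rightarrow> real"
  assumes [measurable]: "g \<in> borel_measurable borel"
    and int: "\<And>a b. integrable lborel (\<lambda>x. indicator (box a b) x * g x)"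
    and 0: "\<And>a b. (\<integral>x. indicator (box a b) x * g x \<partial>lborel) = 0"
  shows "AE x in lborel. g x = 0"
proof -
  let ?P = "density lborel (\<lambda>x. ennreal (g x))" and ?M = "density lborel (\<lambda>x. ennreal (- g x))"
  have *: "emeasure ?P (box a b) = ennreal (\<integral>x. max 0 (indicator (box a b) x * g x) \<partial>lborel)"
      "emeasure ?M (box a b) = ennreal (\<integral>x. max 0 (- (indicator (box a b) x * g x)) \<partial>lborel)" for a b
  proof -
    have "emeasure ?P (box a b) = (\<integral>\<^sup>+x. ennreal (max 0 (indicator (box a b) x * g x)) \<partial>lborel)"
      by (subst emeasure_density) (auto intro!: nn_integral_cong simp: indicator_def max_def ennreal_neg)
    also have "\<dots> = ennreal (\<integral>x. max 0 (indicator (box a b) x * g x) \<partial>lborel)"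
      by (intro nn_integral_eq_integral integrable_max int) auto
    finally show "emeasure ?P (box a b) = ennreal (\<integral>x. max 0 (indicator (box a b) x * g x) \<partial>lborel)" .
    have "emeasure ?M (box a b) = (\<integral>\<^sup>+x. ennreal (max 0 (- (indicator (box a b) x * g x))) \<partial>lborel)"
      by (subst emeasure_density) (auto intro!: nn_integral_cong simp: indicator_def max_def ennreal_neg)
    also have "\<dots> = ennreal (\<integral>x. max 0 (- (indicator (box a b) x * g x)) \<partial>lborel)"
      by (intro nn_integral_eq_integral integrable_max integrable_minus int) auto
    finally show "emeasure ?M (box a b) = ennreal (\<integral>x. max 0 (- (indicator (box a b) x * g x)) \<partial>lborel)" .
  qed
  have eq: "emeasure ?P (box a b) = emeasure ?M (box a b)" for a b
  proof -
    have "(\<integral>x. max 0 (indicator (box a b) x * g x) - max 0 (- (indicator (box a b) x * g x)) \<partial>lborel) =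
        (\<integral>x. indicator (box a b) x * g x \<partial>lborel)"
      by (intro Bochner_Integration.integral_cong) (auto simp: max_def)
    then have "(\<integral>x. max 0 (indicator (box a b) x * g x) \<partial>lborel) =
        (\<integral>x. max 0 (- (indicator (box a b) x * g x)) \<partial>lborel)"
      using 0[of a b] int[of a b] by (simp add: Bochner_Integration.integral_diff)
    then show ?thesis by (simp add: *)
  qed
  have "?P = ?M"
  proof (rule measure_eqI_generator_eq)
    let ?E = "range (\<lambda>(a, b). box a b :: (real ^ 'n) set)"
    show "Int_stable ?E" by (auto simp: Int_stable_def box_Int_box)
    show "?E \<subseteq> Pow UNIV" "sets ?P = sigma_sets UNIV ?E" "sets ?M = sigma_sets UNIV ?E"
      by (simp_all add: borel_eq_box)
    let ?A = "\<lambda>n::nat. box (- (real n *\<^sub>R One)) (real n *\<^sub>R One) :: (real ^ 'n) set"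
    show "range ?A \<subseteq> ?E" "(\<Union>i. ?A i) = UNIV" unfolding UN_box_eq_UNIV by auto
    show "emeasure ?P (?A i) \<noteq> \<infinity>" for i by (simp add: *)
    show "emeasure ?P X = emeasure ?M X" if "X \<in> ?E" for X using that eq by auto
  qed
  then have "AE x in lborel. ennreal (g x) = ennreal (- g x)"
    by (intro sigma_finite_measure.density_unique[OF sigma_finite_lborel]) auto
  then show ?thesis
  proof eventually_elim
    case (elim x)
    then show ?case by (cases "g x" "0::real" rule: linorder_cases) (auto simp: ennreal_neg ennreal_eq_0_iff)
  qed
qed

lemma AE_0_if_orthogonal_to_test_functions:
  assumes f: "f \<in> L2_functions"
    and 0: "\<And>\<phi>. \<phi> \<in> test_functions \<Longrightarrow> (\<integral>x. f x * \<phi> x \<partial>lborel) = 0"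
  shows "AE x in lborel. f x = 0"
proof -
  have fm [measurable]: "f \<in> borel_measurable borel" using f by (rule L2_measurable)
  have ind_L2: "(\<lambda>x. indicator (cbox a b) x) \<in> L2_functions" for a b :: "real ^ 'a"
  proof -
    have "(\<lambda>x. (cmod (indicator (cbox a b) x))\<^sup>2) = indicat_real (cbox a b)" by (auto simp: indicator_def)
    moreover have "integrable lborel (indicat_real (cbox a b))"
      by (intro integrable_real_indicator emeasure_lborel_cbox_finite) auto
    ultimately show ?thesis by (simp add: L2_functions_def)
  qed
  have int: "integrable lborel (\<lambda>x. f x * indicator (cbox a b) x)" for a b
    by (rule L2_mult_integrable[OF f ind_L2])
  have int': "integrable lborel (\<lambda>x. f x * indicator (box a b) x)" for a b
    by (rule Bochner_Integration.integrable_bound[OF int[of a b]])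
       (auto intro!: AE_I2 simp: indicator_def norm_mult box_subset_cbox[THEN subsetD])
  have box: "(\<integral>x. f x * indicator (box a b) x \<partial>lborel) = 0" for a b
  proof -
    define \<phi> where "\<phi> m x = (\<Prod>i\<in>UNIV. complex_of_real (flat 0 (real m * (x $ i - a $ i))) *
      complex_of_real (flat 0 (real m * (b $ i - x $ i))))" for m x
    have \<phi>: "\<phi> m \<in> test_functions" for m unfolding \<phi>_def[abs_def] by (rule box_bump_test)
    have [measurable]: "\<phi> m \<in> borel_measurable borel" for m
      by (intro schwartz_measurable test_imp_schwartz \<phi>)
    have "(\<lambda>m. \<integral>x. f x * \<phi> m x \<partial>lborel) \<longlonglongrightarrow> (\<integral>x. f x * indicator (box a b) x \<partial>lborel)"
    proof (rule integral_dominated_convergence[where w = "\<lambda>x. norm (f x * indicator (cbox a b) x)"])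
      show "integrable lborel (\<lambda>x. norm (f x * indicator (cbox a b) x))" by (intro integrable_norm int)
      show "AE x in lborel. (\<lambda>m. f x * \<phi> m x) \<longlonglongrightarrow> f x * indicator (box a b) x"
      proof (intro AE_I2 tendsto_intros)
        fix x
        have "(\<lambda>m. \<phi> m x) \<longlonglongrightarrow> (\<Prod>i\<in>UNIV. complex_of_real (if x $ i - a $ i > 0 then 1 else 0) *
            complex_of_real (if b $ i - x $ i > 0 then 1 else 0))"
          unfolding \<phi>_def by (intro tendsto_intros flat_scale_limit)
        also have "(\<Prod>i\<in>UNIV. complex_of_real (if x $ i - a $ i > 0 then 1 else 0) *
            complex_of_real (if b $ i - x $ i > 0 then 1 else 0)) = indicator (box a b) x"
          by (auto simp: indicator_def mem_box_cart intro!: prod.neutral)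
        finally show "(\<lambda>m. \<phi> m x) \<longlonglongrightarrow> indicator (box a b) x" .
      qed
      show "AE x in lborel. norm (f x * \<phi> m x) \<le> norm (f x * indicator (cbox a b) x)" for m
      proof (rule AE_I2)
        fix x
        show "norm (f x * \<phi> m x) \<le> norm (f x * indicator (cbox a b) x)"
        proof (cases "x \<in> cbox a b")
          case True
          have "norm (\<phi> m x) \<le> 1"
            unfolding \<phi>_def prod_norm[symmetric] norm_mult
            by (intro prod_le_1) (auto simp: flat_nonneg flat_le_1 intro!: mult_le_one)
          then show ?thesis using True mult_left_mono[of "norm (\<phi> m x)" 1 "norm (f x)"] by (simp add: norm_mult)
        next
          case False
          then obtain i where "x $ i < a $ i \<or> b $ i < x $ i" by (auto simp: mem_box_cart not_le)
          then have "real m * (x $ i - a $ i) \<le> 0 \<or> real m * (b $ i - x $ i) \<le> 0"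
            by (auto simp: mult_nonneg_nonpos)
          then have "\<phi> m x = 0" unfolding \<phi>_def by (auto simp: prod_zero_iff intro!: exI[of _ i])
          then show ?thesis by simp
        qed
      qed
    qed auto
    then show ?thesis by (simp add: 0 \<phi> LIMSEQ_const_iff)
  qed
  have "AE x in lborel. Re (f x) = 0"
  proof (rule AE_0_if_box_integrals_0)
    fix a b
    have eq: "indicator (box a b) x * Re (f x) = Re (f x * indicator (box a b) x)" for x
      by (simp add: indicator_def)
    show "integrable lborel (\<lambda>x. indicator (box a b) x * Re (f x))"
      unfolding eq by (intro integrable_Re int')
    show "(\<integral>x. indicator (box a b) x * Re (f x) \<partial>lborel) = 0"
      unfolding eq by (subst integral_Re[OF int']) (simp add: box)
  qed auto
  moreover have "AE x in lborel. Im (f x) = 0"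
  proof (rule AE_0_if_box_integrals_0)
    fix a b
    have eq: "indicator (box a b) x * Im (f x) = Im (f x * indicator (box a b) x)" for x
      by (simp add: indicator_def)
    show "integrable lborel (\<lambda>x. indicator (box a b) x * Im (f x))"
      unfolding eq by (intro integrable_Im int')
    show "(\<integral>x. indicator (box a b) x * Im (f x) \<partial>lborel) = 0"
      unfolding eq by (subst integral_Im[OF int']) (simp add: box)
  qed auto
  ultimately show ?thesis by eventually_elim (simp add: complex_eq_iff)
qed

subsection \<open>The Fourier transform on Schwartz functions\<close>

lemma distr_lborel_uminus:
  "distr lborel borel uminus = (lborel :: 'a::euclidean_space measure)"
  using lborel_affine[of "-1" "0::'a"] by (simp add: density_1)

lemma integral_translate:
  fixes f :: "'a::euclidean_space \<Rightarrow> complex"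
  assumes [measurable]: "f \<in> borel_measurable borel"
  shows "(\<integral>x. f (c + x) \<partial>lborel) = (\<integral>x. f x \<partial>lborel)"
  using integral_distr[of "(+) c" lborel borel f] by (simp add: lborel_distr_plus)

lemma nn_integral_translate:
  fixes f :: "'a::euclidean_space \<Rightarrow> ennreal"
  assumes [measurable]: "f \<in> borel_measurable borel"
  shows "(\<integral>\<^sup>+x. f (c + x) \<partial>lborel) = (\<integral>\<^sup>+x. f x \<partial>lborel)"
  using nn_integral_distr[of "(+) c" lborel borel f] by (simp add: lborel_distr_plus)

lemma integral_reflect_lborel:
  fixes f :: "'a::euclidean_space \<Rightarrow> 'b::{banach, second_countable_topology}"
  assumes [measurable]: "f \<in> borel_measurable borel"
  shows "(\<integral>x. f (- x) \<partial>lborel) = (\<integral>x. f x \<partial>lborel)"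
  using integral_distr[of "uminus" lborel borel f] by (simp add: distr_lborel_uminus)

lemma nn_integral_reflect:
  fixes f :: "'a::euclidean_space \<Rightarrow> ennreal"
  assumes [measurable]: "f \<in> borel_measurable borel"
  shows "(\<integral>\<^sup>+x. f (c - x) \<partial>lborel) = (\<integral>\<^sup>+x. f x \<partial>lborel)"
  using nn_integral_distr[of "uminus" lborel borel "\<lambda>x. f (c + x)"] nn_integral_translate[OF assms, of c]
  by (simp add: distr_lborel_uminus)

lemma integral_scale:
  fixes f :: "'a::euclidean_space \<Rightarrow> complex"
  assumes [measurable]: "f \<in> borel_measurable borel" and c: "c > 0"
  shows "(\<integral>x. f (c *\<^sub>R x) \<partial>lborel) = (\<integral>x. f x \<partial>lborel) / of_real (c ^ DIM('a))"
proof -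
  have "(\<integral>x. f x \<partial>lborel) = (\<integral>x. f x \<partial>density (distr lborel borel (\<lambda>x. 0 + c *\<^sub>R x))
      (\<lambda>_. ennreal (\<bar>c\<bar> ^ DIM('a))))"
    using c by (subst lborel_affine[of c 0]) auto
  also have "\<dots> = (\<integral>x. (\<bar>c\<bar> ^ DIM('a)) *\<^sub>R f x \<partial>distr lborel borel (\<lambda>x. 0 + c *\<^sub>R x))"
    by (subst integral_density) auto
  also have "\<dots> = (\<integral>x. (\<bar>c\<bar> ^ DIM('a)) *\<^sub>R f (c *\<^sub>R x) \<partial>lborel)"
    by (subst integral_distr) auto
  also have "\<dots> = of_real (c ^ DIM('a)) * (\<integral>x. f (c *\<^sub>R x) \<partial>lborel)"
    using c by (simp add: scaleR_conv_of_real)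
  finally show ?thesis using c by simp
qed

text \<open>The tensor product of \<open>f\<close> and \<open>g\<close> is integrable and a bounded
  kernel preserves this. The kernels in use are characters, for the Fourier transform, and
  translated windows, for the averaging.\<close>

lemma Fubini_bounded_kernel:
  fixes f :: "'a::euclidean_space \<Rightarrow> complex" and g :: "'b::euclidean_space \<Rightarrow> complex"
  assumes f: "integrable lborel f" and g: "integrable lborel g"
    and [measurable]: "(\<lambda>(x, y). k x y) \<in> borel_measurable (borel \<Otimes>\<^sub>M borel)"
    and k: "\<And>x y. cmod (k x y) \<le> B"
  shows "(\<integral>x. (\<integral>y. k x y * f x * g y \<partial>lborel) \<partial>lborel) = (\<integral>y. (\<integral>x. k x y * f x * g y \<partial>lborel) \<partial>lborel)"
proof (rule lborel_pair.Fubini_integral[symmetric])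
  have [measurable]: "f \<in> borel_measurable borel" "g \<in> borel_measurable borel" using f g by auto
  have "integrable (lborel \<Otimes>\<^sub>M lborel) (\<lambda>(x, y). of_real B * (f x * g y))"
  proof (rule lborel_pair.Fubini_integrable)
    show "(\<lambda>(x, y). of_real B * (f x * g y)) \<in> borel_measurable (lborel \<Otimes>\<^sub>M lborel)" by measurable
    have "integrable lborel (\<lambda>x. cmod (f x) * (\<bar>B\<bar> * (\<integral>y. cmod (g y) \<partial>lborel)))"
      using f by (intro integrable_mult_left integrable_norm)
    then show "integrable lborel (\<lambda>x. \<integral>y. norm (case (x, y) of (x, y) \<Rightarrow> of_real B * (f x * g y)) \<partial>lborel)"
      by (simp add: norm_mult mult_ac)
    show "AE x in lborel. integrable lborel (\<lambda>y. case (x, y) of (x, y) \<Rightarrow> of_real B * (f x * g y))"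
      using g by (intro AE_I2) simp
  qed
  then show "integrable (lborel \<Otimes>\<^sub>M lborel) (\<lambda>(x, y). k x y * f x * g y)"
  proof (rule Bochner_Integration.integrable_bound)
    show "(\<lambda>(x, y). k x y * f x * g y) \<in> borel_measurable (lborel \<Otimes>\<^sub>M lborel)" by measurable
    show "AE x in lborel \<Otimes>\<^sub>M lborel. norm (case x of (x, y) \<Rightarrow> k x y * f x * g y)
        \<le> norm (case x of (x, y) \<Rightarrow> of_real B * (f x * g y))"
      using k by (intro AE_I2) (auto simp: norm_mult mult.assoc intro!: mult_right_mono
        order_trans[OF k] abs_ge_self)
  qed
qed

lemma norm_char [simp]: "cmod (exp (- \<i> * complex_of_real t)) = 1" "cmod (exp (- (\<i> * complex_of_real t))) = 1"
  "cmod (exp (\<i> * complex_of_real t)) = 1"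
  using norm_exp_i_times[of t] norm_exp_i_times[of "- t"] by simp_all

lemma integrable_char_mult:
  fixes f :: "real ^ 'n::finite \<Rightarrow> complex"
  assumes "integrable lborel f"
  shows "integrable lborel (\<lambda>x. exp (- \<i> * complex_of_real (x \<bullet> \<xi>)) * f x)"
    "integrable lborel (\<lambda>x. exp (\<i> * complex_of_real (x \<bullet> \<xi>)) * f x)"
proof -
  have [measurable]: "f \<in> borel_measurable borel" using assms by auto
  show "integrable lborel (\<lambda>x. exp (- \<i> * complex_of_real (x \<bullet> \<xi>)) * f x)"
    by (rule Bochner_Integration.integrable_bound[OF assms]) (auto simp: norm_mult intro!: AE_I2)
  show "integrable lborel (\<lambda>x. exp (\<i> * complex_of_real (x \<bullet> \<xi>)) * f x)"
    by (rule Bochner_Integration.integrable_bound[OF assms]) (auto simp: norm_mult intro!: AE_I2)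
qed

lemma char_add:
  "exp (- \<i> * complex_of_real (s + t)) = exp (- \<i> * complex_of_real s) * exp (- \<i> * complex_of_real t)"
  by (simp only: of_real_add distrib_left exp_add)

lemma char_diff:
  "exp (- \<i> * complex_of_real (s - t)) = exp (- \<i> * complex_of_real s) * exp (\<i> * complex_of_real t)"
  by (simp add: exp_add[symmetric] right_diff_distrib)

lemma char_slow_smooth: "(\<lambda>x. exp (- \<i> * complex_of_real (x \<bullet> \<xi>))) \<in> slow_smooth"
  using slow_smooth.char[of "- \<xi>"] by simp

lemma fourier_norm_le: "cmod (fourier f \<xi>) \<le> (\<integral>x. cmod (f x) \<partial>lborel)"
proof -
  have "cmod (fourier f \<xi>) \<le> (\<integral>x. cmod (exp (- \<i> * complex_of_real (x \<bullet> \<xi>)) * f x) \<partial>lborel)"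
    unfolding fourier_def by (rule integral_norm_bound)
  then show ?thesis by (simp add: norm_mult)
qed

lemma inverse_fourier_eq:
  fixes f :: "real ^ 'n::finite \<Rightarrow> complex"
  shows "inverse_fourier f x = fourier f (- x) / of_real ((2 * pi) ^ CARD('n))"
  by (simp add: inverse_fourier_def fourier_def inner_commute)

lemma fourier_add:
  assumes "f \<in> schwartz_functions" "g \<in> schwartz_functions"
  shows "fourier (\<lambda>x. f x + g x) = (\<lambda>\<xi>. fourier f \<xi> + fourier g \<xi>)"
  unfolding fourier_def distrib_left
  by (intro ext Bochner_Integration.integral_add integrable_char_mult schwartz_integrable assms)

lemma fourier_cmult: "fourier (\<lambda>x. c * f x) = (\<lambda>\<xi>. c * fourier f \<xi>)"
  unfolding fourier_def by (simp add: mult.left_commute[of _ c])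

lemma fourier_sum:
  assumes "\<And>i. i \<in> I \<Longrightarrow> f i \<in> schwartz_functions"
  shows "fourier (\<lambda>x. \<Sum>i\<in>I. f i x) = (\<lambda>\<xi>. \<Sum>i\<in>I. fourier (f i) \<xi>)"
  unfolding fourier_def sum_distrib_left
  using assms by (intro ext Bochner_Integration.integral_sum integrable_char_mult schwartz_integrable)

text \<open>Difference quotients have integral zero by translation invariance.\<close>

lemma integral_partial_derivative:
  fixes f :: "real ^ 'n::finite \<Rightarrow> complex"
  assumes f: "f \<in> schwartz_functions"
  shows "(\<integral>x. partial_derivative i f x \<partial>lborel) = 0"
proof -
  let ?e = "axis i (1::real) :: real ^ 'n"
  have fm [measurable]: "f \<in> borel_measurable borel" using f by (rule schwartz_measurable)
  have dm [measurable]: "partial_derivative i f \<in> borel_measurable borel"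
    by (intro schwartz_measurable schwartz_partial_derivative f)
  obtain C where C: "C \<ge> 0" "\<And>x. (1 + norm x) ^ 0 * cmod (partial_derivative i f x) \<le> C * decay x"
    using rapid_decay[OF schwartz_rapid[OF schwartz_partial_derivative[OF f]]] by metis
  define h where "h k = inverse (real (Suc k))" for k
  have h: "h k > 0" "h k \<le> 1" for k unfolding h_def by (simp_all add: inverse_le_1_iff)
  define g where "g k x = (f (h k *\<^sub>R ?e + x) - f x) / of_real (h k)" for k x
  have [measurable]: "g k \<in> borel_measurable borel" for k unfolding g_def[abs_def] by measurable
  have der: "((\<lambda>t. f (t *\<^sub>R ?e + x)) has_vector_derivative partial_derivative i f (t *\<^sub>R ?e + x))
      (at t)" for t x
  proof -
    have d: "(f has_derivative frechet_derivative f (at (t *\<^sub>R ?e + x))) (at (t *\<^sub>R ?e + x))"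
      by (intro differentiable_on_UNIV_has_derivative smooth_imp_differentiable_on schwartz_smooth f)
    have "((\<lambda>t. t *\<^sub>R ?e + x) has_derivative (\<lambda>s. s *\<^sub>R ?e)) (at t)"
      by (auto intro!: derivative_eq_intros)
    from has_derivative_compose[OF this d]
    show ?thesis unfolding has_vector_derivative_def partial_derivative_def
      by (simp add: linear_scale[OF has_derivative_linear[OF d]])
  qed
  \<comment> \<open>Mean value inequality along the segment from \<open>x\<close> to the shifted
    point. A shift of length at most 1 changes \<open>1 + norm x\<close> by a factor of at most 2,
    which accounts for the power of 2.\<close>
  have bound: "cmod (g k x) \<le> (C * 2 ^ (2 * CARD('n))) * decay x" for k x
  proof -
    have dec: "decay (t *\<^sub>R ?e + x) \<le> 2 ^ (2 * CARD('n)) * decay x" if "t \<in> {0..h k}" for t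
    proof -
      have "norm (t *\<^sub>R ?e) \<le> 1" using that h[of k] by (simp add: norm_axis_1)
      moreover have "norm x \<le> norm (t *\<^sub>R ?e + x) + norm (t *\<^sub>R ?e)"
        using norm_triangle_ineq4[of "t *\<^sub>R ?e + x" "t *\<^sub>R ?e"] by simp
      moreover have "b \<le> 1 \<Longrightarrow> c \<le> a + b \<Longrightarrow> 0 \<le> a \<Longrightarrow> 1 + c \<le> 2 * (1 + a)" for a b c :: real by simp
      ultimately have "1 + norm x \<le> 2 * (1 + norm (t *\<^sub>R ?e + x))" using norm_ge_zero by metis
      then have "(1 + norm x) ^ (2 * CARD('n)) \<le> (2 * (1 + norm (t *\<^sub>R ?e + x))) ^ (2 * CARD('n))"
        by (intro power_mono) auto
      moreover have "(1 + norm x) ^ (2 * CARD('n)) > 0" "(1 + norm (t *\<^sub>R ?e + x)) ^ (2 * CARD('n)) > 0"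
        by (simp_all add: add_pos_nonneg)
      ultimately show ?thesis unfolding decay_def power_mult_distrib by (simp add: divide_simps mult_ac)
    qed
    have "norm (f (h k *\<^sub>R ?e + x) - f (0 *\<^sub>R ?e + x)) \<le> (C * 2 ^ (2 * CARD('n)) * decay x) * norm (h k - 0)"
    proof (rule differentiable_bound[of "{0..h k}" "\<lambda>t. f (t *\<^sub>R ?e + x)" "\<lambda>t s. s *\<^sub>R
      partial_derivative i f (t *\<^sub>R ?e + x)"])
      fix t assume t: "t \<in> {0..h k}"
      show "((\<lambda>t. f (t *\<^sub>R ?e + x)) has_derivative (\<lambda>s. s *\<^sub>R partial_derivative i f (t *\<^sub>R ?e + x)))
          (at t within {0..h k})"
        using der[where t = t and x = x] unfolding has_vector_derivative_def by (rule has_derivative_at_withinI)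
      have "cmod (partial_derivative i f (t *\<^sub>R ?e + x)) \<le> C * (2 ^ (2 * CARD('n)) * decay x)"
        using C(2)[of "t *\<^sub>R ?e + x"] mult_left_mono[OF dec[OF t] C(1)] by simp
      then have "norm (s *\<^sub>R partial_derivative i f (t *\<^sub>R ?e + x)) \<le> C * 2 ^ (2 * CARD('n)) * decay x *
          norm s" for s
        by (simp only: norm_scaleR real_norm_def mult.assoc mult.commute[of "\<bar>s\<bar>"])
          (simp only: mult.assoc[symmetric] mult_right_mono abs_ge_zero)
      then show "onorm (\<lambda>s. s *\<^sub>R partial_derivative i f (t *\<^sub>R ?e + x)) \<le> C * 2 ^ (2 * CARD('n)) * decay x"
        by (rule onorm_le)
    qed (use h[of k] in auto)
    then show ?thesis using h[of k] by (simp add: g_def norm_divide divide_le_eq mult_ac)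
  qed
  have "(\<lambda>k. \<integral>x. g k x \<partial>lborel) \<longlonglongrightarrow> (\<integral>x. partial_derivative i f x \<partial>lborel)"
  proof (rule integral_dominated_convergence[where w = "\<lambda>x. (C * 2 ^ (2 * CARD('n))) * decay x"])
    show "integrable lborel (\<lambda>x. (C * 2 ^ (2 * CARD('n))) * decay (x :: real ^ 'n))"
      by (intro integrable_mult_right integrable_decay)
    show "AE x in lborel. (\<lambda>k. g k x) \<longlonglongrightarrow> partial_derivative i f x"
    proof (rule AE_I2)
      fix x
      have "(h \<longlongrightarrow> 0) sequentially" unfolding h_def[abs_def] by (rule LIMSEQ_inverse_real_of_nat)
      moreover have "\<forall>k. h k \<noteq> 0" using h(1) by (metis less_irrefl)
      ultimately have flim: "filterlim h (at 0) sequentially" by (simp add: filterlim_at)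
      have "((\<lambda>t. (f ((0 + t) *\<^sub>R ?e + x) - f (0 *\<^sub>R ?e + x)) /\<^sub>R t) \<longlongrightarrow> partial_derivative i f
          (0 *\<^sub>R ?e + x)) (at 0)"
      proof (rule LIM_zero_cancel, rule tendsto_norm_zero_cancel, rule Lim_transform_eventually)
        show "((\<lambda>t. norm (f ((0 + t) *\<^sub>R ?e + x) - f (0 *\<^sub>R ?e + x) - t *\<^sub>R partial_derivative i f
            (0 *\<^sub>R ?e + x)) / norm t) \<longlongrightarrow> 0) (at 0)"
          using der[where t = 0 and x = x] unfolding has_vector_derivative_def has_derivative_at by simp
        have "norm (a - c - t *\<^sub>R d) / norm t = norm ((a - c) /\<^sub>R t - d)" if "t \<noteq> 0"
            for a c d :: complex and t :: real
        proof -
          have "(a - c) /\<^sub>R t - d = (a - c - t *\<^sub>R d) /\<^sub>R t"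
            using that by (simp add: scaleR_diff_right)
          then show ?thesis by (simp add: divide_inverse mult.commute)
        qed
        then show "\<forall>\<^sub>F t in at 0. norm (f ((0 + t) *\<^sub>R ?e + x) - f (0 *\<^sub>R ?e + x) - t *\<^sub>R
            partial_derivative i f (0 *\<^sub>R ?e + x)) / norm t =
            norm ((f ((0 + t) *\<^sub>R ?e + x) - f (0 *\<^sub>R ?e + x)) /\<^sub>R t - partial_derivative i f (0 *\<^sub>R ?e + x))"
          by (intro eventually_at_topological[THEN iffD2] exI[of _ UNIV]) simp
      qed
      from filterlim_compose[OF this flim] show "(\<lambda>k. g k x) \<longlonglongrightarrow> partial_derivative i f x"
        by (simp add: g_def scaleR_conv_of_real divide_inverse mult.commute)
    qed
    show "AE x in lborel. norm (g k x) \<le> C * 2 ^ (2 * CARD('n)) * decay x" for k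
      by (intro AE_I2 bound)
  qed auto
  moreover have "(\<integral>x. g k x \<partial>lborel) = 0" for k
  proof -
    have int: "integrable lborel f" by (rule schwartz_integrable[OF f])
    have int2: "integrable lborel (\<lambda>x. f (h k *\<^sub>R ?e + x))"
      using schwartz_integrable[OF schwartz_translate[OF f, of "- (h k *\<^sub>R ?e)"]]
        by (simp add: translate_def add.commute)
    have "(\<integral>x. g k x \<partial>lborel) = (\<integral>x. f (h k *\<^sub>R ?e + x) - f x \<partial>lborel) / of_real (h k)"
      unfolding g_def by (rule integral_divide_zero)
    also have "(\<integral>x. f (h k *\<^sub>R ?e + x) - f x \<partial>lborel) = 0"
      using int int2 by (simp add: integral_translate)
    finally show ?thesis by simp
  qed
  ultimately show ?thesis by (simp add: LIMSEQ_const_iff)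
qed

section \<open>Derivatives and decay under the Fourier transform\<close>

text \<open>Integration by parts, in the form that the derivative of \<open>f\<close> times the
  character has integral zero.\<close>

lemma fourier_partial_derivative:
  assumes f: "f \<in> schwartz_functions"
  shows "fourier (partial_derivative i f) \<xi> = \<i> * of_real (\<xi> $ i) * fourier f \<xi>"
proof -
  let ?e = "\<lambda>x. exp (- \<i> * complex_of_real (x \<bullet> \<xi>))"
  have ef: "(\<lambda>x. ?e x * f x) \<in> schwartz_functions" by (rule schwartz_slow_mult[OF char_slow_smooth f])
  have pe: "partial_derivative i ?e x = - \<i> * of_real (\<xi> $ i) * ?e x" for x
    using partial_derivative_eqI[OF char_has_derivative[of "- \<xi>" x], of i]
    by (simp add: inner_axis' )
  have "partial_derivative i (\<lambda>x. ?e x * f x) = (\<lambda>x. ?e x * partial_derivative i f x +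
      partial_derivative i ?e x * f x)"
    by (intro partial_derivative_mult slow_smooth_smooth char_slow_smooth schwartz_smooth f)
  then have "0 = (\<integral>x. ?e x * partial_derivative i f x + partial_derivative i ?e x * f x \<partial>lborel)"
    using integral_partial_derivative[OF ef, of i] by simp
  also have "\<dots> = (\<integral>x. ?e x * partial_derivative i f x + (- \<i> * of_real (\<xi> $ i)) * (?e x * f x) \<partial>lborel)"
    unfolding pe by (simp only: mult.assoc)
  also have "\<dots> = (\<integral>x. ?e x * partial_derivative i f x \<partial>lborel) + (- \<i> * of_real (\<xi> $ i)) *
      (\<integral>x. ?e x * f x \<partial>lborel)"
    by (subst Bochner_Integration.integral_add)
      (intro integrable_mult_right integrable_char_mult schwartz_integrable schwartz_partial_derivative
        f | simp)+
  finally show ?thesis unfolding fourier_def by (simp add: algebra_simps eq_neg_iff_add_eq_0)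
qed

lemma schwartz_coord_mult:
  "f \<in> schwartz_functions \<Longrightarrow> (\<lambda>x. (c * of_real (x $ i)) * f x) \<in> schwartz_functions"
  by (intro schwartz_slow_mult slow_smooth.mult slow_smooth.const slow_smooth.coord)

text \<open>The first-order Taylor remainder of the character is at most (x \<bullet> h)^2 / 2 in
  modulus, and the second moment of |f| is finite. This gives the remainder
  \<open>K * norm h * norm h\<close> directly, without a limit under the integral.\<close>

lemma fourier_has_derivative:
  fixes f :: "real ^ 'n::finite \<Rightarrow> complex"
  assumes f: "f \<in> schwartz_functions"
  shows "(fourier f has_derivative
    (\<lambda>h. \<Sum>i\<in>UNIV. of_real (h $ i) * fourier (\<lambda>x. (- \<i> * of_real (x $ i)) * f x) \<xi>)) (at \<xi>)"
proof -
  let ?e = "\<lambda>\<xi> x. exp (- \<i> * complex_of_real (x \<bullet> \<xi>))"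
  let ?G = "\<lambda>i. fourier (\<lambda>x. (- \<i> * of_real (x $ i)) * f x) \<xi>"
  have G: "(\<Sum>i\<in>UNIV. of_real (h $ i) * ?G i) = fourier (\<lambda>x. (- \<i> * of_real (x \<bullet> h)) * f x) \<xi>" for h
  proof -
    have "(\<lambda>\<xi>. \<Sum>i\<in>UNIV. of_real (h $ i) * fourier (\<lambda>x. (- \<i> * of_real (x $ i)) * f x) \<xi>) =
        fourier (\<lambda>x. \<Sum>i\<in>UNIV. of_real (h $ i) * ((- \<i> * of_real (x $ i)) * f x))"
      by (subst fourier_sum, intro schwartz_cmult schwartz_coord_mult f) (simp only: fourier_cmult)
    moreover have "(\<Sum>i\<in>UNIV. of_real (h $ i) * ((- \<i> * of_real (x $ i)) * f x)) =
        (- \<i> * of_real (x \<bullet> h)) * f x" for x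
      by (simp add: inner_vec_def sum_distrib_left sum_distrib_right sum_negf mult_ac)
    ultimately show ?thesis by (metis (no_types, lifting) ext)
  qed
  have fh: "(\<lambda>x. (- \<i> * of_real (x \<bullet> h)) * f x) \<in> schwartz_functions" for h
  proof -
    have "(\<lambda>x. (- \<i> * of_real (x \<bullet> h))) = (\<lambda>x. \<Sum>i\<in>UNIV. (- \<i> * of_real (h $ i)) * of_real (x $ i))"
      by (auto simp: inner_vec_def sum_distrib_left mult_ac)
    then show ?thesis
      by (intro schwartz_slow_mult f) (simp only: slow_smooth_sum slow_smooth.mult slow_smooth.const
        slow_smooth.coord)
  qed
  have int: "integrable lborel (\<lambda>x. (norm x)\<^sup>2 * cmod (f x))"
  proof -
    obtain C where C: "C \<ge> 0" "\<And>x. (1 + norm x) ^ 2 * cmod (f x) \<le> C * decay x"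
      using rapid_decay[OF schwartz_rapid[OF f]] by metis
    have [measurable]: "f \<in> borel_measurable borel" by (rule schwartz_measurable[OF f])
    show ?thesis
    proof (rule Bochner_Integration.integrable_bound[OF integrable_mult_right[OF integrable_decay, of C]])
      show "AE x in lborel. norm ((norm x)\<^sup>2 * cmod (f x)) \<le> norm (C * decay x)"
      proof (rule AE_I2)
        fix x :: "real ^ 'n"
        have "(norm x)\<^sup>2 * cmod (f x) \<le> (1 + norm x) ^ 2 * cmod (f x)"
          by (intro mult_right_mono power_mono) auto
        also note C(2)[of x]
        finally show "norm ((norm x)\<^sup>2 * cmod (f x)) \<le> norm (C * decay x)" using C(1)
          by (simp add: abs_mult abs_of_pos[OF decay_pos])
      qed
    qed measurable
  qed
  define K where "K = (\<integral>x. (norm x)\<^sup>2 * cmod (f x) \<partial>lborel) / 2"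
  show ?thesis
  proof (rule has_derivativeI_sandwich[where e = 1 and H = "\<lambda>y. K * norm (y - \<xi>)"])
    show "bounded_linear (\<lambda>h. \<Sum>i\<in>UNIV. of_real (h $ i) * ?G i)"
      by (intro bounded_linear_sum bounded_linear_mult_const
        bounded_linear_compose[OF bounded_linear_of_real] bounded_linear_vec_nth)
    have "((\<lambda>y. K * norm (y - \<xi>)) \<longlongrightarrow> K * norm (\<xi> - \<xi>)) (at \<xi>)" by (intro tendsto_intros)
    then show "((\<lambda>y. K * norm (y - \<xi>)) \<longlongrightarrow> 0) (at \<xi>)" by simp
    fix y assume "y \<noteq> \<xi>"
    define h where "h = y - \<xi>"
    have h0: "norm h > 0" using \<open>y \<noteq> \<xi>\<close> by (simp add: h_def)
    let ?r = "\<lambda>x. ?e y x * f x - ?e \<xi> x * f x - ?e \<xi> x * ((- \<i> * of_real (x \<bullet> h)) * f x)"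
    have i: "integrable lborel (\<lambda>x. ?e y x * f x)" "integrable lborel (\<lambda>x. ?e \<xi> x * f x)"
      "integrable lborel (\<lambda>x. ?e \<xi> x * ((- \<i> * of_real (x \<bullet> h)) * f x))"
      by (intro integrable_char_mult schwartz_integrable f fh)+
    have eq: "fourier f y - fourier f \<xi> - fourier (\<lambda>x. (- \<i> * of_real (x \<bullet> h)) * f x) \<xi> = (\<integral>x. ?r x \<partial>lborel)"
      unfolding fourier_def
      by (simp only: Bochner_Integration.integral_diff[OF Bochner_Integration.integrable_diff[OF i(1,2)]
        i(3)] Bochner_Integration.integral_diff[OF i(1,2)])
    have "cmod (fourier f y - fourier f \<xi> - fourier (\<lambda>x. (- \<i> * of_real (x \<bullet> h)) * f x) \<xi>) \<le>
        (\<integral>x. cmod (?r x) \<partial>lborel)"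
      unfolding eq by (rule integral_norm_bound)
    also have "\<dots> \<le> (\<integral>x. (norm h)\<^sup>2 / 2 * ((norm x)\<^sup>2 * cmod (f x)) \<partial>lborel)"
    proof (rule integral_mono)
      show "integrable lborel (\<lambda>x. cmod (?r x))"
        by (rule integrable_norm[OF Bochner_Integration.integrable_diff[OF
          Bochner_Integration.integrable_diff[OF i(1,2)] i(3)]])
      show "integrable lborel (\<lambda>x. (norm h)\<^sup>2 / 2 * ((norm x)\<^sup>2 * cmod (f x)))"
        by (intro integrable_mult_right int)
      fix x :: "real ^ 'n"
      have "y = \<xi> + h" by (simp add: h_def)
      then have "?e y x = ?e \<xi> x * ?e h x" by (simp only: inner_add_right char_add)
      then have "?e y x = ?e \<xi> x * exp (\<i> * of_real (- (x \<bullet> h)))" by simp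
      then have "?r x = ?e \<xi> x * f x * (exp (\<i> * of_real (- (x \<bullet> h))) -
          (\<Sum>k\<le>1. (\<i> * of_real (- (x \<bullet> h)))^k / fact k))"
        by (simp only: ring_distribs mult.assoc) (simp add: ring_distribs mult_ac)
      then have "cmod (?r x) = cmod (f x) * cmod (exp (\<i> * of_real (- (x \<bullet> h))) -
          (\<Sum>k\<le>1. (\<i> * of_real (- (x \<bullet> h)))^k / fact k))"
        by (simp only: norm_mult norm_char mult_1)
      also have "\<dots> \<le> cmod (f x) * (\<bar>- (x \<bullet> h)\<bar> ^ Suc 1 / fact (Suc 1))"
        by (intro mult_left_mono iexp_approx1) simp
      also have "\<dots> \<le> cmod (f x) * ((norm x * norm h) ^ 2 / 2)"
        using Cauchy_Schwarz_ineq2[of x h] power_mono[of "\<bar>x \<bullet> h\<bar>" "norm x * norm h" 2]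
        by (intro mult_left_mono) (auto simp: numeral_2_eq_2)
      finally show "cmod (?r x) \<le> (norm h)\<^sup>2 / 2 * ((norm x)\<^sup>2 * cmod (f x))"
        by (simp add: power_mult_distrib mult_ac)
    qed
    also have "\<dots> = K * norm h * norm h" by (simp add: K_def power2_eq_square)
    finally show "norm (fourier f y - fourier f \<xi> - (\<Sum>i\<in>UNIV. of_real ((y - \<xi>) $ i) * ?G i)) / norm
        (y - \<xi>) \<le> K * norm (y - \<xi>)"
      unfolding G h_def[symmetric] using h0 by (simp add: pos_divide_le_eq)
  qed simp
qed

lemma partial_derivative_fourier:
  assumes "f \<in> schwartz_functions"
  shows "partial_derivative i (fourier f) = fourier (\<lambda>x. (- \<i> * of_real (x $ i)) * f x)"
proof
  fix \<xi>
  have "partial_derivative i (fourier f) \<xi> =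
      (\<Sum>k\<in>UNIV. of_real (axis i 1 $ k) * fourier (\<lambda>x. (- \<i> * of_real (x $ k)) * f x) \<xi>)"
    by (rule partial_derivative_eqI[OF fourier_has_derivative[OF assms]])
  also have "\<dots> = (\<Sum>k\<in>UNIV. if k = i then fourier (\<lambda>x. (- \<i> * of_real (x $ k)) * f x) \<xi> else 0)"
    by (intro sum.cong) (auto simp: axis_def)
  finally show "partial_derivative i (fourier f) \<xi> = fourier (\<lambda>x. (- \<i> * of_real (x $ i)) * f x) \<xi>" by simp
qed

text \<open>The operator 1 - Laplacian, with Fourier symbol 1 + |\<xi>|^2; its powers exchange
  derivatives for polynomial weights in frequency. The factor -1 is written out to match the rules
  for sums and scalar multiples.\<close>

definition bessel :: "(real ^ 'n::finite \<Rightarrow> complex) \<Rightarrow> real ^ 'n \<Rightarrow> complex" where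
  "bessel f x = f x + (-1) * (\<Sum>i\<in>UNIV. partial_derivative i (partial_derivative i f) x)"

lemma schwartz_bessel: "f \<in> schwartz_functions \<Longrightarrow> bessel f \<in> schwartz_functions"
  unfolding bessel_def[abs_def] by (intro schwartz_add schwartz_cmult schwartz_sum schwartz_partial_derivative)

lemma fourier_bessel:
  fixes f :: "real ^ 'n::finite \<Rightarrow> complex"
  assumes f: "f \<in> schwartz_functions"
  shows "fourier (bessel f) \<xi> = of_real (1 + (norm \<xi>)\<^sup>2) * fourier f \<xi>"
proof -
  have S: "(\<lambda>x. \<Sum>i\<in>UNIV. partial_derivative i (partial_derivative i f) x) \<in> schwartz_functions"
    by (intro schwartz_sum schwartz_partial_derivative f)
  have "fourier (bessel f) \<xi> = fourier f \<xi> + (-1) *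
      (\<Sum>i\<in>UNIV. fourier (partial_derivative i (partial_derivative i f)) \<xi>)"
    unfolding bessel_def[abs_def] fourier_add[OF f schwartz_cmult[OF S]] fourier_cmult
    by (subst fourier_sum) (auto intro: schwartz_partial_derivative f)
  also have "(\<Sum>i\<in>UNIV. fourier (partial_derivative i (partial_derivative i f)) \<xi>) =
      (\<Sum>i\<in>UNIV. - of_real ((\<xi> $ i)\<^sup>2) * fourier f \<xi>)"
    by (intro sum.cong refl) (simp add: fourier_partial_derivative schwartz_partial_derivative f
      power2_eq_square mult_ac)
  also have "\<dots> = - of_real ((norm \<xi>)\<^sup>2) * fourier f \<xi>"
    by (simp add: norm_vec_def L2_set_def sum_nonneg sum_distrib_right sum_negf)
  finally show ?thesis by (simp add: algebra_simps)
qed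

lemma schwartz_bessel_power: "f \<in> schwartz_functions \<Longrightarrow> (bessel ^^ m) f \<in> schwartz_functions"
  by (induction m) (auto intro: schwartz_bessel)

lemma fourier_bessel_power:
  assumes "f \<in> schwartz_functions"
  shows "fourier ((bessel ^^ m) f) \<xi> = of_real ((1 + (norm \<xi>)\<^sup>2) ^ m) * fourier f \<xi>"
  by (induction m) (simp_all add: fourier_bessel schwartz_bessel_power assms)

text \<open>The weight \<open>(1 + norm \<xi>) ^ N\<close> is dominated by the symbol of the N-th
  power of \<open>bessel\<close>, up to \<open>2 ^ N\<close>, and the transform of an integrable
  function is bounded by its L^1 norm.\<close>

lemma rapid_fourier:
  fixes f :: "real ^ 'n::finite \<Rightarrow> complex"
  assumes f: "f \<in> schwartz_functions" shows "rapid (fourier f)"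
  unfolding rapid_def
proof
  fix N
  define C where "C = (\<integral>x. cmod ((bessel ^^ N) f x) \<partial>lborel)"
  have "(1 + norm \<xi>) ^ N * cmod (fourier f \<xi>) \<le> 2 ^ N * C" for \<xi>
  proof -
    have one_plus_nonneg: "0 \<le> 1 + (norm \<xi>)\<^sup>2" by simp
    have "2 * norm \<xi> \<le> 1 + (norm \<xi>)\<^sup>2" using sum_squares_bound[of 1 "norm \<xi>"] by simp
    moreover have "2 * a \<le> 1 + b \<Longrightarrow> 0 \<le> b \<Longrightarrow> 1 + a \<le> 2 * (1 + b)" for a b :: real by simp
    ultimately have "1 + norm \<xi> \<le> 2 * (1 + (norm \<xi>)\<^sup>2)" using zero_le_power2 by metis
    then have "(1 + norm \<xi>) ^ N * cmod (fourier f \<xi>) \<le> (2 * (1 + (norm \<xi>)\<^sup>2)) ^ N * cmod (fourier f \<xi>)"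
      by (intro mult_right_mono power_mono) auto
    also have "\<dots> = 2 ^ N * cmod (fourier ((bessel ^^ N) f) \<xi>)"
      unfolding fourier_bessel_power[OF f] norm_mult norm_of_real
        abs_of_nonneg[OF zero_le_power[OF one_plus_nonneg]]
      by (simp only: power_mult_distrib mult.assoc)
    also have "\<dots> \<le> 2 ^ N * C" unfolding C_def by (intro mult_left_mono fourier_norm_le) simp
    finally show ?thesis .
  qed
  then show "\<exists>C. \<forall>\<xi>. (1 + norm \<xi>) ^ N * cmod (fourier f \<xi>) \<le> C" by blast
qed

lemma schwartz_fourier:
  assumes "f \<in> schwartz_functions" shows "fourier f \<in> schwartz_functions"
proof (rule schwartz_coinduct[where P = "\<lambda>g. g \<in> fourier ` schwartz_functions"])
  fix g i assume "g \<in> fourier ` (schwartz_functions :: (real ^ 'a \<Rightarrow> complex) set)"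
  then obtain f where f: "f \<in> schwartz_functions" "g = fourier f" by blast
  show "g differentiable_on UNIV"
    unfolding f using fourier_has_derivative[OF f(1)] by (intro differentiable_onI_has_derivative exI)
  show "rapid g" unfolding f by (rule rapid_fourier[OF f(1)])
  show "partial_derivative i g \<in> fourier ` schwartz_functions"
    unfolding f partial_derivative_fourier[OF f(1)] by (intro imageI schwartz_coord_mult f)
qed (use assms in simp)

lemma fourier_exchange:
  fixes f g :: "real ^ 'n::finite \<Rightarrow> complex"
  assumes f: "f \<in> schwartz_functions" and g: "g \<in> schwartz_functions"
  shows "(\<integral>x. fourier f x * g x \<partial>lborel) = (\<integral>x. f x * fourier g x \<partial>lborel)"
proof -
  have "(\<integral>x. (\<integral>y. exp (- \<i> * complex_of_real (x \<bullet> y)) * f x * g y \<partial>lborel) \<partial>lborel) =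
      (\<integral>y. (\<integral>x. exp (- \<i> * complex_of_real (x \<bullet> y)) * f x * g y \<partial>lborel) \<partial>lborel)"
    by (rule Fubini_bounded_kernel[where B = 1]) (auto intro: schwartz_integrable f g)
  moreover have "(\<integral>y. exp (- \<i> * complex_of_real (x \<bullet> y)) * f x * g y \<partial>lborel) = f x * fourier g x" for x
    unfolding fourier_def by (subst integral_mult_right_zero[symmetric]) (simp add: mult_ac inner_commute)
  moreover have "(\<integral>x. exp (- \<i> * complex_of_real (x \<bullet> y)) * f x * g y \<partial>lborel) = fourier f y * g y" for y
    unfolding fourier_def by (subst integral_mult_left_zero[symmetric]) simp
  ultimately show ?thesis by (simp only:)
qed

subsection \<open>Fourier inversion\<close>

definition gauss :: "real ^ 'n::finite \<Rightarrow> complex" where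
  "gauss x = of_real (exp (- (x \<bullet> x) / 2))"

lemma gauss_has_derivative: "(gauss has_derivative (\<lambda>v. - of_real (x \<bullet> v) * gauss x)) (at x)"
proof -
  have "((\<lambda>x. exp (- (x \<bullet> x) / 2)) has_derivative (\<lambda>v. - (x \<bullet> v) * exp (- (x \<bullet> x) / 2))) (at x)"
    by (rule derivative_eq_intros refl | simp add: inner_commute)+
  then show ?thesis unfolding gauss_def[abs_def]
    using has_derivative_of_real by fastforce
qed

lemma rapid_gauss: "rapid (gauss :: real ^ 'n::finite \<Rightarrow> complex)"
  unfolding rapid_def
proof
  fix N
  have "(1 + norm x) ^ N * cmod (gauss x) \<le> exp ((real N)\<^sup>2 / 2)" for x :: "real ^ 'n"
  proof -
    have "(1 + norm x) ^ N \<le> exp (norm x) ^ N" by (intro power_mono exp_ge_add_one_self) simp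
    also have "\<dots> = exp (real N * norm x)" by (simp add: exp_of_nat_mult)
    finally have "(1 + norm x) ^ N * cmod (gauss x) \<le> exp (real N * norm x) * exp (- (norm x)\<^sup>2 / 2)"
      by (simp add: gauss_def power2_norm_eq_inner)
    also have "\<dots> = exp (real N * norm x - (norm x)\<^sup>2 / 2)" by (simp add: exp_add[symmetric])
    \<comment> \<open>The square (N - |x|)^2 is nonnegative.\<close>
    also have "\<dots> \<le> exp ((real N)\<^sup>2 / 2)"
      using sum_squares_bound[of "real N" "norm x"] by simp
    finally show ?thesis .
  qed
  then show "\<exists>C. \<forall>x :: real ^ 'n. (1 + norm x) ^ N * cmod (gauss x) \<le> C" by blast
qed

text \<open>A derivative of the Gaussian is a polynomial multiple of it, so the multiples by
  \<open>slow_smooth\<close> functions form a class closed under differentiation.\<close>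

lemma schwartz_gauss: "(gauss :: real ^ 'n::finite \<Rightarrow> complex) \<in> schwartz_functions"
proof (rule schwartz_coinduct[where P = "\<lambda>g. g \<in> (\<lambda>p x. p x * gauss x) ` slow_smooth"])
  show "(gauss :: real ^ 'n::finite \<Rightarrow> complex) \<in> (\<lambda>p x. p x * gauss x) ` slow_smooth"
    by (rule image_eqI[of _ _ "\<lambda>x. 1"]) (auto intro: slow_smooth.const)
  fix g :: "real ^ 'n \<Rightarrow> complex" and i
  assume "g \<in> (\<lambda>p x. p x * gauss x) ` slow_smooth"
  then obtain p where p: "p \<in> slow_smooth" "g = (\<lambda>x. p x * gauss x)" by (elim imageE)
  have d: "(g has_derivative (\<lambda>v. p x * (- of_real (x \<bullet> v) * gauss x) + frechet_derivative p (at x) v *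
      gauss x)) (at x)" for x
    unfolding p(2) by (intro has_derivative_mult gauss_has_derivative differentiable_on_UNIV_has_derivative
      smooth_imp_differentiable_on slow_smooth_smooth p)
  then show "g differentiable_on UNIV" by (intro differentiable_onI_has_derivative exI)
  show "rapid g" unfolding p(2) using p(1) by (intro rapid_slow_mult rapid_gauss) (simp add: slow_smooth_step)
  have "partial_derivative i g = (\<lambda>x. (partial_derivative i p x + p x * ((-1) * of_real (x $ i))) * gauss x)"
    by (intro ext, subst partial_derivative_eqI[OF d])
      (simp add: partial_derivative_def inner_axis algebra_simps)
  moreover have "(\<lambda>x. partial_derivative i p x + p x * ((-1) * of_real (x $ i))) \<in> slow_smooth"
    by (intro slow_smooth.add slow_smooth.mult slow_smooth.const slow_smooth.coord p(1)
      slow_smooth_step[OF p(1), THEN conjunct2, THEN conjunct2, rule_format])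
  ultimately show "partial_derivative i g \<in> (\<lambda>p x. p x * gauss x) ` slow_smooth" by (rule image_eqI)
qed

lemma integral_gauss: "(\<integral>x. (gauss :: real ^ 'n::finite \<Rightarrow> complex) x \<partial>lborel) =
  of_real (sqrt (2 * pi) ^ CARD('n))"
proof -
  have 1: "(\<integral>\<^sup>+x. ennreal (exp (- x\<^sup>2 / 2)) \<partial>lborel) = ennreal (sqrt (2 * pi))"
  proof -
    have eq: "exp (- x\<^sup>2 / 2) = sqrt (2 * pi) * normal_density 0 1 x" for x :: real
      by (simp add: normal_density_def)
    have "(\<integral>\<^sup>+x. ennreal (exp (- x\<^sup>2 / 2)) \<partial>lborel) =
        ennreal (\<integral>x. sqrt (2 * pi) * normal_density 0 1 x \<partial>lborel)"
      unfolding eq by (rule nn_integral_eq_integral) (auto simp: normal_density_nonneg)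
    then show ?thesis by simp
  qed
  have "(\<integral>\<^sup>+x. ennreal (exp (- (x \<bullet> x) / 2)) \<partial>(lborel :: (real ^ 'n) measure)) =
      (\<integral>\<^sup>+x. ennreal (\<Prod>i\<in>UNIV. exp (- (x $ i)\<^sup>2 / 2)) \<partial>(lborel :: (real ^ 'n) measure))"
    by (intro nn_integral_cong) (simp add: exp_sum[symmetric] inner_vec_def power2_eq_square sum_negf
      sum_divide_distrib)
  also have "\<dots> = (\<Prod>i\<in>(UNIV :: 'n set). (\<integral>\<^sup>+x. ennreal (exp (- x\<^sup>2 / 2)) \<partial>lborel))"
    by (rule nn_integral_vec_prod) auto
  also have "\<dots> = ennreal (sqrt (2 * pi) ^ CARD('n))" unfolding 1 by (simp add: ennreal_power)
  finally have "has_bochner_integral lborel (\<lambda>x :: real ^ 'n. exp (- (x \<bullet> x) / 2)) (sqrt (2 * pi) ^ CARD('n))"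
    by (intro has_bochner_integral_nn_integral) auto
  then show ?thesis
    unfolding gauss_def[abs_def] by (simp add: has_bochner_integral_iff)
qed

text \<open>The Gaussian satisfies a first-order differential equation that the transform turns into
  itself. Hence the transform times exp(|\<xi>|^2 / 2) has derivative zero, and the constant is its
  value at the origin, the Gaussian integral.\<close>

lemma fourier_gauss:
  "fourier (gauss :: real ^ 'n::finite \<Rightarrow> complex) \<xi> = of_real (sqrt (2 * pi) ^ CARD('n)) * gauss \<xi>"
proof -
  let ?g = "gauss :: real ^ 'n \<Rightarrow> complex"
  have pg: "partial_derivative i ?g = (\<lambda>x. (- of_real (x $ i)) * ?g x)" for i
    by (intro ext, subst partial_derivative_eqI[OF gauss_has_derivative]) (simp add: inner_axis)
  have G: "fourier (\<lambda>x. (- \<i> * of_real (x $ i)) * ?g x) \<xi> = - of_real (\<xi> $ i) * fourier ?g \<xi>" for i \<xi>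
  proof -
    have "(\<lambda>x. (- \<i> * of_real (x $ i)) * ?g x) = (\<lambda>x. \<i> * partial_derivative i ?g x)"
      by (simp add: pg mult_ac)
    then show ?thesis by (simp add: fourier_cmult fourier_partial_derivative schwartz_gauss mult_ac)
  qed
  have d: "(fourier ?g has_derivative (\<lambda>h. - of_real (\<xi> \<bullet> h) * fourier ?g \<xi>)) (at \<xi>)" for \<xi>
  proof -
    have "(\<Sum>i\<in>UNIV. of_real (h $ i) * fourier (\<lambda>x. (- \<i> * of_real (x $ i)) * ?g x) \<xi>) =
        - of_real (\<xi> \<bullet> h) * fourier ?g \<xi>" for h
      unfolding G by (simp add: inner_vec_def sum_distrib_left sum_distrib_right sum_negf mult_ac)
    then show ?thesis using fourier_has_derivative[OF schwartz_gauss, of \<xi>] by (simp only:)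
  qed
  have "((\<lambda>\<xi>. fourier ?g \<xi> * of_real (exp (\<xi> \<bullet> \<xi> / 2))) has_derivative (\<lambda>h. 0)) (at \<xi>)" for \<xi>
  proof -
    have "((\<lambda>x::real^'n. exp (x \<bullet> x / 2)) has_derivative (\<lambda>v. (\<xi> \<bullet> v) * exp (\<xi> \<bullet> \<xi> / 2))) (at \<xi>)"
      by (rule derivative_eq_intros refl | simp add: inner_commute)+
    from has_derivative_mult[OF d has_derivative_of_real[OF this]]
    show ?thesis by (simp add: mult_ac)
  qed
  then obtain c where c: "\<And>\<xi>. fourier ?g \<xi> * of_real (exp (\<xi> \<bullet> \<xi> / 2)) = c"
    using has_derivative_zero_constant[of UNIV "\<lambda>\<xi>. fourier ?g \<xi> * of_real (exp (\<xi> \<bullet> \<xi> / 2))"] by auto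
  have "c = of_real (sqrt (2 * pi) ^ CARD('n))"
    using c[of 0] integral_gauss[where 'n = 'n] by (simp add: fourier_def)
  moreover have "fourier ?g \<xi> = c * gauss \<xi>"
    using c[of \<xi>] by (auto simp: gauss_def exp_minus field_simps simp flip: of_real_mult exp_add)
  ultimately show ?thesis by simp
qed

lemma fourier_translate:
  assumes f: "f \<in> schwartz_functions"
  shows "fourier (translate y f) \<xi> = exp (- \<i> * of_real (y \<bullet> \<xi>)) * fourier f \<xi>"
proof -
  have [measurable]: "f \<in> borel_measurable borel" by (rule schwartz_measurable[OF f])
  have "fourier (translate y f) \<xi> = (\<integral>x. exp (- \<i> * of_real ((y + x) \<bullet> \<xi>)) * translate y f (y + x) \<partial>lborel)"
    unfolding fourier_def by (rule integral_translate[symmetric]) (simp add: translate_def)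
  also have "\<dots> = (\<integral>x. exp (- \<i> * of_real (y \<bullet> \<xi>)) * (exp (- \<i> * of_real (x \<bullet> \<xi>)) * f x) \<partial>lborel)"
    by (simp only: translate_def inner_add_left char_add mult.assoc add_diff_cancel_left')
  finally show ?thesis unfolding fourier_def by simp
qed

lemma fourier_modulate:
  "fourier (\<lambda>x. exp (\<i> * of_real (x \<bullet> y)) * f x) \<xi> = fourier f (\<xi> - y)"
  unfolding fourier_def inner_diff_right char_diff mult.assoc ..

lemma fourier_scale:
  fixes f :: "real ^ 'n::finite \<Rightarrow> complex"
  assumes f: "f \<in> schwartz_functions" and c: "c > 0"
  shows "fourier (\<lambda>x. f (c *\<^sub>R x)) \<xi> = fourier f (\<xi> /\<^sub>R c) / of_real (c ^ CARD('n))"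
proof -
  have [measurable]: "f \<in> borel_measurable borel" by (rule schwartz_measurable[OF f])
  have 2: "(c *\<^sub>R x) \<bullet> (\<xi> /\<^sub>R c) = x \<bullet> \<xi>" for x using c by simp
  have 1: "(\<integral>x. exp (- \<i> * of_real ((c *\<^sub>R x) \<bullet> (\<xi> /\<^sub>R c))) * f (c *\<^sub>R x) \<partial>lborel) =
      fourier f (\<xi> /\<^sub>R c) / of_real (c ^ CARD('n))"
    unfolding fourier_def using c
    by (subst integral_scale[where f = "\<lambda>x. exp (- \<i> * of_real (x \<bullet> (\<xi> /\<^sub>R c))) * f x"]) auto
  show ?thesis using 1 unfolding 2 by (simp only: fourier_def)
qed

text \<open>Testing \<open>\<integral> F(f\<^sub>\<epsilon>) G = \<integral> f\<^sub>\<epsilon> F(G)\<close> with a Gaussian \<open>G\<close> and the dilations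
  \<open>f\<^sub>\<epsilon>(x) = f(\<epsilon> x)\<close>, as \<open>\<epsilon>\<close> tends to zero.\<close>

lemma integral_fourier:
  fixes f :: "real ^ 'n::finite \<Rightarrow> complex"
  assumes f: "f \<in> schwartz_functions"
  shows "(\<integral>\<xi>. fourier f \<xi> \<partial>lborel) = of_real ((2 * pi) ^ CARD('n)) * f 0"
proof -
  let ?g = "gauss :: real ^ 'n \<Rightarrow> complex"
  define a where "a = complex_of_real (sqrt (2 * pi) ^ CARD('n))"
  have aa: "a * a = of_real ((2 * pi) ^ CARD('n))"
    unfolding a_def of_real_mult[symmetric] power_mult_distrib[symmetric] by simp
  define h where "h k = inverse (real (Suc k))" for k
  have h: "h k > 0" for k unfolding h_def by simp
  have h0: "h \<longlonglongrightarrow> 0" unfolding h_def[abs_def] by (rule LIMSEQ_inverse_real_of_nat)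
  have [measurable]: "f \<in> borel_measurable borel" "fourier f \<in> borel_measurable borel" "?g \<in>
      borel_measurable borel"
    by (intro schwartz_measurable schwartz_fourier schwartz_gauss f)+
  obtain B where B: "\<And>x. cmod (f x) \<le> B" using rapid_imp_bounded[OF schwartz_rapid[OF f]] by metis
  have g1: "cmod (?g x) \<le> 1" for x by (simp add: gauss_def)
  have eq: "(\<integral>\<xi>. fourier f \<xi> * ?g (h k *\<^sub>R \<xi>) \<partial>lborel) = a * (\<integral>x. f (h k *\<^sub>R x) * ?g x \<partial>lborel)" for k
  proof -
    let ?f = "\<lambda>x. f (h k *\<^sub>R x)"
    have smooth_f: "?f \<in> schwartz_functions"
    proof -
      have "rapid (\<lambda>x. F (h k *\<^sub>R x))" if F: "rapid F" for F :: "real ^ 'n \<Rightarrow> complex"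
        unfolding rapid_def
      proof
        fix N
        obtain C where C: "\<And>x. (1 + norm x) ^ N * cmod (F x) \<le> C" using F unfolding rapid_def by metis
        \<comment> \<open>With this \<open>c\<close> the quantity \<open>1 + norm x\<close> is at
          most \<open>c\<close> times its value at the dilated point.\<close>
        define c where "c = 1 + 1 / h k"
        have "(1 + norm x) ^ N * cmod (F (h k *\<^sub>R x)) \<le> c ^ N * C" for x
        proof -
          have "1 + norm x \<le> c * (1 + norm (h k *\<^sub>R x))"
            using h[of k] by (simp add: c_def field_simps)
          then have "(1 + norm x) ^ N \<le> (c * (1 + norm (h k *\<^sub>R x))) ^ N" by (intro power_mono) auto
          then have "(1 + norm x) ^ N * cmod (F (h k *\<^sub>R x)) \<le> c ^ N *
              ((1 + norm (h k *\<^sub>R x)) ^ N * cmod (F (h k *\<^sub>R x)))"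
            by (metis mult.assoc mult_right_mono norm_ge_zero power_mult_distrib)
          also have "\<dots> \<le> c ^ N * C" using h[of k] by (intro mult_left_mono C) (simp add: c_def)
          finally show ?thesis .
        qed
        then show "\<exists>C. \<forall>x. (1 + norm x) ^ N * cmod (F (h k *\<^sub>R x)) \<le> C" by blast
      qed
      note rapid_scale = this
      show ?thesis
      proof (rule schwartz_coinduct[where P = "\<lambda>g. g \<in> (\<lambda>f x. f (h k *\<^sub>R x)) ` schwartz_functions"])
        fix g :: "real ^ 'n \<Rightarrow> complex" and i assume "g \<in> (\<lambda>f x. f (h k *\<^sub>R x)) ` schwartz_functions"
        then obtain F where F: "F \<in> schwartz_functions" "g = (\<lambda>x. F (h k *\<^sub>R x))" by (elim imageE)
        show "g differentiable_on UNIV"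
          unfolding F by (intro smooth_imp_differentiable_on smooth_scale schwartz_smooth F)
        show "rapid g" unfolding F by (intro rapid_scale schwartz_rapid F)
        show "partial_derivative i g \<in> (\<lambda>f x. f (h k *\<^sub>R x)) ` schwartz_functions"
          unfolding F partial_derivative_scale[OF schwartz_smooth[OF F(1)]]
          by (rule image_eqI[of _ _ "\<lambda>x. of_real (h k) * partial_derivative i F x"])
            (auto intro: schwartz_cmult schwartz_partial_derivative F)
      qed (use f in simp)
    qed
    \<comment> \<open>A change of variables moves the dilation from the transform of
      \<open>f\<close> to the Gaussian; the two powers of \<open>h k\<close> cancel.\<close>
    have "(\<integral>\<xi>. fourier ?f \<xi> * ?g \<xi> \<partial>lborel) = (\<integral>\<xi>.
        (fourier f (inverse (h k) *\<^sub>R \<xi>) * ?g (h k *\<^sub>R inverse (h k) *\<^sub>R \<xi>)) / of_real (h k ^ CARD('n))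
          \<partial>lborel)"
      using h[of k] by (simp add: fourier_scale[OF f h])
    also have "\<dots> = (\<integral>\<xi>. fourier f (inverse (h k) *\<^sub>R \<xi>) * ?g (h k *\<^sub>R inverse (h k) *\<^sub>R \<xi>) \<partial>lborel) /
        of_real (h k ^ CARD('n))"
      by (rule integral_divide_zero)
    also have "(\<integral>\<xi>. fourier f (inverse (h k) *\<^sub>R \<xi>) * ?g (h k *\<^sub>R inverse (h k) *\<^sub>R \<xi>) \<partial>lborel)
        = (\<integral>\<xi>. fourier f \<xi> * ?g (h k *\<^sub>R \<xi>) \<partial>lborel) / of_real (inverse (h k) ^ CARD('n))"
      using h[of k] by (subst integral_scale[where f = "\<lambda>\<xi>. fourier f \<xi> * ?g (h k *\<^sub>R \<xi>)"]) simp_all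
    finally have "(\<integral>\<xi>. fourier ?f \<xi> * ?g \<xi> \<partial>lborel) = (\<integral>\<xi>. fourier f \<xi> * ?g (h k *\<^sub>R \<xi>) \<partial>lborel)"
      using h[of k] by (simp add: power_inverse)
    moreover have "(\<integral>\<xi>. fourier ?f \<xi> * ?g \<xi> \<partial>lborel) = (\<integral>x. ?f x * (a * ?g x) \<partial>lborel)"
      unfolding fourier_exchange[OF smooth_f schwartz_gauss] by (simp only: fourier_gauss a_def)
    moreover have "(\<integral>x. ?f x * (a * ?g x) \<partial>lborel) = a * (\<integral>x. ?f x * ?g x \<partial>lborel)"
      by (subst integral_mult_right_zero[symmetric]) (simp add: mult_ac)
    ultimately show ?thesis by simp
  qed
  have gl: "(\<lambda>k. F (h k *\<^sub>R x)) \<longlonglongrightarrow> F 0" if "F \<in> schwartz_functions" for F :: "real ^ 'n \<Rightarrow> complex" and x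
  proof -
    have "isCont F 0"
      using smooth_imp_continuous_on[OF schwartz_smooth[OF that], of UNIV]
        by (simp add: continuous_on_eq_continuous_at)
    moreover have "(\<lambda>k. h k *\<^sub>R x) \<longlonglongrightarrow> 0 *\<^sub>R x" by (intro tendsto_intros h0)
    ultimately show ?thesis using isCont_tendsto_compose by fastforce
  qed
  have "(\<lambda>k. \<integral>\<xi>. fourier f \<xi> * ?g (h k *\<^sub>R \<xi>) \<partial>lborel) \<longlonglongrightarrow> (\<integral>\<xi>. fourier f \<xi> * ?g 0 \<partial>lborel)"
  proof (rule integral_dominated_convergence[where w = "\<lambda>\<xi>. norm (fourier f \<xi>)"])
    show "integrable lborel (\<lambda>\<xi>. norm (fourier f \<xi>))"
      by (intro integrable_norm schwartz_integrable schwartz_fourier f)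
    show "AE x in lborel. (\<lambda>k. fourier f x * ?g (h k *\<^sub>R x)) \<longlonglongrightarrow> fourier f x * ?g 0"
      by (intro AE_I2 tendsto_intros gl schwartz_gauss)
    show "AE x in lborel. norm (fourier f x * ?g (h k *\<^sub>R x)) \<le> norm (fourier f x)" for k
      using g1 by (intro AE_I2) (simp add: norm_mult mult_left_le)
  qed measurable
  moreover have "(\<lambda>k. \<integral>x. f (h k *\<^sub>R x) * ?g x \<partial>lborel) \<longlonglongrightarrow> (\<integral>x. f 0 * ?g x \<partial>lborel)"
  proof (rule integral_dominated_convergence[where w = "\<lambda>x. B * norm (?g x)"])
    show "integrable lborel (\<lambda>x. B * norm (?g x))"
      by (intro integrable_mult_right integrable_norm schwartz_integrable schwartz_gauss)
    show "AE x in lborel. (\<lambda>k. f (h k *\<^sub>R x) * ?g x) \<longlonglongrightarrow> f 0 * ?g x"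
      by (intro AE_I2 tendsto_intros gl f)
    show "AE x in lborel. norm (f (h k *\<^sub>R x) * ?g x) \<le> B * norm (?g x)" for k
      using B by (intro AE_I2) (simp add: norm_mult mult_right_mono)
  qed measurable
  then have "(\<lambda>k. a * (\<integral>x. f (h k *\<^sub>R x) * ?g x \<partial>lborel)) \<longlonglongrightarrow> a * (\<integral>x. f 0 * ?g x \<partial>lborel)"
    by (intro tendsto_intros)
  ultimately have "(\<integral>\<xi>. fourier f \<xi> * ?g 0 \<partial>lborel) = a * (\<integral>x. f 0 * ?g x \<partial>lborel)"
    unfolding eq by (rule LIMSEQ_unique)
  also have "(\<integral>x. f 0 * ?g x \<partial>lborel) = f 0 * a" by (simp add: integral_gauss a_def)
  finally show ?thesis using aa by (simp add: gauss_def mult_ac)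
qed

text \<open>Translating \<open>f\<close> by \<open>- x\<close> reduces the value at \<open>x\<close>
  to the one at the origin, and multiplies the transform by exactly the character of the inverse
  transform.\<close>

lemma inverse_fourier_fourier:
  fixes f :: "real ^ 'n::finite \<Rightarrow> complex"
  assumes f: "f \<in> schwartz_functions"
  shows "inverse_fourier (fourier f) = f"
proof
  fix x
  have "f x = translate (- x) f 0" by (simp add: translate_def)
  also have "\<dots> = (\<integral>\<xi>. fourier (translate (- x) f) \<xi> \<partial>lborel) / of_real ((2 * pi) ^ CARD('n))"
    using integral_fourier[OF schwartz_translate[OF f, of "- x"]] by simp
  finally show "inverse_fourier (fourier f) x = f x"
    unfolding inverse_fourier_def fourier_translate[OF f] by simp
qed

lemma fourier_reflect:
  assumes f: "f \<in> schwartz_functions"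
  shows "fourier (\<lambda>x. f (- x)) \<xi> = fourier f (- \<xi>)"
proof -
  have [measurable]: "f \<in> borel_measurable borel" by (rule schwartz_measurable[OF f])
  show ?thesis unfolding fourier_def
    using integral_reflect_lborel[of "\<lambda>x. exp (- \<i> * of_real (x \<bullet> - \<xi>)) * f x"] by simp
qed

lemma schwartz_inverse_fourier:
  fixes f :: "real ^ 'n::finite \<Rightarrow> complex"
  assumes "f \<in> schwartz_functions"
  shows "inverse_fourier f \<in> schwartz_functions"
proof -
  have "inverse_fourier f = (\<lambda>x. inverse (of_real ((2 * pi) ^ CARD('n))) * fourier f (- x))"
    by (auto simp: inverse_fourier_eq divide_inverse mult.commute)
  then show ?thesis using schwartz_cmult[OF schwartz_reflect[OF schwartz_fourier[OF assms]]] by simp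
qed

lemma fourier_inverse_fourier:
  fixes f :: "real ^ 'n::finite \<Rightarrow> complex"
  assumes f: "f \<in> schwartz_functions"
  shows "fourier (inverse_fourier f) = f"
proof
  fix x
  have 1: "inverse_fourier f = (\<lambda>x. inverse (of_real ((2 * pi) ^ CARD('n))) * fourier f (- x))"
    by (auto simp: inverse_fourier_eq divide_inverse mult.commute)
  have "fourier (inverse_fourier f) x = inverse (of_real ((2 * pi) ^ CARD('n))) * fourier (fourier f) (- x)"
    by (simp only: 1 fourier_cmult fourier_reflect[OF schwartz_fourier[OF f]])
  also have "\<dots> = inverse_fourier (fourier f) x"
    by (simp only: inverse_fourier_eq[of "fourier f"] divide_inverse mult.commute)
  finally have "fourier (inverse_fourier f) x = inverse_fourier (fourier f) x" .
  then show "fourier (inverse_fourier f) x = f x" by (simp add: inverse_fourier_fourier[OF f])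
qed

section \<open>Plancherel's identity and transforms of products\<close>

lemma fourier_cnj: "fourier (\<lambda>x. cnj (f x)) \<xi> = cnj (fourier f (- \<xi>))"
proof -
  have "fourier (\<lambda>x. cnj (f x)) \<xi> = (\<integral>x. cnj (exp (- \<i> * of_real (x \<bullet> - \<xi>)) * f x) \<partial>lborel)"
    unfolding fourier_def by (simp add: exp_cnj del: Bochner_Integration.integral_cnj)
  also have "\<dots> = cnj (fourier f (- \<xi>))" unfolding fourier_def by (rule Bochner_Integration.integral_cnj)
  finally show ?thesis .
qed

text \<open>By inversion the conjugate of \<open>fourier f\<close> has transform (2 pi)^n times the
  conjugate of \<open>f\<close>, so moving one transform across the integral suffices. The factor
  remains because the transform is not normalized.\<close>

lemma Plancherel:
  fixes f :: "real ^ 'n::finite \<Rightarrow> complex"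
  assumes f: "f \<in> schwartz_functions"
  shows "(L2_function_norm (fourier f))\<^sup>2 = (2 * pi) ^ CARD('n) * (L2_function_norm f)\<^sup>2"
proof -
  have sq: "of_real ((L2_function_norm h)\<^sup>2) = (\<integral>x. h x * cnj (h x) \<partial>lborel)" for h :: "real ^ 'n \<Rightarrow> complex"
    unfolding L2_norm_power2 complex_norm_square[symmetric] by (simp only: integral_complex_of_real)
  have "fourier (\<lambda>x. cnj (fourier f x)) \<xi> = of_real ((2 * pi) ^ CARD('n)) * cnj (f \<xi>)" for \<xi>
  proof -
    have "f \<xi> = fourier (fourier f) (- \<xi>) / of_real ((2 * pi) ^ CARD('n))"
      using inverse_fourier_fourier[OF f] by (metis inverse_fourier_eq)
    then show ?thesis by (simp add: fourier_cnj)
  qed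
  then have "(\<integral>x. fourier f x * cnj (fourier f x) \<partial>lborel) =
      (\<integral>x. f x * (of_real ((2 * pi) ^ CARD('n)) * cnj (f x)) \<partial>lborel)"
    by (subst fourier_exchange[OF f schwartz_cnj[OF schwartz_fourier[OF f]]]) simp
  also have "\<dots> = of_real ((2 * pi) ^ CARD('n)) * (\<integral>x. f x * cnj (f x) \<partial>lborel)"
    by (subst integral_mult_right_zero[symmetric]) (simp add: mult_ac)
  finally have "complex_of_real ((L2_function_norm (fourier f))\<^sup>2) =
      of_real ((2 * pi) ^ CARD('n) * (L2_function_norm f)\<^sup>2)"
    unfolding sq of_real_mult .
  then show ?thesis by (simp only: of_real_eq_iff)
qed

text \<open>The inverse transform contains the factor (2 pi)^-n, so it turns products into
  convolutions with constant 1. For this reason the frequency side of the estimates below is written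
  with the inverse transform.\<close>

lemma inverse_fourier_mult:
  fixes f g :: "real ^ 'n::finite \<Rightarrow> complex"
  assumes f: "f \<in> schwartz_functions" and g: "g \<in> schwartz_functions"
  shows "inverse_fourier (\<lambda>x. f x * g x) \<xi> = (\<integral>\<eta>. inverse_fourier f (\<xi> - \<eta>) * inverse_fourier g \<eta> \<partial>lborel)"
proof -
  let ?c = "of_real ((2 * pi) ^ CARD('n)) :: complex"
  have ef: "(\<lambda>x. exp (\<i> * of_real (x \<bullet> \<xi>)) * f x) \<in> schwartz_functions"
    by (intro schwartz_slow_mult slow_smooth.char f)
  have "(\<integral>\<eta>. inverse_fourier f (\<xi> - \<eta>) * inverse_fourier g \<eta> \<partial>lborel) =
      (\<integral>\<eta>. (fourier (\<lambda>x. exp (\<i> * of_real (x \<bullet> \<xi>)) * f x) \<eta> * inverse_fourier g \<eta>) / ?c \<partial>lborel)"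
    by (simp only: inverse_fourier_eq[of f] fourier_modulate minus_diff_eq times_divide_eq_left)
  also have "\<dots> = (\<integral>\<eta>. fourier (\<lambda>x. exp (\<i> * of_real (x \<bullet> \<xi>)) * f x) \<eta> * inverse_fourier g \<eta> \<partial>lborel) / ?c"
    by (rule integral_divide_zero)
  also have "\<dots> = (\<integral>x. (exp (\<i> * of_real (x \<bullet> \<xi>)) * f x) * g x \<partial>lborel) / ?c"
    by (simp only: fourier_exchange[OF ef schwartz_inverse_fourier[OF g]] fourier_inverse_fourier[OF g])
  finally show ?thesis unfolding inverse_fourier_def by (simp add: mult.assoc inner_commute)
qed

subsection \<open>Anisotropic weights\<close>

lemma bracket_eq: "bracket b s \<xi> = (\<Prod>l\<in>UNIV. block (b -` {l}) \<xi> powr (s $ l / 2))"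
  by (simp add: bracket_def block_def)

lemma bracket_pos: "bracket b s \<xi> > 0"
  unfolding bracket_eq by (intro prod_pos) (auto simp: block_pos less_imp_neq[OF block_pos, symmetric])

lemma bracket_nonneg [simp]: "bracket b s \<xi> \<ge> 0"
  by (rule less_imp_le[OF bracket_pos])

lemma bracket_uminus [simp]: "bracket b s (- \<xi>) = bracket b s \<xi>"
  by (simp add: bracket_def)

lemma bracket_minus_mult: "bracket b (- s) \<xi> * bracket b s \<xi> = 1"
  unfolding bracket_eq prod.distrib[symmetric]
  by (intro prod.neutral ballI) (simp add: powr_add[symmetric] less_imp_neq[OF block_pos, symmetric])

lemma bracket_slow_smooth: "(\<lambda>\<xi>. complex_of_real (bracket b s \<xi>)) \<in> slow_smooth"
  unfolding bracket_eq of_real_prod by (intro slow_smooth_prod slow_smooth.block)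

lemma block_measurable [measurable]: "block I \<in> borel_measurable borel"
  unfolding block_def[abs_def] by measurable

lemma bracket_measurable [measurable]: "bracket b s \<in> borel_measurable borel"
  unfolding bracket_eq[abs_def] by measurable

lemma bracket_power2: "(bracket b s \<xi>)\<^sup>2 = (\<Prod>l\<in>UNIV. block (b -` {l}) \<xi> powr (s $ l))"
  unfolding bracket_eq prod_power_distrib
  by (intro prod.cong refl) (simp add: power2_eq_square powr_add[symmetric])

lemma block_add_le: "block I (x + y) \<le> 2 * (block I x + block I y)"
proof -
  have "(\<Sum>i\<in>I. ((x + y) $ i)\<^sup>2) \<le> (\<Sum>i\<in>I. 2 * (x $ i)\<^sup>2 + 2 * (y $ i)\<^sup>2)"
  proof (rule sum_mono)
    fix i
    have "0 \<le> (x $ i - y $ i)\<^sup>2" by simp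
    then show "((x + y) $ i)\<^sup>2 \<le> 2 * (x $ i)\<^sup>2 + 2 * (y $ i)\<^sup>2"
      by (simp add: power2_sum power2_diff)
  qed
  then show ?thesis by (simp add: block_def sum.distrib sum_distrib_left)
qed

lemma block_uminus [simp]: "block I (- x) = block I x"
  by (simp add: block_def)

lemma block_add_le_mult: "block I (x + y) \<le> 4 * block I x * block I y"
proof -
  have "2 * (block I x + block I y) \<le> 2 * (block I x * block I y + block I x * block I y)"
    using mult_left_mono[OF block_ge_1[of I y], of "block I x"]
      mult_right_mono[OF block_ge_1[of I x], of "block I y"]
      block_ge_1[of I x] block_ge_1[of I y] by (intro mult_left_mono add_mono) auto
  then show ?thesis using block_add_le[of I x y] by simp
qed

text \<open>For \<open>r\<close> nonnegative this is submultiplicativity of the block raised to a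
  power. For negative \<open>r\<close> the roles of \<xi> and \<eta> are exchanged and the
  inequality is inverted.\<close>

lemma Peetre_block:
  "block I \<xi> powr r \<le> 4 powr \<bar>r\<bar> * block I (\<xi> - \<eta>) powr \<bar>r\<bar> * block I \<eta> powr r"
proof (cases "r \<ge> 0")
  case True
  have "block I \<xi> powr r \<le> (4 * block I (\<xi> - \<eta>) * block I \<eta>) powr r"
    using block_add_le_mult[of I "\<xi> - \<eta>" \<eta>] True block_pos[of I \<xi>] by (intro powr_mono2) auto
  then show ?thesis using True by (simp add: powr_mult)
next
  case False
  have "block I \<eta> \<le> 4 * block I (\<eta> - \<xi>) * block I \<xi>"
    using block_add_le_mult[of I "\<eta> - \<xi>" \<xi>] by simp
  also have "block I (\<eta> - \<xi>) = block I (\<xi> - \<eta>)" using block_uminus[of I "\<xi> - \<eta>"] by simp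
  finally have "(4 * block I (\<xi> - \<eta>) * block I \<xi>) powr r \<le> block I \<eta> powr r"
    using False block_pos[of I \<eta>] by (intro powr_mono2') auto
  then have *: "4 powr r * block I (\<xi> - \<eta>) powr r * block I \<xi> powr r \<le> block I \<eta> powr r"
    by (simp add: powr_mult)
  have k: "4 powr (- r) * 4 powr r = (1::real)" "block I (\<xi> - \<eta>) powr (- r) * block I (\<xi> - \<eta>) powr r = 1"
    using block_pos[of I "\<xi> - \<eta>"] by (simp_all add: powr_add[symmetric])
  have "(u * p) * (v * q * x) = (u * v) * (p * q) * x" for u v p q x :: real by (simp only: mult_ac)
  then have "block I \<xi> powr r = (4 powr (-r) * block I (\<xi> - \<eta>) powr (-r)) *
      (4 powr r * block I (\<xi> - \<eta>) powr r * block I \<xi> powr r)"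
    by (simp only: k mult_1)
  also have "\<dots> \<le> (4 powr (-r) * block I (\<xi> - \<eta>) powr (-r)) * block I \<eta> powr r"
    by (intro mult_left_mono *) auto
  finally show ?thesis using False by simp
qed

definition vabs :: "real ^ 'j::finite \<Rightarrow> real ^ 'j" where
  "vabs s = vec_lambda (\<lambda>l. \<bar>s $ l\<bar>)"

text \<open>Peetre's inequality, factor by factor: a change of frequency costs a weight in the
  difference alone. For convolution with the transform of a Schwartz function that weight is
  absorbed by rapid decay.\<close>

lemma Peetre_bracket:
  obtains C where "C > 0" "\<And>\<xi> \<eta>. bracket b s \<xi> \<le> C * bracket b (vabs s) (\<xi> - \<eta>) * bracket b s \<eta>"
proof -
  define C where "C = (\<Prod>l\<in>UNIV. 4 powr (\<bar>s $ l\<bar> / 2))"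
  have "bracket b s \<xi> \<le> C * bracket b (vabs s) (\<xi> - \<eta>) * bracket b s \<eta>" for \<xi> \<eta>
    unfolding bracket_eq C_def prod.distrib[symmetric]
  proof (rule prod_mono, intro conjI)
    fix l
    show "block (b -` {l}) \<xi> powr (s $ l / 2) \<le>
        4 powr (\<bar>s $ l\<bar> / 2) * block (b -` {l}) (\<xi> - \<eta>) powr (vabs s $ l / 2) * block (b -` {l}) \<eta> powr
          (s $ l / 2)"
      using Peetre_block[of "b -` {l}" \<xi> "s $ l / 2" \<eta>] by (simp add: vabs_def)
  qed simp
  moreover have "C > 0" unfolding C_def by (intro prod_pos) auto
  ultimately show thesis using that by blast
qed

text \<open>The comparison with symbols of powers of \<open>bessel\<close>, which brings Sobolev
  norms of every order down to L^2 norms of derivatives.\<close>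

lemma bracket_le_power:
  fixes b :: "'n::finite \<Rightarrow> 'j::finite"
  obtains m where "\<And>\<xi>. bracket b s \<xi> \<le> (1 + (norm \<xi>)\<^sup>2) ^ m"
proof -
  obtain M :: nat where M: "\<And>l. \<bar>s $ l\<bar> / 2 \<le> real M"
  proof -
    have "\<bar>s $ l\<bar> / 2 \<le> (\<Sum>l\<in>UNIV. \<bar>s $ l\<bar> / 2)" for l by (rule member_le_sum) auto
    then show ?thesis using that real_arch_simple[of "\<Sum>l\<in>UNIV. \<bar>s $ l\<bar> / 2"] order_trans by blast
  qed
  have "bracket b s \<xi> \<le> (1 + (norm \<xi>)\<^sup>2) ^ (M * CARD('j))" for \<xi>
  proof -
    have "bracket b s \<xi> \<le> (\<Prod>l\<in>(UNIV :: 'j set). (1 + (norm \<xi>)\<^sup>2) ^ M)"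
      unfolding bracket_eq
    proof (rule prod_mono, intro conjI)
      fix l
      have "block (b -` {l}) \<xi> powr (s $ l / 2) \<le> block (b -` {l}) \<xi> powr (real M)"
        using M[of l] by (intro powr_mono block_ge_1) auto
      also have "\<dots> = block (b -` {l}) \<xi> ^ M" by (simp add: powr_realpow block_pos)
      also have "\<dots> \<le> (1 + (norm \<xi>)\<^sup>2) ^ M"
        using sum_squares_le_norm[of \<xi> "b -` {l}"] block_pos[of "b -` {l}" \<xi>]
          by (intro power_mono) (auto simp: block_def)
      finally show "block (b -` {l}) \<xi> powr (s $ l / 2) \<le> (1 + (norm \<xi>)\<^sup>2) ^ M" .
    qed simp
    then show ?thesis by (simp add: power_mult)
  qed
  with that show thesis by blast
qed

subsection \<open>Sobolev norms of Schwartz functions\<close>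

text \<open>The transpose of \<open>bracket_D b s\<close>, which is why the inverse transform comes
  first: applying the multiplier to a functional means evaluating the functional at
  \<open>bpot b s \<phi>\<close>. Since the bracket is even, it is the same operator on Schwartz
  functions.\<close>

definition bpot :: "('n::finite \<Rightarrow> 'j::finite) \<Rightarrow> real ^ 'j \<Rightarrow> (real ^ 'n \<Rightarrow> complex) \<Rightarrow> real ^ 'n \<Rightarrow> complex" where
  "bpot b s \<phi> = fourier (\<lambda>\<xi>. of_real (bracket b s \<xi>) * inverse_fourier \<phi> \<xi>)"

definition Sob :: "('n::finite \<Rightarrow> 'j::finite) \<Rightarrow> real ^ 'j \<Rightarrow> (real ^ 'n \<Rightarrow> complex) \<Rightarrow> real" where
  "Sob b s \<phi> = L2_function_norm (bpot b s \<phi>)"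

lemma Sob_nonneg: "Sob b s \<phi> \<ge> 0"
  by (simp add: Sob_def L2_norm_nonneg)

lemma bracket_inverse_fourier_schwartz:
  "\<phi> \<in> schwartz_functions \<Longrightarrow> (\<lambda>\<xi>. of_real (bracket b s \<xi>) * inverse_fourier \<phi> \<xi>) \<in> schwartz_functions"
  by (intro schwartz_slow_mult bracket_slow_smooth schwartz_inverse_fourier)

lemma bpot_schwartz: "\<phi> \<in> schwartz_functions \<Longrightarrow> bpot b s \<phi> \<in> schwartz_functions"
  unfolding bpot_def by (intro schwartz_fourier bracket_inverse_fourier_schwartz)

lemma bpot_L2: "\<phi> \<in> schwartz_functions \<Longrightarrow> bpot b s \<phi> \<in> L2_functions"
  by (intro schwartz_L2 bpot_schwartz)

lemma inverse_fourier_bpot: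
  "\<phi> \<in> schwartz_functions \<Longrightarrow> inverse_fourier (bpot b s \<phi>) \<xi> = of_real (bracket b s \<xi>) * inverse_fourier \<phi> \<xi>"
  unfolding bpot_def by (simp add: inverse_fourier_fourier bracket_inverse_fourier_schwartz)

lemma bpot_minus_bpot:
  assumes "\<phi> \<in> schwartz_functions"
  shows "bpot b (- s) (bpot b s \<phi>) = \<phi>"
proof -
  have "complex_of_real (bracket b (- s) \<xi>) * (complex_of_real (bracket b s \<xi>) * z) = z" for \<xi> z
    by (simp only: mult.assoc[symmetric] of_real_mult[symmetric] bracket_minus_mult) simp
  then show ?thesis
    unfolding bpot_def[of b "- s"] inverse_fourier_bpot[OF assms]
      by (simp only: fourier_inverse_fourier[OF assms])
qed

lemma bpot_bpot_minus: "\<phi> \<in> schwartz_functions \<Longrightarrow> bpot b s (bpot b (- s) \<phi>) = \<phi>"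
  using bpot_minus_bpot[of \<phi> b "- s"] by simp

lemma inverse_fourier_add:
  assumes "f \<in> schwartz_functions" "g \<in> schwartz_functions"
  shows "inverse_fourier (\<lambda>x. f x + g x) = (\<lambda>\<xi>. inverse_fourier f \<xi> + inverse_fourier g \<xi>)"
  by (simp add: inverse_fourier_eq[abs_def] fourier_add[OF assms] add_divide_distrib)

lemma inverse_fourier_cmult: "inverse_fourier (\<lambda>x. c * f x) = (\<lambda>\<xi>. c * inverse_fourier f \<xi>)"
  by (simp add: inverse_fourier_eq[abs_def] fourier_cmult)

lemma bpot_add:
  assumes "f \<in> schwartz_functions" "g \<in> schwartz_functions"
  shows "bpot b s (\<lambda>x. f x + g x) = (\<lambda>x. bpot b s f x + bpot b s g x)"
  unfolding bpot_def inverse_fourier_add[OF assms] distrib_left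
  by (intro fourier_add bracket_inverse_fourier_schwartz assms)

lemma bpot_cmult: "bpot b s (\<lambda>x. c * f x) = (\<lambda>x. c * bpot b s f x)"
  unfolding bpot_def inverse_fourier_cmult mult.left_commute[of _ c] fourier_cmult ..

lemma inverse_fourier_exchange:
  assumes "f \<in> schwartz_functions" "g \<in> schwartz_functions"
  shows "(\<integral>x. inverse_fourier f x * g x \<partial>lborel) = (\<integral>x. f x * inverse_fourier g x \<partial>lborel)"
  using fourier_exchange[OF assms(1)[THEN schwartz_inverse_fourier] assms(2)[THEN schwartz_inverse_fourier]]
  by (simp add: fourier_inverse_fourier assms)

lemma bpot_eq_inverse:
  fixes \<phi> :: "real ^ 'n::finite \<Rightarrow> complex"
  assumes "\<phi> \<in> schwartz_functions"
  shows "bpot b s \<phi> = inverse_fourier (\<lambda>\<xi>. of_real (bracket b s \<xi>) * fourier \<phi> \<xi>)"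
proof
  fix x
  let ?K = "complex_of_real ((2 * pi) ^ CARD('n))" and ?h = "\<lambda>\<xi>. of_real (bracket b s \<xi>) * fourier \<phi> \<xi>"
  have h: "?h \<in> schwartz_functions" by (intro schwartz_slow_mult bracket_slow_smooth schwartz_fourier assms)
  have "(\<lambda>\<xi>. of_real (bracket b s \<xi>) * inverse_fourier \<phi> \<xi>) = (\<lambda>\<xi>. inverse ?K * ?h (- \<xi>))"
    by (auto simp: inverse_fourier_eq divide_inverse mult_ac)
  then have "bpot b s \<phi> x = inverse ?K * fourier ?h (- x)"
    unfolding bpot_def by (simp only: fourier_cmult fourier_reflect[OF h])
  then show "bpot b s \<phi> x = inverse_fourier ?h x" by (simp only: inverse_fourier_eq divide_inverse mult.commute)
qed

lemma bpot_exchange: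
  assumes f: "f \<in> schwartz_functions" and g: "g \<in> schwartz_functions"
  shows "(\<integral>x. f x * bpot b s g x \<partial>lborel) = (\<integral>x. bpot b s f x * g x \<partial>lborel)"
proof -
  have "(\<integral>x. f x * bpot b s g x \<partial>lborel) = (\<integral>x. fourier f x *
      (of_real (bracket b s x) * inverse_fourier g x) \<partial>lborel)"
    unfolding bpot_def by (rule fourier_exchange[symmetric]) (intro f bracket_inverse_fourier_schwartz g)+
  also have "\<dots> = (\<integral>x. (of_real (bracket b s x) * fourier f x) * inverse_fourier g x \<partial>lborel)"
    by (simp add: mult_ac)
  also have "\<dots> = (\<integral>x. bpot b s f x * g x \<partial>lborel)"
    unfolding bpot_eq_inverse[OF f]
    by (rule inverse_fourier_exchange[symmetric]) (intro schwartz_slow_mult bracket_slow_smooth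
      schwartz_fourier f g)+
  finally show ?thesis .
qed

lemma integral_mult_bpot:
  assumes "f \<in> schwartz_functions" "g \<in> schwartz_functions"
  shows "(\<integral>x. f x * g x \<partial>lborel) = (\<integral>x. bpot b s f x * bpot b (- s) g x \<partial>lborel)"
  using bpot_exchange[OF assms(1) bpot_schwartz[OF assms(2)], of b s b "- s"]
    bpot_bpot_minus[OF assms(2), of b s] by simp

lemma Sob_duality:
  assumes "f \<in> schwartz_functions" "g \<in> schwartz_functions"
  shows "cmod (\<integral>x. f x * g x \<partial>lborel) \<le> Sob b s f * Sob b (- s) g"
  unfolding integral_mult_bpot[OF assms, of b s] Sob_def by (intro L2_Cauchy_Schwarz bpot_L2 assms)

text \<open>The test function is \<open>bpot b s\<close> of the conjugate of
  \<open>bpot b s f\<close>: its pairing with \<open>f\<close> is the squared norm of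
  \<open>f\<close>, and its dual norm is the norm of \<open>f\<close>.\<close>

lemma Sob_le_if_dual_bound:
  assumes f: "f \<in> schwartz_functions" and C: "C \<ge> 0"
    and bound: "\<And>g. g \<in> schwartz_functions \<Longrightarrow> cmod (\<integral>x. f x * g x \<partial>lborel) \<le> C * Sob b (- s) g"
  shows "Sob b s f \<le> C"
proof -
  let ?h = "\<lambda>x. cnj (bpot b s f x)"
  have h: "?h \<in> schwartz_functions" by (intro schwartz_cnj bpot_schwartz f)
  let ?g = "bpot b s ?h"
  have g: "?g \<in> schwartz_functions" by (rule bpot_schwartz[OF h])
  have "Sob b (- s) ?g = L2_function_norm ?h" unfolding Sob_def bpot_minus_bpot[OF h] ..
  then have n: "Sob b (- s) ?g = Sob b s f" by (simp add: L2_norm_cnj Sob_def)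
  have "(\<integral>x. f x * ?g x \<partial>lborel) = (\<integral>x. bpot b s f x * ?h x \<partial>lborel)" by (rule bpot_exchange[OF f h])
  also have "\<dots> = of_real ((Sob b s f)\<^sup>2)"
    unfolding Sob_def L2_norm_power2 complex_norm_square[symmetric] by (simp only: integral_complex_of_real)
  finally have eq: "(\<integral>x. f x * ?g x \<partial>lborel) = of_real ((Sob b s f)\<^sup>2)" .
  have "(Sob b s f)\<^sup>2 = cmod (\<integral>x. f x * ?g x \<partial>lborel)" unfolding eq norm_of_real by simp
  then have "(Sob b s f)\<^sup>2 \<le> C * Sob b s f" using bound[OF g] n by simp
  then show ?thesis using C Sob_nonneg[of b s f]
    by (cases "Sob b s f = 0") (auto simp: power2_eq_square)
qed

section \<open>Weighted norms in frequency and multiplication by Schwartz functions\<close>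

text \<open>The squared Sobolev norm without its factor (2 pi)^n, valued in the extended reals so
  that Tonelli's theorem and Cauchy-Schwarz apply directly.\<close>

definition W2 :: "('n::finite \<Rightarrow> 'j::finite) \<Rightarrow> real ^ 'j \<Rightarrow> (real ^ 'n \<Rightarrow> complex) \<Rightarrow> ennreal" where
  "W2 b s \<phi> = (\<integral>\<^sup>+\<xi>. ennreal ((bracket b s \<xi> * cmod (inverse_fourier \<phi> \<xi>))\<^sup>2) \<partial>lborel)"

lemma Sob_power2:
  fixes \<phi> :: "real ^ 'n::finite \<Rightarrow> complex"
  assumes "\<phi> \<in> schwartz_functions"
  shows "ennreal ((Sob b s \<phi>)\<^sup>2) = ennreal ((2 * pi) ^ CARD('n)) * W2 b s \<phi>"
proof -
  have S: "(\<lambda>\<xi>. of_real (bracket b s \<xi>) * inverse_fourier \<phi> \<xi>) \<in> schwartz_functions"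
    by (rule bracket_inverse_fourier_schwartz[OF assms])
  show ?thesis
    unfolding Sob_def bpot_def Plancherel[OF S] W2_def using L2_nn_integral[OF schwartz_L2[OF S]]
    by (simp add: norm_mult abs_of_pos[OF bracket_pos] ennreal_mult)
qed

lemma W2_eq:
  fixes \<phi> :: "real ^ 'n::finite \<Rightarrow> complex"
  assumes "\<phi> \<in> schwartz_functions"
  shows "W2 b s \<phi> = ennreal ((Sob b s \<phi>)\<^sup>2 / (2 * pi) ^ CARD('n))"
proof -
  have "c > 0 \<Longrightarrow> x = ennreal (inverse c) * (ennreal c * x)" for c x
    by (simp add: mult.assoc[symmetric] ennreal_mult[symmetric])
  then have "W2 b s \<phi> = ennreal (inverse ((2 * pi) ^ CARD('n))) * (ennreal ((2 * pi) ^ CARD('n)) * W2 b s \<phi>)"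
    by this simp
  also have "\<dots> = ennreal ((Sob b s \<phi>)\<^sup>2 / (2 * pi) ^ CARD('n))"
    unfolding Sob_power2[OF assms, symmetric] by (simp add: ennreal_mult[symmetric] divide_inverse mult.commute)
  finally show ?thesis .
qed

lemma inverse_fourier_measurable [measurable]:
  "\<phi> \<in> schwartz_functions \<Longrightarrow> inverse_fourier \<phi> \<in> borel_measurable borel"
  by (intro schwartz_measurable schwartz_inverse_fourier)

lemma schwartz_shift_reflect:
  "f \<in> schwartz_functions \<Longrightarrow> (\<lambda>\<eta>. f (\<xi> - \<eta>)) \<in> schwartz_functions"
  using schwartz_translate[OF schwartz_reflect[of f], of \<xi>] by (simp add: translate_def)

lemma norm_inverse_fourier_mult_le:
  assumes "f \<in> schwartz_functions" "g \<in> schwartz_functions"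
  shows "ennreal (cmod (inverse_fourier (\<lambda>x. f x * g x) \<xi>)) \<le>
    (\<integral>\<^sup>+\<eta>. ennreal (cmod (inverse_fourier f (\<xi> - \<eta>)) * cmod (inverse_fourier g \<eta>)) \<partial>lborel)"
proof -
  have "(\<lambda>\<eta>. inverse_fourier f (\<xi> - \<eta>) * inverse_fourier g \<eta>) \<in> schwartz_functions"
    by (intro schwartz_mult schwartz_shift_reflect schwartz_inverse_fourier assms)
  then have "integrable lborel (\<lambda>\<eta>. inverse_fourier f (\<xi> - \<eta>) * inverse_fourier g \<eta>)"
    by (rule schwartz_integrable)
  from integral_norm_bound_ennreal[OF this] show ?thesis
    by (simp add: inverse_fourier_mult[OF assms] norm_mult)
qed

lemma nn_integral_convolution:
  fixes f g :: "real ^ 'n::finite \<Rightarrow> ennreal"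
  assumes [measurable]: "f \<in> borel_measurable borel" "g \<in> borel_measurable borel"
  shows "(\<integral>\<^sup>+\<xi>. (\<integral>\<^sup>+\<eta>. f (\<xi> - \<eta>) * g \<eta> \<partial>lborel) \<partial>lborel) = (\<integral>\<^sup>+x. f x \<partial>lborel) * (\<integral>\<^sup>+x. g x \<partial>lborel)"
proof -
  have "(\<integral>\<^sup>+\<xi>. (\<integral>\<^sup>+\<eta>. f (\<xi> - \<eta>) * g \<eta> \<partial>lborel) \<partial>lborel) = (\<integral>\<^sup>+\<eta>. (\<integral>\<^sup>+\<xi>. f (\<xi> - \<eta>) * g \<eta> \<partial>lborel) \<partial>lborel)"
    by (rule lborel_pair.Fubini'[symmetric]) measurable
  also have "\<dots> = (\<integral>\<^sup>+\<eta>. (\<integral>\<^sup>+x. f x \<partial>lborel) * g \<eta> \<partial>lborel)"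
  proof (rule nn_integral_cong)
    fix \<eta>
    have "(\<integral>\<^sup>+\<xi>. f (\<xi> - \<eta>) * g \<eta> \<partial>lborel) = (\<integral>\<^sup>+\<xi>. f (\<xi> - \<eta>) \<partial>lborel) * g \<eta>"
      by (rule nn_integral_multc) measurable
    then show "(\<integral>\<^sup>+\<xi>. f (\<xi> - \<eta>) * g \<eta> \<partial>lborel) = (\<integral>\<^sup>+x. f x \<partial>lborel) * g \<eta>"
      using nn_integral_translate[of f "- \<eta>"] by simp
  qed
  also have "\<dots> = (\<integral>\<^sup>+x. f x \<partial>lborel) * (\<integral>\<^sup>+x. g x \<partial>lborel)" by (rule nn_integral_cmult) measurable
  finally show ?thesis .
qed

text \<open>Splitting \<omega> into two square roots, Cauchy-Schwarz in \<eta> produces one factor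
  of the L^1 norm; Tonelli's theorem produces the second.\<close>

lemma Young_L1_L2:
  fixes \<omega> :: "real ^ 'n::finite \<Rightarrow> real" and h :: "real ^ 'n \<Rightarrow> ennreal"
  assumes [measurable]: "\<omega> \<in> borel_measurable borel" "h \<in> borel_measurable borel" and \<omega>: "\<And>x. \<omega> x \<ge> 0"
  shows "(\<integral>\<^sup>+\<xi>. (\<integral>\<^sup>+\<eta>. ennreal (\<omega> (\<xi> - \<eta>)) * h \<eta> \<partial>lborel)\<^sup>2 \<partial>lborel) \<le>
    (\<integral>\<^sup>+x. ennreal (\<omega> x) \<partial>lborel)\<^sup>2 * (\<integral>\<^sup>+x. (h x)\<^sup>2 \<partial>lborel)"
proof -
  let ?I = "\<integral>\<^sup>+x. ennreal (\<omega> x) \<partial>lborel"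
  have sq: "ennreal (sqrt (\<omega> x)) * ennreal (sqrt (\<omega> x)) = ennreal (\<omega> x)" for x
    by (simp add: ennreal_mult[symmetric] \<omega>)
  have sq1: "(ennreal (sqrt (\<omega> x)))\<^sup>2 = ennreal (\<omega> x)" for x by (simp only: power2_eq_square sq)
  have sq2: "(ennreal (sqrt (\<omega> x)) * z)\<^sup>2 = ennreal (\<omega> x) * z\<^sup>2" for x z by (simp only: power_mult_distrib sq1)
  have "(\<integral>\<^sup>+\<eta>. ennreal (\<omega> (\<xi> - \<eta>)) * h \<eta> \<partial>lborel)\<^sup>2 \<le> ?I * (\<integral>\<^sup>+\<eta>. ennreal (\<omega> (\<xi> - \<eta>)) * (h \<eta>)\<^sup>2 \<partial>lborel)" for \<xi>
  proof -
    have "(\<integral>\<^sup>+\<eta>. ennreal (\<omega> (\<xi> - \<eta>)) * h \<eta> \<partial>lborel)\<^sup>2 =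
        (\<integral>\<^sup>+\<eta>. ennreal (sqrt (\<omega> (\<xi> - \<eta>))) * (ennreal (sqrt (\<omega> (\<xi> - \<eta>))) * h \<eta>) \<partial>lborel)\<^sup>2"
      by (simp only: mult.assoc[symmetric] sq)
    also have "\<dots> \<le> (\<integral>\<^sup>+\<eta>. (ennreal (sqrt (\<omega> (\<xi> - \<eta>))))\<^sup>2 \<partial>lborel) *
        (\<integral>\<^sup>+\<eta>. (ennreal (sqrt (\<omega> (\<xi> - \<eta>))) * h \<eta>)\<^sup>2 \<partial>lborel)"
      by (rule Cauchy_Schwarz_nn_integral) measurable
    also have "\<dots> = (\<integral>\<^sup>+\<eta>. ennreal (\<omega> (\<xi> - \<eta>)) \<partial>lborel) * (\<integral>\<^sup>+\<eta>. ennreal (\<omega> (\<xi> - \<eta>)) * (h \<eta>)\<^sup>2 \<partial>lborel)"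
      by (simp only: sq1 sq2)
    finally show ?thesis using nn_integral_reflect[of "\<lambda>x. ennreal (\<omega> x)" \<xi>] by simp
  qed
  then have "(\<integral>\<^sup>+\<xi>. (\<integral>\<^sup>+\<eta>. ennreal (\<omega> (\<xi> - \<eta>)) * h \<eta> \<partial>lborel)\<^sup>2 \<partial>lborel) \<le>
      (\<integral>\<^sup>+\<xi>. ?I * (\<integral>\<^sup>+\<eta>. ennreal (\<omega> (\<xi> - \<eta>)) * (h \<eta>)\<^sup>2 \<partial>lborel) \<partial>lborel)"
    by (rule nn_integral_mono)
  also have "\<dots> = ?I * (\<integral>\<^sup>+\<xi>. (\<integral>\<^sup>+\<eta>. ennreal (\<omega> (\<xi> - \<eta>)) * (h \<eta>)\<^sup>2 \<partial>lborel) \<partial>lborel)"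
    by (rule nn_integral_cmult) measurable
  also have "\<dots> = ?I * (?I * (\<integral>\<^sup>+x. (h x)\<^sup>2 \<partial>lborel))"
    by (subst nn_integral_convolution) auto
  finally show ?thesis by (simp add: power2_eq_square mult.assoc)
qed

lemma bracket_fourier_integral_finite:
  assumes "\<theta> \<in> schwartz_functions"
  shows "(\<integral>\<^sup>+\<xi>. ennreal (bracket b s \<xi> * cmod (inverse_fourier \<theta> \<xi>)) \<partial>lborel) < \<infinity>"
proof -
  have "integrable lborel (\<lambda>\<xi>. cmod (of_real (bracket b s \<xi>) * inverse_fourier \<theta> \<xi>))"
    by (intro integrable_norm schwartz_integrable bracket_inverse_fourier_schwartz assms)
  then show ?thesis unfolding integrable_iff_bounded by (simp add: norm_mult abs_mult)
qed

text \<open>Peetre's inequality carries the weight into the convolution, where it splits into a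
  weight on the transform of \<theta>, making the integrable kernel \<open>\<omega>\<close>, and the
  weight \<open>r\<close> on the transform of \<phi>. The constant is the mass of the kernel and so
  depends on \<theta> and \<open>r\<close> only.\<close>

lemma Sob_mult_schwartz:
  fixes b :: "'n::finite \<Rightarrow> 'j::finite"
  assumes \<theta>: "\<theta> \<in> schwartz_functions"
  obtains C where "C \<ge> 0" "\<And>\<phi>. \<phi> \<in> schwartz_functions \<Longrightarrow> Sob b r (\<lambda>x. \<theta> x * \<phi> x) \<le> C * Sob b r \<phi>"
proof -
  obtain P where P: "P > 0" "\<And>\<xi> \<eta>. bracket b r \<xi> \<le> P * bracket b (vabs r) (\<xi> - \<eta>) * bracket b r \<eta>"
    using Peetre_bracket[of b r] by metis
  define \<omega> where "\<omega> \<zeta> = P * (bracket b (vabs r) \<zeta> * cmod (inverse_fourier \<theta> \<zeta>))" for \<zeta>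
  have \<omega>0: "\<omega> x \<ge> 0" for x using P bracket_pos[of b "vabs r" x] by (simp add: \<omega>_def)
  have [measurable]: "inverse_fourier \<theta> \<in> borel_measurable borel" by (rule inverse_fourier_measurable[OF \<theta>])
  have [measurable]: "\<omega> \<in> borel_measurable borel" unfolding \<omega>_def[abs_def] by measurable
  have "(\<integral>\<^sup>+x. ennreal (\<omega> x) \<partial>lborel) = ennreal P *
      (\<integral>\<^sup>+\<xi>. ennreal (bracket b (vabs r) \<xi> * cmod (inverse_fourier \<theta> \<xi>)) \<partial>lborel)"
    using P by (subst nn_integral_cmult[symmetric]) (simp_all add: \<omega>_def ennreal_mult less_imp_le)
  also have "\<dots> < \<infinity>" using bracket_fourier_integral_finite[OF \<theta>, of b "vabs r"]
    by (simp add: ennreal_mult_less_top)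
  finally obtain C where C: "(\<integral>\<^sup>+x. ennreal (\<omega> x) \<partial>lborel) = ennreal C" "C \<ge> 0"
    by (cases "\<integral>\<^sup>+x. ennreal (\<omega> x) \<partial>lborel") auto
  have "Sob b r (\<lambda>x. \<theta> x * \<phi> x) \<le> C * Sob b r \<phi>" if \<phi>: "\<phi> \<in> schwartz_functions" for \<phi>
  proof -
    have \<theta>\<phi>: "(\<lambda>x. \<theta> x * \<phi> x) \<in> schwartz_functions" by (rule schwartz_mult[OF \<theta> \<phi>])
    have [measurable]: "inverse_fourier \<phi> \<in> borel_measurable borel" by (rule inverse_fourier_measurable[OF \<phi>])
    let ?h = "\<lambda>\<eta>. ennreal (bracket b r \<eta> * cmod (inverse_fourier \<phi> \<eta>))"
    have pw: "ennreal (bracket b r \<xi> * cmod (inverse_fourier (\<lambda>x. \<theta> x * \<phi> x) \<xi>)) \<le>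
        (\<integral>\<^sup>+\<eta>. ennreal (\<omega> (\<xi> - \<eta>)) * ?h \<eta> \<partial>lborel)" for \<xi>
    proof -
      have "ennreal (bracket b r \<xi> * cmod (inverse_fourier (\<lambda>x. \<theta> x * \<phi> x) \<xi>)) \<le>
          ennreal (bracket b r \<xi>) * (\<integral>\<^sup>+\<eta>. ennreal
            (cmod (inverse_fourier \<theta> (\<xi> - \<eta>)) * cmod (inverse_fourier \<phi> \<eta>)) \<partial>lborel)"
        unfolding ennreal_mult[OF bracket_nonneg norm_ge_zero]
          by (intro mult_left_mono norm_inverse_fourier_mult_le \<theta> \<phi>) simp
      also have "\<dots> = (\<integral>\<^sup>+\<eta>. ennreal (bracket b r \<xi>) * ennreal
          (cmod (inverse_fourier \<theta> (\<xi> - \<eta>)) * cmod (inverse_fourier \<phi> \<eta>)) \<partial>lborel)"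
        by (rule nn_integral_cmult[symmetric]) measurable
      also have "\<dots> \<le> (\<integral>\<^sup>+\<eta>. ennreal (\<omega> (\<xi> - \<eta>)) * ?h \<eta> \<partial>lborel)"
      proof (rule nn_integral_mono)
        fix \<eta>
        have "bracket b r \<xi> * (cmod (inverse_fourier \<theta> (\<xi> - \<eta>)) * cmod (inverse_fourier \<phi> \<eta>)) \<le>
            (P * bracket b (vabs r) (\<xi> - \<eta>) * bracket b r \<eta>) *
              (cmod (inverse_fourier \<theta> (\<xi> - \<eta>)) * cmod (inverse_fourier \<phi> \<eta>))"
          by (intro mult_right_mono P) simp
        also have "\<dots> = \<omega> (\<xi> - \<eta>) * (bracket b r \<eta> * cmod (inverse_fourier \<phi> \<eta>))" by (simp add: \<omega>_def)
        finally show "ennreal (bracket b r \<xi>) * ennreal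
            (cmod (inverse_fourier \<theta> (\<xi> - \<eta>)) * cmod (inverse_fourier \<phi> \<eta>)) \<le> ennreal (\<omega> (\<xi> - \<eta>)) * ?h \<eta>"
          using bracket_pos[of b r \<xi>] bracket_pos[of b r \<eta>] \<omega>0
            by (simp add: ennreal_mult[symmetric] ennreal_leI)
      qed
      finally show ?thesis .
    qed
    have "W2 b r (\<lambda>x. \<theta> x * \<phi> x) \<le> (\<integral>\<^sup>+\<xi>. (\<integral>\<^sup>+\<eta>. ennreal (\<omega> (\<xi> - \<eta>)) * ?h \<eta> \<partial>lborel)\<^sup>2 \<partial>lborel)"
      unfolding W2_def by (intro nn_integral_mono)
        (simp add: ennreal_power[symmetric] power_mono pw less_imp_le)
    also have "\<dots> \<le> (ennreal C)\<^sup>2 * (\<integral>\<^sup>+x. (?h x)\<^sup>2 \<partial>lborel)"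
      unfolding C(1)[symmetric] by (rule Young_L1_L2) (auto simp: \<omega>0)
    also have "(\<integral>\<^sup>+x. (?h x)\<^sup>2 \<partial>lborel) = W2 b r \<phi>"
      unfolding W2_def by (simp add: ennreal_power less_imp_le)
    finally have "(Sob b r (\<lambda>x. \<theta> x * \<phi> x))\<^sup>2 / (2 * pi) ^ CARD('n) \<le> C\<^sup>2 *
        ((Sob b r \<phi>)\<^sup>2 / (2 * pi) ^ CARD('n))"
      unfolding W2_eq[OF \<theta>\<phi>] W2_eq[OF \<phi>] ennreal_power[OF C(2)]
      by (subst (asm) ennreal_mult[symmetric]) (simp_all add: ennreal_le_iff)
    then have "(Sob b r (\<lambda>x. \<theta> x * \<phi> x))\<^sup>2 \<le> (C * Sob b r \<phi>)\<^sup>2"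
      by (simp add: divide_le_cancel power_mult_distrib)
    then show ?thesis by (rule power2_le_imp_le) (simp add: C Sob_nonneg)
  qed
  with C that show thesis by blast
qed

subsection \<open>Localization\<close>

lemma inverse_fourier_translate:
  assumes "f \<in> schwartz_functions"
  shows "inverse_fourier (translate y f) \<xi> = exp (\<i> * of_real (y \<bullet> \<xi>)) * inverse_fourier f \<xi>"
  by (simp add: inverse_fourier_eq fourier_translate[OF assms])

text \<open>As a function of \<open>y\<close>, the inverse transform of \<open>\<chi>(\<cdot> - y) \<phi>\<close> at \<open>\<xi>\<close> is up to a phase the
  Fourier transform of \<open>\<eta> \<mapsto> F\<^sup>-\<^sup>1\<chi>(\<xi> - \<eta>) F\<^sup>-\<^sup>1\<phi>(\<eta>)\<close>, to which Plancherel applies.\<close>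

lemma inverse_fourier_translate_mult:
  assumes \<theta>: "\<theta> \<in> schwartz_functions" and \<phi>: "\<phi> \<in> schwartz_functions"
  shows "inverse_fourier (\<lambda>x. translate y \<theta> x * \<phi> x) \<xi> =
    exp (\<i> * of_real (y \<bullet> \<xi>)) * fourier (\<lambda>\<eta>. inverse_fourier \<theta> (\<xi> - \<eta>) * inverse_fourier \<phi> \<eta>) y"
proof -
  have "inverse_fourier (\<lambda>x. translate y \<theta> x * \<phi> x) \<xi> =
      (\<integral>\<eta>. (exp (\<i> * of_real (y \<bullet> (\<xi> - \<eta>))) * inverse_fourier \<theta> (\<xi> - \<eta>)) * inverse_fourier \<phi> \<eta> \<partial>lborel)"
    by (simp only: inverse_fourier_mult[OF schwartz_translate[OF \<theta>] \<phi>] inverse_fourier_translate[OF \<theta>])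
  also have "\<dots> = (\<integral>\<eta>. exp (\<i> * of_real (y \<bullet> \<xi>)) * (exp (- \<i> * of_real (\<eta> \<bullet> y)) *
      (inverse_fourier \<theta> (\<xi> - \<eta>) * inverse_fourier \<phi> \<eta>)) \<partial>lborel)"
  proof (rule Bochner_Integration.integral_cong[OF refl])
    fix \<eta>
    have "exp (\<i> * complex_of_real (y \<bullet> (\<xi> - \<eta>))) = exp (\<i> * of_real (y \<bullet> \<xi>)) * exp (- \<i> * of_real (\<eta> \<bullet> y))"
      by (simp add: exp_add[symmetric] inner_diff_right right_diff_distrib inner_commute)
    then show "(exp (\<i> * of_real (y \<bullet> (\<xi> - \<eta>))) * inverse_fourier \<theta> (\<xi> - \<eta>)) * inverse_fourier \<phi> \<eta> =
      exp (\<i> * of_real (y \<bullet> \<xi>)) * (exp (- \<i> * of_real (\<eta> \<bullet> y)) *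
        (inverse_fourier \<theta> (\<xi> - \<eta>) * inverse_fourier \<phi> \<eta>))"
      by (simp only: mult.assoc)
  qed
  finally show ?thesis unfolding fourier_def by simp
qed

lemma inverse_fourier_translate_mult_measurable:
  fixes \<theta> \<phi> :: "real ^ 'n::finite \<Rightarrow> complex"
  assumes "\<theta> \<in> schwartz_functions" "\<phi> \<in> schwartz_functions"
  shows "(\<lambda>p. inverse_fourier (\<lambda>x. translate (fst p) \<theta> x * \<phi> x) (snd p)) \<in> borel_measurable (lborel \<Otimes>\<^sub>M lborel)"
proof -
  have [measurable]: "\<theta> \<in> borel_measurable borel" "\<phi> \<in> borel_measurable borel"
    using assms by (auto intro: schwartz_measurable)
  have "(\<lambda>p. \<integral>x. exp (\<i> * complex_of_real ((snd p) \<bullet> x)) * (\<theta> (x - fst p) * \<phi> x) \<partial>lborel) \<in>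
      borel_measurable (lborel \<Otimes>\<^sub>M (lborel :: (real ^ 'n) measure))"
    by measurable
  then show ?thesis unfolding inverse_fourier_def translate_def by measurable
qed

text \<open>The squared norm is an integral over frequency of a function jointly measurable in
  position and frequency. Without this the window position could not be integrated over.\<close>

lemma Sob_translate_measurable [measurable]:
  fixes \<theta> \<phi> :: "real ^ 'n::finite \<Rightarrow> complex"
  assumes "\<theta> \<in> schwartz_functions" "\<phi> \<in> schwartz_functions"
  shows "(\<lambda>y. Sob b r (\<lambda>x. translate y \<theta> x * \<phi> x)) \<in> borel_measurable borel"
proof -
  have S: "(\<lambda>x. translate y \<theta> x * \<phi> x) \<in> schwartz_functions" for y
    by (intro schwartz_mult schwartz_translate assms)
  note [measurable] = inverse_fourier_translate_mult_measurable[OF assms]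
  have "(\<lambda>p. ennreal ((bracket b r (snd p) * cmod (inverse_fourier (\<lambda>x. translate (fst p) \<theta> x * \<phi> x)
      (snd p)))\<^sup>2)) \<in> borel_measurable (lborel \<Otimes>\<^sub>M lborel)"
    by measurable
  then have "(\<lambda>y. W2 b r (\<lambda>x. translate y \<theta> x * \<phi> x)) \<in> borel_measurable borel"
    unfolding W2_def using lborel.borel_measurable_nn_integral_fst by fastforce
  then have "(\<lambda>y. sqrt (enn2real (ennreal ((2 * pi) ^ CARD('n)) * W2 b r (\<lambda>x. translate y \<theta> x * \<phi> x))))
      \<in> borel_measurable borel"
    by measurable
  then show ?thesis unfolding Sob_power2[OF S, symmetric] by (simp add: Sob_nonneg)
qed

text \<open>Integrating in y before \<xi> replaces the squared modulus of a convolution by a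
  convolution of squared moduli. No cancellation is lost, and the remaining double integral is a
  product of two weighted norms.\<close>

lemma Sob_translate_square_integral:
  fixes b :: "'n::finite \<Rightarrow> 'j::finite"
  assumes \<theta>: "\<theta> \<in> schwartz_functions"
  obtains C where "C \<ge> 0" "\<And>\<phi>. \<phi> \<in> schwartz_functions \<Longrightarrow>
    (\<integral>\<^sup>+y. ennreal ((Sob b r (\<lambda>x. translate y \<theta> x * \<phi> x))\<^sup>2) \<partial>lborel) \<le> ennreal (C\<^sup>2 * (Sob b r \<phi>)\<^sup>2)"
proof -
  let ?K = "(2 * pi) ^ CARD('n)"
  obtain P where P: "P > 0" "\<And>\<xi> \<eta>. bracket b r \<xi> \<le> P * bracket b (vabs r) (\<xi> - \<eta>) * bracket b r \<eta>"
    using Peetre_bracket[of b r] by metis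
  \<comment> \<open>\<open>P\<close> comes from Peetre's inequality. The factors (2 pi)^n of
    Plancherel's identity and of the passage to \<open>W2\<close> cancel against the two conversions
    back to \<open>Sob\<close>.\<close>
  define A where "A = P\<^sup>2 * (Sob b (vabs r) \<theta>)\<^sup>2"
  have A0: "A \<ge> 0" by (simp add: A_def)
  have [measurable]: "inverse_fourier \<theta> \<in> borel_measurable borel" by (rule inverse_fourier_measurable[OF \<theta>])
  have "(\<integral>\<^sup>+y. ennreal ((Sob b r (\<lambda>x. translate y \<theta> x * \<phi> x))\<^sup>2) \<partial>lborel) \<le> ennreal
      ((sqrt A)\<^sup>2 * (Sob b r \<phi>)\<^sup>2)"
    if \<phi>: "\<phi> \<in> schwartz_functions" for \<phi>
  proof -
    note [measurable] = inverse_fourier_translate_mult_measurable[OF \<theta> \<phi>]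
    have [measurable]: "inverse_fourier \<phi> \<in> borel_measurable borel" by (rule inverse_fourier_measurable[OF \<phi>])
    have S: "(\<lambda>x. translate y \<theta> x * \<phi> x) \<in> schwartz_functions" for y
      by (intro schwartz_mult schwartz_translate \<theta> \<phi>)
    let ?h = "\<lambda>\<xi> \<eta>. inverse_fourier \<theta> (\<xi> - \<eta>) * inverse_fourier \<phi> \<eta>"
    have h: "?h \<xi> \<in> schwartz_functions" for \<xi>
      by (intro schwartz_mult schwartz_shift_reflect schwartz_inverse_fourier \<theta> \<phi>)
    let ?f = "\<lambda>y \<xi>. ennreal ((bracket b r \<xi> * cmod (inverse_fourier (\<lambda>x. translate y \<theta> x * \<phi> x) \<xi>))\<^sup>2)"
    let ?u = "\<lambda>\<zeta>. ennreal ((bracket b (vabs r) \<zeta> * cmod (inverse_fourier \<theta> \<zeta>))\<^sup>2)"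
    let ?v = "\<lambda>\<eta>. ennreal ((bracket b r \<eta> * cmod (inverse_fourier \<phi> \<eta>))\<^sup>2)"
    have fm: "(\<lambda>(y, \<xi>). ?f y \<xi>) \<in> borel_measurable (lborel \<Otimes>\<^sub>M lborel)" unfolding split_beta by measurable
    \<comment> \<open>The phase has modulus 1, so Plancherel's identity applies in y for each fixed
      \<xi>; afterwards the weight at \<xi> is distributed over \<open>\<xi> - \<eta>\<close> and
      \<eta>.\<close>
    have inner: "(\<integral>\<^sup>+y. ?f y \<xi> \<partial>lborel) \<le> ennreal (?K * P\<^sup>2) * (\<integral>\<^sup>+\<eta>. ?u (\<xi> - \<eta>) * ?v \<eta> \<partial>lborel)" for \<xi>
    proof -
      have [measurable]: "?h \<xi> \<in> borel_measurable borel" "fourier (?h \<xi>) \<in> borel_measurable borel"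
        by (intro schwartz_measurable schwartz_fourier h)+
      have "(\<integral>\<^sup>+y. ?f y \<xi> \<partial>lborel) = (\<integral>\<^sup>+y. ennreal ((bracket b r \<xi>)\<^sup>2) * ennreal
          ((cmod (fourier (?h \<xi>) y))\<^sup>2) \<partial>lborel)"
        by (simp add: inverse_fourier_translate_mult[OF \<theta> \<phi>] norm_mult power_mult_distrib ennreal_mult)
      also have "\<dots> = ennreal ((bracket b r \<xi>)\<^sup>2) * (\<integral>\<^sup>+y. ennreal ((cmod (fourier (?h \<xi>) y))\<^sup>2) \<partial>lborel)"
        by (rule nn_integral_cmult) measurable
      also have "(\<integral>\<^sup>+y. ennreal ((cmod (fourier (?h \<xi>) y))\<^sup>2) \<partial>lborel) =
          ennreal ?K * (\<integral>\<^sup>+\<eta>. ennreal ((cmod (?h \<xi> \<eta>))\<^sup>2) \<partial>lborel)"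
        unfolding L2_nn_integral[OF schwartz_L2[OF schwartz_fourier[OF h]]]
          L2_nn_integral[OF schwartz_L2[OF h]] Plancherel[OF h]
        by (simp add: ennreal_mult)
      finally have "(\<integral>\<^sup>+y. ?f y \<xi> \<partial>lborel) = ennreal (?K * (bracket b r \<xi>)\<^sup>2) *
          (\<integral>\<^sup>+\<eta>. ennreal ((cmod (?h \<xi> \<eta>))\<^sup>2) \<partial>lborel)"
        by (simp add: ennreal_mult mult_ac)
      also have "\<dots> = (\<integral>\<^sup>+\<eta>. ennreal (?K * (bracket b r \<xi>)\<^sup>2) * ennreal ((cmod (?h \<xi> \<eta>))\<^sup>2) \<partial>lborel)"
        by (rule nn_integral_cmult[symmetric]) measurable
      also have "\<dots> \<le> (\<integral>\<^sup>+\<eta>. ennreal (?K * P\<^sup>2) * (?u (\<xi> - \<eta>) * ?v \<eta>) \<partial>lborel)"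
      proof (rule nn_integral_mono)
        fix \<eta>
        have "(bracket b r \<xi>)\<^sup>2 \<le> (P * bracket b (vabs r) (\<xi> - \<eta>) * bracket b r \<eta>)\<^sup>2"
          by (intro power_mono P) simp
        then have "?K * ((bracket b r \<xi>)\<^sup>2 * (cmod (?h \<xi> \<eta>))\<^sup>2) \<le> ?K *
            ((P * bracket b (vabs r) (\<xi> - \<eta>) * bracket b r \<eta>)\<^sup>2 * (cmod (?h \<xi> \<eta>))\<^sup>2)"
          by (intro mult_left_mono mult_right_mono) auto
        also have "\<dots> = ?K * P\<^sup>2 * ((bracket b (vabs r) (\<xi> - \<eta>) * cmod (inverse_fourier \<theta> (\<xi> - \<eta>)))\<^sup>2 *
            (bracket b r \<eta> * cmod (inverse_fourier \<phi> \<eta>))\<^sup>2)"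
          by (simp only: norm_mult power_mult_distrib mult_ac)
        finally have le: "(?K * (bracket b r \<xi>)\<^sup>2) * (cmod (?h \<xi> \<eta>))\<^sup>2 \<le> (?K * P\<^sup>2) *
            ((bracket b (vabs r) (\<xi> - \<eta>) * cmod (inverse_fourier \<theta> (\<xi> - \<eta>)))\<^sup>2 *
              (bracket b r \<eta> * cmod (inverse_fourier \<phi> \<eta>))\<^sup>2)"
          by (simp only: mult.assoc)
        have K0: "0 \<le> ?K" by simp
        show "ennreal (?K * (bracket b r \<xi>)\<^sup>2) * ennreal ((cmod (?h \<xi> \<eta>))\<^sup>2) \<le> ennreal (?K * P\<^sup>2) *
            (?u (\<xi> - \<eta>) * ?v \<eta>)"
          using ennreal_leI[OF le] by (simp only: ennreal_mult mult_nonneg_nonneg zero_le_power2 K0)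
      qed
      also have "\<dots> = ennreal (?K * P\<^sup>2) * (\<integral>\<^sup>+\<eta>. ?u (\<xi> - \<eta>) * ?v \<eta> \<partial>lborel)"
        by (rule nn_integral_cmult) measurable
      finally show ?thesis .
    qed
    have "(\<integral>\<^sup>+y. ennreal ((Sob b r (\<lambda>x. translate y \<theta> x * \<phi> x))\<^sup>2) \<partial>lborel) =
        (\<integral>\<^sup>+y. ennreal ?K * (\<integral>\<^sup>+\<xi>. ?f y \<xi> \<partial>lborel) \<partial>lborel)"
      unfolding Sob_power2[OF S] W2_def ..
    also have "\<dots> = ennreal ?K * (\<integral>\<^sup>+y. (\<integral>\<^sup>+\<xi>. ?f y \<xi> \<partial>lborel) \<partial>lborel)"
      using fm by (intro nn_integral_cmult lborel.borel_measurable_nn_integral)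
    also have "(\<integral>\<^sup>+y. (\<integral>\<^sup>+\<xi>. ?f y \<xi> \<partial>lborel) \<partial>lborel) = (\<integral>\<^sup>+\<xi>. (\<integral>\<^sup>+y. ?f y \<xi> \<partial>lborel) \<partial>lborel)"
      using lborel_pair.Fubini'[OF fm] by simp
    also have "\<dots> \<le> (\<integral>\<^sup>+\<xi>. ennreal (?K * P\<^sup>2) * (\<integral>\<^sup>+\<eta>. ?u (\<xi> - \<eta>) * ?v \<eta> \<partial>lborel) \<partial>lborel)"
      by (rule nn_integral_mono[OF inner])
    also have "\<dots> = ennreal (?K * P\<^sup>2) * (\<integral>\<^sup>+\<xi>. (\<integral>\<^sup>+\<eta>. ?u (\<xi> - \<eta>) * ?v \<eta> \<partial>lborel) \<partial>lborel)"
      by (rule nn_integral_cmult) measurable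
    also have "(\<integral>\<^sup>+\<xi>. (\<integral>\<^sup>+\<eta>. ?u (\<xi> - \<eta>) * ?v \<eta> \<partial>lborel) \<partial>lborel) = W2 b (vabs r) \<theta> * W2 b r \<phi>"
      unfolding W2_def by (rule nn_integral_convolution) measurable
    also have "ennreal ?K * (ennreal (?K * P\<^sup>2) * (W2 b (vabs r) \<theta> * W2 b r \<phi>)) =
        ennreal ((sqrt A)\<^sup>2 * (Sob b r \<phi>)\<^sup>2)"
    proof -
      have K0: "0 \<le> ?K" and "?K > 0" by simp_all
      moreover have "K > 0 \<Longrightarrow> K * (K * p * (a / K * (c / K))) = p * a * c" for K p a c :: real
        by (simp add: field_simps)
      ultimately have "?K * (?K * P\<^sup>2 * ((Sob b (vabs r) \<theta>)\<^sup>2 / ?K * ((Sob b r \<phi>)\<^sup>2 / ?K))) = A * (Sob b r \<phi>)\<^sup>2"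
        unfolding A_def by blast
      then show ?thesis
        unfolding W2_eq[OF \<theta>] W2_eq[OF \<phi>] real_sqrt_pow2[OF A0]
        by (simp only: ennreal_mult[symmetric] mult_nonneg_nonneg divide_nonneg_nonneg zero_le_power2 K0)
    qed
    finally show ?thesis by (simp add: mult_left_mono)
  qed
  then show thesis using that[of "sqrt A"] A0 by simp
qed

subsection \<open>The trilinear estimate\<close>

lemma powr_comparable:
  fixes A B :: real
  assumes "A > 0" "B > 0" "A \<le> 4 * B" "B \<le> 4 * A"
  shows "A powr r \<le> 4 powr \<bar>r\<bar> * B powr r"
proof (cases "r \<ge> 0")
  case True
  then have "A powr r \<le> (4 * B) powr r" using assms by (intro powr_mono2) auto
  then show ?thesis using True assms by (simp add: powr_mult)
next
  case False
  have "(4 * A) powr r \<le> B powr r" using False assms by (intro powr_mono2') auto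
  then have "4 powr (- r) * (4 powr r * A powr r) \<le> 4 powr (- r) * B powr r"
    using assms by (intro mult_left_mono) (simp_all add: powr_mult)
  then show ?thesis using False by (simp add: mult.assoc[symmetric] powr_add[symmetric])
qed

text \<open>Two of the three quantities are always comparable. If X \<le> Z, then Y and Z are, and
  the remaining power of Y has the exponent \<sigma> - t \<le> 0, so that Y may be lowered to X. If
  Z < X, then X and Y are, and the power of Z is at most that of X with exponent
  \<open>max 0 \<sigma>\<close>, because Z \<ge> 1. The maximum is what makes both cases end in the
  same bound.\<close>

lemma powr_weight_bound:
  fixes X Y Z s t \<sigma> :: real
  assumes X: "1 \<le> X" "X \<le> Y" and Z: "1 \<le> Z" and Y: "Y \<le> 2 * (X + Z)" "Z \<le> 2 * (X + Y)"
    and \<sigma>: "\<sigma> \<le> t"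
  shows "X powr (- s) * Y powr (- t) * Z powr \<sigma> \<le> 4 powr (\<bar>t\<bar> + \<bar>\<sigma>\<bar>) * X powr (- (s + t - max 0 \<sigma>))"
proof -
  have c: "4 powr \<bar>\<sigma>\<bar> \<le> (4::real) powr (\<bar>t\<bar> + \<bar>\<sigma>\<bar>)" "4 powr \<bar>t\<bar> \<le> (4::real) powr (\<bar>t\<bar> + \<bar>\<sigma>\<bar>)"
    by (intro powr_mono; simp)+
  show ?thesis
  proof (cases "X \<le> Z")
    case True
    have "Z powr \<sigma> \<le> 4 powr \<bar>\<sigma>\<bar> * Y powr \<sigma>" using assms True by (intro powr_comparable) auto
    then have "X powr (- s) * Y powr (- t) * Z powr \<sigma> \<le> X powr (- s) * Y powr (- t) * (4 powr \<bar>\<sigma>\<bar> * Y powr \<sigma>)"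
      by (intro mult_left_mono) auto
    also have "\<dots> = 4 powr \<bar>\<sigma>\<bar> * (X powr (- s) * Y powr (\<sigma> - t))"
      by (simp add: powr_add[symmetric] mult_ac)
    also have "\<dots> \<le> 4 powr \<bar>\<sigma>\<bar> * (X powr (- s) * X powr (\<sigma> - t))"
      using assms by (intro mult_left_mono powr_mono2') auto
    also have "X powr (- s) * X powr (\<sigma> - t) = X powr (- (s + t - \<sigma>))"
      by (simp add: powr_add[symmetric] algebra_simps)
    also have "4 powr \<bar>\<sigma>\<bar> * X powr (- (s + t - \<sigma>)) \<le> 4 powr (\<bar>t\<bar> + \<bar>\<sigma>\<bar>) * X powr (- (s + t - max 0 \<sigma>))"
      using X by (intro mult_mono c powr_mono) auto
    finally show ?thesis .
  next
    case False
    have 1: "Y powr (- t) \<le> 4 powr \<bar>t\<bar> * X powr (- t)"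
      using powr_comparable[of Y X "- t"] assms False by auto
    have "Z powr \<sigma> \<le> Z powr (max 0 \<sigma>)" using Z by (intro powr_mono) auto
    also have "\<dots> \<le> X powr (max 0 \<sigma>)" using Z False by (intro powr_mono2) auto
    finally have "X powr (- s) * Y powr (- t) * Z powr \<sigma> \<le> X powr (- s) * (4 powr \<bar>t\<bar> * X powr (- t)) *
        X powr (max 0 \<sigma>)"
      using 1 by (intro mult_mono mult_left_mono) auto
    also have "\<dots> = 4 powr \<bar>t\<bar> * X powr (- (s + t - max 0 \<sigma>))"
    proof -
      have "X powr (- (s + t - max 0 \<sigma>)) = X powr (- s) * X powr (- t) * X powr (max 0 \<sigma>)"
        by (simp only: powr_add[symmetric]) (simp add: algebra_simps)
      then show ?thesis by (simp only: mult_ac)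
    qed
    also have "\<dots> \<le> 4 powr (\<bar>t\<bar> + \<bar>\<sigma>\<bar>) * X powr (- (s + t - max 0 \<sigma>))"
      by (intro mult_right_mono c) auto
    finally show ?thesis .
  qed
qed

text \<open>The smaller of X and Y carries the decay; the sum covers both cases at once.\<close>

lemma weight_bound:
  fixes X Y Z s t \<sigma> :: real
  assumes "1 \<le> X" "1 \<le> Y" "1 \<le> Z" "X \<le> 2 * (Y + Z)" "Y \<le> 2 * (X + Z)" "Z \<le> 2 * (X + Y)"
    and "\<sigma> \<le> s" "\<sigma> \<le> t"
  shows "X powr (- s) * Y powr (- t) * Z powr \<sigma> \<le>
    4 powr (\<bar>s\<bar> + \<bar>t\<bar> + \<bar>\<sigma>\<bar>) * (X powr (- (s + t - max 0 \<sigma>)) + Y powr (- (s + t - max 0 \<sigma>)))"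
proof (cases "X \<le> Y")
  case True
  have "X powr (- s) * Y powr (- t) * Z powr \<sigma> \<le> 4 powr (\<bar>t\<bar> + \<bar>\<sigma>\<bar>) * X powr (- (s + t - max 0 \<sigma>))"
    using assms True by (intro powr_weight_bound) auto
  also have "\<dots> \<le> 4 powr (\<bar>s\<bar> + \<bar>t\<bar> + \<bar>\<sigma>\<bar>) * (X powr (- (s + t - max 0 \<sigma>)) + Y powr (- (s + t - max 0 \<sigma>)))"
    by (intro mult_mono powr_mono) auto
  finally show ?thesis .
next
  case False
  have "Y powr (- t) * X powr (- s) * Z powr \<sigma> \<le> 4 powr (\<bar>s\<bar> + \<bar>\<sigma>\<bar>) * Y powr (- (t + s - max 0 \<sigma>))"
    using assms False by (intro powr_weight_bound) (auto simp: add.commute)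
  also have "\<dots> \<le> 4 powr (\<bar>s\<bar> + \<bar>t\<bar> + \<bar>\<sigma>\<bar>) * (X powr (- (s + t - max 0 \<sigma>)) + Y powr (- (s + t - max 0 \<sigma>)))"
    by (intro mult_mono powr_mono) (auto simp: add.commute)
  finally show ?thesis by (simp add: mult_ac)
qed

section \<open>Integration of the kernel coordinate by coordinate\<close>

text \<open>Expanding the right side leaves further nonnegative terms. The inequality turns a sum of
  two products into a single product over coordinates, whose integral factors. For empty
  \<open>A\<close> it would say 2 \<le> 1; for the blocks this is excluded by surjectivity of
  \<open>b\<close>.\<close>

lemma prod_add_prod_le:
  fixes f g :: "'a \<Rightarrow> real"
  assumes "finite A" "A \<noteq> {}" "\<And>i. i \<in> A \<Longrightarrow> f i \<ge> 0" "\<And>i. i \<in> A \<Longrightarrow> g i \<ge> 0"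
  shows "prod f A + prod g A \<le> (\<Prod>i\<in>A. f i + g i)"
  using assms
proof (induction A rule: finite_ne_induct)
  case (insert x F)
  have "f x * prod f F + g x * prod g F \<le> (f x + g x) * (prod f F + prod g F)"
    using insert.prems by (simp add: algebra_simps prod_nonneg)
  also have "\<dots> \<le> (f x + g x) * (\<Prod>i\<in>F. f i + g i)"
    using insert by (intro mult_left_mono) auto
  finally show ?case using insert.hyps by simp
qed simp

text \<open>The block dominates each 1 + x_i^2, so the exponent can be shared equally among the
  coordinates. Each share exceeds 1/2 exactly if \<open>q\<close> exceeds half the dimension of the
  block.\<close>

lemma block_powr_le_prod:
  assumes "finite I" "I \<noteq> {}" "q \<ge> 0"
  shows "block I x powr (- q) \<le> (\<Prod>i\<in>I. (1 + (x $ i)\<^sup>2) powr (- (q / real (card I))))"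
proof -
  let ?r = "q / real (card I)"
  have "card I > 0" using assms by (simp add: card_gt_0_iff)
  then have "block I x powr (- q) = (\<Prod>i\<in>I. block I x powr (- ?r))"
    using block_pos[of I x] assms(2) by (simp add: powr_power)
  also have "\<dots> \<le> (\<Prod>i\<in>I. (1 + (x $ i)\<^sup>2) powr (- ?r))"
  proof (rule prod_mono, intro conjI)
    fix i assume "i \<in> I"
    then have "(x $ i)\<^sup>2 \<le> (\<Sum>i\<in>I. (x $ i)\<^sup>2)" using assms(1) by (intro member_le_sum) auto
    then show "block I x powr (- ?r) \<le> (1 + (x $ i)\<^sup>2) powr (- ?r)"
      using assms(3) by (intro powr_mono2') (auto simp: block_def add_pos_nonneg)
  qed simp
  finally show ?thesis .
qed

text \<open>After the pointwise bound the integral over \<eta> splits into one-dimensional integrals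
  of a function of \<eta>_i plus its reflection about \<xi>_i / 2. Reflection preserves the
  integral, hence the bound is uniform in \<xi>.\<close>

lemma kernel_square_integral_bound:
  fixes b :: "'n::finite \<Rightarrow> 'j::finite" and s t \<sigma> :: "real ^ 'j"
  assumes b: "surj b"
    and st: "\<And>l. s $ l + t $ l > real (card (b -` {l})) / 2"
    and st\<sigma>: "\<And>l. s $ l + t $ l - \<sigma> $ l > real (card (b -` {l})) / 2"
    and \<sigma>: "\<And>l. \<sigma> $ l \<le> s $ l" "\<And>l. \<sigma> $ l \<le> t $ l"
  obtains M where "M \<ge> 0"
    "\<And>\<xi>. (\<integral>\<^sup>+\<eta>. ennreal ((bracket b (- s) (\<xi> - \<eta>) * bracket b (- t) \<eta> * bracket b \<sigma> \<xi>)\<^sup>2) \<partial>lborel) \<le> ennreal M"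
proof -
  \<comment> \<open>The decay left over by \<open>weight_bound\<close>. Both lower bounds in the
    assumptions are used: the one on s + t for \<sigma> \<le> 0, the one on s + t - \<sigma>
    otherwise.\<close>
  define q where "q l = s $ l + t $ l - max 0 (\<sigma> $ l)" for l
  define r where "r i = q (b i) / real (card (b -` {b i}))" for i
  define C where "C = (\<Prod>l\<in>UNIV. (4::real) powr (\<bar>s $ l\<bar> + \<bar>t $ l\<bar> + \<bar>\<sigma> $ l\<bar>))"
  have C0: "C \<ge> 0" unfolding C_def by (intro prod_nonneg) auto
  have ne: "b -` {l} \<noteq> {}" for l using b by (metis surjD insertI1 vimage_eq empty_iff singletonI)
  have cp: "card (b -` {l}) > 0" for l using ne[of l] by (simp add: card_gt_0_iff)
  have q: "q l > real (card (b -` {l})) / 2" for l using st[of l] st\<sigma>[of l] by (simp add: q_def max_def)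
  have q0: "q l \<ge> 0" for l using q[of l]
    by (meson divide_nonneg_nonneg less_eq_real_def of_nat_0_le_iff order_trans zero_le_numeral)
  have r: "r i > 1 / 2" for i
    using q[of "b i"] cp[of "b i"] by (simp add: r_def field_simps)
  define g where "g i u = (1 + u\<^sup>2) powr (- r i)" for i u
  have g0: "g i u \<ge> 0" for i u by (simp add: g_def)
  have gm [measurable]: "g i \<in> borel_measurable borel" for i unfolding g_def[abs_def] by measurable
  have pw: "(bracket b (- s) (\<xi> - \<eta>) * bracket b (- t) \<eta> * bracket b \<sigma> \<xi>)\<^sup>2 \<le>
      C * (\<Prod>i\<in>UNIV. g i (\<xi> $ i - \<eta> $ i) + g i (\<eta> $ i))" for \<xi> \<eta>
  proof -
    have bl: "block (b -` {l}) (\<xi> - \<eta>) powr (- q l) \<le> (\<Prod>i\<in>b -` {l}. g i (\<xi> $ i - \<eta> $ i))"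
        "block (b -` {l}) \<eta> powr (- q l) \<le> (\<Prod>i\<in>b -` {l}. g i (\<eta> $ i))" for l
    proof -
      have eq: "(\<Prod>i\<in>b -` {l}. (1 + (z $ i)\<^sup>2) powr (- (q l / real (card (b -` {l}))))) =
          (\<Prod>i\<in>b -` {l}. g i (z $ i))" for z :: "real ^ 'n"
        by (intro prod.cong) (auto simp: g_def r_def)
      show "block (b -` {l}) (\<xi> - \<eta>) powr (- q l) \<le> (\<Prod>i\<in>b -` {l}. g i (\<xi> $ i - \<eta> $ i))"
        using block_powr_le_prod[of "b -` {l}" "q l" "\<xi> - \<eta>"] ne[of l] q0[of l] unfolding eq by simp
      show "block (b -` {l}) \<eta> powr (- q l) \<le> (\<Prod>i\<in>b -` {l}. g i (\<eta> $ i))"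
        using block_powr_le_prod[of "b -` {l}" "q l" "\<eta>"] ne[of l] q0[of l] unfolding eq by simp
    qed
    have "(bracket b (- s) (\<xi> - \<eta>) * bracket b (- t) \<eta> * bracket b \<sigma> \<xi>)\<^sup>2 =
        (\<Prod>l\<in>UNIV. block (b -` {l}) (\<xi> - \<eta>) powr (- s $ l) * block (b -` {l}) \<eta> powr (- t $ l) * block
          (b -` {l}) \<xi> powr (\<sigma> $ l))"
      by (simp add: power_mult_distrib bracket_power2 prod.distrib)
    also have "\<dots> \<le> (\<Prod>l\<in>UNIV. 4 powr (\<bar>s $ l\<bar> + \<bar>t $ l\<bar> + \<bar>\<sigma> $ l\<bar>) *
        (\<Prod>i\<in>b -` {l}. g i (\<xi> $ i - \<eta> $ i) + g i (\<eta> $ i)))"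
    proof (rule prod_mono, intro conjI)
      fix l
      let ?X = "block (b -` {l}) (\<xi> - \<eta>)" and ?Y = "block (b -` {l}) \<eta>" and ?Z = "block (b -` {l}) \<xi>"
      have X: "block (b -` {l}) (\<eta> - \<xi>) = ?X" using block_uminus[of "b -` {l}" "\<xi> - \<eta>"] by simp
      have "?X powr (- s $ l) * ?Y powr (- t $ l) * ?Z powr (\<sigma> $ l) \<le>
          4 powr (\<bar>s $ l\<bar> + \<bar>t $ l\<bar> + \<bar>\<sigma> $ l\<bar>) * (?X powr (- q l) + ?Y powr (- q l))"
        unfolding q_def
        using weight_bound[of ?X ?Y ?Z "\<sigma> $ l" "s $ l" "t $ l"] block_ge_1[of "b -` {l}"]
          block_add_le[of "b -` {l}" \<xi> "- \<eta>"] block_add_le[of "b -` {l}" "\<eta> - \<xi>" \<xi>]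
            block_add_le[of "b -` {l}" "\<xi> - \<eta>" \<eta>] \<sigma>[of l]
        unfolding X by (simp add: algebra_simps)
      also have "?X powr (- q l) + ?Y powr (- q l) \<le> (\<Prod>i\<in>b -` {l}. g i (\<xi> $ i - \<eta> $ i)) +
          (\<Prod>i\<in>b -` {l}. g i (\<eta> $ i))"
        by (intro add_mono bl)
      also have "\<dots> \<le> (\<Prod>i\<in>b -` {l}. g i (\<xi> $ i - \<eta> $ i) + g i (\<eta> $ i))"
        by (intro prod_add_prod_le ne g0) simp
      finally show "?X powr (- s $ l) * ?Y powr (- t $ l) * ?Z powr (\<sigma> $ l) \<le>
          4 powr (\<bar>s $ l\<bar> + \<bar>t $ l\<bar> + \<bar>\<sigma> $ l\<bar>) * (\<Prod>i\<in>b -` {l}. g i (\<xi> $ i - \<eta> $ i) + g i (\<eta> $ i))"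
        by (simp add: mult_left_mono)
    qed simp
    also have "\<dots> = C * (\<Prod>l\<in>UNIV. \<Prod>i\<in>{i \<in> UNIV. b i = l}. g i (\<xi> $ i - \<eta> $ i) + g i (\<eta> $ i))"
      by (simp add: prod.distrib C_def vimage_def)
    also have "(\<Prod>l\<in>UNIV. \<Prod>i\<in>{i \<in> UNIV. b i = l}. g i (\<xi> $ i - \<eta> $ i) + g i (\<eta> $ i)) =
        (\<Prod>i\<in>UNIV. g i (\<xi> $ i - \<eta> $ i) + g i (\<eta> $ i))"
      by (rule prod.group) auto
    finally show ?thesis .
  qed
  define G where "G i = (\<integral>\<^sup>+u. ennreal (g i u) \<partial>lborel)" for i
  have G: "G i < \<infinity>" for i unfolding G_def g_def using nn_integral_japanese_bracket_finite[OF r[of i]] .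
  have bound: "(\<integral>\<^sup>+\<eta>. ennreal ((bracket b (- s) (\<xi> - \<eta>) * bracket b (- t) \<eta> * bracket b \<sigma> \<xi>)\<^sup>2) \<partial>lborel)
      \<le> ennreal C * (\<Prod>i\<in>UNIV. G i + G i)" for \<xi>
  proof -
    have "(\<integral>\<^sup>+\<eta>. ennreal ((bracket b (- s) (\<xi> - \<eta>) * bracket b (- t) \<eta> * bracket b \<sigma> \<xi>)\<^sup>2) \<partial>lborel) \<le>
        (\<integral>\<^sup>+\<eta>. ennreal C * ennreal (\<Prod>i\<in>UNIV. g i (\<xi> $ i - \<eta> $ i) + g i (\<eta> $ i)) \<partial>lborel)"
      using pw C0 g0 by (intro nn_integral_mono) (simp add: ennreal_mult[symmetric] prod_nonneg ennreal_leI)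
    also have "\<dots> = ennreal C * (\<integral>\<^sup>+\<eta>. ennreal (\<Prod>i\<in>UNIV. g i (\<xi> $ i - \<eta> $ i) + g i (\<eta> $ i)) \<partial>lborel)"
      by (rule nn_integral_cmult) measurable
    also have "(\<integral>\<^sup>+\<eta>. ennreal (\<Prod>i\<in>UNIV. g i (\<xi> $ i - \<eta> $ i) + g i (\<eta> $ i)) \<partial>lborel) =
        (\<Prod>i\<in>UNIV. \<integral>\<^sup>+u. ennreal (g i (\<xi> $ i - u) + g i u) \<partial>lborel)"
      by (rule nn_integral_vec_prod[of "\<lambda>i u. g i (\<xi> $ i - u) + g i u"]) (auto simp: g0)
    also have "\<dots> = (\<Prod>i\<in>UNIV. G i + G i)"
    proof (rule prod.cong[OF refl])
      fix i
      have "(\<integral>\<^sup>+u. ennreal (g i (\<xi> $ i - u) + g i u) \<partial>lborel) =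
          (\<integral>\<^sup>+u. ennreal (g i (\<xi> $ i - u)) \<partial>lborel) + (\<integral>\<^sup>+u. ennreal (g i u) \<partial>lborel)"
        by (simp add: g0 ennreal_plus nn_integral_add)
      also have "(\<integral>\<^sup>+u. ennreal (g i (\<xi> $ i - u)) \<partial>lborel) = G i"
        unfolding G_def by (rule nn_integral_reflect[of "\<lambda>u. ennreal (g i u)"]) measurable
      finally show "(\<integral>\<^sup>+u. ennreal (g i (\<xi> $ i - u) + g i u) \<partial>lborel) = G i + G i" by (simp add: G_def)
    qed
    finally show ?thesis .
  qed
  have "(\<Prod>i\<in>I. G i + G i) < \<infinity>" for I
    by (induction I rule: infinite_finite_induct) (use G in \<open>simp_all add: ennreal_mult_less_top\<close>)
  then have "ennreal C * (\<Prod>i\<in>UNIV. G i + G i) < \<infinity>" by (simp add: ennreal_mult_less_top)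
  then obtain M where M: "ennreal C * (\<Prod>i\<in>UNIV. G i + G i) = ennreal M" "M \<ge> 0"
    by (cases "ennreal C * (\<Prod>i\<in>UNIV. G i + G i)") auto
  show thesis by (rule that[OF M(2) bound[unfolded M(1)]])
qed

text \<open>Each transform is grouped with its own weight, which leaves a kernel of reciprocal
  weights. Cauchy-Schwarz in \<eta> uses that this kernel is square integrable uniformly in \<xi>;
  Cauchy-Schwarz in \<xi> splits off \<open>h\<close>, and the rest is a convolution of squared
  moduli, whose integral is a product.\<close>

lemma Sob_trilinear:
  fixes b :: "'n::finite \<Rightarrow> 'j::finite" and s t \<sigma> :: "real ^ 'j"
  assumes "surj b"
    and "\<And>l. s $ l + t $ l > real (card (b -` {l})) / 2"
    and "\<And>l. s $ l + t $ l - \<sigma> $ l > real (card (b -` {l})) / 2"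
    and "\<And>l. \<sigma> $ l \<le> s $ l" "\<And>l. \<sigma> $ l \<le> t $ l"
  obtains C where "C \<ge> 0" "\<And>f g h. f \<in> schwartz_functions \<Longrightarrow> g \<in> schwartz_functions \<Longrightarrow> h \<in> schwartz_functions \<Longrightarrow>
    cmod (\<integral>x. f x * g x * h x \<partial>lborel) \<le> C * Sob b s f * Sob b t g * Sob b (- \<sigma>) h"
proof -
  let ?K = "(2 * pi) ^ CARD('n)"
  have K: "?K > 0" by simp
  obtain M where M: "M \<ge> 0"
    "\<And>\<xi>. (\<integral>\<^sup>+\<eta>. ennreal ((bracket b (- s) (\<xi> - \<eta>) * bracket b (- t) \<eta> * bracket b \<sigma> \<xi>)\<^sup>2) \<partial>lborel) \<le> ennreal M"
    by (rule kernel_square_integral_bound[OF assms]) (rule that)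
  \<comment> \<open>The conversions of \<open>f\<close> and \<open>g\<close> from \<open>W2\<close>
    contribute 1 / ?K each; \<open>h\<close> enters through its forward transform and contributes
    ?K.\<close>
  define C where "C = sqrt (M / ?K)"
  have C0: "C \<ge> 0" using M by (simp add: C_def)
  have "cmod (\<integral>x. f x * g x * h x \<partial>lborel) \<le> C * Sob b s f * Sob b t g * Sob b (- \<sigma>) h"
    if f: "f \<in> schwartz_functions" and g: "g \<in> schwartz_functions" and h: "h \<in> schwartz_functions" for f g h
  proof -
    have [measurable]: "inverse_fourier f \<in> borel_measurable borel" "inverse_fourier g \<in> borel_measurable borel"
      "fourier h \<in> borel_measurable borel" "inverse_fourier h \<in> borel_measurable borel"
      by (intro schwartz_measurable schwartz_fourier schwartz_inverse_fourier f g h)+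
    have fg: "(\<lambda>x. f x * g x) \<in> schwartz_functions" by (rule schwartz_mult[OF f g])
    let ?f = "\<lambda>\<zeta>. ennreal (bracket b s \<zeta> * cmod (inverse_fourier f \<zeta>))"
    let ?g = "\<lambda>\<eta>. ennreal (bracket b t \<eta> * cmod (inverse_fourier g \<eta>))"
    let ?h = "\<lambda>\<xi>. ennreal (bracket b (- \<sigma>) \<xi> * cmod (fourier h \<xi>))"
    let ?k = "\<lambda>\<xi> \<eta>. ennreal (bracket b (- s) (\<xi> - \<eta>) * bracket b (- t) \<eta> * bracket b \<sigma> \<xi>)"
    let ?I = "\<lambda>\<xi>. \<integral>\<^sup>+\<eta>. (?f (\<xi> - \<eta>) * ?g \<eta>) * ?k \<xi> \<eta> \<partial>lborel"
    have pw: "ennreal (cmod (inverse_fourier (\<lambda>x. f x * g x) \<xi> * fourier h \<xi>)) \<le> ?h \<xi> * ?I \<xi>" for \<xi>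
    proof -
      have "ennreal (cmod (inverse_fourier (\<lambda>x. f x * g x) \<xi> * fourier h \<xi>)) =
          ennreal (cmod (fourier h \<xi>)) * ennreal (cmod (inverse_fourier (\<lambda>x. f x * g x) \<xi>))"
        by (simp add: norm_mult ennreal_mult mult.commute)
      also have "\<dots> \<le> ennreal (cmod (fourier h \<xi>)) *
          (\<integral>\<^sup>+\<eta>. ennreal (cmod (inverse_fourier f (\<xi> - \<eta>)) * cmod (inverse_fourier g \<eta>)) \<partial>lborel)"
        by (intro mult_left_mono norm_inverse_fourier_mult_le f g) simp
      also have "\<dots> = (\<integral>\<^sup>+\<eta>. ennreal (cmod (fourier h \<xi>)) * ennreal
          (cmod (inverse_fourier f (\<xi> - \<eta>)) * cmod (inverse_fourier g \<eta>)) \<partial>lborel)"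
        by (rule nn_integral_cmult[symmetric]) measurable
      also have "\<dots> = (\<integral>\<^sup>+\<eta>. ?h \<xi> * ((?f (\<xi> - \<eta>) * ?g \<eta>) * ?k \<xi> \<eta>) \<partial>lborel)"
      proof (rule nn_integral_cong)
        fix \<eta>
        \<comment> \<open>The cancellation is proved for abstract reciprocal weights, so that all
          three brackets can be substituted together.\<close>
        have "w1' * w1 = 1 \<Longrightarrow> w2' * w2 = 1 \<Longrightarrow> w3' * w3 = 1 \<Longrightarrow>
            (w3' * c) * (((w1 * a) * (w2 * d)) * (w1' * w2' * w3)) = c * (a * d)"
              for w1 w1' w2 w2' w3 w3' a c d :: real
          by algebra
        from this[OF bracket_minus_mult bracket_minus_mult bracket_minus_mult]
        have "(bracket b (- \<sigma>) \<xi> * cmod (fourier h \<xi>)) *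
            (((bracket b s (\<xi> - \<eta>) * cmod (inverse_fourier f (\<xi> - \<eta>))) *
              (bracket b t \<eta> * cmod (inverse_fourier g \<eta>)))
            * (bracket b (- s) (\<xi> - \<eta>) * bracket b (- t) \<eta> * bracket b \<sigma> \<xi>)) =
              cmod (fourier h \<xi>) * (cmod (inverse_fourier f (\<xi> - \<eta>)) * cmod (inverse_fourier g \<eta>))" .
        then show "ennreal (cmod (fourier h \<xi>)) * ennreal
            (cmod (inverse_fourier f (\<xi> - \<eta>)) * cmod (inverse_fourier g \<eta>)) =
              ?h \<xi> * ((?f (\<xi> - \<eta>) * ?g \<eta>) * ?k \<xi> \<eta>)"
          by (simp only: ennreal_mult[symmetric] mult_nonneg_nonneg bracket_nonneg norm_ge_zero)
      qed
      also have "\<dots> = ?h \<xi> * ?I \<xi>" by (rule nn_integral_cmult) measurable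
      finally show ?thesis .
    qed
    have I2: "(?I \<xi>)\<^sup>2 \<le> (\<integral>\<^sup>+\<eta>. (?f (\<xi> - \<eta>))\<^sup>2 * (?g \<eta>)\<^sup>2 \<partial>lborel) * ennreal M" for \<xi>
    proof -
      have "(?I \<xi>)\<^sup>2 \<le> (\<integral>\<^sup>+\<eta>. (?f (\<xi> - \<eta>) * ?g \<eta>)\<^sup>2 \<partial>lborel) * (\<integral>\<^sup>+\<eta>. (?k \<xi> \<eta>)\<^sup>2 \<partial>lborel)"
        by (rule Cauchy_Schwarz_nn_integral) measurable
      also have "\<dots> \<le> (\<integral>\<^sup>+\<eta>. (?f (\<xi> - \<eta>) * ?g \<eta>)\<^sup>2 \<partial>lborel) * ennreal M"
        using M(2)[of \<xi>] by (intro mult_left_mono) (simp_all add: ennreal_power)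
      finally show ?thesis by (simp only: power_mult_distrib)
    qed
    have hW: "(\<integral>\<^sup>+\<xi>. (?h \<xi>)\<^sup>2 \<partial>lborel) = ennreal (?K * (Sob b (- \<sigma>) h)\<^sup>2)"
    proof -
      have "fourier h \<xi> = of_real ?K * inverse_fourier h (- \<xi>)" for \<xi> by (simp add: inverse_fourier_eq)
      then have "(\<integral>\<^sup>+\<xi>. (?h \<xi>)\<^sup>2 \<partial>lborel) = (\<integral>\<^sup>+\<xi>. ennreal (?K\<^sup>2) * ennreal
          ((bracket b (- \<sigma>) (- \<xi>) * cmod (inverse_fourier h (- \<xi>)))\<^sup>2) \<partial>lborel)"
        by (intro nn_integral_cong) (simp add: ennreal_power ennreal_mult[symmetric] norm_mult
          power_mult_distrib norm_power mult_ac)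
      also have "\<dots> = ennreal (?K\<^sup>2) * (\<integral>\<^sup>+\<xi>. ennreal
          ((bracket b (- \<sigma>) (- \<xi>) * cmod (inverse_fourier h (- \<xi>)))\<^sup>2) \<partial>lborel)"
        by (rule nn_integral_cmult) measurable
      also have "(\<integral>\<^sup>+\<xi>. ennreal ((bracket b (- \<sigma>) (- \<xi>) * cmod (inverse_fourier h (- \<xi>)))\<^sup>2) \<partial>lborel) =
          W2 b (- \<sigma>) h"
        unfolding W2_def using nn_integral_reflect[of "\<lambda>\<xi>. ennreal
          ((bracket b (- \<sigma>) \<xi> * cmod (inverse_fourier h \<xi>))\<^sup>2)" 0] by simp
      also have "ennreal (?K\<^sup>2) * W2 b (- \<sigma>) h = ennreal (?K * (Sob b (- \<sigma>) h)\<^sup>2)"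
        unfolding W2_eq[OF h] using K by (subst ennreal_mult[symmetric]) (auto simp: power2_eq_square)
      finally show ?thesis .
    qed
    have eq: "(\<integral>x. f x * g x * h x \<partial>lborel) = (\<integral>\<xi>. inverse_fourier (\<lambda>x. f x * g x) \<xi> * fourier h \<xi> \<partial>lborel)"
      by (subst inverse_fourier_exchange[OF fg schwartz_fourier[OF h]])
        (simp add: inverse_fourier_fourier[OF h])
    have int: "integrable lborel (\<lambda>\<xi>. inverse_fourier (\<lambda>x. f x * g x) \<xi> * fourier h \<xi>)"
      by (intro schwartz_integrable schwartz_mult schwartz_inverse_fourier schwartz_fourier fg h)
    have "ennreal (cmod (\<integral>x. f x * g x * h x \<partial>lborel)) \<le>
        (\<integral>\<^sup>+\<xi>. ennreal (cmod (inverse_fourier (\<lambda>x. f x * g x) \<xi> * fourier h \<xi>)) \<partial>lborel)"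
      unfolding eq by (rule integral_norm_bound_ennreal[OF int])
    also have "\<dots> \<le> (\<integral>\<^sup>+\<xi>. ?h \<xi> * ?I \<xi> \<partial>lborel)" by (rule nn_integral_mono[OF pw])
    finally have 1: "(ennreal (cmod (\<integral>x. f x * g x * h x \<partial>lborel)))\<^sup>2 \<le> (\<integral>\<^sup>+\<xi>. ?h \<xi> * ?I \<xi> \<partial>lborel)\<^sup>2"
      by (intro power_mono) auto
    have 2: "(\<integral>\<^sup>+\<xi>. ?h \<xi> * ?I \<xi> \<partial>lborel)\<^sup>2 \<le> (\<integral>\<^sup>+\<xi>. (?h \<xi>)\<^sup>2 \<partial>lborel) * (\<integral>\<^sup>+\<xi>. (?I \<xi>)\<^sup>2 \<partial>lborel)"
      by (rule Cauchy_Schwarz_nn_integral) measurable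
    have "(\<integral>\<^sup>+\<xi>. (?I \<xi>)\<^sup>2 \<partial>lborel) \<le> (\<integral>\<^sup>+\<xi>. (\<integral>\<^sup>+\<eta>. (?f (\<xi> - \<eta>))\<^sup>2 * (?g \<eta>)\<^sup>2 \<partial>lborel) * ennreal M \<partial>lborel)"
      by (rule nn_integral_mono[OF I2])
    also have "\<dots> = (\<integral>\<^sup>+\<xi>. (\<integral>\<^sup>+\<eta>. (?f (\<xi> - \<eta>))\<^sup>2 * (?g \<eta>)\<^sup>2 \<partial>lborel) \<partial>lborel) * ennreal M"
      by (rule nn_integral_multc) measurable
    also have "(\<integral>\<^sup>+\<xi>. (\<integral>\<^sup>+\<eta>. (?f (\<xi> - \<eta>))\<^sup>2 * (?g \<eta>)\<^sup>2 \<partial>lborel) \<partial>lborel) =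
        (\<integral>\<^sup>+x. (?f x)\<^sup>2 \<partial>lborel) * (\<integral>\<^sup>+x. (?g x)\<^sup>2 \<partial>lborel)"
      by (rule nn_integral_convolution[of "\<lambda>x. (?f x)\<^sup>2" "\<lambda>x. (?g x)\<^sup>2"]) measurable
    finally have 3: "(\<integral>\<^sup>+\<xi>. (?I \<xi>)\<^sup>2 \<partial>lborel) \<le> (\<integral>\<^sup>+x. (?f x)\<^sup>2 \<partial>lborel) * (\<integral>\<^sup>+x. (?g x)\<^sup>2 \<partial>lborel) *
        ennreal M" .
    have W: "(\<integral>\<^sup>+x. (?f x)\<^sup>2 \<partial>lborel) = W2 b s f" "(\<integral>\<^sup>+x. (?g x)\<^sup>2 \<partial>lborel) = W2 b t g"
      unfolding W2_def by (simp_all add: ennreal_power)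
    have "(ennreal (cmod (\<integral>x. f x * g x * h x \<partial>lborel)))\<^sup>2 \<le> (\<integral>\<^sup>+\<xi>. (?h \<xi>)\<^sup>2 \<partial>lborel) *
        (W2 b s f * W2 b t g * ennreal M)"
      using 1 2 mult_left_mono[OF 3, of "\<integral>\<^sup>+\<xi>. (?h \<xi>)\<^sup>2 \<partial>lborel"] unfolding W by (meson order_trans zero_le)
    also have "\<dots> = ennreal (?K * (Sob b (- \<sigma>) h)\<^sup>2 * ((Sob b s f)\<^sup>2 / ?K * ((Sob b t g)\<^sup>2 / ?K) * M))"
      unfolding hW W2_eq[OF f] W2_eq[OF g] using M(1) less_imp_le[OF K]
      by (simp only: ennreal_mult[symmetric] mult_nonneg_nonneg divide_nonneg_nonneg zero_le_power2)
    also have "?K * (Sob b (- \<sigma>) h)\<^sup>2 * ((Sob b s f)\<^sup>2 / ?K * ((Sob b t g)\<^sup>2 / ?K) * M) =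
        (C * Sob b s f * Sob b t g * Sob b (- \<sigma>) h)\<^sup>2"
    proof -
      have "L > 0 \<Longrightarrow> L * z * (x / L * (y / L) * M) = M / L * x * y * z" for L x y z :: real
        by (simp add: field_simps)
      from this[OF K] show ?thesis using M K
        by (simp only: C_def power_mult_distrib real_sqrt_pow2 divide_nonneg_pos)
    qed
    finally have "(cmod (\<integral>x. f x * g x * h x \<partial>lborel))\<^sup>2 \<le> (C * Sob b s f * Sob b t g * Sob b (- \<sigma>) h)\<^sup>2"
      by (simp add: ennreal_power)
    then show ?thesis by (rule power2_le_imp_le) (simp add: C0 Sob_nonneg)
  qed
  with C0 that show thesis by blast
qed

subsection \<open>Density of the test functions\<close>

lemma test_partial_derivative:
  assumes "f \<in> test_functions" shows "partial_derivative i f \<in> test_functions"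
proof -
  obtain R where R: "\<And>x. norm x > R \<Longrightarrow> f x = 0" and "smooth f"
    using assms unfolding test_functions_iff by (metis not_le)
  have "norm x \<le> R" if "partial_derivative i f x \<noteq> 0" for x
    using partial_derivative_eq_0_outside[of R f x i] R that by (cases "norm x > R") auto
  then show ?thesis unfolding test_functions_iff
    using smooth_partial_derivative[OF \<open>smooth f\<close>, of i] by blast
qed

lemma test_scale:
  fixes f :: "real ^ 'n::finite \<Rightarrow> complex"
  assumes "f \<in> test_functions" "c > 0" shows "(\<lambda>x. f (c *\<^sub>R x)) \<in> test_functions"
proof -
  obtain S where S: "\<And>x. f x \<noteq> 0 \<Longrightarrow> norm x \<le> S" using assms(1) unfolding test_functions_iff by metis
  have "norm x \<le> S / c" if "f (c *\<^sub>R x) \<noteq> 0" for x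
    using S[OF that] assms(2) by (simp add: field_simps)
  then show ?thesis using smooth_scale[OF test_smooth[OF assms(1)], of c] unfolding test_functions_iff by blast
qed

lemma partial_derivative_eq_0_ball:
  fixes f :: "real ^ 'n::finite \<Rightarrow> complex"
  assumes "\<And>x. norm x < 1 \<Longrightarrow> f x = 0" "norm x < 1"
  shows "partial_derivative i f x = 0"
proof -
  have "((\<lambda>x. 0::complex) has_derivative (\<lambda>v. 0)) (at x)" by simp
  moreover have "open {x :: real ^ 'n. norm x < 1}" by (intro open_Collect_less continuous_intros)
  ultimately have "(f has_derivative (\<lambda>v. 0)) (at x)"
    using assms has_derivative_transform_within_open[of "\<lambda>x. 0" "\<lambda>v. 0" x UNIV "{x. norm x < 1}" f] by auto
  then show ?thesis by (simp add: partial_derivative_eqI)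
qed

definition shrink :: "nat \<Rightarrow> real" where "shrink k = inverse (real (Suc k))"

lemma shrink: "shrink k > 0" "\<bar>shrink k\<bar> \<le> 1" "shrink \<longlonglongrightarrow> 0"
  using LIMSEQ_inverse_real_of_nat by (simp_all add: shrink_def[abs_def] inverse_le_1_iff)

text \<open>The members vanish on the balls of radius \<open>k + 1\<close>. Since the class is closed under
  differentiation, their \<open>L\<^sup>2\<close> convergence to zero passes to all derivatives.\<close>

inductive_set escaping :: "(nat \<Rightarrow> real ^ 'n::finite \<Rightarrow> complex) set" where
  base: "f \<in> schwartz_functions \<Longrightarrow> smooth \<rho> \<Longrightarrow> \<rho> \<in> test_functions \<or> (\<lambda>x. 1 + (-1) * \<rho> x) \<in> test_functions \<Longrightarrow>
    (\<And>x. norm x < 1 \<Longrightarrow> \<rho> x = 0) \<Longrightarrow> (\<lambda>k x. f x * \<rho> (shrink k *\<^sub>R x)) \<in> escaping"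
| add: "F \<in> escaping \<Longrightarrow> G \<in> escaping \<Longrightarrow> (\<lambda>k x. F k x + G k x) \<in> escaping"
| scale: "F \<in> escaping \<Longrightarrow> (\<And>k. \<bar>c k\<bar> \<le> 1) \<Longrightarrow> (\<lambda>k x. of_real (c k) * F k x) \<in> escaping"

text \<open>For the base case a fixed point is eventually inside the ball where the cutoff vanishes,
  and dominated convergence applies. Both alternatives for \<rho> lead to a derivative that is a
  test function vanishing on the unit ball, and the inner derivative of the dilation is the factor
  \<open>shrink k\<close>, at most 1; so differentiation stays in the class.\<close>

lemma escaping_step:
  fixes F :: "nat \<Rightarrow> real ^ 'n::finite \<Rightarrow> complex"
  assumes "F \<in> escaping"
  shows "(\<forall>k. F k \<in> schwartz_functions) \<and> (\<lambda>k. L2_function_norm (F k)) \<longlonglongrightarrow> 0 \<and>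
    (\<forall>i. (\<lambda>k. partial_derivative i (F k)) \<in> escaping)"
  using assms
proof (induction rule: escaping.induct)
  case (base f \<rho>)
  have fm [measurable]: "f \<in> borel_measurable borel" by (rule schwartz_measurable[OF base(1)])
  have \<rho>c: "continuous_on UNIV \<rho>" by (rule smooth_imp_continuous_on[OF base(2)])
  have \<rho>m [measurable]: "\<rho> \<in> borel_measurable borel" by (rule borel_measurable_continuous_onI[OF \<rho>c])
  have S: "(\<lambda>x. f x * \<rho> (shrink k *\<^sub>R x)) \<in> schwartz_functions" for k
    using base(3)
  proof
    assume "\<rho> \<in> test_functions"
    then show ?thesis by (intro schwartz_mult base(1) test_imp_schwartz test_scale shrink)
  next
    assume t: "(\<lambda>x. 1 + (-1) * \<rho> x) \<in> test_functions"
    have "(\<lambda>x. f x - f x * (1 + (-1) * \<rho> (shrink k *\<^sub>R x))) \<in> schwartz_functions"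
      using test_scale[OF t, of "shrink k"]
        by (intro schwartz_diff schwartz_mult base(1) test_imp_schwartz) (simp add: shrink)
    then show ?thesis by (simp add: algebra_simps)
  qed
  obtain B where B: "\<And>x. cmod (\<rho> x) \<le> B"
    using base(3)
  proof
    assume "\<rho> \<in> test_functions"
    then show ?thesis using that rapid_imp_bounded[OF schwartz_rapid[OF test_imp_schwartz]] by metis
  next
    assume t: "(\<lambda>x. 1 + (-1) * \<rho> x) \<in> test_functions"
    obtain B where B: "\<And>x. cmod (1 + (-1) * \<rho> x) \<le> B"
      using rapid_imp_bounded[OF schwartz_rapid[OF test_imp_schwartz[OF t]]] by metis
    have "cmod (\<rho> x) \<le> 1 + B" for x
      using B[of x] norm_triangle_ineq4[of 1 "1 + (-1) * \<rho> x"] by simp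
    then show ?thesis using that by blast
  qed
  have lim: "(\<lambda>k. \<integral>x. (cmod (f x * \<rho> (shrink k *\<^sub>R x)))\<^sup>2 \<partial>lborel) \<longlonglongrightarrow>
      (\<integral>x. (0::real) \<partial>(lborel :: (real ^ 'n) measure))"
  proof (rule integral_dominated_convergence[where w = "\<lambda>x. B\<^sup>2 * (cmod (f x))\<^sup>2"])
    show "integrable lborel (\<lambda>x. B\<^sup>2 * (cmod (f x))\<^sup>2)"
      by (intro integrable_mult_right L2_integrable schwartz_L2 base(1))
    show "AE x in lborel. (\<lambda>k. (cmod (f x * \<rho> (shrink k *\<^sub>R x)))\<^sup>2) \<longlonglongrightarrow> 0"
    proof (rule AE_I2)
      fix x :: "real ^ 'n"
      have "(\<lambda>k. norm (shrink k *\<^sub>R x)) \<longlonglongrightarrow> norm (0 *\<^sub>R x)" by (intro tendsto_intros shrink)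
      then have "\<forall>\<^sub>F k in sequentially. norm (shrink k *\<^sub>R x) < 1" by (rule order_tendstoD) simp
      then have "\<forall>\<^sub>F k in sequentially. 0 = (cmod (f x * \<rho> (shrink k *\<^sub>R x)))\<^sup>2"
        by eventually_elim (simp add: base(4))
      then show "(\<lambda>k. (cmod (f x * \<rho> (shrink k *\<^sub>R x)))\<^sup>2) \<longlonglongrightarrow> 0"
        by (rule Lim_transform_eventually[OF tendsto_const])
    qed
    show "AE x in lborel. norm ((cmod (f x * \<rho> (shrink k *\<^sub>R x)))\<^sup>2) \<le> B\<^sup>2 * (cmod (f x))\<^sup>2" for k
      using B by (intro AE_I2) (simp add: norm_mult power_mult_distrib mult.commute[of "B\<^sup>2"]
        mult_left_mono power_mono)
  qed measurable
  have "(\<lambda>k. L2_function_norm (\<lambda>x. f x * \<rho> (shrink k *\<^sub>R x))) \<longlonglongrightarrow> 0"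
    unfolding L2_function_norm_def using tendsto_real_sqrt[OF lim] by simp
  moreover have "(\<lambda>k. partial_derivative i (\<lambda>x. f x * \<rho> (shrink k *\<^sub>R x))) \<in> escaping" for i
  proof -
    have t: "partial_derivative i \<rho> \<in> test_functions" using base(3)
    proof
      assume t: "(\<lambda>x. 1 + (-1) * \<rho> x) \<in> test_functions"
      have "partial_derivative i (\<lambda>x. 1 + (-1) * (1 + (-1) * \<rho> x)) =
          (\<lambda>x. 0 + (-1) * partial_derivative i (\<lambda>x. 1 + (-1) * \<rho> x) x)"
        by (subst partial_derivative_add, simp, rule smooth_mult[OF smooth_const test_smooth[OF t]],
            subst partial_derivative_cmult[OF test_smooth[OF t]])
              (simp add: partial_derivative_eqI[OF has_derivative_const])
      then have "partial_derivative i \<rho> = (\<lambda>x. (-1) * partial_derivative i (\<lambda>x. 1 + (-1) * \<rho> x) x)" by simp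
      then show ?thesis using test_cmult[OF test_partial_derivative[OF t], of "-1" i] by simp
    qed (rule test_partial_derivative)
    have "partial_derivative i (\<lambda>x. f x * \<rho> (shrink k *\<^sub>R x)) =
        (\<lambda>x. of_real (shrink k) * (f x * partial_derivative i \<rho> (shrink k *\<^sub>R x)) + partial_derivative i
          f x * \<rho> (shrink k *\<^sub>R x))" for k
      by (simp add: partial_derivative_mult schwartz_smooth base smooth_scale partial_derivative_scale mult_ac)
    moreover have "(\<lambda>k x. f x * partial_derivative i \<rho> (shrink k *\<^sub>R x)) \<in> escaping"
      using t by (intro escaping.base base(1)) (auto intro: test_smooth
        partial_derivative_eq_0_ball[OF base(4)])
    moreover have "(\<lambda>k x. partial_derivative i f x * \<rho> (shrink k *\<^sub>R x)) \<in> escaping"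
      by (intro escaping.base schwartz_partial_derivative base)
    ultimately show ?thesis by (simp add: escaping.add escaping.scale shrink)
  qed
  ultimately show ?case using S by blast
next
  case (add F G)
  have L: "F k \<in> L2_functions" "G k \<in> L2_functions" for k using add.IH by (auto intro: schwartz_L2)
  have "(\<lambda>k. L2_function_norm (F k) + L2_function_norm (G k)) \<longlonglongrightarrow> 0 + 0" using add.IH by (intro tendsto_add) auto
  then have lim: "(\<lambda>k. L2_function_norm (F k) + L2_function_norm (G k)) \<longlonglongrightarrow> 0" by simp
  have "\<forall>\<^sub>F k in sequentially. norm (L2_function_norm (\<lambda>x. F k x + G k x)) \<le> L2_function_norm (F k) +
      L2_function_norm (G k)"
    by (rule always_eventually) (simp add: L2_norm_nonneg L2_triangle L)
  from Lim_null_comparison[OF this lim]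
  have "(\<lambda>k. L2_function_norm (\<lambda>x. F k x + G k x)) \<longlonglongrightarrow> 0" .
  moreover have "(\<lambda>k. partial_derivative i (\<lambda>x. F k x + G k x)) \<in> escaping" for i
    using add.IH by (simp add: partial_derivative_add schwartz_smooth escaping.add)
  ultimately show ?case using add.IH by (simp add: schwartz_add)
next
  case (scale F c)
  have "(\<lambda>k. L2_function_norm (\<lambda>x. of_real (c k) * F k x)) \<longlonglongrightarrow> 0"
  proof (rule Lim_null_comparison[OF always_eventually[OF allI]])
    fix k
    have "F k \<in> L2_functions" using scale.IH by (auto intro: schwartz_L2)
    from L2_cmult(2)[OF this] show "norm (L2_function_norm (\<lambda>x. of_real (c k) * F k x)) \<le>
        L2_function_norm (F k)"
      using mult_right_mono[OF scale.hyps(2)[of k] L2_norm_nonneg[of "F k"]] by (simp add: L2_norm_nonneg)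
  qed (use scale.IH in simp)
  moreover have "(\<lambda>k. partial_derivative i (\<lambda>x. of_real (c k) * F k x)) \<in> escaping" for i
    using scale by (simp add: partial_derivative_cmult schwartz_smooth escaping.scale)
  ultimately show ?case using scale.IH by (simp add: schwartz_cmult)
qed

lemma escaping_zero:
  fixes F :: "nat \<Rightarrow> real ^ 'n::finite \<Rightarrow> complex"
  assumes "F \<in> escaping" shows "(\<lambda>k x. 0) \<in> (escaping :: (nat \<Rightarrow> real ^ 'n \<Rightarrow> complex) set)"
  using assms escaping.scale[of F "\<lambda>k. 0"] by simp

lemma escaping_bessel:
  fixes F :: "nat \<Rightarrow> real ^ 'n::finite \<Rightarrow> complex"
  assumes "F \<in> escaping" shows "(\<lambda>k. bessel (F k)) \<in> escaping"
proof -
  have "(\<lambda>k x. \<Sum>i\<in>I. partial_derivative i (partial_derivative i (F k)) x) \<in> escaping" for I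
  proof (induction I rule: infinite_finite_induct)
    case (insert i I)
    have "(\<lambda>k. partial_derivative i (partial_derivative i (F k))) \<in> escaping"
      using escaping_step[OF assms] escaping_step[of "\<lambda>k. partial_derivative i (F k)"] by blast
    from escaping.add[OF this insert.IH] show ?case using insert.hyps by simp
  qed (use escaping_zero[OF assms] in simp_all)
  from escaping.add[OF assms escaping.scale[OF this, of "\<lambda>k. -1"]] show ?thesis
    unfolding bessel_def[abs_def] by simp
qed

lemma escaping_bessel_power: "F \<in> escaping \<Longrightarrow> (\<lambda>k. (bessel ^^ m) (F k)) \<in> escaping"
  by (induction m) (auto intro: escaping_bessel)

text \<open>The bracket is dominated by the symbol of a power of \<open>bessel\<close>; Plancherel's
  identity removes the transform.\<close>

lemma Sob_le_bessel:
  fixes b :: "'n::finite \<Rightarrow> 'j::finite"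
  obtains m where "\<And>\<phi>. \<phi> \<in> schwartz_functions \<Longrightarrow> Sob b r \<phi> \<le> L2_function_norm ((bessel ^^ m) \<phi>)"
proof -
  let ?K = "(2 * pi) ^ CARD('n)"
  have K: "?K > 0" by simp
  obtain m where m: "\<And>\<xi>. bracket b r \<xi> \<le> (1 + (norm \<xi>)\<^sup>2) ^ m" using bracket_le_power[of b r] by metis
  have "Sob b r \<phi> \<le> L2_function_norm ((bessel ^^ m) \<phi>)" if \<phi>: "\<phi> \<in> schwartz_functions" for \<phi>
  proof -
    let ?g = "(bessel ^^ m) \<phi>"
    have g: "?g \<in> schwartz_functions" by (rule schwartz_bessel_power[OF \<phi>])
    have IF: "inverse_fourier ?g \<xi> = of_real ((1 + (norm \<xi>)\<^sup>2) ^ m) * inverse_fourier \<phi> \<xi>" for \<xi>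
      by (simp add: inverse_fourier_eq fourier_bessel_power[OF \<phi>])
    have 1: "(L2_function_norm ?g)\<^sup>2 = ?K * (L2_function_norm (inverse_fourier ?g))\<^sup>2"
      using Plancherel[OF schwartz_inverse_fourier[OF g]] by (simp add: fourier_inverse_fourier[OF g])
    have "W2 b r \<phi> \<le> (\<integral>\<^sup>+\<xi>. ennreal ((cmod (inverse_fourier ?g \<xi>))\<^sup>2) \<partial>lborel)"
      unfolding W2_def
    proof (intro nn_integral_mono ennreal_leI power_mono)
      fix \<xi>
      have "bracket b r \<xi> * cmod (inverse_fourier \<phi> \<xi>) \<le> (1 + (norm \<xi>)\<^sup>2) ^ m * cmod (inverse_fourier \<phi> \<xi>)"
        by (intro mult_right_mono m) simp
      also have "\<dots> = cmod (inverse_fourier ?g \<xi>)"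
        unfolding IF norm_mult norm_of_real by simp
      finally show "bracket b r \<xi> * cmod (inverse_fourier \<phi> \<xi>) \<le> cmod (inverse_fourier ?g \<xi>)" .
    qed simp
    then have "(Sob b r \<phi>)\<^sup>2 / ?K \<le> (L2_function_norm (inverse_fourier ?g))\<^sup>2"
      unfolding W2_eq[OF \<phi>] L2_nn_integral[OF schwartz_L2[OF schwartz_inverse_fourier[OF g]]]
        by (simp add: ennreal_le_iff)
    then have "(Sob b r \<phi>)\<^sup>2 \<le> (L2_function_norm ?g)\<^sup>2"
      unfolding 1 using K by (simp add: pos_divide_le_eq mult.commute)
    then show ?thesis by (rule power2_le_imp_le) (rule L2_norm_nonneg)
  qed
  with that show thesis by blast
qed

text \<open>The truncation error is \<phi> times 1 - \<eta>(x / (k + 1)), an escaping sequence, and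
  so is its image under any power of \<open>bessel\<close>. Since such a power controls the norm of
  order \<open>r\<close>, the error tends to 0 for every \<open>r\<close>.\<close>

lemma test_dense:
  assumes \<phi>: "\<phi> \<in> schwartz_functions"
  obtains \<psi> where "\<And>k::nat. \<psi> k \<in> test_functions" "(\<lambda>k. Sob b r (\<lambda>x. \<phi> x - \<psi> k x)) \<longlonglongrightarrow> 0"
proof -
  obtain \<eta> :: "real ^ 'a \<Rightarrow> complex" where \<eta>: "\<eta> \<in> test_functions" "\<And>x. norm x \<le> 1 \<Longrightarrow> \<eta> x = 1"
    using cutoff_exists by blast
  obtain m where m: "\<And>\<phi>. \<phi> \<in> schwartz_functions \<Longrightarrow> Sob b r \<phi> \<le> L2_function_norm ((bessel ^^ m) \<phi>)"
    using Sob_le_bessel[of b r] by metis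
  have "(\<lambda>k x. \<phi> x * (1 + (-1) * \<eta> (shrink k *\<^sub>R x))) \<in> escaping"
  proof (rule escaping.base[OF \<phi>, of "\<lambda>x. 1 + (-1) * \<eta> x"])
    show "smooth (\<lambda>x. 1 + (-1) * \<eta> x)" by (intro smooth_add smooth_const smooth_mult test_smooth \<eta>)
    have "(\<lambda>x. 1 + (-1) * (1 + (-1) * \<eta> x)) \<in> test_functions" using \<eta>(1) by simp
    then show "(\<lambda>x. 1 + (-1) * \<eta> x) \<in> test_functions \<or> (\<lambda>x. 1 + (-1) * (1 + (-1) * \<eta> x)) \<in> test_functions" ..
  qed (simp add: \<eta>)
  note E = escaping_step[OF this] escaping_step[OF escaping_bessel_power[OF this, of m]]
  have "(\<lambda>k. Sob b r (\<lambda>x. \<phi> x * (1 + (-1) * \<eta> (shrink k *\<^sub>R x)))) \<longlonglongrightarrow> 0"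
    by (rule Lim_null_comparison[OF always_eventually[OF allI]], subst real_norm_def, subst
      abs_of_nonneg[OF Sob_nonneg], rule m)
       (use E in auto)
  then have 1: "(\<lambda>k. Sob b r (\<lambda>x. \<phi> x - \<eta> (shrink k *\<^sub>R x) * \<phi> x)) \<longlonglongrightarrow> 0"
    by (simp add: algebra_simps)
  have 2: "(\<lambda>x. \<eta> (shrink k *\<^sub>R x) * \<phi> x) \<in> test_functions" for k
    using test_smooth_mult[OF schwartz_smooth[OF \<phi>] test_scale[OF \<eta>(1) shrink(1)], of k]
      by (simp add: mult.commute)
  show thesis by (rule that[OF 2 1])
qed

subsection \<open>Seminorm bounds\<close>

lemma partial_derivatives_add:
  "smooth f \<Longrightarrow> smooth g \<Longrightarrow> partial_derivatives is (\<lambda>x. f x + g x) =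
    (\<lambda>x. partial_derivatives is f x + partial_derivatives is g x)"
  by (induction "is") (simp_all add: partial_derivative_add smooth_partial_derivatives)

lemma partial_derivatives_cmult:
  "smooth f \<Longrightarrow> partial_derivatives is (\<lambda>x. c * f x) = (\<lambda>x. c * partial_derivatives is f x)"
  by (induction "is") (simp_all add: partial_derivative_cmult smooth_partial_derivatives)

lemma partial_derivatives_sum:
  assumes "finite I" "\<And>i. i \<in> I \<Longrightarrow> smooth (f i)"
  shows "partial_derivatives is (\<lambda>x. \<Sum>i\<in>I. f i x) = (\<lambda>x. \<Sum>i\<in>I. partial_derivatives is (f i) x)"
  using assms
proof (induction I rule: finite_induct)
  case empty
  have "partial_derivatives is (\<lambda>x. 0 * (0::complex)) = (\<lambda>x. 0 * partial_derivatives is (\<lambda>x. 0) x)"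
    by (rule partial_derivatives_cmult) simp
  then show ?case by simp
next
  case (insert i I)
  then show ?case by (simp add: partial_derivatives_add smooth_sum)
qed

text \<open>Each application of \<open>bessel\<close> costs two derivatives and produces at most 1 +
  n terms. The point \<open>x\<close> and the weight \<open>w\<close> stay fixed throughout the
  induction.\<close>

lemma bessel_power_bound:
  fixes f :: "real ^ 'n::finite \<Rightarrow> complex"
  assumes "smooth f" "\<And>is. length is \<le> l + 2 * m \<Longrightarrow> w * cmod (partial_derivatives is f x) \<le> B" "w \<ge> 0"
    and "length is \<le> l"
  shows "w * cmod (partial_derivatives is ((bessel ^^ m) f) x) \<le> (1 + real CARD('n)) ^ m * B"
  using assms
proof (induction m arbitrary: f B)
  case (Suc m)
  have sm: "smooth (bessel f)"
    unfolding bessel_def[abs_def] using Suc.prems(1)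
    by (intro smooth_add smooth_mult smooth_const smooth_sum smooth_partial_derivative)
  have "w * cmod (partial_derivatives is (bessel f) x) \<le> (1 + real CARD('n)) * B"
      if "length is \<le> l + 2 * m" for "is"
  proof -
    have eq: "partial_derivatives is (bessel f) x =
        partial_derivatives is f x + (-1) * (\<Sum>i\<in>UNIV. partial_derivatives (is @ [i, i]) f x)"
    proof -
      have s2: "smooth (partial_derivative i (partial_derivative i f))" for i
        by (intro smooth_partial_derivative Suc.prems)
      have "partial_derivatives is (bessel f) = (\<lambda>x. partial_derivatives is f x + (-1) *
          (\<Sum>i\<in>UNIV. partial_derivatives is (partial_derivative i (partial_derivative i f)) x))"
        unfolding bessel_def[abs_def]
        by (subst partial_derivatives_add, rule Suc.prems, intro smooth_mult smooth_const smooth_sum s2,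
            subst partial_derivatives_cmult, intro smooth_sum s2, subst partial_derivatives_sum)
              (simp_all add: s2)
      then show ?thesis by (simp add: partial_derivatives_snoc)
    qed
    have "w * cmod (partial_derivatives is (bessel f) x) \<le> w *
        (cmod (partial_derivatives is f x) + (\<Sum>i\<in>UNIV. cmod (partial_derivatives (is @ [i, i]) f x)))"
    proof (intro mult_left_mono Suc.prems)
      have "cmod (partial_derivatives is (bessel f) x) \<le> cmod (partial_derivatives is f x) + cmod
          (\<Sum>i\<in>UNIV. partial_derivatives (is @ [i, i]) f x)"
        unfolding eq using norm_triangle_ineq4 by simp
      also have "cmod (\<Sum>i\<in>UNIV. partial_derivatives (is @ [i, i]) f x) \<le>
          (\<Sum>i\<in>UNIV. cmod (partial_derivatives (is @ [i, i]) f x))"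
        by (rule norm_sum)
      finally show "cmod (partial_derivatives is (bessel f) x) \<le> cmod (partial_derivatives is f x) +
          (\<Sum>i\<in>UNIV. cmod (partial_derivatives (is @ [i, i]) f x))"
        by simp
    qed
    also have "\<dots> = w * cmod (partial_derivatives is f x) +
        (\<Sum>i\<in>UNIV. w * cmod (partial_derivatives (is @ [i, i]) f x))"
      by (simp add: distrib_left sum_distrib_left)
    also have "\<dots> \<le> B + (\<Sum>i\<in>(UNIV::'n set). B)"
      using that by (intro add_mono sum_mono Suc.prems(2)) auto
    finally show ?thesis by (simp add: algebra_simps)
  qed
  from Suc.IH[OF sm this Suc.prems(3,4)] show ?case
    by (simp add: funpow_swap1 mult_ac)
qed simp

text \<open>The hypothesis is a pointwise bound \<open>B\<close> rather than a seminorm, so that the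
  seminorms of test functions and of Schwartz functions can both be inserted.\<close>

lemma bessel_L2_bound:
  fixes b :: "'n::finite \<Rightarrow> 'j::finite"
  shows "\<exists>N C. C \<ge> 0 \<and> (\<forall>f\<in>schwartz_functions. \<forall>B.
    (\<forall>is x. length is \<le> N \<longrightarrow> (1 + norm x) ^ N * cmod (partial_derivatives is f x) \<le> B) \<longrightarrow> Sob b r f \<le> C * B)"
proof -
  obtain m where m: "\<And>\<phi>. \<phi> \<in> schwartz_functions \<Longrightarrow> Sob b r \<phi> \<le> L2_function_norm ((bessel ^^ m) \<phi>)"
    using Sob_le_bessel[of b r] by metis
  \<comment> \<open>The part \<open>2 * m\<close> pays for the derivatives in
    \<open>bessel ^^ m\<close>; the part \<open>CARD('n)\<close> gives, after squaring, the power
    occurring in \<open>decay\<close>.\<close>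
  define N where "N = 2 * m + CARD('n)"
  define D where "D = (\<integral>x. decay (x :: real ^ 'n) \<partial>lborel)"
  have D0: "D \<ge> 0" unfolding D_def by (intro integral_nonneg_AE AE_I2) (simp add: decay_pos less_imp_le)
  define C where "C = (1 + real CARD('n)) ^ m * sqrt D"
  have "Sob b r f \<le> C * B" if f: "f \<in> schwartz_functions"
    and B: "\<And>is x. length is \<le> N \<Longrightarrow> (1 + norm x) ^ N * cmod (partial_derivatives is f x) \<le> B" for f B
  proof -
    define E where "E = (1 + real CARD('n)) ^ m * B"
    have g: "(bessel ^^ m) f \<in> schwartz_functions" by (rule schwartz_bessel_power[OF f])
    have [measurable]: "(bessel ^^ m) f \<in> borel_measurable borel" by (rule schwartz_measurable[OF g])
    have "0 \<le> (1 + norm (0 :: real ^ 'n)) ^ N * cmod (partial_derivatives [] f 0)" by simp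
    also have "\<dots> \<le> B" by (rule B) simp
    finally have B0: "B \<ge> 0" .
    then have E0: "E \<ge> 0" by (simp add: E_def)
    have pw: "(1 + norm x) ^ N * cmod ((bessel ^^ m) f x) \<le> E" for x
      using bessel_power_bound[of f 0 m "(1 + norm x) ^ N" x B "[]"] B schwartz_smooth[OF f]
      by (simp add: N_def E_def)
    have sq: "(cmod ((bessel ^^ m) f x))\<^sup>2 \<le> E\<^sup>2 * decay x" for x
    proof -
      have "((1 + norm x) ^ N * cmod ((bessel ^^ m) f x))\<^sup>2 \<le> E\<^sup>2"
        by (intro power_mono pw) simp
      then have 1: "(1 + norm x) ^ (2 * N) * (cmod ((bessel ^^ m) f x))\<^sup>2 \<le> E\<^sup>2"
        by (simp add: power_mult_distrib power_mult[symmetric] mult.commute)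
      have "(1 + norm x) ^ (2 * CARD('n)) * (cmod ((bessel ^^ m) f x))\<^sup>2 \<le> (1 + norm x) ^ (2 * N) *
          (cmod ((bessel ^^ m) f x))\<^sup>2"
        by (intro mult_right_mono power_increasing) (auto simp: N_def)
      also note 1
      finally show ?thesis
        by (simp add: decay_def field_simps add_pos_nonneg)
    qed
    have "(\<integral>\<^sup>+x. ennreal ((cmod ((bessel ^^ m) f x))\<^sup>2) \<partial>lborel) \<le>
        (\<integral>\<^sup>+x. ennreal (E\<^sup>2 * decay (x :: real ^ 'n)) \<partial>lborel)"
      by (intro nn_integral_mono ennreal_leI sq)
    also have "\<dots> = ennreal (\<integral>x. E\<^sup>2 * decay (x :: real ^ 'n) \<partial>lborel)"
      by (intro nn_integral_eq_integral integrable_mult_right integrable_decay)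
        (simp add: decay_pos less_imp_le)
    also have "(\<integral>x. E\<^sup>2 * decay (x :: real ^ 'n) \<partial>lborel) = (E * sqrt D)\<^sup>2"
      using D0 by (simp add: D_def power_mult_distrib)
    finally have "L2_function_norm ((bessel ^^ m) f) \<le> E * sqrt D"
      by (rule L2_functionsI(2)[rotated]) (use E0 D0 in simp_all)
    then show ?thesis using m[OF f] by (simp add: C_def E_def mult_ac)
  qed
  moreover have "C \<ge> 0" using D0 by (simp add: C_def)
  ultimately show ?thesis by blast
qed

lemma finite_short_lists: "finite {is :: 'n::finite list. length is \<le> N}"
  using finite_lists_length_le[of "UNIV :: 'n set" N] by simp

lemma schwartz_seminorm_upper:
  assumes f: "f \<in> schwartz_functions" and "length is \<le> N"
  shows "(1 + norm x) ^ N * cmod (partial_derivatives is f x) \<le> schwartz_seminorm N f"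
proof -
  have "\<exists>C. \<forall>x. (1 + norm x) ^ N * cmod (partial_derivatives is f x) \<le> C" for "is"
    using f unfolding schwartz_iff_rapid rapid_def by blast
  then obtain C where C: "\<And>is x. (1 + norm x) ^ N * cmod (partial_derivatives is f x) \<le> C is" by metis
  have "bdd_above ((\<lambda>(is, x). (1 + norm x) ^ N * cmod (partial_derivatives is f x)) `
      ({is. length is \<le> N} \<times> UNIV))"
  proof (rule bdd_aboveI2)
    fix p :: "'a list \<times> (real ^ 'a)" assume "p \<in> {is. length is \<le> N} \<times> UNIV"
    then obtain "is" x where p: "p = (is, x)" "length is \<le> N" by auto
    have "C is \<le> Max (C ` {is. length is \<le> N})" using p finite_short_lists by (intro Max_ge) auto
    then show "(case p of (is, x) \<Rightarrow> (1 + norm x) ^ N * cmod (partial_derivatives is f x)) \<le> Max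
        (C ` {is. length is \<le> N})"
      using C[of x "is"] p by auto
  qed
  from cSUP_upper[OF _ this, of "(is, x)"] show ?thesis using assms unfolding schwartz_seminorm_def by simp
qed

lemma test_seminorm_upper:
  assumes f: "f \<in> test_functions" and "length is \<le> N"
  shows "cmod (partial_derivatives is f x) \<le> test_seminorm N f"
proof -
  have "\<exists>C. \<forall>x. cmod (partial_derivatives is f x) \<le> C" for "is"
    using test_imp_schwartz[OF f] rapid_imp_bounded unfolding schwartz_iff_rapid by blast
  then obtain C where C: "\<And>is x. cmod (partial_derivatives is f x) \<le> C is" by metis
  have "bdd_above ((\<lambda>(is, x). cmod (partial_derivatives is f x)) ` ({is. length is \<le> N} \<times> UNIV))"
  proof (rule bdd_aboveI2)
    fix p :: "'a list \<times> (real ^ 'a)" assume "p \<in> {is. length is \<le> N} \<times> UNIV"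
    then obtain "is" x where p: "p = (is, x)" "length is \<le> N" by auto
    have "C is \<le> Max (C ` {is. length is \<le> N})" using p finite_short_lists by (intro Max_ge) auto
    then show "(case p of (is, x) \<Rightarrow> cmod (partial_derivatives is f x)) \<le> Max (C ` {is. length is \<le> N})"
      using C[of "is" x] p by auto
  qed
  from cSUP_upper[OF _ this, of "(is, x)"] show ?thesis using assms unfolding test_seminorm_def by simp
qed

lemma Sob_le_schwartz_seminorm:
  fixes b :: "'n::finite \<Rightarrow> 'j::finite"
  obtains C N where "\<And>f. f \<in> schwartz_functions \<Longrightarrow> Sob b r f \<le> C * schwartz_seminorm N f" "C \<ge> 0"
proof -
  obtain N C where *: "C \<ge> 0" "\<And>f B. f \<in> schwartz_functions \<Longrightarrow>
    (\<And>is x. length is \<le> N \<Longrightarrow> (1 + norm x) ^ N * cmod (partial_derivatives is f x) \<le> B) \<Longrightarrow> Sob b r f \<le> C * B"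
    using bessel_L2_bound[of b r] by blast
  show thesis by (rule that[of C N]) (auto intro!: *(2) schwartz_seminorm_upper *(1))
qed

lemma partial_derivatives_eq_0_outside:
  assumes "\<And>x. norm x > R \<Longrightarrow> f x = 0" "norm x > R"
  shows "partial_derivatives is f x = 0"
proof -
  have "\<forall>x. norm x > R \<longrightarrow> partial_derivatives is f x = 0"
  proof (induction "is")
    case (Cons i "is")
    then show ?case using partial_derivative_eq_0_outside[of R "partial_derivatives is f"] by simp
  qed (simp add: assms)
  then show ?thesis using assms by blast
qed

lemma Sob_le_test_seminorm:
  fixes b :: "'n::finite \<Rightarrow> 'j::finite"
  obtains C N where "\<And>f. f \<in> test_functions \<Longrightarrow> (\<And>x. norm x > R \<Longrightarrow> f x = 0) \<Longrightarrow>
      Sob b r f \<le> C * test_seminorm N f" "C \<ge> 0"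
proof -
  obtain N C where *: "C \<ge> 0" "\<And>f B. f \<in> schwartz_functions \<Longrightarrow>
    (\<And>is x. length is \<le> N \<Longrightarrow> (1 + norm x) ^ N * cmod (partial_derivatives is f x) \<le> B) \<Longrightarrow> Sob b r f \<le> C * B"
    using bessel_L2_bound[of b r] by blast
  \<comment> \<open>A bound for the polynomial weight on the ball that contains the support.\<close>
  define D where "D = (1 + \<bar>R\<bar>) ^ N"
  have "Sob b r f \<le> (C * D) * test_seminorm N f" if f: "f \<in> test_functions" "\<And>x. norm x > R \<Longrightarrow> f x = 0" for f
    unfolding mult.assoc
  proof (rule *(2)[OF test_imp_schwartz[OF f(1)]])
    fix "is" :: "'n list" and x :: "real ^ 'n" assume l: "length is \<le> N"
    have t0: "0 \<le> test_seminorm N f" using test_seminorm_upper[OF f(1) l] norm_ge_zero order_trans by blast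
    show "(1 + norm x) ^ N * cmod (partial_derivatives is f x) \<le> D * test_seminorm N f"
    proof (cases "norm x > R")
      case True
      then show ?thesis using t0 partial_derivatives_eq_0_outside[OF f(2) True] by (simp add: D_def)
    next
      case False
      then show ?thesis unfolding D_def
        by (intro mult_mono power_mono test_seminorm_upper f l) auto
    qed
  qed
  moreover have "C * D \<ge> 0" using *(1) by (simp add: D_def)
  ultimately show thesis by (rule that)
qed

subsection \<open>Sobolev spaces by duality\<close>

text \<open>By Riesz representation this says that \<open>u\<close> lies in H^s with norm at most
  \<open>C\<close>, a form in which limits and products are handled without naming a representing
  function. Linearity is included because distributions are bare functionals here.\<close>

definition dual_bound :: "('n::finite \<Rightarrow> 'j::finite) \<Rightarrow> real ^ 'j \<Rightarrow> 'n func \<Rightarrow> real \<Rightarrow> bool" where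
  "dual_bound b s u C \<longleftrightarrow> linear_functional_on test_functions u \<and> C \<ge> 0 \<and>
     (\<forall>\<phi>\<in>test_functions. cmod (u \<phi>) \<le> C * Sob b (- s) \<phi>)"

lemma bracket_D_eq: "bracket_D b s U \<phi> = U (bpot b s \<phi>)"
  by (simp add: bracket_D_def fourier_multiplier_def inverse_fourier_distribution_def
      mult_distribution_def fourier_distribution_def bpot_def)

lemma integral_L2_schwartz_add:
  assumes "f \<in> L2_functions" "g \<in> L2_functions" "h \<in> L2_functions"
  shows "(\<integral>x. f x * (g x + h x) \<partial>lborel) = (\<integral>x. f x * g x \<partial>lborel) + (\<integral>x. f x * h x \<partial>lborel)"
  unfolding distrib_left by (intro Bochner_Integration.integral_add L2_mult_integrable assms)

lemma integral_L2_diff: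
  assumes "f \<in> L2_functions" "g \<in> L2_functions" "h \<in> L2_functions"
  shows "(\<integral>x. (f x - g x) * h x \<partial>lborel) = (\<integral>x. f x * h x \<partial>lborel) - (\<integral>x. g x * h x \<partial>lborel)"
  unfolding left_diff_distrib by (intro Bochner_Integration.integral_diff L2_mult_integrable assms)

lemma integral_mult_cmult:
  fixes f g :: "real ^ 'n::finite \<Rightarrow> complex"
  shows "(\<integral>x. f x * (c * g x) \<partial>lborel) = c * (\<integral>x. f x * g x \<partial>lborel)"
  by (subst integral_mult_right_zero[symmetric]) (simp add: mult.left_commute)

lemma linear_functional_integral_bpot:
  assumes f: "f \<in> L2_functions"
  shows "linear_functional_on schwartz_functions (\<lambda>\<phi>. \<integral>x. f x * bpot b s \<phi> x \<partial>lborel)"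
  unfolding linear_functional_on_def
  by (simp add: bpot_add bpot_cmult integral_L2_schwartz_add f bpot_L2 integral_mult_cmult)

lemma linear_functional_on_subset:
  "linear_functional_on V u \<Longrightarrow> W \<subseteq> V \<Longrightarrow> linear_functional_on W u"
  unfolding linear_functional_on_def by blast

lemma linear_functional_on_cong:
  assumes "linear_functional_on test_functions u" "same_distribution u v"
  shows "linear_functional_on test_functions v"
  using assms unfolding linear_functional_on_def same_distribution_def
  by (auto simp: test_add test_cmult)

text \<open>\<open>bpot b (- s) \<phi>\<close> is a Schwartz function but in general has no compact
  support, so the tempered extension has to be evaluated there, not \<open>u\<close> itself.\<close>

lemma represents_imp_integral:
  assumes "represents_bracket_D b s u f" "\<phi> \<in> test_functions"
  shows "u \<phi> = (\<integral>x. f x * bpot b (- s) \<phi> x \<partial>lborel)"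
proof -
  obtain U where U: "same_distribution U u" "\<forall>\<phi>\<in>schwartz_functions. bracket_D b s U \<phi> = distribution_of f \<phi>"
    using assms(1) unfolding represents_bracket_D_def by blast
  have \<phi>: "\<phi> \<in> schwartz_functions" by (rule test_imp_schwartz[OF assms(2)])
  have "u \<phi> = U \<phi>" using U(1) assms(2) by (simp add: same_distribution_def)
  also have "\<dots> = bracket_D b s U (bpot b (- s) \<phi>)" by (simp add: bracket_D_eq bpot_bpot_minus[OF \<phi>])
  also have "\<dots> = (\<integral>x. f x * bpot b (- s) \<phi> x \<partial>lborel)"
    using U(2)[rule_format, OF bpot_schwartz[OF \<phi>]] by (simp add: distribution_of_def)
  finally show ?thesis .
qed

lemma represents_imp_dual_bound:
  assumes "represents_bracket_D b s u f"
  shows "dual_bound b s u (L2_function_norm f)"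
proof -
  have f: "f \<in> L2_functions" using assms by (simp add: represents_bracket_D_def)
  obtain U where U: "U \<in> tempered_distributions" "same_distribution U u"
    using assms unfolding represents_bracket_D_def by blast
  have "linear_functional_on test_functions U"
    using U(1) linear_functional_on_subset test_imp_schwartz unfolding tempered_distributions_def by blast
  then have "linear_functional_on test_functions u" using U(2) by (rule linear_functional_on_cong)
  moreover have "cmod (u \<phi>) \<le> L2_function_norm f * Sob b (- s) \<phi>" if "\<phi> \<in> test_functions" for \<phi>
    unfolding represents_imp_integral[OF assms that] Sob_def
    by (intro L2_Cauchy_Schwarz f bpot_L2 test_imp_schwartz that)
  ultimately show ?thesis by (simp add: dual_bound_def L2_norm_nonneg)
qed

lemma represents_if_integral:
  fixes b :: "'n::finite \<Rightarrow> 'j::finite"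
  assumes f: "f \<in> L2_functions"
    and u: "\<And>\<phi>. \<phi> \<in> test_functions \<Longrightarrow> u \<phi> = (\<integral>x. f x * bpot b (- s) \<phi> x \<partial>lborel)"
  shows "represents_bracket_D b s u f"
proof -
  \<comment> \<open>The formula makes sense for all Schwartz functions and thereby supplies the
    tempered extension.\<close>
  define U where "U \<phi> = (\<integral>x. f x * bpot b (- s) \<phi> x \<partial>lborel)" for \<phi>
  obtain C N where CN: "\<And>\<phi>. \<phi> \<in> schwartz_functions \<Longrightarrow> Sob b (- s) \<phi> \<le> C * schwartz_seminorm N \<phi>"
    using Sob_le_schwartz_seminorm[of b "- s"] by blast
  have "cmod (U \<phi>) \<le> (L2_function_norm f * C) * schwartz_seminorm N \<phi>" if \<phi>: "\<phi> \<in> schwartz_functions" for \<phi>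
  proof -
    have "cmod (U \<phi>) \<le> L2_function_norm f * Sob b (- s) \<phi>"
      unfolding U_def Sob_def by (intro L2_Cauchy_Schwarz f bpot_L2 \<phi>)
    also have "\<dots> \<le> L2_function_norm f * (C * schwartz_seminorm N \<phi>)"
      by (intro mult_left_mono CN \<phi> L2_norm_nonneg)
    finally show ?thesis by (simp add: mult.assoc)
  qed
  then have "U \<in> tempered_distributions"
    using linear_functional_integral_bpot[OF f, of b "- s"]
      unfolding tempered_distributions_def U_def[abs_def] by blast
  moreover have "same_distribution U u" by (simp add: same_distribution_def U_def u)
  moreover have "bracket_D b s U \<phi> = distribution_of f \<phi>" if "\<phi> \<in> schwartz_functions" for \<phi>
    by (simp add: bracket_D_eq U_def bpot_minus_bpot[OF that] distribution_of_def)
  ultimately show ?thesis using f unfolding represents_bracket_D_def by blast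
qed

text \<open>Density of the test functions. The crude constant \<open>E\<close> only multiplies an
  error that tends to 0, so the sharp constant \<open>D\<close> survives the extension to Schwartz
  functions.\<close>

lemma dual_bound_schwartz_limit:
  assumes bound: "\<And>\<phi>. \<phi> \<in> test_functions \<Longrightarrow> cmod (U \<phi>) \<le> D * Sob b r \<phi>"
    and diff: "\<And>\<phi> \<psi>. \<phi> \<in> schwartz_functions \<Longrightarrow> \<psi> \<in> test_functions \<Longrightarrow>
      cmod (U \<phi> - U \<psi>) \<le> E * Sob b r (\<lambda>x. \<phi> x - \<psi> x)"
    and \<phi>: "\<phi> \<in> schwartz_functions" and D: "D \<ge> 0"
  shows "cmod (U \<phi>) \<le> D * Sob b r \<phi>"
proof -
  obtain \<psi> where \<psi>: "\<And>k::nat. \<psi> k \<in> test_functions" "(\<lambda>k. Sob b r (\<lambda>x. \<phi> x - \<psi> k x)) \<longlonglongrightarrow> 0"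
    using test_dense[OF \<phi>, of b r] by metis
  have le: "cmod (U \<phi>) \<le> D * Sob b r \<phi> + (D + E) * Sob b r (\<lambda>x. \<phi> x - \<psi> k x)" for k
  proof -
    have \<psi>S: "\<psi> k \<in> schwartz_functions" by (rule test_imp_schwartz[OF \<psi>(1)])
    have d: "(\<lambda>x. \<phi> x - \<psi> k x) \<in> schwartz_functions" by (rule schwartz_diff[OF \<phi> \<psi>S])
    have "bpot b r (\<lambda>x. \<phi> x + (-1) * (\<phi> x - \<psi> k x)) = (\<lambda>x. bpot b r \<phi> x + (-1) * bpot b r (\<lambda>x. \<phi> x - \<psi> k x) x)"
      using bpot_add[OF \<phi> schwartz_cmult[OF d, of "-1"], of b r] unfolding bpot_cmult .
    then have "Sob b r (\<psi> k) = L2_function_norm (\<lambda>x. bpot b r \<phi> x + (-1) * bpot b r (\<lambda>x. \<phi> x - \<psi> k x) x)"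
      unfolding Sob_def by simp
    also have "\<dots> \<le> Sob b r \<phi> + L2_function_norm (\<lambda>x. (-1) * bpot b r (\<lambda>x. \<phi> x - \<psi> k x) x)"
      unfolding Sob_def by (intro L2_triangle L2_cmult bpot_L2 \<phi> d)
    also have "L2_function_norm (\<lambda>x. (-1) * bpot b r (\<lambda>x. \<phi> x - \<psi> k x) x) = Sob b r (\<lambda>x. \<phi> x - \<psi> k x)"
      unfolding L2_cmult(2)[OF bpot_L2[OF d]] by (simp add: Sob_def)
    finally have 1: "Sob b r (\<psi> k) \<le> Sob b r \<phi> + Sob b r (\<lambda>x. \<phi> x - \<psi> k x)" .
    have "cmod (U \<phi>) \<le> cmod (U (\<psi> k)) + cmod (U \<phi> - U (\<psi> k))"
      using norm_triangle_ineq[of "U (\<psi> k)" "U \<phi> - U (\<psi> k)"] by simp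
    also have "\<dots> \<le> D * Sob b r (\<psi> k) + E * Sob b r (\<lambda>x. \<phi> x - \<psi> k x)"
      by (intro add_mono bound diff \<psi> \<phi>)
    also have "\<dots> \<le> D * (Sob b r \<phi> + Sob b r (\<lambda>x. \<phi> x - \<psi> k x)) + E * Sob b r (\<lambda>x. \<phi> x - \<psi> k x)"
      by (intro add_mono mult_left_mono 1 D order_refl)
    finally show ?thesis by (simp add: algebra_simps)
  qed
  have "(\<lambda>k. D * Sob b r \<phi> + (D + E) * Sob b r (\<lambda>x. \<phi> x - \<psi> k x)) \<longlonglongrightarrow> D * Sob b r \<phi> + (D + E) * 0"
    by (intro tendsto_add tendsto_mult tendsto_const \<psi>)
  from LIMSEQ_le_const[OF this, of "cmod (U \<phi>)"] le show ?thesis by auto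
qed

text \<open>The difference of the two functions annihilates \<open>bpot b (- s)\<close> of every
  test function, by density of every Schwartz function, and \<open>bpot b (- s)\<close> is onto. The
  arbitrary choice inside \<open>sobolev_norm\<close> is therefore harmless.\<close>

lemma represents_unique_norm:
  assumes "represents_bracket_D b s u f" "represents_bracket_D b s u g"
  shows "L2_function_norm f = L2_function_norm g"
proof -
  have f: "f \<in> L2_functions" and g: "g \<in> L2_functions" using assms by (auto simp: represents_bracket_D_def)
  let ?h = "\<lambda>x. f x - g x"
  have h: "?h \<in> L2_functions" by (rule L2_diff[OF f g])
  let ?U = "\<lambda>\<phi>. \<integral>x. ?h x * bpot b (- s) \<phi> x \<partial>lborel"
  have U0: "?U \<phi> = 0" if "\<phi> \<in> test_functions" for \<phi>
    using represents_imp_integral[OF assms(1) that] represents_imp_integral[OF assms(2) that]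
    by (simp add: integral_L2_diff[OF f g bpot_L2[OF test_imp_schwartz[OF that]]])
  have "cmod (?U \<phi>) \<le> 0 * Sob b (- s) \<phi>" if \<phi>: "\<phi> \<in> schwartz_functions" for \<phi>
  proof (rule dual_bound_schwartz_limit[where E = "L2_function_norm ?h"])
    fix \<phi> \<psi> :: "real ^ 'a \<Rightarrow> complex" assume \<phi>: "\<phi> \<in> schwartz_functions" and \<psi>: "\<psi> \<in> test_functions"
    have \<psi>S: "\<psi> \<in> schwartz_functions" by (rule test_imp_schwartz[OF \<psi>])
    have d: "(\<lambda>x. \<phi> x - \<psi> x) \<in> schwartz_functions" by (rule schwartz_diff[OF \<phi> \<psi>S])
    have "?U (\<lambda>x. \<psi> x + (\<phi> x - \<psi> x)) = ?U \<psi> + ?U (\<lambda>x. \<phi> x - \<psi> x)"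
      unfolding bpot_add[OF \<psi>S d] by (intro integral_L2_schwartz_add h bpot_L2 \<psi>S d)
    then have "?U \<phi> - ?U \<psi> = ?U (\<lambda>x. \<phi> x - \<psi> x)" by simp
    then show "cmod (?U \<phi> - ?U \<psi>) \<le> L2_function_norm ?h * Sob b (- s) (\<lambda>x. \<phi> x - \<psi> x)"
      unfolding Sob_def using L2_Cauchy_Schwarz[OF h bpot_L2[OF d]] by simp
  qed (use U0 \<phi> in simp_all)
  then have U0': "?U \<phi> = 0" if "\<phi> \<in> schwartz_functions" for \<phi> using that by fastforce
  have "AE x in lborel. ?h x = 0"
  proof (rule AE_0_if_orthogonal_to_test_functions[OF h])
    fix \<phi> :: "real ^ 'a \<Rightarrow> complex" assume "\<phi> \<in> test_functions"
    then have \<phi>: "\<phi> \<in> schwartz_functions" by (rule test_imp_schwartz)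
    show "(\<integral>x. ?h x * \<phi> x \<partial>lborel) = 0"
      using U0'[OF bpot_schwartz[OF \<phi>, of b s]] by (simp add: bpot_minus_bpot[OF \<phi>])
  qed
  then have "AE x in lborel. (cmod (f x))\<^sup>2 = (cmod (g x))\<^sup>2" by eventually_elim simp
  then have "(\<integral>x. (cmod (f x))\<^sup>2 \<partial>lborel) = (\<integral>x. (cmod (g x))\<^sup>2 \<partial>lborel)"
    using f g by (intro integral_cong_AE) (auto dest: L2_integrable)
  then show ?thesis by (simp add: L2_function_norm_def)
qed

lemma sobolev_norm_eq:
  assumes "represents_bracket_D b s u f"
  shows "sobolev_norm b s u = ennreal (L2_function_norm f)"
proof -
  have "u \<in> sobolev b s" using assms by (auto simp: sobolev_def)
  moreover have "represents_bracket_D b s u (SOME f. represents_bracket_D b s u f)" using assms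
    by (rule someI[where P = "represents_bracket_D b s u"])
  ultimately show ?thesis using represents_unique_norm[OF _ assms] by (simp add: sobolev_norm_def)
qed

lemma sobolevE:
  assumes "u \<in> sobolev b s"
  obtains C where "sobolev_norm b s u = ennreal C" "dual_bound b s u C"
  using assms sobolev_norm_eq represents_imp_dual_bound unfolding sobolev_def by blast

text \<open>Convergence of \<open>a\<close> to \<open>u\<close> in the Sobolev norm of order \<open>s\<close>, expressed by duality.\<close>

definition approximates :: "('n::finite \<Rightarrow> 'j::finite) \<Rightarrow> real ^ 'j \<Rightarrow> 'n func \<Rightarrow>
  (nat \<Rightarrow> real ^ 'n \<Rightarrow> complex) \<Rightarrow> bool" where
  "approximates b s u a \<longleftrightarrow> (\<forall>k. a k \<in> schwartz_functions) \<and>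
     (\<exists>e. e \<longlonglongrightarrow> 0 \<and> (\<forall>k. e k \<ge> 0) \<and> (\<forall>k. \<forall>\<phi>\<in>test_functions. cmod (u \<phi> - (\<integral>x. a k x * \<phi> x \<partial>lborel)) \<le> e k *
       Sob b (- s) \<phi>))"

text \<open>Riesz representation with the map \<open>bpot b (- s)\<close>: the bound says that the
  functional is continuous in the L^2 norm of the image. The minimizing sequence also yields the
  Schwartz approximations.\<close>

lemma dual_bound_imp:
  fixes b :: "'n::finite \<Rightarrow> 'j::finite"
  assumes "dual_bound b s u C"
  shows "u \<in> sobolev b s" "sobolev_norm b s u \<le> ennreal C" "\<exists>a. approximates b s u a"
proof -
  have u: "linear_functional_on test_functions u" "C \<ge> 0"
    and bound: "\<And>\<phi>. \<phi> \<in> test_functions \<Longrightarrow> cmod (u \<phi>) \<le> C * L2_function_norm (bpot b (- s) \<phi>)"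
    using assms by (auto simp: dual_bound_def Sob_def)
  obtain f \<psi> where f: "f \<in> L2_functions" "L2_function_norm f \<le> C"
      "\<And>\<phi>. \<phi> \<in> test_functions \<Longrightarrow> u \<phi> = (\<integral>x. f x * bpot b (- s) \<phi> x \<partial>lborel)"
    and \<psi>: "\<And>k::nat. \<psi> k \<in> test_functions" "(\<lambda>k. L2_function_norm (\<lambda>x. f x - cnj (bpot b (- s) (\<psi> k) x))) \<longlonglongrightarrow> 0"
  proof (rule Riesz_representation[of test_functions u "bpot b (- s)" C])
    fix f \<psi>
    assume "f \<in> L2_functions" "L2_function_norm f \<le> C"
      "\<And>\<phi>. \<phi> \<in> test_functions \<Longrightarrow> u \<phi> = (\<integral>x. f x * bpot b (- s) \<phi> x \<partial>lborel)"
      "\<And>k::nat. \<psi> k \<in> test_functions" "(\<lambda>k. L2_function_norm (\<lambda>x. f x - cnj (bpot b (- s) (\<psi> k) x))) \<longlonglongrightarrow> 0"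
    then show thesis by (rule that)
  qed (simp_all add: test_zero test_add test_cmult u bpot_add bpot_cmult bound test_imp_schwartz bpot_L2)
  have rep: "represents_bracket_D b s u f" by (rule represents_if_integral[OF f(1,3)])
  then show "u \<in> sobolev b s" by (auto simp: sobolev_def)
  show "sobolev_norm b s u \<le> ennreal C" unfolding sobolev_norm_eq[OF rep] by (rule ennreal_leI[OF f(2)])
  \<comment> \<open>The conjugates approximate the representing function \<open>f\<close> in L^2;
    one more application of \<open>bpot b (- s)\<close>, moved across the pairing by symmetry, turns
    this into an approximation of \<open>u\<close>.\<close>
  define a where "a k = bpot b (- s) (\<lambda>x. cnj (bpot b (- s) (\<psi> k) x))" for k
  have c: "(\<lambda>x. cnj (bpot b (- s) (\<psi> k) x)) \<in> schwartz_functions" for k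
    by (intro schwartz_cnj bpot_schwartz test_imp_schwartz \<psi>)
  have "cmod (u \<phi> - (\<integral>x. a k x * \<phi> x \<partial>lborel)) \<le> L2_function_norm (\<lambda>x. f x - cnj (bpot b (- s) (\<psi> k) x))
      * Sob b (- s) \<phi>"
    if "\<phi> \<in> test_functions" for \<phi> k
  proof -
    have \<phi>: "\<phi> \<in> schwartz_functions" by (rule test_imp_schwartz[OF that])
    have "u \<phi> - (\<integral>x. a k x * \<phi> x \<partial>lborel) = (\<integral>x. (f x - cnj (bpot b (- s) (\<psi> k) x)) * bpot b (- s) \<phi> x \<partial>lborel)"
      unfolding f(3)[OF that] a_def bpot_exchange[OF c \<phi>, symmetric]
      by (rule integral_L2_diff[symmetric]) (intro f schwartz_L2 c bpot_schwartz \<phi>)+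
    then show ?thesis
      using L2_Cauchy_Schwarz[OF L2_diff[OF f(1) schwartz_L2[OF c]] bpot_L2[OF \<phi>]] by (simp add: Sob_def)
  qed
  moreover have "a k \<in> schwartz_functions" for k unfolding a_def by (rule bpot_schwartz[OF c])
  ultimately show "\<exists>a. approximates b s u a"
    unfolding approximates_def using \<psi>(2) L2_norm_nonneg
    by (intro exI[of _ a] conjI allI exI[of _ "\<lambda>k. L2_function_norm
      (\<lambda>x. f x - cnj (bpot b (- s) (\<psi> k) x))"]) auto
qed

lemma approximates_exists: "u \<in> sobolev b s \<Longrightarrow> \<exists>a. approximates b s u a"
  using sobolevE dual_bound_imp(3) by metis

lemma approximates_schwartz: "approximates b s u a \<Longrightarrow> a k \<in> schwartz_functions"
  by (simp add: approximates_def)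

lemma sobolev_normD:
  assumes "sobolev_norm b s u \<le> ennreal C" "C \<ge> 0" shows "dual_bound b s u C"
proof -
  have "u \<in> sobolev b s" using assms by (auto simp: sobolev_norm_def top_unique split: if_splits)
  then obtain D where D: "sobolev_norm b s u = ennreal D" "dual_bound b s u D" by (rule sobolevE)
  then have "D \<le> C" using assms by (simp add: ennreal_le_iff)
  then show ?thesis using D(2) assms(2) unfolding dual_bound_def
    by (meson mult_right_mono order_trans Sob_nonneg)
qed

lemma sobolev_iff: "u \<in> sobolev b s \<longleftrightarrow> (\<exists>C. dual_bound b s u C)"
  using sobolevE dual_bound_imp(1) by metis

lemma dual_bound_schwartz:
  assumes a: "a \<in> schwartz_functions"
  shows "dual_bound b s (distribution_of a) (Sob b s a)"
proof -
  have "linear_functional_on test_functions (distribution_of a)"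
    unfolding linear_functional_on_def distribution_of_def
    by (simp add: integral_L2_schwartz_add schwartz_L2 a test_imp_schwartz integral_mult_cmult)
  then show ?thesis
    by (simp add: dual_bound_def Sob_nonneg distribution_of_def Sob_duality a test_imp_schwartz)
qed

lemma Sob_le_if_test_bound:
  assumes a: "a \<in> schwartz_functions" and C: "C \<ge> 0"
    and bound: "\<And>\<phi>. \<phi> \<in> test_functions \<Longrightarrow> cmod (\<integral>x. a x * \<phi> x \<partial>lborel) \<le> C * Sob b (- s) \<phi>"
  shows "Sob b s a \<le> C"
proof (rule Sob_le_if_dual_bound[OF a C])
  fix \<phi> :: "real ^ 'a \<Rightarrow> complex" assume \<phi>: "\<phi> \<in> schwartz_functions"
  show "cmod (\<integral>x. a x * \<phi> x \<partial>lborel) \<le> C * Sob b (- s) \<phi>"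
  proof (rule dual_bound_schwartz_limit[where E = "Sob b s a" and U = "\<lambda>\<phi>. \<integral>x. a x * \<phi> x \<partial>lborel"])
    fix \<phi> \<psi> :: "real ^ 'a \<Rightarrow> complex" assume \<phi>: "\<phi> \<in> schwartz_functions" and \<psi>: "\<psi> \<in> test_functions"
    have \<psi>S: "\<psi> \<in> schwartz_functions" by (rule test_imp_schwartz[OF \<psi>])
    have d: "(\<lambda>x. \<phi> x - \<psi> x) \<in> schwartz_functions" by (rule schwartz_diff[OF \<phi> \<psi>S])
    have "(\<integral>x. a x * (\<psi> x + (\<phi> x - \<psi> x)) \<partial>lborel) = (\<integral>x. a x * \<psi> x \<partial>lborel) + (\<integral>x. a x * (\<phi> x - \<psi> x) \<partial>lborel)"
      by (intro integral_L2_schwartz_add schwartz_L2 a \<psi>S d)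
    then have "(\<integral>x. a x * \<phi> x \<partial>lborel) - (\<integral>x. a x * \<psi> x \<partial>lborel) = (\<integral>x. a x * (\<phi> x - \<psi> x) \<partial>lborel)" by simp
    then show "cmod ((\<integral>x. a x * \<phi> x \<partial>lborel) - (\<integral>x. a x * \<psi> x \<partial>lborel)) \<le> Sob b s a * Sob b (- s)
        (\<lambda>x. \<phi> x - \<psi> x)"
      using Sob_duality[OF a d] by simp
  qed (use bound \<phi> C in auto)
qed

subsection \<open>Approximation by Schwartz functions\<close>

text \<open>The Sobolev norm of a Schwartz function is the best constant in its pairing with test
  functions, so the triangle inequality for functionals becomes one for norms. With
  \<open>u = v\<close> and \<open>D = 0\<close> it compares two approximations of the same
  distribution.\<close>

lemma approximates_Sob_diff:
  assumes u: "approximates b s u a" and v: "approximates b s v c"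
    and D: "\<And>\<phi>. \<phi> \<in> test_functions \<Longrightarrow> cmod (u \<phi> - v \<phi>) \<le> D * Sob b (- s) \<phi>" "D \<ge> 0"
  obtains e e' where "e \<longlonglongrightarrow> 0" "e' \<longlonglongrightarrow> 0" "\<And>k. e k \<ge> 0" "\<And>k. e' k \<ge> 0"
    "\<And>k l. Sob b s (\<lambda>x. a k x - c l x) \<le> D + e k + e' l"
proof -
  have S: "a k \<in> schwartz_functions" "c k \<in> schwartz_functions" for k using u v by (auto simp: approximates_def)
  obtain e where e: "e \<longlonglongrightarrow> 0" "\<And>k. e k \<ge> 0"
    "\<And>k \<phi>. \<phi> \<in> test_functions \<Longrightarrow> cmod (u \<phi> - (\<integral>x. a k x * \<phi> x \<partial>lborel)) \<le> e k * Sob b (- s) \<phi>"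
    using u unfolding approximates_def by blast
  obtain e' where e': "e' \<longlonglongrightarrow> 0" "\<And>k. e' k \<ge> 0"
    "\<And>k \<phi>. \<phi> \<in> test_functions \<Longrightarrow> cmod (v \<phi> - (\<integral>x. c k x * \<phi> x \<partial>lborel)) \<le> e' k * Sob b (- s) \<phi>"
    using v unfolding approximates_def by blast
  have "Sob b s (\<lambda>x. a k x - c l x) \<le> D + e k + e' l" for k l
  proof (rule Sob_le_if_test_bound)
    show "(\<lambda>x. a k x - c l x) \<in> schwartz_functions" by (intro schwartz_diff S)
    show "D + e k + e' l \<ge> 0" using D e e' by simp
    fix \<phi> :: "real ^ 'a \<Rightarrow> complex" assume \<phi>: "\<phi> \<in> test_functions"
    have "(\<integral>x. (a k x - c l x) * \<phi> x \<partial>lborel) = (\<integral>x. a k x * \<phi> x \<partial>lborel) - (\<integral>x. c l x * \<phi> x \<partial>lborel)"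
      by (intro integral_L2_diff schwartz_L2 S test_imp_schwartz \<phi>)
    then have "cmod (\<integral>x. (a k x - c l x) * \<phi> x \<partial>lborel) =
        cmod ((u \<phi> - v \<phi>) - (u \<phi> - (\<integral>x. a k x * \<phi> x \<partial>lborel)) + (v \<phi> - (\<integral>x. c l x * \<phi> x \<partial>lborel)))" by simp
    also have "\<dots> \<le> cmod (u \<phi> - v \<phi>) + cmod (u \<phi> - (\<integral>x. a k x * \<phi> x \<partial>lborel)) + cmod
        (v \<phi> - (\<integral>x. c l x * \<phi> x \<partial>lborel))"
      by (intro norm_triangle_le add_mono norm_triangle_ineq4 order_refl)
    also have "\<dots> \<le> D * Sob b (- s) \<phi> + e k * Sob b (- s) \<phi> + e' l * Sob b (- s) \<phi>"
      by (intro add_mono D e e' \<phi>)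
    finally show "cmod (\<integral>x. (a k x - c l x) * \<phi> x \<partial>lborel) \<le> (D + e k + e' l) * Sob b (- s) \<phi>"
      by (simp add: distrib_right)
  qed
  then show thesis using that[OF e(1) e'(1) e(2) e'(2)] by blast
qed

lemma approximates_Sob:
  assumes u: "approximates b s u a" and D: "dual_bound b s u D"
  obtains e where "e \<longlonglongrightarrow> 0" "\<And>k. e k \<ge> 0" "\<And>k. Sob b s (a k) \<le> D + e k"
proof -
  obtain e where e: "e \<longlonglongrightarrow> 0" "\<And>k. e k \<ge> 0"
    "\<And>k \<phi>. \<phi> \<in> test_functions \<Longrightarrow> cmod (u \<phi> - (\<integral>x. a k x * \<phi> x \<partial>lborel)) \<le> e k * Sob b (- s) \<phi>"
    using u unfolding approximates_def by blast
  have "Sob b s (a k) \<le> D + e k" for k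
  proof (rule Sob_le_if_test_bound[OF approximates_schwartz[OF u]])
    show "D + e k \<ge> 0" using D e by (simp add: dual_bound_def)
    fix \<phi> :: "real ^ 'a \<Rightarrow> complex" assume \<phi>: "\<phi> \<in> test_functions"
    have "cmod (\<integral>x. a k x * \<phi> x \<partial>lborel) \<le> cmod (u \<phi>) + cmod (u \<phi> - (\<integral>x. a k x * \<phi> x \<partial>lborel))"
      using norm_triangle_ineq4[of "u \<phi>" "u \<phi> - (\<integral>x. a k x * \<phi> x \<partial>lborel)"] by simp
    also have "\<dots> \<le> D * Sob b (- s) \<phi> + e k * Sob b (- s) \<phi>"
      using D \<phi> by (intro add_mono e) (auto simp: dual_bound_def)
    finally show "cmod (\<integral>x. a k x * \<phi> x \<partial>lborel) \<le> (D + e k) * Sob b (- s) \<phi>" by (simp add: distrib_right)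
  qed
  then show thesis using that[OF e(1) e(2)] by blast
qed

lemma approximates_dist:
  assumes "f \<in> schwartz_functions" shows "approximates b s (distribution_of f) (\<lambda>k. f)"
  using assms unfolding approximates_def by (auto simp: distribution_of_def intro!: exI[of _ "\<lambda>k. 0"])

lemma dual_bound_mult:
  assumes "\<theta> \<in> test_functions" "dual_bound b s u D"
  obtains C where "dual_bound b s (mult_distribution \<theta> u) C"
proof -
  obtain C where C: "C \<ge> 0" "\<And>\<phi>. \<phi> \<in> schwartz_functions \<Longrightarrow> Sob b (- s) (\<lambda>x. \<theta> x * \<phi> x) \<le> C * Sob b (- s) \<phi>"
    using Sob_mult_schwartz[OF test_imp_schwartz[OF assms(1)], of b "- s"] by blast
  have lin: "linear_functional_on test_functions u"
      and D: "D \<ge> 0" "\<And>\<phi>. \<phi> \<in> test_functions \<Longrightarrow> cmod (u \<phi>) \<le> D * Sob b (- s) \<phi>"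
    using assms(2) by (auto simp: dual_bound_def)
  have "linear_functional_on test_functions (mult_distribution \<theta> u)"
    using lin unfolding linear_functional_on_def mult_distribution_def
    by (simp add: distrib_left mult.left_commute[of "\<theta> _"] test_mult assms)
  moreover have "cmod (mult_distribution \<theta> u \<phi>) \<le> (D * C) * Sob b (- s) \<phi>" if \<phi>: "\<phi> \<in> test_functions" for \<phi>
  proof -
    have "cmod (mult_distribution \<theta> u \<phi>) \<le> D * Sob b (- s) (\<lambda>x. \<theta> x * \<phi> x)"
      unfolding mult_distribution_def by (intro D test_mult assms \<phi>)
    also have "\<dots> \<le> D * (C * Sob b (- s) \<phi>)" by (intro mult_left_mono C D test_imp_schwartz \<phi>)
    finally show ?thesis by (simp add: mult.assoc)
  qed
  ultimately show thesis using that[of "D * C"] C D by (simp add: dual_bound_def)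
qed

lemma sobolev_mult: "\<theta> \<in> test_functions \<Longrightarrow> u \<in> sobolev b s \<Longrightarrow> mult_distribution \<theta> u \<in> sobolev b s"
  using dual_bound_mult sobolev_iff by metis

lemma approximates_mult:
  assumes "\<theta> \<in> test_functions" "approximates b s u a"
  shows "approximates b s (mult_distribution \<theta> u) (\<lambda>k x. \<theta> x * a k x)"
proof -
  obtain C where C: "C \<ge> 0" "\<And>\<phi>. \<phi> \<in> schwartz_functions \<Longrightarrow> Sob b (- s) (\<lambda>x. \<theta> x * \<phi> x) \<le> C * Sob b (- s) \<phi>"
    using Sob_mult_schwartz[OF test_imp_schwartz[OF assms(1)], of b "- s"] by blast
  have S: "a k \<in> schwartz_functions" for k using assms by (auto simp: approximates_def)
  obtain e where e: "e \<longlonglongrightarrow> 0" "\<And>k. e k \<ge> 0"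
    "\<And>k \<phi>. \<phi> \<in> test_functions \<Longrightarrow> cmod (u \<phi> - (\<integral>x. a k x * \<phi> x \<partial>lborel)) \<le> e k * Sob b (- s) \<phi>"
    using assms(2) unfolding approximates_def by blast
  have "cmod (mult_distribution \<theta> u \<phi> - (\<integral>x. (\<theta> x * a k x) * \<phi> x \<partial>lborel)) \<le> (e k * C) * Sob b (- s) \<phi>"
    if \<phi>: "\<phi> \<in> test_functions" for \<phi> k
  proof -
    have "cmod (mult_distribution \<theta> u \<phi> - (\<integral>x. (\<theta> x * a k x) * \<phi> x \<partial>lborel)) =
        cmod (u (\<lambda>x. \<theta> x * \<phi> x) - (\<integral>x. a k x * (\<theta> x * \<phi> x) \<partial>lborel))"
      by (simp add: mult_distribution_def mult_ac)
    also have "\<dots> \<le> e k * Sob b (- s) (\<lambda>x. \<theta> x * \<phi> x)" by (intro e test_mult assms \<phi>)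
    also have "\<dots> \<le> e k * (C * Sob b (- s) \<phi>)" by (intro mult_left_mono C e test_imp_schwartz \<phi>)
    finally show ?thesis by (simp add: mult.assoc)
  qed
  moreover have "(\<lambda>k. e k * C) \<longlonglongrightarrow> 0" using tendsto_mult_right[OF e(1), of C] by simp
  moreover have "(\<lambda>x. \<theta> x * a k x) \<in> schwartz_functions" for k
    by (intro schwartz_mult test_imp_schwartz assms S)
  ultimately show ?thesis unfolding approximates_def using C e
    by (intro conjI allI exI[of _ "\<lambda>k. e k * C"]) auto
qed

subsection \<open>The product of Sobolev distributions\<close>

definition trilinear_bound :: "('n::finite \<Rightarrow> 'j::finite) \<Rightarrow> real ^ 'j \<Rightarrow> real ^ 'j \<Rightarrow> real ^ 'j \<Rightarrow> real \<Rightarrow>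
  bool" where
  "trilinear_bound b s t \<sigma> C \<longleftrightarrow> C \<ge> 0 \<and>
     (\<forall>f\<in>schwartz_functions. \<forall>g\<in>schwartz_functions. \<forall>h\<in>schwartz_functions.
       cmod (\<integral>x. f x * g x * h x \<partial>lborel) \<le> C * Sob b s f * Sob b t g * Sob b (- \<sigma>) h)"

lemma trilinear_boundD:
  assumes "trilinear_bound b s t \<sigma> C"
  shows "C \<ge> 0" "f \<in> schwartz_functions \<Longrightarrow> g \<in> schwartz_functions \<Longrightarrow> h \<in> schwartz_functions \<Longrightarrow>
       cmod (\<integral>x. f x * g x * h x \<partial>lborel) \<le> C * Sob b s f * Sob b t g * Sob b (- \<sigma>) h"
  using assms by (auto simp: trilinear_bound_def)

lemma trilinear_diff:
  assumes T: "trilinear_bound b s t \<sigma> C"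
    and S: "f \<in> schwartz_functions" "f' \<in> schwartz_functions" "g \<in> schwartz_functions" "g' \<in>
      schwartz_functions" "h \<in> schwartz_functions"
  shows "cmod ((\<integral>x. f x * g x * h x \<partial>lborel) - (\<integral>x. f' x * g' x * h x \<partial>lborel)) \<le>
    C * (Sob b s (\<lambda>x. f x - f' x) * Sob b t g + Sob b s f' * Sob b t (\<lambda>x. g x - g' x)) * Sob b (- \<sigma>) h"
proof -
  have d: "(\<lambda>x. f x - f' x) \<in> schwartz_functions" "(\<lambda>x. g x - g' x) \<in> schwartz_functions"
    by (intro schwartz_diff S)+
  have i: "integrable lborel (\<lambda>x. f x * g x * h x)" "integrable lborel (\<lambda>x. f' x * g' x * h x)"
      "integrable lborel (\<lambda>x. f' x * g x * h x)"
    by (intro schwartz_integrable schwartz_mult S)+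
  have 1: "(\<integral>x. (f x - f' x) * g x * h x \<partial>lborel) =
      (\<integral>x. f x * g x * h x \<partial>lborel) - (\<integral>x. f' x * g x * h x \<partial>lborel)"
    unfolding left_diff_distrib by (rule Bochner_Integration.integral_diff[OF i(1,3)])
  have 2: "(\<integral>x. f' x * (g x - g' x) * h x \<partial>lborel) =
      (\<integral>x. f' x * g x * h x \<partial>lborel) - (\<integral>x. f' x * g' x * h x \<partial>lborel)"
    unfolding left_diff_distrib right_diff_distrib by (rule Bochner_Integration.integral_diff[OF i(3,2)])
  have 3: "(\<integral>x. f x * g x * h x \<partial>lborel) - (\<integral>x. f' x * g' x * h x \<partial>lborel) =
      (\<integral>x. (f x - f' x) * g x * h x \<partial>lborel) + (\<integral>x. f' x * (g x - g' x) * h x \<partial>lborel)"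
    unfolding 1 2 by simp
  have "cmod ((\<integral>x. f x * g x * h x \<partial>lborel) - (\<integral>x. f' x * g' x * h x \<partial>lborel)) \<le>
      cmod (\<integral>x. (f x - f' x) * g x * h x \<partial>lborel) + cmod (\<integral>x. f' x * (g x - g' x) * h x \<partial>lborel)"
    unfolding 3 by (rule norm_triangle_ineq)
  also have "\<dots> \<le> C * Sob b s (\<lambda>x. f x - f' x) * Sob b t g * Sob b (- \<sigma>) h + C * Sob b s f' * Sob b t
      (\<lambda>x. g x - g' x) * Sob b (- \<sigma>) h"
    by (intro add_mono trilinear_boundD(2)[OF T] d S)
  finally show ?thesis by (simp add: algebra_simps)
qed

text \<open>Extension by continuity made concrete: a limit of pairings along chosen Schwartz
  approximations. The order \<sigma> does not occur, since the limit is one of complex numbers for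
  each fixed \<phi>; it enters only through the trilinear bound that makes the sequence
  converge.\<close>

definition sprod :: "('n::finite \<Rightarrow> 'j::finite) \<Rightarrow> real ^ 'j \<Rightarrow> real ^ 'j \<Rightarrow> 'n func \<Rightarrow> 'n func \<Rightarrow> 'n func" where
  "sprod b s t u v \<phi> = lim (\<lambda>k. \<integral>x. (SOME a. approximates b s u a) k x * (SOME c. approximates b t v c)
    k x * \<phi> x \<partial>lborel)"

text \<open>Two pairs of approximations and two indices are treated together: equal pairs give the
  Cauchy property of the pairings, equal indices give independence of the approximations.\<close>

lemma product_sequences_close:
  assumes T: "trilinear_bound b s t \<sigma> C"
    and u: "u \<in> sobolev b s" "approximates b s u a" "approximates b s u a'"
    and v: "v \<in> sobolev b t" "approximates b t v c" "approximates b t v c'"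
    and \<phi>: "\<phi> \<in> schwartz_functions"
  obtains e e' where "e \<longlonglongrightarrow> 0" "e' \<longlonglongrightarrow> 0"
    "\<And>k l. cmod ((\<integral>x. a k x * c k x * \<phi> x \<partial>lborel) - (\<integral>x. a' l x * c' l x * \<phi> x \<partial>lborel)) \<le> e k + e' l"
proof -
  note S = approximates_schwartz[OF u(2)] approximates_schwartz[OF u(3)] approximates_schwartz[OF v(2)]
    approximates_schwartz[OF v(3)]
  obtain e1 e1' where e1: "e1 \<longlonglongrightarrow> 0" "e1' \<longlonglongrightarrow> 0" "\<And>k. e1 k \<ge> 0" "\<And>k. e1' k \<ge> 0"
    "\<And>k l. Sob b s (\<lambda>x. a k x - a' l x) \<le> 0 + e1 k + e1' l"
    by (rule approximates_Sob_diff[OF u(2,3), of 0]) auto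
  obtain e2 e2' where e2: "e2 \<longlonglongrightarrow> 0" "e2' \<longlonglongrightarrow> 0" "\<And>k. e2 k \<ge> 0" "\<And>k. e2' k \<ge> 0"
    "\<And>k l. Sob b t (\<lambda>x. c k x - c' l x) \<le> 0 + e2 k + e2' l"
    by (rule approximates_Sob_diff[OF v(2,3), of 0]) auto
  obtain D E where D: "dual_bound b s u D" and E: "dual_bound b t v E" using u(1) v(1) sobolev_iff by metis
  obtain e3 where e3: "e3 \<longlonglongrightarrow> 0" "\<And>k. e3 k \<ge> 0" "\<And>k. Sob b t (c k) \<le> E + e3 k"
    using approximates_Sob[OF v(2) E] by blast
  obtain e4 where e4: "e4 \<longlonglongrightarrow> 0" "\<And>k. e4 k \<ge> 0" "\<And>k. Sob b s (a' k) \<le> D + e4 k"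
    using approximates_Sob[OF u(3) D] by blast
  obtain M3 where M3: "\<And>k. norm (e3 k) \<le> M3" using convergent_imp_Bseq[OF convergentI[OF e3(1)]]
    unfolding Bseq_def by blast
  obtain M4 where M4: "\<And>k. norm (e4 k) \<le> M4" using convergent_imp_Bseq[OF convergentI[OF e4(1)]]
    unfolding Bseq_def by blast
  \<comment> \<open>Convergent error sequences are bounded, which bounds the norms of all
    approximants uniformly.\<close>
  define P where "P = E + M3" define Q where "Q = D + M4"
  have PQ: "Sob b t (c k) \<le> P" "Sob b s (a' k) \<le> Q" for k
    using e3(3)[of k] M3[of k] e4(3)[of k] M4[of k] by (auto simp: P_def Q_def abs_le_iff)
  have PQ0: "P \<ge> 0" "Q \<ge> 0" using PQ[of 0] Sob_nonneg order_trans by blast+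
  define A where "A = C * Sob b (- \<sigma>) \<phi>"
  have A: "A \<ge> 0" unfolding A_def using trilinear_boundD(1)[OF T] by (simp add: Sob_nonneg)
  have "cmod ((\<integral>x. a k x * c k x * \<phi> x \<partial>lborel) - (\<integral>x. a' l x * c' l x * \<phi> x \<partial>lborel)) \<le> A *
      (e1 k * P + Q * e2 k) + A * (e1' l * P + Q * e2' l)" for k l
  proof -
    have "cmod ((\<integral>x. a k x * c k x * \<phi> x \<partial>lborel) - (\<integral>x. a' l x * c' l x * \<phi> x \<partial>lborel)) \<le>
        C * (Sob b s (\<lambda>x. a k x - a' l x) * Sob b t (c k) + Sob b s (a' l) * Sob b t
          (\<lambda>x. c k x - c' l x)) * Sob b (- \<sigma>) \<phi>"
      by (intro trilinear_diff[OF T] S \<phi>)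
    also have "\<dots> = A * (Sob b s (\<lambda>x. a k x - a' l x) * Sob b t (c k) + Sob b s (a' l) * Sob b t
        (\<lambda>x. c k x - c' l x))"
      by (simp add: A_def)
    also have "\<dots> \<le> A * ((0 + e1 k + e1' l) * P + Q * (0 + e2 k + e2' l))"
      using e1(3,4) e2(3,4) PQ0 by (intro mult_left_mono add_mono mult_mono e1 e2 PQ A Sob_nonneg)
        (simp_all add: add_nonneg_nonneg)
    finally show ?thesis by (simp add: algebra_simps)
  qed
  moreover have "(\<lambda>k. A * (e1 k * P + Q * e2 k)) \<longlonglongrightarrow> A * (0 * P + Q * 0)"
      "(\<lambda>k. A * (e1' k * P + Q * e2' k)) \<longlonglongrightarrow> A * (0 * P + Q * 0)"
    by (intro tendsto_mult tendsto_add tendsto_const e1 e2)+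
  ultimately show thesis using that[of "\<lambda>k. A * (e1 k * P + Q * e2 k)" "\<lambda>k. A *
      (e1' k * P + Q * e2' k)"] by simp
qed

lemma sprod_limit:
  assumes T: "trilinear_bound b s t \<sigma> C"
    and u: "u \<in> sobolev b s" "approximates b s u a"
    and v: "v \<in> sobolev b t" "approximates b t v c"
    and \<phi>: "\<phi> \<in> schwartz_functions"
  shows "(\<lambda>k. \<integral>x. a k x * c k x * \<phi> x \<partial>lborel) \<longlonglongrightarrow> sprod b s t u v \<phi>"
proof -
  let ?a = "SOME a. approximates b s u a" and ?c = "SOME c. approximates b t v c"
  have u': "approximates b s u ?a" using u(2) by (rule someI[where P = "approximates b s u"])
  have v': "approximates b t v ?c" using v(2) by (rule someI[where P = "approximates b t v"])
  let ?F = "\<lambda>k. \<integral>x. ?a k x * ?c k x * \<phi> x \<partial>lborel"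
  have "Cauchy ?F"
  proof -
    obtain e e' where e: "e \<longlonglongrightarrow> 0" "e' \<longlonglongrightarrow> 0" "\<And>k l. cmod (?F k - ?F l) \<le> e k + e' l"
      using product_sequences_close[OF T u(1) u' u' v(1) v' v' \<phi>] by blast
    show ?thesis
    proof (rule CauchyI)
      fix r :: real assume r: "0 < r"
      have "\<forall>\<^sub>F k in sequentially. e k < r / 2 \<and> e' k < r / 2"
        using order_tendstoD(2)[OF e(1), of "r/2"] order_tendstoD(2)[OF e(2), of "r/2"] r
          by (simp add: eventually_conj_iff)
      then obtain M where M: "\<And>k. k \<ge> M \<Longrightarrow> e k < r / 2 \<and> e' k < r / 2" by (auto simp: eventually_sequentially)
      have "norm (?F m - ?F n) < r" if "m \<ge> M" "n \<ge> M" for m n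
        using e(3)[of m n] M[OF that(1)] M[OF that(2)] by simp
      then show "\<exists>M. \<forall>m\<ge>M. \<forall>n\<ge>M. norm (?F m - ?F n) < r" by blast
    qed
  qed
  then have lim: "?F \<longlonglongrightarrow> sprod b s t u v \<phi>"
    unfolding sprod_def by (simp add: Cauchy_convergent_iff convergent_LIMSEQ_iff)
  obtain e e' where e: "e \<longlonglongrightarrow> 0" "e' \<longlonglongrightarrow> 0"
    "\<And>k l. cmod ((\<integral>x. a k x * c k x * \<phi> x \<partial>lborel) - ?F l) \<le> e k + e' l"
    using product_sequences_close[OF T u u' v v' \<phi>] by blast
  have z: "(\<lambda>k. e k + e' k) \<longlonglongrightarrow> 0" using tendsto_add[OF e(1,2)] by simp
  have "\<forall>\<^sub>F k in sequentially. norm ((\<integral>x. a k x * c k x * \<phi> x \<partial>lborel) - ?F k) \<le> e k + e' k"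
    by (rule always_eventually) (use e(3) in blast)
  from Lim_null_comparison[OF this z]
  have "(\<lambda>k. ((\<integral>x. a k x * c k x * \<phi> x \<partial>lborel) - ?F k) + ?F k) \<longlonglongrightarrow> 0 + sprod b s t u v \<phi>"
    using lim by (rule tendsto_add)
  then show ?thesis by simp
qed

text \<open>Only the pointwise triple products matter. As the test functions may differ too, a
  multiplier can travel between \<open>u\<close>, \<open>v\<close> and \<phi>.\<close>

lemma sprod_cong:
  assumes T: "trilinear_bound b s t \<sigma> C"
    and u: "u \<in> sobolev b s" "approximates b s u a" "v \<in> sobolev b t" "approximates b t v c" "\<phi> \<in>
      schwartz_functions"
    and u': "u' \<in> sobolev b s" "approximates b s u' a'" "v' \<in> sobolev b t" "approximates b t v' c'" "\<phi>'
      \<in> schwartz_functions"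
    and eq: "\<And>k x. a k x * c k x * \<phi> x = a' k x * c' k x * \<phi>' x"
  shows "sprod b s t u v \<phi> = sprod b s t u' v' \<phi>'"
  using sprod_limit[OF T u] sprod_limit[OF T u'] unfolding eq by (rule LIMSEQ_unique)

lemma sprod_bound:
  assumes T: "trilinear_bound b s t \<sigma> C" and D: "dual_bound b s u D" and E: "dual_bound b t v E"
    and \<phi>: "\<phi> \<in> schwartz_functions"
  shows "cmod (sprod b s t u v \<phi>) \<le> C * D * E * Sob b (- \<sigma>) \<phi>"
proof -
  have u: "u \<in> sobolev b s" and v: "v \<in> sobolev b t" using D E sobolev_iff by blast+
  obtain a c where a: "approximates b s u a" and c: "approximates b t v c" using approximates_exists u v
    by metis
  obtain e where e: "e \<longlonglongrightarrow> 0" "\<And>k. e k \<ge> 0" "\<And>k. Sob b s (a k) \<le> D + e k"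
    using approximates_Sob[OF a D] by blast
  obtain e' where e': "e' \<longlonglongrightarrow> 0" "\<And>k. e' k \<ge> 0" "\<And>k. Sob b t (c k) \<le> E + e' k"
    using approximates_Sob[OF c E] by blast
  have D0: "D \<ge> 0" "E \<ge> 0" using D E by (auto simp: dual_bound_def)
  have "(\<lambda>k. C * (D + e k) * (E + e' k) * Sob b (- \<sigma>) \<phi>) \<longlonglongrightarrow> C * (D + 0) * (E + 0) * Sob b (- \<sigma>) \<phi>"
    by (intro tendsto_mult tendsto_add tendsto_const e e')
  moreover have "(\<lambda>k. cmod (\<integral>x. a k x * c k x * \<phi> x \<partial>lborel)) \<longlonglongrightarrow> cmod (sprod b s t u v \<phi>)"
    by (intro tendsto_norm sprod_limit[OF T u a v c \<phi>])
  moreover have "cmod (\<integral>x. a k x * c k x * \<phi> x \<partial>lborel) \<le> C * (D + e k) * (E + e' k) * Sob b (- \<sigma>) \<phi>" for k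
  proof -
    have "cmod (\<integral>x. a k x * c k x * \<phi> x \<partial>lborel) \<le> C * Sob b s (a k) * Sob b t (c k) * Sob b (- \<sigma>) \<phi>"
      by (intro trilinear_boundD(2)[OF T] approximates_schwartz[OF a] approximates_schwartz[OF c] \<phi>)
    also have "\<dots> \<le> C * (D + e k) * (E + e' k) * Sob b (- \<sigma>) \<phi>"
      using trilinear_boundD(1)[OF T] D0 e(2) e'(2)
        by (intro mult_mono mult_left_mono e e' order_refl) (simp_all add: Sob_nonneg)
    finally show ?thesis .
  qed
  ultimately have "cmod (sprod b s t u v \<phi>) \<le> C * (D + 0) * (E + 0) * Sob b (- \<sigma>) \<phi>"
    by (intro LIMSEQ_le) auto
  then show ?thesis by simp
qed

lemma sprod_diff_bound:
  assumes T: "trilinear_bound b s t \<sigma> C"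
    and u: "u \<in> sobolev b s" and u': "dual_bound b s u' D'" and v: "dual_bound b t v E"
      and v': "v' \<in> sobolev b t"
    and D: "\<And>\<phi>. \<phi> \<in> test_functions \<Longrightarrow> cmod (u \<phi> - u' \<phi>) \<le> D * Sob b (- s) \<phi>" "D \<ge> 0"
    and F: "\<And>\<phi>. \<phi> \<in> test_functions \<Longrightarrow> cmod (v \<phi> - v' \<phi>) \<le> F * Sob b (- t) \<phi>" "F \<ge> 0"
    and \<phi>: "\<phi> \<in> schwartz_functions"
  shows "cmod (sprod b s t u v \<phi> - sprod b s t u' v' \<phi>) \<le> C * (D * E + D' * F) * Sob b (- \<sigma>) \<phi>"
proof -
  have us: "u' \<in> sobolev b s" and vs: "v \<in> sobolev b t" using u' v sobolev_iff by blast+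
  obtain a c where a: "approximates b s u a" and c: "approximates b t v c"
    using approximates_exists u vs by metis
  obtain a' c' where a': "approximates b s u' a'" and c': "approximates b t v' c'"
    using approximates_exists us v' by metis
  obtain e1 e1' where e1: "e1 \<longlonglongrightarrow> 0" "e1' \<longlonglongrightarrow> 0" "\<And>k. e1 k \<ge> 0" "\<And>k. e1' k \<ge> 0"
    "\<And>k l. Sob b s (\<lambda>x. a k x - a' l x) \<le> D + e1 k + e1' l"
    using approximates_Sob_diff[OF a a' D] by blast
  obtain e2 e2' where e2: "e2 \<longlonglongrightarrow> 0" "e2' \<longlonglongrightarrow> 0" "\<And>k. e2 k \<ge> 0" "\<And>k. e2' k \<ge> 0"
    "\<And>k l. Sob b t (\<lambda>x. c k x - c' l x) \<le> F + e2 k + e2' l"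
    using approximates_Sob_diff[OF c c' F] by blast
  obtain e3 where e3: "e3 \<longlonglongrightarrow> 0" "\<And>k. e3 k \<ge> 0" "\<And>k. Sob b t (c k) \<le> E + e3 k"
    using approximates_Sob[OF c v] by blast
  obtain e4 where e4: "e4 \<longlonglongrightarrow> 0" "\<And>k. e4 k \<ge> 0" "\<And>k. Sob b s (a' k) \<le> D' + e4 k"
    using approximates_Sob[OF a' u'] by blast
  have D0: "D' \<ge> 0" "E \<ge> 0" using u' v by (auto simp: dual_bound_def)
  let ?G = "\<lambda>k. C * ((D + e1 k + e1' k) * (E + e3 k) + (D' + e4 k) * (F + e2 k + e2' k)) * Sob b (- \<sigma>) \<phi>"
  have "?G \<longlonglongrightarrow> C * ((D + 0 + 0) * (E + 0) + (D' + 0) * (F + 0 + 0)) * Sob b (- \<sigma>) \<phi>"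
    by (intro tendsto_mult tendsto_add tendsto_const e1 e2 e3 e4)
  moreover have "(\<lambda>k. cmod ((\<integral>x. a k x * c k x * \<phi> x \<partial>lborel) - (\<integral>x. a' k x * c' k x * \<phi> x \<partial>lborel))) \<longlonglongrightarrow>
      cmod (sprod b s t u v \<phi> - sprod b s t u' v' \<phi>)"
    by (intro tendsto_norm tendsto_diff sprod_limit[OF T u a vs c \<phi>] sprod_limit[OF T us a' v' c' \<phi>])
  moreover have "cmod ((\<integral>x. a k x * c k x * \<phi> x \<partial>lborel) - (\<integral>x. a' k x * c' k x * \<phi> x \<partial>lborel)) \<le> ?G k" for k
  proof -
    have "cmod ((\<integral>x. a k x * c k x * \<phi> x \<partial>lborel) - (\<integral>x. a' k x * c' k x * \<phi> x \<partial>lborel)) \<le>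
        C * (Sob b s (\<lambda>x. a k x - a' k x) * Sob b t (c k) + Sob b s (a' k) * Sob b t
          (\<lambda>x. c k x - c' k x)) * Sob b (- \<sigma>) \<phi>"
      by (intro trilinear_diff[OF T] \<phi> approximates_schwartz[OF a] approximates_schwartz[OF c]
        approximates_schwartz[OF a'] approximates_schwartz[OF c'])
    also have "\<dots> \<le> ?G k"
      using trilinear_boundD(1)[OF T] D0 D(2) F(2) e1(3,4) e4(2)
      by (intro mult_right_mono mult_left_mono add_mono mult_mono e1 e2 e3 e4)
        (simp_all add: Sob_nonneg add_nonneg_nonneg)
    finally show ?thesis .
  qed
  ultimately have "cmod (sprod b s t u v \<phi> - sprod b s t u' v' \<phi>) \<le> C *
      ((D + 0 + 0) * (E + 0) + (D' + 0) * (F + 0 + 0)) * Sob b (- \<sigma>) \<phi>"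
    by (intro LIMSEQ_le) auto
  then show ?thesis by simp
qed

section \<open>Algebraic rules for the extended product\<close>

lemma sprod_linear:
  assumes T: "trilinear_bound b s t \<sigma> C" and u: "u \<in> sobolev b s" and v: "v \<in> sobolev b t"
  shows "linear_functional_on schwartz_functions (sprod b s t u v)"
proof -
  obtain a c where a: "approximates b s u a" and c: "approximates b t v c" using approximates_exists u v
    by metis
  note S = approximates_schwartz[OF a] approximates_schwartz[OF c]
  note L = sprod_limit[OF T u a v c]
  have "sprod b s t u v (\<lambda>x. \<phi> x + \<psi> x) = sprod b s t u v \<phi> + sprod b s t u v \<psi>"
    if \<phi>: "\<phi> \<in> schwartz_functions" and \<psi>: "\<psi> \<in> schwartz_functions" for \<phi> \<psi>
  proof (rule LIMSEQ_unique[OF L[OF schwartz_add[OF \<phi> \<psi>]]])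
    have "(\<integral>x. a k x * c k x * (\<phi> x + \<psi> x) \<partial>lborel) =
        (\<integral>x. a k x * c k x * \<phi> x \<partial>lborel) + (\<integral>x. a k x * c k x * \<psi> x \<partial>lborel)" for k
      by (intro integral_L2_schwartz_add schwartz_L2 schwartz_mult S \<phi> \<psi>)
    then show "(\<lambda>k. \<integral>x. a k x * c k x * (\<phi> x + \<psi> x) \<partial>lborel) \<longlonglongrightarrow> sprod b s t u v \<phi> + sprod b s t u v \<psi>"
      using tendsto_add[OF L[OF \<phi>] L[OF \<psi>]] by simp
  qed
  moreover have "sprod b s t u v (\<lambda>x. r * \<phi> x) = r * sprod b s t u v \<phi>" if \<phi>: "\<phi> \<in> schwartz_functions" for \<phi> r
  proof (rule LIMSEQ_unique[OF L[OF schwartz_cmult[OF \<phi>]]])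
    show "(\<lambda>k. \<integral>x. a k x * c k x * (r * \<phi> x) \<partial>lborel) \<longlonglongrightarrow> r * sprod b s t u v \<phi>"
      unfolding integral_mult_cmult by (intro tendsto_mult tendsto_const L \<phi>)
  qed
  ultimately show ?thesis by (simp add: linear_functional_on_def)
qed

lemma linear_functional_on_test: "linear_functional_on schwartz_functions u \<Longrightarrow>
  linear_functional_on test_functions u"
  by (erule linear_functional_on_subset) (auto intro: test_imp_schwartz)

lemma sprod_dual_bound:
  assumes T: "trilinear_bound b s t \<sigma> C" and D: "dual_bound b s u D" and E: "dual_bound b t v E"
  shows "dual_bound b \<sigma> (sprod b s t u v) (C * D * E)"
proof -
  have "linear_functional_on test_functions (sprod b s t u v)"
    using sprod_linear[OF T] D E sobolev_iff linear_functional_on_test by metis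
  moreover have "C * D * E \<ge> 0" using trilinear_boundD(1)[OF T] D E by (simp add: dual_bound_def)
  ultimately show ?thesis using sprod_bound[OF T D E] by (simp add: dual_bound_def test_imp_schwartz)
qed

lemma sprod_schwartz:
  assumes T: "trilinear_bound b s t \<sigma> C"
    and S: "f \<in> schwartz_functions" "g \<in> schwartz_functions" "\<phi> \<in> schwartz_functions"
  shows "sprod b s t (distribution_of f) (distribution_of g) \<phi> = (\<integral>x. f x * g x * \<phi> x \<partial>lborel)"
proof -
  have "distribution_of f \<in> sobolev b s" "distribution_of g \<in> sobolev b t"
    using dual_bound_schwartz S sobolev_iff by blast+
  from sprod_limit[OF T this(1) approximates_dist[OF S(1)] this(2) approximates_dist[OF S(2)] S(3)]
  show ?thesis by (simp add: LIMSEQ_const_iff)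
qed

lemma sprod_mult_left:
  assumes T: "trilinear_bound b s t \<sigma> C" and u: "u \<in> sobolev b s" and v: "v \<in> sobolev b t"
    and \<theta>: "\<theta> \<in> test_functions" and \<phi>: "\<phi> \<in> schwartz_functions"
  shows "sprod b s t (mult_distribution \<theta> u) v \<phi> = sprod b s t u v (\<lambda>x. \<theta> x * \<phi> x)"
proof -
  obtain a c where a: "approximates b s u a" and c: "approximates b t v c" using approximates_exists u v
    by metis
  show ?thesis
    by (rule sprod_cong[OF T sobolev_mult[OF \<theta> u] approximates_mult[OF \<theta> a] v c \<phi> u a v c])
       (auto intro: schwartz_mult test_imp_schwartz \<theta> \<phi>)
qed

lemma sprod_mult_right:
  assumes T: "trilinear_bound b s t \<sigma> C" and u: "u \<in> sobolev b s" and v: "v \<in> sobolev b t"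
    and \<theta>: "\<theta> \<in> test_functions" and \<phi>: "\<phi> \<in> schwartz_functions"
  shows "sprod b s t u (mult_distribution \<theta> v) \<phi> = sprod b s t u v (\<lambda>x. \<theta> x * \<phi> x)"
proof -
  obtain a c where a: "approximates b s u a" and c: "approximates b t v c" using approximates_exists u v
    by metis
  show ?thesis
    by (rule sprod_cong[OF T u a sobolev_mult[OF \<theta> v] approximates_mult[OF \<theta> c] \<phi> u a v c])
       (auto intro: schwartz_mult test_imp_schwartz \<theta> \<phi>)
qed

section \<open>Continuity and uniqueness of the extended product\<close>

text \<open>The norms are extended reals and may be infinite for finitely many indices, where
  \<open>enn2real\<close> returns 0. The bound by \<open>D k\<close> can therefore hold only
  eventually.\<close>

lemma sobolev_convergesD:
  assumes "sobolev_converges b s us u"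
  obtains D where "D \<longlonglongrightarrow> 0" "\<forall>\<^sub>F k in sequentially. dual_bound b s (\<lambda>\<phi>. us k \<phi> - u \<phi>) (D k)" "\<And>k. D k \<ge> 0"
proof -
  define n where "n k = sobolev_norm b s (\<lambda>\<phi>. us k \<phi> - u \<phi>)" for k
  have n: "n \<longlonglongrightarrow> 0" using assms by (simp add: sobolev_converges_def n_def[abs_def])
  have "\<forall>\<^sub>F k in sequentially. n k < \<infinity>" by (rule order_tendstoD(2)[OF n]) simp
  then have "\<forall>\<^sub>F k in sequentially. dual_bound b s (\<lambda>\<phi>. us k \<phi> - u \<phi>) (enn2real (n k))"
    by eventually_elim (rule sobolev_normD, auto simp: n_def less_top)
  moreover have "(\<lambda>k. enn2real (n k)) \<longlonglongrightarrow> 0" using tendsto_enn2real[of n 0 sequentially] n by simp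
  ultimately show thesis using that[of "\<lambda>k. enn2real (n k)"] by simp
qed

lemma sobolev_convergesI:
  assumes "D \<longlonglongrightarrow> 0" "\<forall>\<^sub>F k in sequentially. dual_bound b s (\<lambda>\<phi>. us k \<phi> - u \<phi>) (D k)"
  shows "sobolev_converges b s us u"
  unfolding sobolev_converges_def
proof (rule tendsto_sandwich[OF _ _ tendsto_const])
  have "(\<lambda>k. ennreal (D k)) \<longlonglongrightarrow> ennreal 0" by (rule tendsto_ennrealI[OF assms(1)])
  then show "(\<lambda>k. ennreal (D k)) \<longlonglongrightarrow> 0" by simp
  show "\<forall>\<^sub>F k in sequentially. sobolev_norm b s (\<lambda>\<phi>. us k \<phi> - u \<phi>) \<le> ennreal (D k)"
    using assms(2) by eventually_elim (rule dual_bound_imp(2))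
qed simp

lemma linear_functional_on_diff:
  "linear_functional_on V u \<Longrightarrow> linear_functional_on V v \<Longrightarrow> linear_functional_on V (\<lambda>\<phi>. u \<phi> - v \<phi>)"
  by (simp add: linear_functional_on_def right_diff_distrib)

lemma is_extended_product_sprod:
  assumes T: "trilinear_bound b s t \<sigma> C"
  shows "is_extended_product b s t \<sigma> (sprod b s t)"
  unfolding is_extended_product_def
proof (intro conjI ballI allI impI)
  fix u v assume "u \<in> sobolev b s" "v \<in> sobolev b t"
  then show "sprod b s t u v \<in> sobolev b \<sigma>" using sprod_dual_bound[OF T] sobolev_iff by metis
next
  fix f g :: "real ^ 'a \<Rightarrow> complex" assume "f \<in> schwartz_functions" "g \<in> schwartz_functions"
  then show "same_distribution (sprod b s t (distribution_of f) (distribution_of g))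
      (distribution_of (\<lambda>x. f x * g x))"
    by (simp add: same_distribution_def sprod_schwartz[OF T] test_imp_schwartz) (simp add: distribution_of_def)
next
  fix us vs u v assume u: "u \<in> sobolev b s" and v: "v \<in> sobolev b t"
    and us: "\<forall>k. us k \<in> sobolev b s" and vs: "\<forall>k. vs k \<in> sobolev b t"
    and cu: "sobolev_converges b s us u" and cv: "sobolev_converges b t vs v"
  obtain D where D: "D \<longlonglongrightarrow> 0" "\<forall>\<^sub>F k in sequentially. dual_bound b s (\<lambda>\<phi>. us k \<phi> - u \<phi>) (D k)" "\<And>k. D k \<ge> 0"
    using sobolev_convergesD[OF cu] by blast
  obtain E where E: "E \<longlonglongrightarrow> 0" "\<forall>\<^sub>F k in sequentially. dual_bound b t (\<lambda>\<phi>. vs k \<phi> - v \<phi>) (E k)" "\<And>k. E k \<ge> 0"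
    using sobolev_convergesD[OF cv] by blast
  obtain D0 E0 where D0: "dual_bound b s u D0" and E0: "dual_bound b t v E0" using u v sobolev_iff by metis
  let ?G = "\<lambda>k. C * (D k * (E0 + E k) + D0 * E k)"
  show "sobolev_converges b \<sigma> (\<lambda>k. sprod b s t (us k) (vs k)) (sprod b s t u v)"
  proof (rule sobolev_convergesI)
    have "?G \<longlonglongrightarrow> C * (0 * (E0 + 0) + D0 * 0)" by (intro tendsto_mult tendsto_add tendsto_const D E)
    then show "?G \<longlonglongrightarrow> 0" by simp
    show "\<forall>\<^sub>F k in sequentially. dual_bound b \<sigma> (\<lambda>\<phi>. sprod b s t (us k) (vs k) \<phi> - sprod b s t u v \<phi>) (?G k)"
      using D(2) E(2)
    proof eventually_elim
      case (elim k)
      \<comment> \<open>In the product rule for differences one factor is \<open>vs k\<close>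
        itself, so its norm has to be bounded along the sequence.\<close>
      have vk: "dual_bound b t (vs k) (E0 + E k)"
      proof -
        have "cmod (vs k \<phi>) \<le> (E0 + E k) * Sob b (- t) \<phi>" if "\<phi> \<in> test_functions" for \<phi>
        proof -
          have "cmod (vs k \<phi>) \<le> cmod (v \<phi>) + cmod (vs k \<phi> - v \<phi>)"
            using norm_triangle_ineq[of "v \<phi>" "vs k \<phi> - v \<phi>"] by simp
          also have "\<dots> \<le> E0 * Sob b (- t) \<phi> + E k * Sob b (- t) \<phi>"
            using E0 elim(2) that by (intro add_mono) (auto simp: dual_bound_def)
          finally show ?thesis by (simp add: distrib_right)
        qed
        moreover have "linear_functional_on test_functions (vs k)" using vs sobolev_iff dual_bound_def by metis
        ultimately show ?thesis using E0 E(3)[of k] by (simp add: dual_bound_def)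
      qed
      have "cmod (sprod b s t (us k) (vs k) \<phi> - sprod b s t u v \<phi>) \<le> ?G k * Sob b (- \<sigma>) \<phi>"
          if "\<phi> \<in> test_functions" for \<phi>
        using elim us by (intro sprod_diff_bound[OF T _ D0 vk v _ D(3) _ E(3)
          test_imp_schwartz[OF that]]) (auto simp: dual_bound_def)
      moreover have "linear_functional_on test_functions (\<lambda>\<phi>. sprod b s t (us k) (vs k) \<phi> - sprod b s t u v \<phi>)"
        using us vs u v by (intro linear_functional_on_diff linear_functional_on_test sprod_linear[OF T]) auto
      moreover have "?G k \<ge> 0" using D(3)[of k] E(3)[of k] D0 E0 trilinear_boundD(1)[OF T]
        by (simp add: dual_bound_def)
      ultimately show ?case by (simp add: dual_bound_def)
    qed
  qed
qed

text \<open>Along Schwartz approximations \<open>B\<close> is the pointwise product, whose pairings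
  converge to the value of \<open>sprod\<close>; continuity of \<open>B\<close> sends them to its
  own value. The definition of a product provides just some \<open>B\<close>, and this identifies
  it.\<close>

lemma extended_product_unique:
  assumes T: "trilinear_bound b s t \<sigma> C" and B: "is_extended_product b s t \<sigma> B"
    and u: "u \<in> sobolev b s" and v: "v \<in> sobolev b t" and \<phi>: "\<phi> \<in> test_functions"
  shows "B u v \<phi> = sprod b s t u v \<phi>"
proof -
  obtain a c where a: "approximates b s u a" and c: "approximates b t v c" using approximates_exists u v
    by metis
  note S = approximates_schwartz[OF a] approximates_schwartz[OF c]
  have conv: "sobolev_converges b r (\<lambda>k. distribution_of (h k)) w"
      if w: "w \<in> sobolev b r" and h: "approximates b r w h" for r w h
  proof -
    obtain e where e: "e \<longlonglongrightarrow> 0" "\<And>k. e k \<ge> 0"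
      "\<And>k \<phi>. \<phi> \<in> test_functions \<Longrightarrow> cmod (w \<phi> - (\<integral>x. h k x * \<phi> x \<partial>lborel)) \<le> e k * Sob b (- r) \<phi>"
      using h unfolding approximates_def by blast
    show ?thesis
    proof (rule sobolev_convergesI[OF e(1)], rule always_eventually, rule allI)
      fix k
      have "linear_functional_on test_functions (distribution_of (h k))" "linear_functional_on test_functions w"
        using dual_bound_schwartz[OF approximates_schwartz[OF h]] w sobolev_iff dual_bound_def by metis+
      then show "dual_bound b r (\<lambda>\<phi>. distribution_of (h k) \<phi> - w \<phi>) (e k)"
        using e by (simp add: dual_bound_def linear_functional_on_diff distribution_of_def norm_minus_commute)
    qed
  qed
  have mem: "distribution_of f \<in> sobolev b r" if "f \<in> schwartz_functions" for f r
    using dual_bound_schwartz[OF that] sobolev_iff by blast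
  have "sobolev_converges b \<sigma> (\<lambda>k. B (us k) (vs k)) (B u v)"
    if "\<And>k. us k \<in> sobolev b s" "\<And>k. vs k \<in> sobolev b t" "sobolev_converges b s us u" "sobolev_converges
      b t vs v" for us vs
    using B u v that unfolding is_extended_product_def by blast
  from this[OF mem[OF S(1)] mem[OF S(2)] conv[OF u a] conv[OF v c]]
  have "sobolev_converges b \<sigma> (\<lambda>k. B (distribution_of (a k)) (distribution_of (c k))) (B u v)" .
  then obtain D where D: "D \<longlonglongrightarrow> 0" "\<forall>\<^sub>F k in sequentially. dual_bound b \<sigma>
      (\<lambda>\<phi>. B (distribution_of (a k)) (distribution_of (c k)) \<phi> - B u v \<phi>) (D k)"
    by (rule sobolev_convergesD)
  have eq: "B (distribution_of (a k)) (distribution_of (c k)) \<phi> = (\<integral>x. a k x * c k x * \<phi> x \<partial>lborel)" for k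
    using B S \<phi> unfolding is_extended_product_def same_distribution_def distribution_of_def by blast
  have "\<forall>\<^sub>F k in sequentially. norm ((\<integral>x. a k x * c k x * \<phi> x \<partial>lborel) - B u v \<phi>) \<le> D k * Sob b (- \<sigma>) \<phi>"
    using D(2)
  proof eventually_elim
    case (elim k)
    then have "cmod (B (distribution_of (a k)) (distribution_of (c k)) \<phi> - B u v \<phi>) \<le> D k * Sob b (- \<sigma>) \<phi>"
      using \<phi> unfolding dual_bound_def by blast
    then show ?case unfolding eq .
  qed
  moreover have "(\<lambda>k. D k * Sob b (- \<sigma>) \<phi>) \<longlonglongrightarrow> 0" using tendsto_mult_right[OF D(1), of "Sob b (- \<sigma>) \<phi>"] by simp
  ultimately have "(\<lambda>k. (\<integral>x. a k x * c k x * \<phi> x \<partial>lborel) - B u v \<phi>) \<longlonglongrightarrow> 0" by (rule Lim_null_comparison)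
  then have "(\<lambda>k. \<integral>x. a k x * c k x * \<phi> x \<partial>lborel) \<longlonglongrightarrow> B u v \<phi>" by (rule LIM_zero_cancel)
  then show ?thesis using sprod_limit[OF T u a v c test_imp_schwartz[OF \<phi>]] by (rule LIMSEQ_unique)
qed

subsection \<open>Uniformly local spaces\<close>

lemma sobolev_ulE:
  assumes "u \<in> sobolev_ul b s"
  obtains \<theta> M where "\<theta> \<in> test_functions" "\<theta> \<noteq> (\<lambda>x. 0)" "M \<ge> 0"
    "\<And>y. dual_bound b s (mult_distribution (translate y \<theta>) u) M"
proof -
  obtain \<theta> where \<theta>: "\<theta> \<in> test_functions" "\<theta> \<noteq> (\<lambda>x. 0)"
    and fin: "(SUP y. sobolev_norm b s (mult_distribution (translate y \<theta>) u)) < \<infinity>"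
    using assms by (auto simp: sobolev_ul_def)
  obtain M where M: "(SUP y. sobolev_norm b s (mult_distribution (translate y \<theta>) u)) = ennreal M" "M \<ge> 0"
    using fin by (cases "SUP y. sobolev_norm b s (mult_distribution (translate y \<theta>) u)") auto
  have "sobolev_norm b s (mult_distribution (translate y \<theta>) u) \<le> ennreal M" for y
    unfolding M(1)[symmetric] by (rule SUP_upper) simp
  then have "dual_bound b s (mult_distribution (translate y \<theta>) u) M" for y
    using sobolev_normD M(2) by blast
  with \<theta> M that show thesis by blast
qed

lemma sobolev_ul_linear: "u \<in> sobolev_ul b s \<Longrightarrow> linear_functional_on test_functions u"
  by (auto simp: sobolev_ul_def distributions_def)

text \<open>Finitely many translates of \<open>\<chi>0\<close> have no common zero on a given ball; dividing by the sum
  of their squared moduli, corrected by a flat function off the ball, localizes any test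
  function.\<close>

lemma finite_translate_partition:
  fixes \<chi>0 \<theta> :: "real ^ 'n::finite \<Rightarrow> complex"
  assumes \<chi>: "\<chi>0 \<in> test_functions" "\<chi>0 \<noteq> (\<lambda>x. 0)" and \<theta>: "\<theta> \<in> test_functions"
  obtains Y \<rho> where "finite Y" "\<And>y. \<rho> y \<in> test_functions" "\<And>x. \<theta> x = (\<Sum>y\<in>Y. translate y \<chi>0 x * \<rho> y x)"
proof -
  obtain x0 where x0: "\<chi>0 x0 \<noteq> 0" using \<chi>(2) by blast
  obtain R0 where R0: "\<And>x. \<theta> x \<noteq> 0 \<Longrightarrow> norm x \<le> R0" using \<theta> unfolding test_functions_iff by blast
  \<comment> \<open>Nonnegative, so that the ball below is nonempty and the sum attains a minimum on
    it.\<close>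
  define R where "R = max R0 0"
  have R: "\<theta> x = 0" if "norm x > R" for x using R0[of x] that by (auto simp: R_def)
  let ?B = "cball (0 :: real ^ 'n) R"
  define V where "V y = {x. translate y \<chi>0 x \<noteq> 0}" for y
  have cont: "continuous_on UNIV (translate y \<chi>0)" for y
    by (intro smooth_imp_continuous_on smooth_translate test_smooth \<chi>)
  have "open (V y)" for y unfolding V_def using open_Collect_neq[OF cont continuous_on_const] .
  moreover have "?B \<subseteq> (\<Union>y\<in>UNIV. V y)"
  proof
    fix x have "x \<in> V (x - x0)" using x0 by (simp add: V_def translate_def)
    then show "x \<in> (\<Union>y\<in>UNIV. V y)" by blast
  qed
  ultimately obtain Y where Y: "finite Y" "?B \<subseteq> (\<Union>y\<in>Y. V y)"
    using compactE_image[of ?B UNIV V] compact_cball by metis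
  define \<Sigma> where "\<Sigma> x = (\<Sum>y\<in>Y. translate y \<chi>0 x * cnj (translate y \<chi>0 x))" for x
  have \<Sigma>_re: "\<Sigma> x = of_real (\<Sum>y\<in>Y. (cmod (translate y \<chi>0 x))\<^sup>2)" for x
    by (simp add: \<Sigma>_def complex_norm_square[symmetric])
  have \<Sigma>_smooth: "smooth \<Sigma>"
    unfolding \<Sigma>_def[abs_def] by (intro smooth_sum smooth_mult smooth_cnj smooth_translate test_smooth \<chi>)
  have \<Sigma>_pos: "Re (\<Sigma> x) > 0" if "x \<in> ?B" for x
  proof -
    obtain y where y: "y \<in> Y" "x \<in> V y" using Y(2) \<open>x \<in> ?B\<close> by blast
    then have "0 < (cmod (translate y \<chi>0 x))\<^sup>2" by (simp add: V_def)
    also have "\<dots> \<le> (\<Sum>y\<in>Y. (cmod (translate y \<chi>0 x))\<^sup>2)" using Y(1) y by (intro member_le_sum) auto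
    finally show ?thesis by (simp add: \<Sigma>_re)
  qed
  have "?B \<noteq> {}" by (simp add: R_def)
  then obtain xm where xm: "xm \<in> ?B" "\<And>x. x \<in> ?B \<Longrightarrow> Re (\<Sigma> xm) \<le> Re (\<Sigma> x)"
    using continuous_attains_inf[of ?B "\<lambda>x. Re (\<Sigma> x)"] smooth_imp_continuous_on[OF \<Sigma>_smooth, of ?B]
      compact_cball
    by (metis continuous_on_Re)
  define \<delta> where "\<delta> = Re (\<Sigma> xm)"
  have \<delta>: "\<delta> > 0" unfolding \<delta>_def by (rule \<Sigma>_pos[OF xm(1)])
  \<comment> \<open>The flat term vanishes where \<Sigma> \<ge> \<delta>, in particular on the ball,
    and is positive where \<Sigma> is smaller. Hence \<open>E\<close> is smooth, positive everywhere
    and equal to \<Sigma> on the ball.\<close>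
  define E where "E x = \<Sigma> x + complex_of_real (flat 0 (Re (complex_of_real \<delta> + (-1) * \<Sigma> x)))" for x
  have E_smooth: "smooth E"
    unfolding E_def[abs_def] by (intro smooth_add smooth_flat smooth_mult smooth_const \<Sigma>_smooth)
  have E_pos: "Re (E x) > 0" for x
  proof (cases "Re (\<Sigma> x) \<ge> \<delta>")
    case True
    then show ?thesis using \<delta> flat_nonneg[of 0 "\<delta> - Re (\<Sigma> x)"] by (simp add: E_def)
  next
    case False
    then have "flat 0 (\<delta> - Re (\<Sigma> x)) > 0" by (intro flat_pos) simp
    moreover have "Re (\<Sigma> x) \<ge> 0" by (simp add: \<Sigma>_re sum_nonneg)
    ultimately show ?thesis by (simp add: E_def)
  qed
  have E_ball: "E x = \<Sigma> x" if "x \<in> ?B" for x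
    using xm(2)[OF that] by (simp add: E_def \<delta>_def)
  define \<rho> where "\<rho> y x = (cnj (translate y \<chi>0 x) * of_real (Re (E x) powr (-1))) * \<theta> x" for y x
  have "\<rho> y \<in> test_functions" for y
    unfolding \<rho>_def[abs_def]
    by (intro test_smooth_mult smooth_mult smooth_cnj smooth_translate test_smooth \<chi> smooth_powr
      E_smooth E_pos \<theta>)
  moreover have "\<theta> x = (\<Sum>y\<in>Y. translate y \<chi>0 x * \<rho> y x)" for x
  proof (cases "norm x > R")
    case True
    then show ?thesis by (simp add: \<rho>_def R)
  next
    case False
    then have x: "x \<in> ?B" by simp
    have "(\<Sum>y\<in>Y. translate y \<chi>0 x * \<rho> y x) = \<Sigma> x * of_real (Re (E x) powr (-1)) * \<theta> x"
      unfolding \<rho>_def \<Sigma>_def sum_distrib_right by (intro sum.cong refl) (simp only: mult_ac)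
    also have "\<Sigma> x = of_real (Re (E x))" unfolding E_ball[OF x] by (simp add: \<Sigma>_re)
    also have "of_real (Re (E x)) * of_real (Re (E x) powr (-1)) = (1::complex)"
      using E_pos[of x] by (simp add: powr_minus flip: of_real_mult)
    finally show ?thesis by simp
  qed
  ultimately show thesis using that Y(1) by blast
qed

lemma linear_functional_on_sum:
  assumes u: "linear_functional_on test_functions u" and I: "finite I" "\<And>i. i \<in> I \<Longrightarrow> f i \<in> test_functions"
  shows "u (\<lambda>x. \<Sum>i\<in>I. f i x) = (\<Sum>i\<in>I. u (f i))"
  using I
proof (induction I rule: finite_induct)
  case empty
  have "\<forall>c. \<forall>\<phi>\<in>test_functions. u (\<lambda>x. c * \<phi> x) = c * u \<phi>" using u unfolding linear_functional_on_def by blast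
  from this[rule_format, OF test_zero, of 0]
  show ?case by simp
next
  case (insert i I)
  have add: "u (\<lambda>x. \<phi> x + \<psi> x) = u \<phi> + u \<psi>" if "\<phi> \<in> test_functions" "\<psi> \<in> test_functions" for \<phi> \<psi>
    using u that by (simp add: linear_functional_on_def)
  have t: "f i \<in> test_functions" "(\<lambda>x. \<Sum>i\<in>I. f i x) \<in> test_functions"
    using insert.prems by (auto intro!: test_sum insert.hyps)
  have IH: "u (\<lambda>x. \<Sum>i\<in>I. f i x) = (\<Sum>i\<in>I. u (f i))" by (rule insert.IH) (rule insert.prems, rule insertI2)
  show ?case unfolding sum.insert[OF insert.hyps] add[OF t] IH ..
qed

text \<open>The uniform bound is given for one window only. Writing \<theta> as a finite combination
  of its translates with test functions as coefficients reaches every \<theta>, at the price of a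
  constant that depends on \<theta>.\<close>

lemma sobolev_ul_mult:
  assumes u: "u \<in> sobolev_ul b s" and \<theta>: "\<theta> \<in> test_functions"
  shows "mult_distribution \<theta> u \<in> sobolev b s"
proof -
  obtain \<chi>0 M where \<chi>: "\<chi>0 \<in> test_functions" "\<chi>0 \<noteq> (\<lambda>x. 0)" "M \<ge> 0"
    "\<And>y. dual_bound b s (mult_distribution (translate y \<chi>0) u) M"
    using sobolev_ulE[OF u] by blast
  note lin = sobolev_ul_linear[OF u]
  obtain Y \<rho> where Y: "finite Y" "\<And>y. \<rho> y \<in> test_functions" "\<And>x. \<theta> x = (\<Sum>y\<in>Y. translate y \<chi>0 x * \<rho> y x)"
    using finite_translate_partition[OF \<chi>(1,2) \<theta>] by blast
  have "\<exists>C. C \<ge> 0 \<and> (\<forall>\<phi>\<in>schwartz_functions. Sob b (- s) (\<lambda>x. \<rho> y x * \<phi> x) \<le> C * Sob b (- s) \<phi>)" for y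
  proof -
    obtain C where "C \<ge> 0" "\<And>\<phi>. \<phi> \<in> schwartz_functions \<Longrightarrow> Sob b (- s) (\<lambda>x. \<rho> y x * \<phi> x) \<le> C * Sob b (- s) \<phi>"
      by (rule Sob_mult_schwartz[OF test_imp_schwartz[OF Y(2)[of y]], of b "- s"]) (rule that)
    then show ?thesis by blast
  qed
  then have "\<exists>C. \<forall>y. C y \<ge> 0 \<and> (\<forall>\<phi>\<in>schwartz_functions. Sob b (- s) (\<lambda>x. \<rho> y x * \<phi> x) \<le> C y * Sob b (- s) \<phi>)"
    by (intro choice allI)
  then obtain C where C: "\<And>y. C y \<ge> 0" "\<And>y \<phi>. \<phi> \<in> schwartz_functions \<Longrightarrow>
      Sob b (- s) (\<lambda>x. \<rho> y x * \<phi> x) \<le> C y * Sob b (- s) \<phi>"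
    by blast
  have "cmod (mult_distribution \<theta> u \<phi>) \<le> (\<Sum>y\<in>Y. M * C y) * Sob b (- s) \<phi>" if \<phi>: "\<phi> \<in> test_functions" for \<phi>
  proof -
    have t: "(\<lambda>x. translate y \<chi>0 x * (\<rho> y x * \<phi> x)) \<in> test_functions" for y
      by (intro test_mult test_translate \<chi> Y \<phi>)
    have "mult_distribution \<theta> u \<phi> = u (\<lambda>x. \<Sum>y\<in>Y. translate y \<chi>0 x * (\<rho> y x * \<phi> x))"
      unfolding mult_distribution_def by (subst Y(3)) (simp add: sum_distrib_right mult.assoc)
    also have "\<dots> = (\<Sum>y\<in>Y. mult_distribution (translate y \<chi>0) u (\<lambda>x. \<rho> y x * \<phi> x))"
      unfolding mult_distribution_def by (rule linear_functional_on_sum[OF lin Y(1) t])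
    finally have eq: "mult_distribution \<theta> u \<phi> = (\<Sum>y\<in>Y. mult_distribution (translate y \<chi>0) u
        (\<lambda>x. \<rho> y x * \<phi> x))" .
    have "cmod (mult_distribution \<theta> u \<phi>) \<le> (\<Sum>y\<in>Y. cmod
        (mult_distribution (translate y \<chi>0) u (\<lambda>x. \<rho> y x * \<phi> x)))"
      unfolding eq by (rule norm_sum)
    also have "\<dots> \<le> (\<Sum>y\<in>Y. M * C y * Sob b (- s) \<phi>)"
    proof (rule sum_mono)
      fix y
      have "cmod (mult_distribution (translate y \<chi>0) u (\<lambda>x. \<rho> y x * \<phi> x)) \<le> M * Sob b (- s) (\<lambda>x. \<rho> y x * \<phi> x)"
        using \<chi>(4)[of y] test_mult[OF Y(2) \<phi>, of y] by (simp add: dual_bound_def)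
      also have "\<dots> \<le> M * (C y * Sob b (- s) \<phi>)" by (intro mult_left_mono C \<chi> test_imp_schwartz \<phi>)
      finally show "cmod (mult_distribution (translate y \<chi>0) u (\<lambda>x. \<rho> y x * \<phi> x)) \<le> M * C y * Sob b
          (- s) \<phi>" by (simp add: mult.assoc)
    qed
    finally show ?thesis by (simp add: sum_distrib_right)
  qed
  moreover have "linear_functional_on test_functions (mult_distribution \<theta> u)"
    using lin unfolding linear_functional_on_def mult_distribution_def
    by (simp add: distrib_left mult.left_commute[of "\<theta> _"] test_mult \<theta>)
  moreover have "(\<Sum>y\<in>Y. M * C y) \<ge> 0" by (intro sum_nonneg mult_nonneg_nonneg C \<chi>)
  ultimately have "dual_bound b s (mult_distribution \<theta> u) (\<Sum>y\<in>Y. M * C y)" by (simp add: dual_bound_def)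
  then show ?thesis using sobolev_iff by blast
qed

text \<open>The integrand is the squared modulus of \<open>\<chi>0 x * \<chi>0 x\<close>. Were the
  integral zero, this square would vanish almost everywhere, its Fourier transform would be zero,
  and inversion would make it zero at every point.\<close>

lemma test_integral_norm_pos:
  assumes \<chi>: "\<chi>0 \<in> test_functions" "\<chi>0 \<noteq> (\<lambda>x. 0)"
  shows "(\<integral>x. \<chi>0 x * \<chi>0 x * (cnj (\<chi>0 x) * cnj (\<chi>0 x)) \<partial>lborel) \<noteq> 0"
proof
  let ?f = "\<lambda>x. \<chi>0 x * \<chi>0 x"
  have f: "?f \<in> schwartz_functions" by (intro test_imp_schwartz test_mult \<chi>)
  assume "(\<integral>x. \<chi>0 x * \<chi>0 x * (cnj (\<chi>0 x) * cnj (\<chi>0 x)) \<partial>lborel) = 0"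
  then have "(\<integral>x. ?f x * cnj (?f x) \<partial>lborel) = 0" by simp
  then have "complex_of_real (\<integral>x. (cmod (?f x))\<^sup>2 \<partial>lborel) = 0"
    unfolding complex_norm_square[symmetric] by (simp only: integral_complex_of_real)
  then have "(\<integral>x. (cmod (?f x))\<^sup>2 \<partial>lborel) = 0" by (simp only: of_real_eq_0_iff)
  then have "AE x in lborel. (cmod (?f x))\<^sup>2 = 0"
    using integral_nonneg_eq_0_iff_AE[OF L2_integrable[OF schwartz_L2[OF f]]] by simp
  then have ae: "AE x in lborel. ?f x = 0" by simp
  have "fourier ?f = (\<lambda>\<xi>. 0)"
  proof
    fix \<xi>
    have [measurable]: "?f \<in> borel_measurable borel" by (rule schwartz_measurable[OF f])
    have "fourier ?f \<xi> = (\<integral>x. 0 \<partial>(lborel :: (real ^ 'a) measure))"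
      unfolding fourier_def by (rule integral_cong_AE) (use ae in \<open>auto elim: eventually_mono\<close>)
    then show "fourier ?f \<xi> = 0" by simp
  qed
  then have "?f = inverse_fourier (\<lambda>\<xi>. 0)" using inverse_fourier_fourier[OF f] by simp
  also have "\<dots> = (\<lambda>x. 0)" by (simp add: inverse_fourier_def)
  finally have "?f x = 0" for x by (rule fun_cong)
  then show False using \<chi>(2) by (auto simp: fun_eq_iff)
qed

lemma ennreal_le_if_square_le:
  assumes "x\<^sup>2 \<le> ennreal (r\<^sup>2)" "r \<ge> 0"
  shows "x \<le> ennreal r"
proof (cases x)
  case (real y)
  then have "y\<^sup>2 \<le> r\<^sup>2" using assms by (simp add: ennreal_power)
  then have "y \<le> r" using assms(2) by (rule power2_le_imp_le)
  then show ?thesis using real by (simp add: ennreal_leI)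
next
  case top
  then show ?thesis using assms by (simp add: power2_eq_square ennreal_top_mult top_unique)
qed

subsection \<open>Averaging over translates\<close>

text \<open>If |y| > R + R', the translated window misses the support of \<open>f\<close>. The
  indicator thus changes nothing, and it supplies the integrable function of y that Fubini's theorem
  asks for.\<close>

lemma translate_kernel_integral:
  fixes \<psi> f :: "real ^ 'n::finite \<Rightarrow> complex"
  assumes \<psi>: "\<psi> \<in> test_functions" "\<And>x. norm x > R' \<Longrightarrow> \<psi> x = 0"
    and f: "integrable lborel f" "\<And>x. norm x > R \<Longrightarrow> f x = 0"
  shows "(\<integral>x. \<psi> x \<partial>lborel) * (\<integral>x. f x \<partial>lborel) =
    (\<integral>y. (\<integral>x. translate y \<psi> x * f x \<partial>lborel) * indicator (cball 0 (R + R')) y \<partial>lborel)"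
proof -
  let ?g = "indicator (cball 0 (R + R')) :: real ^ 'n \<Rightarrow> complex"
  have [measurable]: "\<psi> \<in> borel_measurable borel" by (intro schwartz_measurable test_imp_schwartz \<psi>)
  obtain B where B: "\<And>x. cmod (\<psi> x) \<le> B"
    using rapid_imp_bounded[OF schwartz_rapid[OF test_imp_schwartz[OF \<psi>(1)]]] by blast
  have g: "integrable lborel ?g"
  proof -
    have "integrable lborel (\<lambda>y. complex_of_real (indicator (cball 0 (R + R') :: (real ^ 'n) set) y))"
      by (intro integrable_of_real integrable_real_indicator)
        (simp_all add: emeasure_lborel_cball_finite[unfolded infinity_ennreal_def])
    then show ?thesis by (simp add: of_real_indicator)
  qed
  have inner: "(\<integral>y. \<psi> (x - y) * f x * ?g y \<partial>lborel) = (\<integral>x. \<psi> x \<partial>lborel) * f x" for x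
  proof -
    have pt: "\<psi> (x - y) * f x * ?g y = \<psi> (x - y) * f x" for y
    proof (cases "norm x \<le> R \<and> norm (x - y) \<le> R'")
      case True
      then have "norm y \<le> R + R'" using norm_triangle_ineq4[of x "x - y"] by simp
      then show ?thesis by simp
    next
      case False
      then show ?thesis using \<psi>(2)[of "x - y"] f(2)[of x] by auto
    qed
    have eq: "(\<integral>y. \<psi> (x - y) * f x * ?g y \<partial>lborel) = (\<integral>y. \<psi> (x - y) \<partial>lborel) * f x"
      by (simp only: pt integral_mult_left_zero)
    show ?thesis
      using integral_reflect_lborel[of "\<lambda>y. \<psi> (x + y)"] integral_translate[of \<psi> x] unfolding eq by simp
  qed
  have "(\<integral>x. (\<integral>y. \<psi> (x - y) * f x * ?g y \<partial>lborel) \<partial>lborel) = (\<integral>y. (\<integral>x. \<psi> (x - y) * f x * ?g y \<partial>lborel) \<partial>lborel)"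
    by (rule Fubini_bounded_kernel[OF f(1) g _ B]) measurable
  then show ?thesis unfolding inner translate_def by simp
qed

text \<open>For a function that is not integrable the left side is 0 by convention.\<close>

lemma norm_integral_le_nn_integral:
  fixes f :: "'a \<Rightarrow> complex"
  shows "ennreal (cmod (\<integral>x. f x \<partial>M)) \<le> (\<integral>\<^sup>+x. ennreal (cmod (f x)) \<partial>M)"
  by (cases "integrable M f") (simp_all add: integral_norm_bound_ennreal not_integrable_integral_eq)

text \<open>For a Schwartz function in place of \<open>S\<close> the averaging identity is Fubini's
  theorem. Replacing \<open>S\<close> by its approximations \<open>m k\<close> costs at each y at
  most \<open>e k\<close> times the dual norm of the windowed \<phi>; the integral of these norms
  over the relevant y is finite, so the error disappears as k grows and only the integral of
  \<open>F\<close> is left.\<close>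

lemma averaged_bound:
  fixes \<psi> \<phi> :: "real ^ 'n::finite \<Rightarrow> complex"
  assumes S: "dual_bound b \<sigma> S D" and \<psi>: "\<psi> \<in> test_functions" and \<phi>: "\<phi> \<in> test_functions"
    and [measurable]: "F \<in> borel_measurable borel"
    and F: "\<And>y. ennreal (cmod (S (\<lambda>x. translate y \<psi> x * \<phi> x))) \<le> F y"
    and \<kappa>: "(\<integral>\<^sup>+y. F y \<partial>lborel) \<le> ennreal \<kappa>" "\<kappa> \<ge> 0"
  shows "cmod (\<integral>x. \<psi> x \<partial>lborel) * cmod (S \<phi>) \<le> \<kappa>"
proof -
  note \<psi>S = test_imp_schwartz[OF \<psi>] and \<phi>S = test_imp_schwartz[OF \<phi>]
  obtain m where "approximates b \<sigma> S m" using dual_bound_imp(3)[OF S] by blast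
  then obtain e where m: "\<And>k. m k \<in> schwartz_functions" and e: "e \<longlonglongrightarrow> 0" "\<And>k. e k \<ge> 0"
    "\<And>k \<phi>. \<phi> \<in> test_functions \<Longrightarrow> cmod (S \<phi> - (\<integral>x. m k x * \<phi> x \<partial>lborel)) \<le> e k * Sob b (- \<sigma>) \<phi>"
    unfolding approximates_def by blast
  obtain R where "\<And>x. \<phi> x \<noteq> 0 \<Longrightarrow> norm x \<le> R" using \<phi> unfolding test_functions_iff by blast
  then have R: "\<And>x. norm x > R \<Longrightarrow> \<phi> x = 0" by force
  obtain R' where "\<And>x. \<psi> x \<noteq> 0 \<Longrightarrow> norm x \<le> R'" using \<psi> unfolding test_functions_iff by blast
  then have R': "\<And>x. norm x > R' \<Longrightarrow> \<psi> x = 0" by force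
  let ?B = "cball 0 (R + R') :: (real ^ 'n) set"
  let ?H = "\<lambda>y. Sob b (- \<sigma>) (\<lambda>x. translate y \<psi> x * \<phi> x)"
  note [measurable] = Sob_translate_measurable[OF \<psi>S \<phi>S, of b "- \<sigma>"]
  obtain C where C: "C \<ge> 0" "\<And>\<phi>. \<phi> \<in> schwartz_functions \<Longrightarrow>
    (\<integral>\<^sup>+y. ennreal ((Sob b (- \<sigma>) (\<lambda>x. translate y \<psi> x * \<phi> x))\<^sup>2) \<partial>lborel) \<le> ennreal (C\<^sup>2 * (Sob b (- \<sigma>) \<phi>)\<^sup>2)"
    by (rule Sob_translate_square_integral[OF \<psi>S, of b "- \<sigma>"]) (rule that)
  have ind [measurable]: "indicator ?B \<in> borel_measurable lborel" by (intro borel_measurable_indicator) simp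
  \<comment> \<open>Inside the ball the error involves the norm \<open>?H y\<close>, of which only
    the square is known to be integrable; it is at most 1 + (?H y)^2, and the ball has finite
    measure.\<close>
  let ?G = "\<lambda>y. indicator ?B y + ennreal ((?H y)\<^sup>2)"
  have "(\<integral>\<^sup>+y. ?G y \<partial>lborel) = emeasure lborel ?B + (\<integral>\<^sup>+y. ennreal ((?H y)\<^sup>2) \<partial>lborel)"
    using nn_integral_add[OF ind, of "\<lambda>y. ennreal ((?H y)\<^sup>2)"] by simp
  also have "\<dots> < \<infinity>"
    using emeasure_lborel_cball_finite[of "0 :: real ^ 'n" "R + R'"]
      le_less_trans[OF C(2)[OF \<phi>S] ennreal_less_top] by simp
  finally obtain l where l: "(\<integral>\<^sup>+y. ?G y \<partial>lborel) = ennreal l" "l \<ge> 0"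
    by (cases "\<integral>\<^sup>+y. ?G y \<partial>lborel") auto
  have le: "cmod (\<integral>x. \<psi> x \<partial>lborel) * cmod (\<integral>x. m k x * \<phi> x \<partial>lborel) \<le> \<kappa> + e k * l" for k
  proof -
    let ?I = "\<lambda>y. \<integral>x. translate y \<psi> x * (m k x * \<phi> x) \<partial>lborel"
    have pt: "ennreal (cmod (?I y * indicator ?B y)) \<le> F y + ennreal (e k) * ?G y" for y
    proof (cases "y \<in> ?B")
      case True
      have t: "(\<lambda>x. translate y \<psi> x * \<phi> x) \<in> test_functions" by (intro test_mult test_translate \<psi> \<phi>)
      have I: "?I y = (\<integral>x. m k x * (translate y \<psi> x * \<phi> x) \<partial>lborel)" by (simp only: mult_ac)
      have "cmod (?I y) \<le> cmod (S (\<lambda>x. translate y \<psi> x * \<phi> x)) + e k * ?H y"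
        using e(3)[OF t, of k] norm_triangle_ineq2[of "?I y" "S (\<lambda>x. translate y \<psi> x * \<phi> x)"]
        unfolding I by (simp add: norm_minus_commute)
      also have "e k * ?H y \<le> e k * (1 + (?H y)\<^sup>2)"
      proof (rule mult_left_mono[OF _ e(2)])
        have "0 \<le> (?H y - 1)\<^sup>2" "0 \<le> ?H y" by (simp_all add: Sob_nonneg)
        then show "?H y \<le> 1 + (?H y)\<^sup>2" unfolding power2_diff by simp
      qed
      finally have "ennreal (cmod (?I y)) \<le> ennreal
          (cmod (S (\<lambda>x. translate y \<psi> x * \<phi> x)) + e k * (1 + (?H y)\<^sup>2))"
        by (intro ennreal_leI) simp
      also have "\<dots> = ennreal (cmod (S (\<lambda>x. translate y \<psi> x * \<phi> x))) + ennreal (e k) * (1 + ennreal ((?H y)\<^sup>2))"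
        using e(2)[of k] by (simp add: ennreal_plus ennreal_mult)
      also have "\<dots> \<le> F y + ennreal (e k) * (1 + ennreal ((?H y)\<^sup>2))" by (intro add_right_mono F)
      finally show ?thesis using True by simp
    qed simp
    have Gm: "?G \<in> borel_measurable lborel" by measurable
    have int: "integrable lborel (\<lambda>x. m k x * \<phi> x)" by (intro schwartz_integrable schwartz_mult m \<phi>S)
    have eq: "(\<integral>x. \<psi> x \<partial>lborel) * (\<integral>x. m k x * \<phi> x \<partial>lborel) = (\<integral>y. ?I y * indicator ?B y \<partial>lborel)"
      by (rule translate_kernel_integral[OF \<psi> R' int]) (simp_all add: R)
    have "ennreal (cmod ((\<integral>x. \<psi> x \<partial>lborel) * (\<integral>x. m k x * \<phi> x \<partial>lborel))) \<le>
        (\<integral>\<^sup>+y. ennreal (cmod (?I y * indicator ?B y)) \<partial>lborel)"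
      unfolding eq by (rule norm_integral_le_nn_integral)
    also have "\<dots> \<le> (\<integral>\<^sup>+y. F y + ennreal (e k) * ?G y \<partial>lborel)" by (intro nn_integral_mono pt)
    also have "\<dots> = (\<integral>\<^sup>+y. F y \<partial>lborel) + ennreal (e k) * (\<integral>\<^sup>+y. ?G y \<partial>lborel)"
      unfolding nn_integral_cmult[OF Gm, symmetric] by (rule nn_integral_add) measurable
    also have "\<dots> \<le> ennreal \<kappa> + ennreal (e k) * ennreal l" unfolding l(1) by (intro add_right_mono \<kappa>)
    also have "\<dots> = ennreal (\<kappa> + e k * l)" using \<kappa>(2) l(2) e(2)[of k] by (simp add: ennreal_plus ennreal_mult)
    finally have "ennreal (cmod ((\<integral>x. \<psi> x \<partial>lborel) * (\<integral>x. m k x * \<phi> x \<partial>lborel))) \<le> ennreal (\<kappa> + e k * l)" .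
    moreover have "0 \<le> \<kappa> + e k * l" using \<kappa>(2) l(2) e(2)[of k] by simp
    ultimately show ?thesis by (simp only: ennreal_le_iff norm_mult)
  qed
  have lim: "(\<lambda>k. \<integral>x. m k x * \<phi> x \<partial>lborel) \<longlonglongrightarrow> S \<phi>"
  proof -
    have "\<forall>\<^sub>F k in sequentially. norm ((\<integral>x. m k x * \<phi> x \<partial>lborel) - S \<phi>) \<le> e k * Sob b (- \<sigma>) \<phi>"
      using e(3)[OF \<phi>] by (simp add: norm_minus_commute)
    moreover have "(\<lambda>k. e k * Sob b (- \<sigma>) \<phi>) \<longlonglongrightarrow> 0" using tendsto_mult_right[OF e(1), of "Sob b (- \<sigma>) \<phi>"] by simp
    ultimately have "(\<lambda>k. (\<integral>x. m k x * \<phi> x \<partial>lborel) - S \<phi>) \<longlonglongrightarrow> 0" by (rule Lim_null_comparison)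
    then show ?thesis by (rule LIM_zero_cancel)
  qed
  have lim1: "(\<lambda>k. cmod (\<integral>x. \<psi> x \<partial>lborel) * cmod (\<integral>x. m k x * \<phi> x \<partial>lborel)) \<longlonglongrightarrow> cmod (\<integral>x. \<psi> x \<partial>lborel) *
      cmod (S \<phi>)"
    by (intro tendsto_mult tendsto_const tendsto_norm lim)
  have lim2: "(\<lambda>k. \<kappa> + e k * l) \<longlonglongrightarrow> \<kappa> + 0 * l" by (intro tendsto_intros e)
  have "cmod (\<integral>x. \<psi> x \<partial>lborel) * cmod (S \<phi>) \<le> \<kappa> + 0 * l" by (rule LIMSEQ_le[OF lim1 lim2]) (use le in blast)
  then show ?thesis by simp
qed

lemma mult_distribution_of: "mult_distribution \<theta> (distribution_of f) = distribution_of (\<lambda>x. \<theta> x * f x)"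
  by (simp add: mult_distribution_def distribution_of_def fun_eq_iff mult_ac)

lemma mult_distribution_commute:
  "mult_distribution \<theta> (mult_distribution \<eta> u) = mult_distribution \<eta> (mult_distribution \<theta> u)"
  by (simp add: mult_distribution_def mult.left_commute)

section \<open>A bound for cut-off products that is uniform in the cutoff\<close>

text \<open>What matters is that \<open>K\<close> is chosen before \<theta>. The norm of the cut-off
  factor only certifies that the product lies in H^\<sigma>, so that averaging applies; it does not
  enter the bound. The second factor is a Schwartz function because the square integral over window
  positions is available for those.\<close>

lemma cutoff_sprod_schwartz_bound:
  fixes b :: "'n::finite \<Rightarrow> 'j::finite"
  assumes T: "trilinear_bound b s t \<sigma> C" and \<chi>: "\<chi>0 \<in> test_functions" "\<chi>0 \<noteq> (\<lambda>x. 0)"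
    and uM: "\<And>y. dual_bound b s (mult_distribution (translate y \<chi>0) u) M"
  obtains K where "K \<ge> 0" "\<And>\<theta> g \<phi>. \<theta> \<in> test_functions \<Longrightarrow> mult_distribution \<theta> u \<in> sobolev b s \<Longrightarrow>
      g \<in> schwartz_functions \<Longrightarrow> \<phi> \<in> test_functions \<Longrightarrow> (\<lambda>x. \<theta> x * \<phi> x) = \<phi> \<Longrightarrow>
      cmod (sprod b s t (mult_distribution \<theta> u) (distribution_of g) \<phi>) \<le> K * Sob b t g * Sob b (- \<sigma>) \<phi>"
proof -
  let ?\<eta> = "\<lambda>x. cnj (\<chi>0 x) * cnj (\<chi>0 x)"
  let ?\<psi> = "\<lambda>x. \<chi>0 x * \<chi>0 x * ?\<eta> x"
  note \<chi>S = test_imp_schwartz[OF \<chi>(1)]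
  have \<eta>: "?\<eta> \<in> test_functions" by (intro test_mult test_cnj \<chi>)
  note \<eta>S = test_imp_schwartz[OF \<eta>]
  have \<psi>: "?\<psi> \<in> test_functions" by (intro test_mult test_cnj \<chi>)
  define c where "c = cmod (\<integral>x. ?\<psi> x \<partial>lborel)"
  have c: "c > 0" unfolding c_def using test_integral_norm_pos[OF \<chi>] by simp
  have C0: "C \<ge> 0" by (rule trilinear_boundD(1)[OF T])
  obtain C1 where C1: "C1 \<ge> 0" "\<And>\<phi>. \<phi> \<in> schwartz_functions \<Longrightarrow>
    (\<integral>\<^sup>+y. ennreal ((Sob b t (\<lambda>x. translate y \<chi>0 x * \<phi> x))\<^sup>2) \<partial>lborel) \<le> ennreal (C1\<^sup>2 * (Sob b t \<phi>)\<^sup>2)"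
    by (rule Sob_translate_square_integral[OF \<chi>S, of b t]) (rule that)
  obtain C2 where C2: "C2 \<ge> 0" "\<And>\<phi>. \<phi> \<in> schwartz_functions \<Longrightarrow>
    (\<integral>\<^sup>+y. ennreal ((Sob b (- \<sigma>) (\<lambda>x. translate y ?\<eta> x * \<phi> x))\<^sup>2) \<partial>lborel) \<le> ennreal (C2\<^sup>2 * (Sob b (- \<sigma>) \<phi>)\<^sup>2)"
    by (rule Sob_translate_square_integral[OF \<eta>S, of b "- \<sigma>"]) (rule that)
  have M: "M \<ge> 0" using uM by (simp add: dual_bound_def)
  \<comment> \<open>\<open>C\<close> is the trilinear constant, \<open>M\<close> the uniform bound
    for the windowed u, \<open>C1\<close> and \<open>C2\<close> belong to the square integrals for
    \<open>g\<close> and \<phi>, and \<open>c\<close> is the mass of the averaging window.\<close>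
  have "cmod (sprod b s t (mult_distribution \<theta> u) (distribution_of g) \<phi>) \<le> (C * M * C1 * C2 / c) * Sob b
      t g * Sob b (- \<sigma>) \<phi>"
    if \<theta>: "\<theta> \<in> test_functions"
      and \<theta>u: "mult_distribution \<theta> u \<in> sobolev b s" and g: "g \<in> schwartz_functions"
      and \<phi>: "\<phi> \<in> test_functions" and \<theta>\<phi>: "(\<lambda>x. \<theta> x * \<phi> x) = \<phi>" for \<theta> g \<phi>
  proof -
    note \<phi>S = test_imp_schwartz[OF \<phi>]
    let ?S = "sprod b s t (mult_distribution \<theta> u) (distribution_of g)"
    obtain D where "dual_bound b s (mult_distribution \<theta> u) D" using \<theta>u sobolev_iff by blast
    then have S: "dual_bound b \<sigma> ?S (C * D * Sob b t g)"
      by (rule sprod_dual_bound[OF T _ dual_bound_schwartz[OF g]])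
    let ?A = "\<lambda>y. Sob b t (\<lambda>x. translate y \<chi>0 x * g x)"
    let ?H = "\<lambda>y. Sob b (- \<sigma>) (\<lambda>x. translate y ?\<eta> x * \<phi> x)"
    note [measurable] = Sob_translate_measurable[OF \<chi>S g, of b t] Sob_translate_measurable[OF \<eta>S \<phi>S, of b "- \<sigma>"]
    let ?F = "\<lambda>y. ennreal (C * M) * (ennreal (?A y) * ennreal (?H y))"
    have pt: "ennreal (cmod (?S (\<lambda>x. translate y ?\<psi> x * \<phi> x))) \<le> ?F y" for y
    proof -
      let ?\<chi> = "translate y \<chi>0"
      let ?h = "\<lambda>x. translate y ?\<eta> x * \<phi> x"
      have h: "?h \<in> schwartz_functions" by (intro schwartz_mult schwartz_translate \<eta>S \<phi>S)
      have \<chi>h: "(\<lambda>x. ?\<chi> x * ?h x) \<in> schwartz_functions" by (intro schwartz_mult schwartz_translate \<chi>S h)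
      have \<chi>t: "?\<chi> \<in> test_functions" by (intro test_translate \<chi>)
      have gs: "distribution_of g \<in> sobolev b t" using dual_bound_schwartz[OF g] sobolev_iff by blast
      have us: "mult_distribution ?\<chi> u \<in> sobolev b s" using uM sobolev_iff by blast
      have E: "dual_bound b t (mult_distribution ?\<chi> (distribution_of g)) (?A y)"
        unfolding mult_distribution_of by (intro dual_bound_schwartz schwartz_mult schwartz_translate \<chi>S g)
      then have Es: "mult_distribution ?\<chi> (distribution_of g) \<in> sobolev b t" using sobolev_iff by blast
      \<comment> \<open>The window is taken apart: one copy of the translated \<open>\<chi>0\<close>
        goes to u, one to \<open>g\<close>, and the conjugate square stays with \<phi>.\<close>
      have "(\<lambda>x. translate y ?\<psi> x * \<phi> x) = (\<lambda>x. ?\<chi> x * (?\<chi> x * ?h x))"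
        by (simp add: translate_def fun_eq_iff mult.assoc)
      then have "?S (\<lambda>x. translate y ?\<psi> x * \<phi> x) = ?S (\<lambda>x. ?\<chi> x * (?\<chi> x * ?h x))" by (rule arg_cong)
      also have "\<dots> = sprod b s t (mult_distribution ?\<chi> (mult_distribution \<theta> u))
          (mult_distribution ?\<chi> (distribution_of g)) ?h"
        unfolding sprod_mult_left[OF T \<theta>u gs \<chi>t \<chi>h, symmetric]
          sprod_mult_right[OF T sobolev_mult[OF \<chi>t \<theta>u] gs \<chi>t h] ..
      also have "\<dots> = sprod b s t (mult_distribution \<theta> (mult_distribution ?\<chi> u))
          (mult_distribution ?\<chi> (distribution_of g)) ?h"
        by (simp only: mult_distribution_commute)
      also have "\<dots> = sprod b s t (mult_distribution ?\<chi> u) (mult_distribution ?\<chi> (distribution_of g))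
          (\<lambda>x. \<theta> x * ?h x)"
        by (rule sprod_mult_left[OF T us Es \<theta> h])
      \<comment> \<open>Here \<theta> disappears, as it acts on \<phi> as the identity.\<close>
      also have "(\<lambda>x. \<theta> x * ?h x) = ?h" by (simp only: mult.left_commute[of "\<theta> _"] fun_cong[OF \<theta>\<phi>])
      finally have eq: "?S (\<lambda>x. translate y ?\<psi> x * \<phi> x) =
          sprod b s t (mult_distribution ?\<chi> u) (mult_distribution ?\<chi> (distribution_of g)) ?h" .
      have "cmod (?S (\<lambda>x. translate y ?\<psi> x * \<phi> x)) \<le> C * M * ?A y * ?H y"
        unfolding eq by (rule sprod_bound[OF T uM E h])
      then have "ennreal (cmod (?S (\<lambda>x. translate y ?\<psi> x * \<phi> x))) \<le> ennreal (C * M * ?A y * ?H y)"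
        by (rule ennreal_leI)
      also have "\<dots> = ?F y"
        by (simp only: ennreal_mult[symmetric] mult_nonneg_nonneg Sob_nonneg C0 M mult.assoc)
      finally show ?thesis .
    qed
    have "(\<integral>\<^sup>+y. ennreal (?A y) * ennreal (?H y) \<partial>lborel)\<^sup>2 \<le>
        (\<integral>\<^sup>+y. (ennreal (?A y))\<^sup>2 \<partial>lborel) * (\<integral>\<^sup>+y. (ennreal (?H y))\<^sup>2 \<partial>lborel)"
      by (rule Cauchy_Schwarz_nn_integral) measurable
    also have "\<dots> \<le> ennreal (C1\<^sup>2 * (Sob b t g)\<^sup>2) * ennreal (C2\<^sup>2 * (Sob b (- \<sigma>) \<phi>)\<^sup>2)"
      using C1(2)[OF g] C2(2)[OF \<phi>S] by (intro mult_mono) (simp_all add: ennreal_power Sob_nonneg)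
    also have "\<dots> = ennreal ((C1 * Sob b t g * (C2 * Sob b (- \<sigma>) \<phi>))\<^sup>2)"
      by (simp only: ennreal_mult[symmetric] mult_nonneg_nonneg zero_le_power2 power_mult_distrib)
    finally have "(\<integral>\<^sup>+y. ennreal (?A y) * ennreal (?H y) \<partial>lborel) \<le> ennreal
        (C1 * Sob b t g * (C2 * Sob b (- \<sigma>) \<phi>))"
      by (rule ennreal_le_if_square_le) (intro mult_nonneg_nonneg Sob_nonneg C1 C2)
    then have "ennreal (C * M) * (\<integral>\<^sup>+y. ennreal (?A y) * ennreal (?H y) \<partial>lborel) \<le> ennreal (C * M) *
        ennreal (C1 * Sob b t g * (C2 * Sob b (- \<sigma>) \<phi>))"
      by (rule mult_left_mono) simp
    moreover have "(\<integral>\<^sup>+y. ?F y \<partial>lborel) = ennreal (C * M) * (\<integral>\<^sup>+y. ennreal (?A y) * ennreal (?H y) \<partial>lborel)"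
      by (rule nn_integral_cmult) measurable
    ultimately have int: "(\<integral>\<^sup>+y. ?F y \<partial>lborel) \<le> ennreal (C * M * (C1 * Sob b t g * (C2 * Sob b (- \<sigma>) \<phi>)))"
      by (simp only: ennreal_mult[symmetric] mult_nonneg_nonneg Sob_nonneg C0 M C1(1) C2(1))
    have Fm: "?F \<in> borel_measurable borel" by measurable
    have "c * cmod (?S \<phi>) \<le> C * M * (C1 * Sob b t g * (C2 * Sob b (- \<sigma>) \<phi>))"
      unfolding c_def by (rule averaged_bound[OF S \<psi> \<phi> Fm pt int])
        (intro mult_nonneg_nonneg Sob_nonneg C0 M C1 C2)
    then show ?thesis using c by (simp add: field_simps)
  qed
  moreover have "C * M * C1 * C2 / c \<ge> 0" using C0 C1(1) C2(1) c M by simp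
  ultimately show thesis using that by blast
qed

text \<open>Replacing \<open>v\<close> by a Schwartz approximation costs an error that contains the
  norm \<open>D\<close> of the cut-off u, hence depends on \<theta>. For fixed \<theta> it tends to
  0, so the final constant \<open>K * E\<close> is again independent of \<theta>.\<close>

lemma cutoff_sprod_bound:
  fixes b :: "'n::finite \<Rightarrow> 'j::finite"
  assumes T: "trilinear_bound b s t \<sigma> C" and u: "u \<in> sobolev_ul b s" and v: "dual_bound b t v E"
  obtains K where "K \<ge> 0" "\<And>\<theta> \<phi>. \<theta> \<in> test_functions \<Longrightarrow> \<phi> \<in> test_functions \<Longrightarrow> (\<lambda>x. \<theta> x * \<phi> x) = \<phi> \<Longrightarrow>
      cmod (sprod b s t (mult_distribution \<theta> u) v \<phi>) \<le> K * Sob b (- \<sigma>) \<phi>"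
proof -
  obtain \<chi>0 M where \<chi>: "\<chi>0 \<in> test_functions" "\<chi>0 \<noteq> (\<lambda>x. 0)" "M \<ge> 0"
    "\<And>y. dual_bound b s (mult_distribution (translate y \<chi>0) u) M"
    using sobolev_ulE[OF u] by blast
  obtain K where K: "K \<ge> 0" "\<And>\<theta> g \<phi>. \<theta> \<in> test_functions \<Longrightarrow> mult_distribution \<theta> u \<in> sobolev b s \<Longrightarrow>
      g \<in> schwartz_functions \<Longrightarrow> \<phi> \<in> test_functions \<Longrightarrow> (\<lambda>x. \<theta> x * \<phi> x) = \<phi> \<Longrightarrow>
      cmod (sprod b s t (mult_distribution \<theta> u) (distribution_of g) \<phi>) \<le> K * Sob b t g * Sob b (- \<sigma>) \<phi>"
    by (rule cutoff_sprod_schwartz_bound[OF T \<chi>(1,2,4)]) (rule that)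
  have vs: "v \<in> sobolev b t" using v sobolev_iff by blast
  obtain g where g: "approximates b t v g" using dual_bound_imp(3)[OF v] by blast
  note gS = approximates_schwartz[OF g]
  obtain e where e: "e \<longlonglongrightarrow> 0" "\<And>k. e k \<ge> 0"
      "\<And>k \<phi>. \<phi> \<in> test_functions \<Longrightarrow> cmod (v \<phi> - (\<integral>x. g k x * \<phi> x \<partial>lborel)) \<le> e k * Sob b (- t) \<phi>"
    using g unfolding approximates_def by blast
  obtain e' where e': "e' \<longlonglongrightarrow> 0" "\<And>k. e' k \<ge> 0" "\<And>k. Sob b t (g k) \<le> E + e' k"
    by (rule approximates_Sob[OF g v]) (rule that)
  have E0: "E \<ge> 0" using v by (simp add: dual_bound_def)
  have "cmod (sprod b s t (mult_distribution \<theta> u) v \<phi>) \<le> (K * E) * Sob b (- \<sigma>) \<phi>"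
    if \<theta>: "\<theta> \<in> test_functions" and \<phi>: "\<phi> \<in> test_functions" and \<theta>\<phi>: "(\<lambda>x. \<theta> x * \<phi> x) = \<phi>" for \<theta> \<phi>
  proof -
    let ?u = "mult_distribution \<theta> u" and ?N = "Sob b (- \<sigma>) \<phi>"
    have us: "?u \<in> sobolev b s" by (rule sobolev_ul_mult[OF u \<theta>])
    then obtain D where D: "dual_bound b s ?u D" using sobolev_iff by blast
    have le: "cmod (sprod b s t ?u v \<phi>) \<le> K * (E + e' k) * ?N + C * (0 * E + D * e k) * ?N" for k
    proof -
      let ?g = "distribution_of (g k)"
      have gs: "?g \<in> sobolev b t" using dual_bound_schwartz[OF gS] sobolev_iff by blast
      have 1: "cmod (sprod b s t ?u v \<phi> - sprod b s t ?u ?g \<phi>) \<le> C * (0 * E + D * e k) * ?N"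
        by (rule sprod_diff_bound[OF T us D v gs]) (simp_all add: e distribution_of_def test_imp_schwartz[OF \<phi>])
      have "cmod (sprod b s t ?u ?g \<phi>) \<le> K * Sob b t (g k) * ?N"
        by (rule K(2)[OF \<theta> us gS \<phi> \<theta>\<phi>])
      also have "\<dots> \<le> K * (E + e' k) * ?N"
        by (intro mult_right_mono mult_left_mono e' mult_nonneg_nonneg K \<chi> Sob_nonneg)
      finally show ?thesis
        using 1 norm_triangle_sub[of "sprod b s t ?u v \<phi>" "sprod b s t ?u ?g \<phi>"] by linarith
    qed
    have "(\<lambda>k. K * (E + e' k) * ?N + C * (0 * E + D * e k) * ?N) \<longlonglongrightarrow> K * (E + 0) * ?N + C * (0 * E + D * 0) * ?N"
      by (intro tendsto_intros e e')
    from LIMSEQ_le_const[OF this] le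
    have "cmod (sprod b s t ?u v \<phi>) \<le> K * (E + 0) * ?N + C * (0 * E + D * 0) * ?N" by blast
    then show ?thesis by simp
  qed
  moreover have "K * E \<ge> 0" by (intro mult_nonneg_nonneg K \<chi> E0)
  ultimately show thesis using that by blast
qed

subsection \<open>Products with uniformly local factors\<close>

lemma common_cutoff:
  fixes \<phi> \<psi> :: "real ^ 'n::finite \<Rightarrow> complex"
  assumes "\<phi> \<in> test_functions" "\<psi> \<in> test_functions"
  obtains \<theta> where "\<theta> \<in> test_functions" "(\<lambda>x. \<theta> x * \<phi> x) = \<phi>" "(\<lambda>x. \<theta> x * \<psi> x) = \<psi>"
proof -
  obtain R R' where R: "\<And>x. \<phi> x \<noteq> 0 \<Longrightarrow> norm x \<le> R" "\<And>x. \<psi> x \<noteq> 0 \<Longrightarrow> norm x \<le> R'"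
    using assms unfolding test_functions_iff by blast
  obtain \<theta> :: "real ^ 'n \<Rightarrow> complex" where \<theta>: "\<theta> \<in> test_functions" "\<And>x. norm x \<le> max R R' \<Longrightarrow> \<theta> x = 1"
    by (rule cutoff_ball_exists[of "max R R'"]) (rule that)
  have "\<theta> x * \<phi> x = \<phi> x" "\<theta> x * \<psi> x = \<psi> x" for x
    using R[of x] \<theta>(2)[of x] by (cases "\<phi> x = 0"; cases "\<psi> x = 0"; simp)+
  then show thesis using that[OF \<theta>(1)] by blast
qed

text \<open>A function equal to 1 wherever \<phi> is nonzero: multiplication by it brings a
  uniformly local distribution into the global space without changing its pairing with
  \<phi>.\<close>

definition cutoff :: "(real ^ 'n::finite \<Rightarrow> complex) \<Rightarrow> real ^ 'n \<Rightarrow> complex" where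
  "cutoff \<phi> = (SOME \<theta>. \<theta> \<in> test_functions \<and> (\<lambda>x. \<theta> x * \<phi> x) = \<phi>)"

lemma cutoff:
  assumes "\<phi> \<in> test_functions"
  shows "cutoff \<phi> \<in> test_functions" "(\<lambda>x. cutoff \<phi> x * \<phi> x) = \<phi>"
proof -
  obtain \<theta> where "\<theta> \<in> test_functions" "(\<lambda>x. \<theta> x * \<phi> x) = \<phi>" by (rule common_cutoff[OF assms assms]) (rule that)
  then have "cutoff \<phi> \<in> test_functions \<and> (\<lambda>x. cutoff \<phi> x * \<phi> x) = \<phi>"
    unfolding cutoff_def by (intro someI[where P = "\<lambda>\<theta>. \<theta> \<in> test_functions \<and> (\<lambda>x. \<theta> x * \<phi> x) = \<phi>"] conjI)
  then show "cutoff \<phi> \<in> test_functions" "(\<lambda>x. cutoff \<phi> x * \<phi> x) = \<phi>" by auto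
qed

text \<open>Only \<open>u\<close> has to be cut off. As the cutoff is chosen separately for each
  \<phi>, linearity is not evident and rests on independence of the cutoff.\<close>

definition ul_product :: "('n::finite \<Rightarrow> 'j::finite) \<Rightarrow> real ^ 'j \<Rightarrow> real ^ 'j \<Rightarrow> 'n func \<Rightarrow> 'n func \<Rightarrow> 'n func" where
  "ul_product b s t u v \<phi> = sprod b s t (mult_distribution (cutoff \<phi>) u) v \<phi>"

lemma mult_distribution_absorb:
  assumes "(\<lambda>x. \<theta>' x * \<theta> x) = \<theta>"
  shows "mult_distribution \<theta> (mult_distribution \<theta>' u) = mult_distribution \<theta> u"
  using fun_cong[OF assms] by (simp only: mult_distribution_def mult.assoc[symmetric])

text \<open>With both cutoffs applied to \<open>u\<close>, either one can be moved onto \<phi> and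
  absorbed there, which leaves the other.\<close>

lemma ul_product_eq:
  assumes T: "trilinear_bound b s t \<sigma> C" and u: "u \<in> sobolev_ul b s" and v: "v \<in> sobolev b t"
    and \<theta>: "\<theta> \<in> test_functions" "(\<lambda>x. \<theta> x * \<phi> x) = \<phi>" and \<phi>: "\<phi> \<in> test_functions"
  shows "ul_product b s t u v \<phi> = sprod b s t (mult_distribution \<theta> u) v \<phi>"
proof -
  note \<phi>S = test_imp_schwartz[OF \<phi>]
  note c = cutoff[OF \<phi>]
  note U = sobolev_ul_mult[OF u]
  have "sprod b s t (mult_distribution (cutoff \<phi>) u) v \<phi> =
      sprod b s t (mult_distribution \<theta> (mult_distribution (cutoff \<phi>) u)) v \<phi>"
    unfolding sprod_mult_left[OF T U[OF c(1)] v \<theta>(1) \<phi>S] \<theta>(2) ..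
  also have "\<dots> = sprod b s t (mult_distribution (cutoff \<phi>) (mult_distribution \<theta> u)) v \<phi>"
    by (simp only: mult_distribution_commute)
  also have "\<dots> = sprod b s t (mult_distribution \<theta> u) v \<phi>"
    unfolding sprod_mult_left[OF T U[OF \<theta>(1)] v c(1) \<phi>S] c(2) ..
  finally show ?thesis unfolding ul_product_def .
qed

text \<open>For a sum, one cutoff that serves both summands also serves the sum, and for this fixed
  cutoff \<open>sprod\<close> is linear.\<close>

lemma ul_product_linear:
  assumes T: "trilinear_bound b s t \<sigma> C" and u: "u \<in> sobolev_ul b s" and v: "v \<in> sobolev b t"
  shows "linear_functional_on test_functions (ul_product b s t u v)"
proof -
  note eq = ul_product_eq[OF T u v]
  note lin = sprod_linear[OF T sobolev_ul_mult[OF u] v]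
  have "ul_product b s t u v (\<lambda>x. \<phi> x + \<psi> x) = ul_product b s t u v \<phi> + ul_product b s t u v \<psi>"
    if \<phi>: "\<phi> \<in> test_functions" and \<psi>: "\<psi> \<in> test_functions" for \<phi> \<psi>
  proof -
    obtain \<theta> where \<theta>: "\<theta> \<in> test_functions" "(\<lambda>x. \<theta> x * \<phi> x) = \<phi>" "(\<lambda>x. \<theta> x * \<psi> x) = \<psi>"
      by (rule common_cutoff[OF \<phi> \<psi>]) (rule that)
    have "(\<lambda>x. \<theta> x * (\<phi> x + \<psi> x)) = (\<lambda>x. \<phi> x + \<psi> x)"
      by (simp only: distrib_left fun_cong[OF \<theta>(2)] fun_cong[OF \<theta>(3)])
    from eq[OF \<theta>(1) this test_add[OF \<phi> \<psi>]] show ?thesis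
      unfolding eq[OF \<theta>(1,2) \<phi>] eq[OF \<theta>(1,3) \<psi>]
      using lin[OF \<theta>(1)] test_imp_schwartz[OF \<phi>] test_imp_schwartz[OF \<psi>] by (simp add: linear_functional_on_def)
  qed
  moreover have "ul_product b s t u v (\<lambda>x. c * \<phi> x) = c * ul_product b s t u v \<phi>"
    if \<phi>: "\<phi> \<in> test_functions" for c \<phi>
  proof -
    note \<theta> = cutoff[OF \<phi>]
    have "(\<lambda>x. cutoff \<phi> x * (c * \<phi> x)) = (\<lambda>x. c * \<phi> x)"
      by (simp only: mult.left_commute[of _ c] fun_cong[OF \<theta>(2)])
    from eq[OF \<theta>(1) this test_cmult[OF \<phi>]] show ?thesis
      unfolding eq[OF \<theta> \<phi>]
      using lin[OF \<theta>(1)] test_imp_schwartz[OF \<phi>] by (simp add: linear_functional_on_def)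
  qed
  ultimately show ?thesis by (simp add: linear_functional_on_def)
qed

lemma ul_product_dual_bound:
  assumes T: "trilinear_bound b s t \<sigma> C" and u: "u \<in> sobolev_ul b s" and v: "v \<in> sobolev b t"
  obtains K where "dual_bound b \<sigma> (ul_product b s t u v) K"
proof -
  obtain E where E: "dual_bound b t v E" using v sobolev_iff by blast
  obtain K where K: "K \<ge> 0" "\<And>\<theta> \<phi>. \<theta> \<in> test_functions \<Longrightarrow> \<phi> \<in> test_functions \<Longrightarrow> (\<lambda>x. \<theta> x * \<phi> x) = \<phi> \<Longrightarrow>
      cmod (sprod b s t (mult_distribution \<theta> u) v \<phi>) \<le> K * Sob b (- \<sigma>) \<phi>"
    by (rule cutoff_sprod_bound[OF T u E]) (rule that)
  have "dual_bound b \<sigma> (ul_product b s t u v) K"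
    unfolding dual_bound_def ul_product_def[abs_def]
    using K cutoff ul_product_linear[OF T u v, unfolded ul_product_def[abs_def]] by blast
  then show thesis by (rule that)
qed

text \<open>On functions supported in a fixed compact set the Sobolev norm is dominated by a test
  seminorm. A local product is required to be a distribution, hence this bound.\<close>

lemma dual_bound_distributions:
  assumes u: "dual_bound b s u D" shows "u \<in> distributions"
proof -
  have "\<exists>C N. \<forall>\<phi>\<in>test_functions. closure {x. \<phi> x \<noteq> 0} \<subseteq> K \<longrightarrow> cmod (u \<phi>) \<le> C * test_seminorm N \<phi>"
    if K: "compact K" for K
  proof -
    obtain R where R: "\<And>x. x \<in> K \<Longrightarrow> norm x \<le> R" using compact_imp_bounded[OF K] bounded_iff by blast
    obtain C N where C: "\<And>f. f \<in> test_functions \<Longrightarrow> (\<And>x. norm x > R \<Longrightarrow> f x = 0) \<Longrightarrow>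
        Sob b (- s) f \<le> C * test_seminorm N f"
      using Sob_le_test_seminorm[of R b "- s"] by blast
    have "cmod (u \<phi>) \<le> (D * C) * test_seminorm N \<phi>" if \<phi>: "\<phi> \<in> test_functions" "closure {x. \<phi> x \<noteq> 0} \<subseteq> K" for \<phi>
    proof -
      have "\<phi> x = 0" if "norm x > R" for x
        using R[of x] \<phi>(2) closure_subset[of "{x. \<phi> x \<noteq> 0}"] that by force
      then have "Sob b (- s) \<phi> \<le> C * test_seminorm N \<phi>" by (rule C[OF \<phi>(1)])
      then have "D * Sob b (- s) \<phi> \<le> D * (C * test_seminorm N \<phi>)"
        using u by (intro mult_left_mono) (simp_all add: dual_bound_def)
      moreover have "cmod (u \<phi>) \<le> D * Sob b (- s) \<phi>" using u \<phi>(1) by (simp add: dual_bound_def)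
      ultimately show ?thesis by (simp add: mult.assoc)
    qed
    then show ?thesis by blast
  qed
  then show ?thesis using u by (simp add: distributions_def dual_bound_def)
qed

section \<open>Existence and uniqueness of the local product\<close>

text \<open>The square of \<theta> hands one factor to \<open>u\<close> and one to \<open>v\<close>,
  by the rules that move multipliers between the arguments of \<open>sprod\<close>.\<close>

lemma is_local_product_ul_product:
  assumes T: "trilinear_bound b s t \<sigma> C" and u: "u \<in> sobolev_ul b s" and v: "v \<in> sobolev b t"
  shows "is_local_product b s t \<sigma> u v (ul_product b s t u v)"
proof -
  obtain K where "dual_bound b \<sigma> (ul_product b s t u v) K" by (rule ul_product_dual_bound[OF T u v]) (rule that)
  then have d: "ul_product b s t u v \<in> distributions" by (rule dual_bound_distributions)
  have "is_sobolev_product b s t \<sigma> (mult_distribution \<theta> u) (mult_distribution \<theta> v)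
          (mult_distribution (\<lambda>x. (\<theta> x)\<^sup>2) (ul_product b s t u v))" if \<theta>: "\<theta> \<in> test_functions" for \<theta>
  proof -
    note \<eta> = cutoff[OF \<theta>]
    note u\<theta> = sobolev_ul_mult[OF u \<theta>] and v\<theta> = sobolev_mult[OF \<theta> v]
    have "ul_product b s t u v (\<lambda>x. (\<theta> x)\<^sup>2 * \<phi> x) =
        sprod b s t (mult_distribution \<theta> u) (mult_distribution \<theta> v) \<phi>"
      if \<phi>: "\<phi> \<in> test_functions" for \<phi>
    proof -
      note \<theta>\<phi> = test_mult[OF \<theta> \<phi>] and \<theta>\<theta>\<phi> = test_mult[OF \<theta> test_mult[OF \<theta> \<phi>]]
      \<comment> \<open>The cutoff of \<theta> leaves every multiple of \<theta> unchanged, so a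
        single choice serves all \<phi>.\<close>
      have abs: "(\<lambda>x. cutoff \<theta> x * (\<theta> x * (\<theta> x * \<phi> x))) = (\<lambda>x. \<theta> x * (\<theta> x * \<phi> x))"
        by (simp only: mult.assoc[symmetric] fun_cong[OF \<eta>(2)])
      have "ul_product b s t u v (\<lambda>x. (\<theta> x)\<^sup>2 * \<phi> x) = ul_product b s t u v (\<lambda>x. \<theta> x * (\<theta> x * \<phi> x))"
        by (simp only: power2_eq_square mult.assoc)
      also have "\<dots> = sprod b s t (mult_distribution (cutoff \<theta>) u) v (\<lambda>x. \<theta> x * (\<theta> x * \<phi> x))"
        by (rule ul_product_eq[OF T u v \<eta>(1) abs \<theta>\<theta>\<phi>])
      also have "\<dots> = sprod b s t (mult_distribution \<theta> u) v (\<lambda>x. \<theta> x * \<phi> x)"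
        unfolding sprod_mult_left[OF T sobolev_ul_mult[OF u \<eta>(1)] v \<theta> test_imp_schwartz[OF \<theta>\<phi>], symmetric]
          mult_distribution_absorb[OF \<eta>(2)] ..
      also have "\<dots> = sprod b s t (mult_distribution \<theta> u) (mult_distribution \<theta> v) \<phi>"
        by (rule sprod_mult_right[OF T u\<theta> v \<theta> test_imp_schwartz[OF \<phi>], symmetric])
      finally show ?thesis .
    qed
    then have "same_distribution (mult_distribution (\<lambda>x. (\<theta> x)\<^sup>2) (ul_product b s t u v))
        (sprod b s t (mult_distribution \<theta> u) (mult_distribution \<theta> v))"
      by (simp add: same_distribution_def mult_distribution_def)
    then show ?thesis unfolding is_sobolev_product_def using u\<theta> v\<theta> is_extended_product_sprod[OF T] by blast
  qed
  then show ?thesis unfolding is_local_product_def using d test_translate by blast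
qed

text \<open>The local condition is used with the cutoff of \<phi> as window, at y = 0: its square
  leaves \<phi> unchanged, so the condition determines the value of \<open>w\<close> at
  \<phi>.\<close>

lemma local_product_unique:
  assumes T: "trilinear_bound b s t \<sigma> C" and u: "u \<in> sobolev_ul b s" and v: "v \<in> sobolev b t"
    and w: "is_local_product b s t \<sigma> u v w" and \<phi>: "\<phi> \<in> test_functions"
  shows "w \<phi> = ul_product b s t u v \<phi>"
proof -
  let ?\<theta> = "cutoff \<phi>"
  note \<theta> = cutoff[OF \<phi>]
  have t: "translate 0 ?\<theta> = ?\<theta>" by (simp add: translate_def)
  have "is_sobolev_product b s t \<sigma> (mult_distribution ?\<theta> u) (mult_distribution ?\<theta> v)
      (mult_distribution (\<lambda>x. (?\<theta> x)\<^sup>2) w)"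
    using w \<theta>(1) unfolding is_local_product_def by (metis t)
  then obtain B where B: "is_extended_product b s t \<sigma> B"
    "same_distribution (mult_distribution (\<lambda>x. (?\<theta> x)\<^sup>2) w)
      (B (mult_distribution ?\<theta> u) (mult_distribution ?\<theta> v))"
    unfolding is_sobolev_product_def by blast
  have "(\<lambda>x. (?\<theta> x)\<^sup>2 * \<phi> x) = \<phi>" by (simp only: power2_eq_square mult.assoc fun_cong[OF \<theta>(2)])
  then have "w \<phi> = mult_distribution (\<lambda>x. (?\<theta> x)\<^sup>2) w \<phi>" by (simp only: mult_distribution_def)
  also have "\<dots> = B (mult_distribution ?\<theta> u) (mult_distribution ?\<theta> v) \<phi>"
    using B(2) \<phi> by (simp add: same_distribution_def)
  also have "\<dots> = sprod b s t (mult_distribution ?\<theta> u) (mult_distribution ?\<theta> v) \<phi>"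
    by (rule extended_product_unique[OF T B(1) sobolev_ul_mult[OF u \<theta>(1)] sobolev_mult[OF \<theta>(1) v] \<phi>])
  also have "\<dots> = sprod b s t (mult_distribution ?\<theta> u) v \<phi>"
    unfolding sprod_mult_right[OF T sobolev_ul_mult[OF u \<theta>(1)] v \<theta>(1) test_imp_schwartz[OF \<phi>]] \<theta>(2) ..
  finally show ?thesis unfolding ul_product_def .
qed

lemma sobolev_ul_product:
  assumes T: "trilinear_bound b s t \<sigma> C" and u: "u \<in> sobolev_ul b s" and v: "v \<in> sobolev b t"
  shows "(\<exists>w. is_local_product b s t \<sigma> u v w) \<and> (\<forall>w. is_local_product b s t \<sigma> u v w \<longrightarrow> w \<in> sobolev b \<sigma>)"
proof (intro conjI allI impI)
  show "\<exists>w. is_local_product b s t \<sigma> u v w" using is_local_product_ul_product[OF T u v] by blast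
  fix w assume w: "is_local_product b s t \<sigma> u v w"
  obtain K where K: "dual_bound b \<sigma> (ul_product b s t u v) K"
    by (rule ul_product_dual_bound[OF T u v]) (rule that)
  have "linear_functional_on test_functions w" using w by (simp add: is_local_product_def distributions_def)
  then have "dual_bound b \<sigma> w K" using K by (simp add: dual_bound_def local_product_unique[OF T u v w])
  then show "w \<in> sobolev b \<sigma>" using sobolev_iff by blast
qed

text \<open>The pointwise product is commutative and the conditions on the two factors are
  symmetric; this gives the second inclusion from the first.\<close>

lemma is_extended_product_swap:
  assumes "is_extended_product b s t \<sigma> B" shows "is_extended_product b t s \<sigma> (\<lambda>u v. B v u)"
proof -
  have "(\<lambda>x. \<psi> x * \<phi> x) = (\<lambda>x. \<phi> x * \<psi> x)" for \<phi> \<psi> :: "real ^ 'a \<Rightarrow> complex" by (simp add: mult.commute)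
  then have "same_distribution (B (distribution_of \<psi>) (distribution_of \<phi>)) (distribution_of (\<lambda>x. \<phi> x * \<psi> x))"
    if "\<phi> \<in> schwartz_functions" "\<psi> \<in> schwartz_functions" for \<phi> \<psi>
    using assms that unfolding is_extended_product_def by metis
  then show ?thesis using assms unfolding is_extended_product_def by blast
qed

lemma is_local_product_swap: "is_local_product b s t \<sigma> u v w \<longleftrightarrow> is_local_product b t s \<sigma> v u w"
proof -
  have "is_sobolev_product b t s \<sigma> v u w" if "is_sobolev_product b s t \<sigma> u v w" for s t u v w
    using that is_extended_product_swap unfolding is_sobolev_product_def by fastforce
  then show ?thesis unfolding is_local_product_def by blast
qed

text \<open>Local products are determined only through their values on test functions, so the
  inclusion is rendered in two parts: a local product exists, and every functional that qualifies as
  one lies in the global space of order \<sigma>.\<close>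

theorem corollary3p13:
  fixes b :: "'n::finite \<Rightarrow> 'j::finite"
    and s t \<epsilon> \<sigma> :: "real ^ 'j"
  assumes "surj b"
    and "\<And>l. s $ l + t $ l > real (card (b -` {l})) / 2"
    and "\<And>l. 0 < \<epsilon> $ l"
    and "\<And>l. \<epsilon> $ l < s $ l + t $ l - real (card (b -` {l})) / 2"
    and "\<And>l. \<sigma> $ l =
           Min {s $ l, t $ l, s $ l + t $ l - real (card (b -` {l})) / 2 - \<epsilon> $ l}"
  shows "(\<forall>u\<in>sobolev_ul b s. \<forall>v\<in>sobolev b t.
            (\<exists>w. is_local_product b s t \<sigma> u v w) \<and>
            (\<forall>w. is_local_product b s t \<sigma> u v w \<longrightarrow> w \<in> sobolev b \<sigma>)) \<and>
         (\<forall>u\<in>sobolev b s. \<forall>v\<in>sobolev_ul b t.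
            (\<exists>w. is_local_product b s t \<sigma> u v w) \<and>
            (\<forall>w. is_local_product b s t \<sigma> u v w \<longrightarrow> w \<in> sobolev b \<sigma>))"
proof -
  \<comment> \<open>The third entry of the minimum, with \<epsilon> positive, gives the strict
    inequality that makes the kernel integrable.\<close>
  have \<sigma>: "\<sigma> $ l \<le> s $ l" "\<sigma> $ l \<le> t $ l" "s $ l + t $ l - \<sigma> $ l > real (card (b -` {l})) / 2" for l
  proof -
    let ?M = "{s $ l, t $ l, s $ l + t $ l - real (card (b -` {l})) / 2 - \<epsilon> $ l}"
    have "Min ?M \<le> z" if "z \<in> ?M" for z using that by (intro Min_le) auto
    then show "\<sigma> $ l \<le> s $ l" "\<sigma> $ l \<le> t $ l" "s $ l + t $ l - \<sigma> $ l > real (card (b -` {l})) / 2"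
      using assms(3)[of l] unfolding assms(5) by (blast, blast, fastforce)
  qed
  \<comment> \<open>The conditions involve only the sum of the two orders and their comparison with
    \<sigma>, so one argument serves (s, t) and (t, s).\<close>
  have T: "\<exists>C. trilinear_bound b p q \<sigma> C"
    if st: "\<And>l. p $ l + q $ l = s $ l + t $ l" and le: "\<And>l. \<sigma> $ l \<le> p $ l" "\<And>l. \<sigma> $ l \<le> q $ l" for p q
  proof -
    have pq: "p $ l + q $ l > real (card (b -` {l})) / 2" "p $ l + q $ l - \<sigma> $ l > real
        (card (b -` {l})) / 2" for l
      unfolding st by (rule assms(2), rule \<sigma>(3))
    obtain C where "C \<ge> 0" "\<And>f g h. f \<in> schwartz_functions \<Longrightarrow> g \<in> schwartz_functions \<Longrightarrow> h \<in> schwartz_functions \<Longrightarrow>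
        cmod (\<integral>x. f x * g x * h x \<partial>lborel) \<le> C * Sob b p f * Sob b q g * Sob b (- \<sigma>) h"
      by (rule Sob_trilinear[OF assms(1) pq le]) (rule that)
    then show ?thesis unfolding trilinear_bound_def by blast
  qed
  obtain C where C: "trilinear_bound b s t \<sigma> C" using T[of s t] \<sigma> by blast
  obtain C' where C': "trilinear_bound b t s \<sigma> C'" using T[of t s] \<sigma> by (auto simp: add.commute)
  show ?thesis
    using sobolev_ul_product[OF C] sobolev_ul_product[OF C'] unfolding is_local_product_swap[of b s t] by blast
qed

end
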